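(* Let $d$ be a positive integer, let $T=(T_1,\ldots,T_d)$ be a commuting $d$-tuple on a separable complex Hilbert space $\mathcal H$ and let $\{f_j\}_{j\in I}$ be an orthonormal basis for the joint kernel $\ker T^*=\bigcap_{j=1}^d\ker T_j^*$ for some nonempty directed set $I$. If $T$ is a joint $2$-isometry, then there exists a $\mathcal B(\ell^2(I))$-valued semispectral measure $F_T$ on $\partial\mathbb B^d$ such that for every $\alpha,\beta\in\mathbb Z_+^d$, $k\in\mathbb Z_+$ and $x,y\in\ker T^*$, $$\langle Q_T^k(I)T^\alpha x,T^\beta y\rangle-\langle T^\alpha x,T^\beta y\rangle=\sum_{|\gamma|=k}\frac{|\gamma|!}{\gamma!}\langle z^{\alpha+\gamma}x,z^{\beta+\gamma}y\rangle_{\mathscr D(F_T)}-\langle z^\alpha x,z^\beta y\rangle_{\mathscr D(F_T)},$$ where on the right-hand side $x,y\in\ker T^*$ are identified with elements of $\ell^2(I)$ through the orthonormal basis $\{f_j\}_{j\in I}$.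
   Context: A commuting $d$-tuple on $\mathcal H$ consists of commuting operators $T_1,\ldots,T_d\in\mathcal B(\mathcal H)$; $T^\alpha=T_1^{\alpha_1}\cdots T_d^{\alpha_d}$ for $\alpha\in\mathbb Z_+^d$; $|\gamma|=\sum_j\gamma_j$, $\gamma!=\prod_j\gamma_j!$. $Q_T(X)=\sum_{j=1}^dT_j^*XT_j$, $Q_T^0(X)=X$, $Q_T^n(X)=Q_T(Q_T^{n-1}(X))$. $T$ is a joint $2$-isometry if $I-2Q_T(I)+Q_T^2(I)=0$. $\mathbb B^d$ is the open Euclidean unit ball of $\mathbb C^d$, $\partial\mathbb B^d$ the unit sphere, $V$ the normalized volume measure on $\mathbb B^d$. For a complex separable Hilbert space $\mathcal M$, a $\mathcal B(\mathcal M)$-valued semispectral measure on $\partial\mathbb B^d$ is a finitely additive set function $F$ on the Borel sets of $\partial\mathbb B^d$ with values positive operators in $\mathcal B(\mathcal M)$ such that $\langle F(\cdot)x,y\rangle$ is a complex regular Borel measure for all $x,y\in\mathcal M$. With $P(z,\zeta)=\frac{1-\|z\|^2}{\|z-\zeta\|^{2d}}$, put $P[F](z)=\int_{\partial\mathbb B^d}P(z,\zeta)\,dF(\zeta)\in\mathcal B(\mathcal M)$ (weak sense), $z\in\mathbb B^d$. $H^2_{\mathcal M}(\mathbb B^d)$ is the Hardy space of $\mathcal M$-valued holomorphic $f(z)=\sum_{\alpha}a_\alpha z^\alpha$ with $\|f\|^2_{H^2_{\mathcal M}(\mathbb B^d)}=\sum_\alpha\|a_\alpha\|^2_{\mathcal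 M}\frac{\alpha!\,(d-1)!}{(|\alpha|+d-1)!}<\infty$. The Dirichlet-type space $\mathscr D(F)$ is the Hilbert space of holomorphic $f:\mathbb B^d\to\mathcal M$ with $$\|f\|^2_{\mathscr D(F)}:=\|f\|^2_{H^2_{\mathcal M}(\mathbb B^d)}+\frac1d\int_{\mathbb B^d}\sum_{j=1}^d\Big\langle P[F](z)\frac{\partial f}{\partial z_j}(z),\frac{\partial f}{\partial z_j}(z)\Big\rangle_{\mathcal M}dV(z)<\infty,$$ with the associated (polarized) inner product $\langle\cdot,\cdot\rangle_{\mathscr D(F)}$. Here $\mathcal M=\ell^2(I)$, and $z^\alpha x$ denotes the $\mathcal M$-valued monomial $z\mapsto z^\alpha x$. *)

theory Defs
  imports "HOL-Analysis.Analysis"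
begin

section \<open>Complex Hilbert spaces\<close>

text \<open>The inner product is linear in its first and conjugate-linear in its second argument.\<close>

class scaleC =
  fixes scaleC :: "complex \<Rightarrow> 'a \<Rightarrow> 'a" (infixr \<open>*\<^sub>C\<close> 75)

class complex_inner = real_normed_vector + scaleC +
  fixes cinner :: "'a \<Rightarrow> 'a \<Rightarrow> complex"
  assumes scaleC_add_right: "c *\<^sub>C (x + y) = c *\<^sub>C x + c *\<^sub>C y"
    and scaleC_add_left: "(b + c) *\<^sub>C x = b *\<^sub>C x + c *\<^sub>C x"
    and scaleC_scaleC: "b *\<^sub>C c *\<^sub>C x = (b * c) *\<^sub>C x"
    and scaleR_scaleC: "scaleR r x = complex_of_real r *\<^sub>C x"
    and cinner_add_left: "cinner (x + y) z = cinner x z + cinner y z"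
    and cinner_scaleC_left: "cinner (c *\<^sub>C x) y = c * cinner x y"
    and cinner_commute: "cinner x y = cnj (cinner y x)"
    and cinner_ge_zero: "0 \<le> Re (cinner x x)"
    and cinner_eq_zero_iff: "cinner x x = 0 \<longleftrightarrow> x = 0"
    and norm_eq_sqrt_cinner: "norm x = sqrt (Re (cinner x x))"

class complex_hilbert = complex_inner + complete_space

subclass (in complex_hilbert) banach ..

global_interpretation complex_inner: vector_space "scaleC :: complex \<Rightarrow> 'a \<Rightarrow> 'a::complex_inner"
proof
  show "1 *\<^sub>C x = x" for x :: 'a
    using scaleR_scaleC[of 1 x] by simp
qed (simp_all add: scaleC_add_right scaleC_add_left scaleC_scaleC)

subsection \<open>The space \<open>\<ell>\<^sup>2(I)\<close>, with \<open>I\<close> given as a type\<close>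

typedef 'i ell2 = "{a :: 'i \<Rightarrow> complex. (\<lambda>i. (cmod (a i))\<^sup>2) summable_on UNIV}"
  morphisms ell2_coord Abs_ell2
  by (rule exI[of _ "\<lambda>_. 0"]) simp

setup_lifting type_definition_ell2

lemma ell2_finite_bound:
  fixes a :: "'i \<Rightarrow> complex"
  assumes "\<And>J. finite J \<Longrightarrow> L2_set (\<lambda>i. cmod (a i)) J \<le> B"
  shows "(\<lambda>i. (cmod (a i))\<^sup>2) summable_on UNIV"
    and "sqrt (\<Sum>\<^sub>\<infinity>i. (cmod (a i))\<^sup>2) \<le> B"
proof -
  have B0: "0 \<le> B" using assms[of "{}"] by simp
  have *: "(\<Sum>i\<in>J. (cmod (a i))\<^sup>2) \<le> B\<^sup>2" if "finite J" for J
  proof -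
    have "sqrt (\<Sum>i\<in>J. (cmod (a i))\<^sup>2) \<le> B" using assms[OF that] by (simp add: L2_set_def)
    then show ?thesis by (rule sqrt_le_D)
  qed
  show s: "(\<lambda>i. (cmod (a i))\<^sup>2) summable_on UNIV"
    by (rule nonneg_bdd_above_summable_on) (auto intro!: bdd_aboveI[where M="B\<^sup>2"] *)
  have "(\<Sum>\<^sub>\<infinity>i. (cmod (a i))\<^sup>2) \<le> B\<^sup>2"
    by (rule infsum_le_finite_sums[OF s]) (use * in auto)
  then show "sqrt (\<Sum>\<^sub>\<infinity>i. (cmod (a i))\<^sup>2) \<le> B"
    using B0 by (simp add: real_le_lsqrt)
qed

lemma ell2_finite_le:
  fixes a :: "'i \<Rightarrow> complex"
  assumes "(\<lambda>i. (cmod (a i))\<^sup>2) summable_on UNIV" "finite J"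
  shows "L2_set (\<lambda>i. cmod (a i)) J \<le> sqrt (\<Sum>\<^sub>\<infinity>i. (cmod (a i))\<^sup>2)"
  unfolding L2_set_def using assms by (intro real_sqrt_le_mono finite_sum_le_infsum) auto

lemma ell2_triangle:
  fixes a b :: "'i \<Rightarrow> complex"
  assumes a: "(\<lambda>i. (cmod (a i))\<^sup>2) summable_on UNIV"
    and b: "(\<lambda>i. (cmod (b i))\<^sup>2) summable_on UNIV"
  shows "(\<lambda>i. (cmod (a i + b i))\<^sup>2) summable_on UNIV"
    and "sqrt (\<Sum>\<^sub>\<infinity>i. (cmod (a i + b i))\<^sup>2)
      \<le> sqrt (\<Sum>\<^sub>\<infinity>i. (cmod (a i))\<^sup>2) + sqrt (\<Sum>\<^sub>\<infinity>i. (cmod (b i))\<^sup>2)"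
proof -
  have *: "L2_set (\<lambda>i. cmod (a i + b i)) J
      \<le> sqrt (\<Sum>\<^sub>\<infinity>i. (cmod (a i))\<^sup>2) + sqrt (\<Sum>\<^sub>\<infinity>i. (cmod (b i))\<^sup>2)" if "finite J" for J
  proof -
    have "L2_set (\<lambda>i. cmod (a i + b i)) J \<le> L2_set (\<lambda>i. cmod (a i) + cmod (b i)) J"
      by (rule L2_set_mono) (auto intro: norm_triangle_ineq)
    also have "\<dots> \<le> L2_set (\<lambda>i. cmod (a i)) J + L2_set (\<lambda>i. cmod (b i)) J"
      by (rule L2_set_triangle_ineq)
    finally show ?thesis
      using ell2_finite_le[OF a that] ell2_finite_le[OF b that] by linarith
  qed
  show "(\<lambda>i. (cmod (a i + b i))\<^sup>2) summable_on UNIV"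
    "sqrt (\<Sum>\<^sub>\<infinity>i. (cmod (a i + b i))\<^sup>2)
      \<le> sqrt (\<Sum>\<^sub>\<infinity>i. (cmod (a i))\<^sup>2) + sqrt (\<Sum>\<^sub>\<infinity>i. (cmod (b i))\<^sup>2)"
    using ell2_finite_bound[OF *] by auto
qed

lemma ell2_scale_summable:
  fixes a :: "'i \<Rightarrow> complex"
  assumes "(\<lambda>i. (cmod (a i))\<^sup>2) summable_on UNIV"
  shows "(\<lambda>i. (cmod (c * a i))\<^sup>2) summable_on UNIV"
  using summable_on_cmult_right[OF assms, of "(cmod c)\<^sup>2"] by (simp add: norm_mult power_mult_distrib)

lemma ell2_prod_summable:
  fixes a b :: "'i \<Rightarrow> complex"
  assumes "(\<lambda>i. (cmod (a i))\<^sup>2) summable_on UNIV" "(\<lambda>i. (cmod (b i))\<^sup>2) summable_on UNIV"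
  shows "(\<lambda>i. a i * cnj (b i)) summable_on UNIV"
proof (rule abs_summable_summable, rule summable_on_comparison_test)
  show "(\<lambda>i. (cmod (a i))\<^sup>2 + (cmod (b i))\<^sup>2) summable_on UNIV"
    by (intro summable_on_add assms)
  show "cmod (a i * cnj (b i)) \<le> (cmod (a i))\<^sup>2 + (cmod (b i))\<^sup>2" for i
  proof -
    have "0 \<le> cmod (a i) * cmod (b i)" by simp
    then show ?thesis
      using sum_squares_bound[of "cmod (a i)" "cmod (b i)"]
      by (simp only: norm_mult complex_mod_cnj)
  qed
qed simp

instantiation ell2 :: (type) complex_inner
begin

lift_definition zero_ell2 :: "'a ell2" is "\<lambda>_. 0" by simp
lift_definition plus_ell2 :: "'a ell2 \<Rightarrow> 'a ell2 \<Rightarrow> 'a ell2" is "\<lambda>a b i. a i + b i"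
  by (rule ell2_triangle)
lift_definition uminus_ell2 :: "'a ell2 \<Rightarrow> 'a ell2" is "\<lambda>a i. - a i" by simp
lift_definition minus_ell2 :: "'a ell2 \<Rightarrow> 'a ell2 \<Rightarrow> 'a ell2" is "\<lambda>a b i. a i - b i"
  subgoal for a b using ell2_triangle(1)[of a "\<lambda>i. - b i"] by simp
  done
lift_definition scaleC_ell2 :: "complex \<Rightarrow> 'a ell2 \<Rightarrow> 'a ell2" is "\<lambda>c a i. c * a i"
  by (rule ell2_scale_summable)
lift_definition scaleR_ell2 :: "real \<Rightarrow> 'a ell2 \<Rightarrow> 'a ell2" is "\<lambda>r a i. complex_of_real r * a i"
  by (rule ell2_scale_summable)
lift_definition cinner_ell2 :: "'a ell2 \<Rightarrow> 'a ell2 \<Rightarrow> complex" is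
  "\<lambda>a b. \<Sum>\<^sub>\<infinity>i. a i * cnj (b i)" .
lift_definition norm_ell2 :: "'a ell2 \<Rightarrow> real" is "\<lambda>a. sqrt (\<Sum>\<^sub>\<infinity>i. (cmod (a i))\<^sup>2)" .

definition "dist_ell2 (x :: 'a ell2) y = norm (x - y)"
definition "sgn_ell2 (x :: 'a ell2) = scaleR (inverse (norm x)) x"
definition "uniformity_ell2 = (INF e\<in>{0<..}. principal {(x :: 'a ell2, y). dist x y < e})"
definition "open_ell2 (U :: 'a ell2 set) =
  (\<forall>x\<in>U. eventually (\<lambda>(x', y). x' = x \<longrightarrow> y \<in> U) uniformity)"

lemma ell2_coord_le_norm: "cmod (ell2_coord x i) \<le> norm (x :: 'a ell2)"
  using ell2_finite_le[of "ell2_coord x" "{i}"] ell2_coord[of x]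
  by (simp add: norm_ell2.rep_eq L2_set_def)

instance
proof
  fix x y z :: "'a ell2" and r s :: real and b c :: complex
  show "x + y + z = x + (y + z)" by transfer (simp add: add.assoc)
  show "x + y = y + x" by transfer (simp add: add.commute)
  show "0 + x = x" by transfer simp
  show "- x + x = 0" by transfer simp
  show "x - y = x + - y" by transfer simp
  show "r *\<^sub>R (x + y) = r *\<^sub>R x + r *\<^sub>R y" by transfer (simp add: algebra_simps)
  show "(r + s) *\<^sub>R x = r *\<^sub>R x + s *\<^sub>R x" by transfer (simp add: algebra_simps)
  show "r *\<^sub>R s *\<^sub>R x = (r * s) *\<^sub>R x" by transfer (simp add: algebra_simps)
  show "1 *\<^sub>R x = x" by transfer simp
  show "dist x y = norm (x - y)" by (rule dist_ell2_def)
  show "sgn x = inverse (norm x) *\<^sub>R x" by (rule sgn_ell2_def)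
  show "(uniformity :: ('a ell2 \<times> 'a ell2) filter) =
      (INF e\<in>{0<..}. principal {(x, y). dist x y < e})" by (rule uniformity_ell2_def)
  show "open U = (\<forall>x\<in>U. \<forall>\<^sub>F (x', y) in uniformity. x' = x \<longrightarrow> y \<in> U)" for U :: "'a ell2 set"
    by (rule open_ell2_def)
  show "(norm x = 0) = (x = 0)"
  proof
    assume "norm x = 0"
    then have "ell2_coord x i = 0" for i using ell2_coord_le_norm[of x i] by simp
    then show "x = 0" by transfer auto
  next
    assume "x = 0" then show "norm x = 0" by transfer simp
  qed
  show "norm (x + y) \<le> norm x + norm y" by transfer (rule ell2_triangle)
  show "norm (r *\<^sub>R x) = \<bar>r\<bar> * norm x"
    by transfer (simp add: norm_mult power_mult_distrib infsum_cmult_right' real_sqrt_mult)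
  show "c *\<^sub>C (x + y) = c *\<^sub>C x + c *\<^sub>C y" by transfer (simp add: algebra_simps)
  show "(b + c) *\<^sub>C x = b *\<^sub>C x + c *\<^sub>C x" by transfer (simp add: algebra_simps)
  show "b *\<^sub>C c *\<^sub>C x = (b * c) *\<^sub>C x" by transfer (simp add: algebra_simps)
  show "r *\<^sub>R x = complex_of_real r *\<^sub>C x" by transfer simp
  show "cinner (x + y) z = cinner x z + cinner y z"
    by transfer (simp add: ring_distribs infsum_add ell2_prod_summable)
  show "cinner (c *\<^sub>C x) y = c * cinner x y"
    by transfer (simp add: mult.assoc infsum_cmult_right')
  show "cinner x y = cnj (cinner y x)"
    by transfer (simp add: infsum_cnj[symmetric] mult.commute)
  have *: "cinner x x = complex_of_real ((norm x)\<^sup>2)" for x :: "'a ell2"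
  proof transfer
    fix a :: "'a \<Rightarrow> complex"
    assume "(\<lambda>i. (cmod (a i))\<^sup>2) summable_on UNIV"
    then have "(\<Sum>\<^sub>\<infinity>i. complex_of_real ((cmod (a i))\<^sup>2)) =
        complex_of_real (\<Sum>\<^sub>\<infinity>i. (cmod (a i))\<^sup>2)"
      by (intro infsumI has_sum_of_real has_sum_infsum)
    then show "(\<Sum>\<^sub>\<infinity>i. a i * cnj (a i)) =
        complex_of_real ((sqrt (\<Sum>\<^sub>\<infinity>i. (cmod (a i))\<^sup>2))\<^sup>2)"
      by (simp add: infsum_nonneg flip: complex_norm_square)
  qed
  show "0 \<le> Re (cinner x x)" by (simp add: * flip: of_real_power)
  show "cinner x x = 0 \<longleftrightarrow> x = 0"
    using \<open>(norm x = 0) = (x = 0)\<close> by (simp add: *)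
  show "norm x = sqrt (Re (cinner x x))"
  proof -
    have "0 \<le> norm x" by transfer (simp add: infsum_nonneg)
    then show ?thesis by (simp add: * flip: of_real_power)
  qed
qed

end

instance ell2 :: (type) complex_hilbert
proof
  fix X :: "nat \<Rightarrow> 'a ell2"
  assume X: "Cauchy X"
  have d: "dist x y = norm (x - y)" for x y :: "'a ell2" by (rule dist_ell2_def)
  have coord_minus: "ell2_coord (x - y) i = ell2_coord x i - ell2_coord y i"
    for x y :: "'a ell2" and i by transfer simp
  have "Cauchy (\<lambda>n. ell2_coord (X n) i)" for i
  proof (rule metric_CauchyI)
    fix e :: real assume "0 < e"
    then obtain M where "\<forall>m\<ge>M. \<forall>n\<ge>M. dist (X m) (X n) < e" using metric_CauchyD[OF X] by blast
    then show "\<exists>M. \<forall>m\<ge>M. \<forall>n\<ge>M. dist (ell2_coord (X m) i) (ell2_coord (X n) i) < e"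
      using ell2_coord_le_norm[where i=i]
      by (metis d dist_norm coord_minus le_less_trans)
  qed
  then have "\<exists>l. (\<lambda>n. ell2_coord (X n) i) \<longlonglongrightarrow> l" for i
    using Cauchy_convergent_iff convergent_def by blast
  then obtain L where L: "\<And>i. (\<lambda>n. ell2_coord (X n) i) \<longlonglongrightarrow> L i" by metis
  have fin: "L2_set (\<lambda>i. cmod (ell2_coord (X m) i - L i)) J \<le> e"
    if "\<forall>n\<ge>M. dist (X m) (X n) < e" "finite J" for e M m J
  proof (rule LIMSEQ_le_const2)
    show "(\<lambda>n. L2_set (\<lambda>i. cmod (ell2_coord (X m) i - ell2_coord (X n) i)) J)
        \<longlonglongrightarrow> L2_set (\<lambda>i. cmod (ell2_coord (X m) i - L i)) J"
      unfolding L2_set_def by (intro tendsto_intros L)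
    show "\<exists>N. \<forall>n\<ge>N. L2_set (\<lambda>i. cmod (ell2_coord (X m) i - ell2_coord (X n) i)) J \<le> e"
    proof (intro exI[of _ M] allI impI)
      fix n assume "M \<le> n"
      have "L2_set (\<lambda>i. cmod (ell2_coord (X m - X n) i)) J \<le> norm (X m - X n)"
        using ell2_finite_le[of "ell2_coord (X m - X n)" J] ell2_coord[of "X m - X n"] that(2)
        by (simp add: norm_ell2.rep_eq)
      also have "\<dots> \<le> e" using that(1) \<open>M \<le> n\<close> by (auto simp: d intro: less_imp_le)
      finally show "L2_set (\<lambda>i. cmod (ell2_coord (X m) i - ell2_coord (X n) i)) J \<le> e"
        by (simp add: coord_minus)
    qed
  qed
  obtain M0 where M0: "\<forall>m\<ge>M0. \<forall>n\<ge>M0. dist (X m) (X n) < 1"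
    using metric_CauchyD[OF X, of 1] by auto
  then have "(\<lambda>i. (cmod (ell2_coord (X M0) i - L i))\<^sup>2) summable_on UNIV"
    by (intro ell2_finite_bound(1)[where B=1] fin[where M=M0]) auto
  moreover have "(\<lambda>i. (cmod (ell2_coord (X M0) i))\<^sup>2) summable_on UNIV"
    using ell2_coord[of "X M0"] by simp
  ultimately have "(\<lambda>i. (cmod (L i))\<^sup>2) summable_on UNIV"
    using ell2_triangle(1)[of "\<lambda>i. - (ell2_coord (X M0) i - L i)" "ell2_coord (X M0)"]
    by (simp add: norm_minus_commute)
  then have L': "ell2_coord (Abs_ell2 L) = L" by (simp add: Abs_ell2_inverse)
  have "X \<longlonglongrightarrow> Abs_ell2 L"
  proof (rule metric_LIMSEQ_I)
    fix e :: real assume "0 < e"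
    then obtain M where M: "\<forall>m\<ge>M. \<forall>n\<ge>M. dist (X m) (X n) < e / 2"
      using metric_CauchyD[OF X, of "e / 2"] by auto
    have "dist (X m) (Abs_ell2 L) < e" if "m \<ge> M" for m
    proof -
      have "norm (X m - Abs_ell2 L) = sqrt (\<Sum>\<^sub>\<infinity>i. (cmod (ell2_coord (X m) i - L i))\<^sup>2)"
        by (simp add: norm_ell2.rep_eq coord_minus L')
      also have "\<dots> \<le> e / 2"
        by (rule ell2_finite_bound(2), rule fin[where M=M]) (use M that in auto)
      finally show ?thesis using \<open>0 < e\<close> by (simp add: d)
    qed
    then show "\<exists>M. \<forall>m\<ge>M. dist (X m) (Abs_ell2 L) < e" by blast
  qed
  then show "convergent X" by (auto simp: convergent_def)
qed

section \<open>Bounded operators and commuting tuples\<close>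

definition bounded_clinear :: "('a::complex_inner \<Rightarrow> 'b::complex_inner) \<Rightarrow> bool" where
  "bounded_clinear A \<longleftrightarrow> bounded_linear A \<and> (\<forall>c x. A (c *\<^sub>C x) = c *\<^sub>C A x)"

definition adjoint_op :: "('a::complex_hilbert \<Rightarrow> 'a) \<Rightarrow> 'a \<Rightarrow> 'a" where
  "adjoint_op A = (THE B. \<forall>x y. cinner (A x) y = cinner x (B y))"

definition positive_op :: "('a::complex_inner \<Rightarrow> 'a) \<Rightarrow> bool" where
  "positive_op A \<longleftrightarrow> bounded_clinear A \<and> (\<forall>x. cinner (A x) x \<in> \<real> \<and> 0 \<le> Re (cinner (A x) x))"

definition commuting_tuple :: "('d::finite \<Rightarrow> 'h::complex_hilbert \<Rightarrow> 'h) \<Rightarrow> bool" where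
  "commuting_tuple T \<longleftrightarrow> (\<forall>j. bounded_clinear (T j)) \<and> (\<forall>i j. T i \<circ> T j = T j \<circ> T i)"

text \<open>The factors \<open>T\<^sub>j\<^bsup>\<alpha>\<^sub>j\<^esup>\<close> commute, so the value of the fold does not depend on an
  enumeration of the index type.\<close>

definition tuple_power ::
  "('d::finite \<Rightarrow> 'h \<Rightarrow> 'h) \<Rightarrow> ('d \<Rightarrow> nat) \<Rightarrow> 'h \<Rightarrow> 'h" where
  "tuple_power T \<alpha> = Finite_Set.fold (\<lambda>j S. (T j ^^ \<alpha> j) \<circ> S) id UNIV"

definition Q_op ::
  "('d::finite \<Rightarrow> 'h::complex_hilbert \<Rightarrow> 'h) \<Rightarrow> ('h \<Rightarrow> 'h) \<Rightarrow> 'h \<Rightarrow> 'h" where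
  "Q_op T X = (\<lambda>h. \<Sum>j\<in>UNIV. adjoint_op (T j) (X (T j h)))"

definition joint_2_isometry :: "('d::finite \<Rightarrow> 'h::complex_hilbert \<Rightarrow> 'h) \<Rightarrow> bool" where
  "joint_2_isometry T \<longleftrightarrow>
    (\<forall>h. h - 2 *\<^sub>C Q_op T id h + (Q_op T ^^ 2) id h = 0)"

definition joint_kernel_adjoint :: "('d::finite \<Rightarrow> 'h::complex_hilbert \<Rightarrow> 'h) \<Rightarrow> 'h set" where
  "joint_kernel_adjoint T = (\<Inter>j. {h. adjoint_op (T j) h = 0})"

definition directed_index :: "'i rel \<Rightarrow> bool" where
  "directed_index le \<longleftrightarrow>
    preorder_on UNIV le \<and> (\<forall>i j. \<exists>k. (i, k) \<in> le \<and> (j, k) \<in> le)"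

definition orthonormal_basis :: "('i \<Rightarrow> 'h::complex_inner) \<Rightarrow> 'h set \<Rightarrow> bool" where
  "orthonormal_basis f K \<longleftrightarrow>
    (\<forall>i j. cinner (f i) (f j) = (if i = j then 1 else 0)) \<and>
    closure (complex_inner.span (range f)) = K"

definition basis_coords :: "('i \<Rightarrow> 'h::complex_inner) \<Rightarrow> 'h \<Rightarrow> 'i ell2" where
  "basis_coords f x = Abs_ell2 (\<lambda>i. cinner x (f i))"

section \<open>Semispectral measures on the sphere\<close>

definition sphere_borel :: "(complex^'d) measure" where
  "sphere_borel = restrict_space borel (sphere 0 1)"

definition complex_measure :: "'a measure \<Rightarrow> ('a set \<Rightarrow> complex) \<Rightarrow> bool" where
  "complex_measure M \<mu> \<longleftrightarrow>
    (\<forall>A::nat \<Rightarrow> 'a set. range A \<subseteq> sets M \<and> disjoint_family A \<longrightarrow> (\<lambda>n. \<mu> (A n)) sums \<mu> (\<Union>n. A n))"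

definition total_variation :: "'a measure \<Rightarrow> ('a set \<Rightarrow> complex) \<Rightarrow> 'a set \<Rightarrow> ennreal" where
  "total_variation M \<mu> E =
    (SUP A\<in>{A::nat \<Rightarrow> 'a set. range A \<subseteq> sets M \<and> disjoint_family A \<and> (\<Union>n. A n) = E}.
      \<Sum>n. ennreal (cmod (\<mu> (A n))))"

text \<open>A complex measure is regular if its total variation measure is inner and outer regular.\<close>

definition regular_complex_measure ::
  "'a::topological_space measure \<Rightarrow> ('a set \<Rightarrow> complex) \<Rightarrow> bool" where
  "regular_complex_measure M \<mu> \<longleftrightarrow> complex_measure M \<mu> \<and>
    (\<forall>E\<in>sets M.
      total_variation M \<mu> E =
        (SUP K\<in>{K. compact K \<and> K \<subseteq> E}. total_variation M \<mu> K) \<and>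
      total_variation M \<mu> E =
        (INF U\<in>{U. openin (top_of_set (space M)) U \<and> E \<subseteq> U}. total_variation M \<mu> U))"

definition semispectral_measure ::
  "((complex^'d) set \<Rightarrow> 'm::complex_hilbert \<Rightarrow> 'm) \<Rightarrow> bool" where
  "semispectral_measure F \<longleftrightarrow>
    (\<forall>A\<in>sets sphere_borel. positive_op (F A)) \<and>
    (\<forall>A\<in>sets sphere_borel. \<forall>B\<in>sets sphere_borel. A \<inter> B = {} \<longrightarrow>
      (\<forall>x. F (A \<union> B) x = F A x + F B x)) \<and>
    (\<forall>x y. regular_complex_measure sphere_borel (\<lambda>A. cinner (F A x) y))"

text \<open>The integral against a complex measure \<open>\<mu>\<close>, computed from a decomposition
  \<open>\<mu> = \<nu>\<^sub>0 + \<i> \<nu>\<^sub>1 - \<nu>\<^sub>2 - \<i> \<nu>\<^sub>3\<close> into finite positive measures; the value does not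
  depend on the decomposition.\<close>

definition has_complex_measure_integral ::
  "'a measure \<Rightarrow> ('a set \<Rightarrow> complex) \<Rightarrow> ('a \<Rightarrow> complex) \<Rightarrow> complex \<Rightarrow> bool" where
  "has_complex_measure_integral M \<mu> g c \<longleftrightarrow>
    (\<exists>\<nu> :: nat \<Rightarrow> 'a measure.
      (\<forall>k<4. finite_measure (\<nu> k) \<and> sets (\<nu> k) = sets M \<and> integrable (\<nu> k) g) \<and>
      (\<forall>A\<in>sets M. \<mu> A = (\<Sum>k<4. \<i> ^ k * complex_of_real (measure (\<nu> k) A))) \<and>
      c = (\<Sum>k<4. \<i> ^ k * integral\<^sup>L (\<nu> k) g))"

definition poisson_kernel :: "complex^'d \<Rightarrow> complex^'d \<Rightarrow> real" where
  "poisson_kernel z \<zeta> = (1 - (norm z)\<^sup>2) / norm (z - \<zeta>) ^ (2 * CARD('d))"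

definition poisson_integral ::
  "((complex^'d) set \<Rightarrow> 'm::complex_hilbert \<Rightarrow> 'm) \<Rightarrow> complex^'d \<Rightarrow> 'm \<Rightarrow> 'm" where
  "poisson_integral F z = (THE S. bounded_clinear S \<and>
    (\<forall>x y. has_complex_measure_integral sphere_borel (\<lambda>A. cinner (F A x) y)
      (\<lambda>\<zeta>. complex_of_real (poisson_kernel z \<zeta>)) (cinner (S x) y)))"

section \<open>Hardy and Dirichlet-type spaces on the unit ball\<close>

definition mindex_norm :: "('d::finite \<Rightarrow> nat) \<Rightarrow> nat" where
  "mindex_norm \<alpha> = (\<Sum>j\<in>UNIV. \<alpha> j)"

definition mindex_fact :: "('d::finite \<Rightarrow> nat) \<Rightarrow> nat" where
  "mindex_fact \<alpha> = (\<Prod>j\<in>UNIV. fact (\<alpha> j))"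

definition monomial :: "('d::finite \<Rightarrow> nat) \<Rightarrow> 'm::complex_inner \<Rightarrow> complex^'d \<Rightarrow> 'm" where
  "monomial \<alpha> x = (\<lambda>z. (\<Prod>j\<in>UNIV. (z $ j) ^ \<alpha> j) *\<^sub>C x)"

definition holomorphic_on_ball :: "(complex^'d \<Rightarrow> 'm::complex_inner) \<Rightarrow> bool" where
  "holomorphic_on_ball f \<longleftrightarrow>
    (\<forall>z\<in>ball 0 1. \<exists>D. (f has_derivative D) (at z) \<and> (\<forall>c v. D (c *s v) = c *\<^sub>C D v))"

definition complex_partial ::
  "'d::finite \<Rightarrow> (complex^'d \<Rightarrow> 'm::complex_inner) \<Rightarrow> complex^'d \<Rightarrow> 'm" where
  "complex_partial j f z = frechet_derivative f (at z) (axis j 1)"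

definition power_coeff :: "(complex^'d \<Rightarrow> 'm::complex_inner) \<Rightarrow> ('d \<Rightarrow> nat) \<Rightarrow> 'm" where
  "power_coeff f = (THE a. \<forall>z\<in>ball 0 1. ((\<lambda>\<alpha>. monomial \<alpha> (a \<alpha>) z) has_sum f z) UNIV)"

definition hardy_norm_sq :: "(complex^'d \<Rightarrow> 'm::complex_inner) \<Rightarrow> ennreal" where
  "hardy_norm_sq f = (\<Sum>\<^sub>\<infinity>\<alpha>. ennreal ((norm (power_coeff f \<alpha>))\<^sup>2 *
    (real (mindex_fact \<alpha>) * fact (CARD('d) - 1) / fact (mindex_norm \<alpha> + CARD('d) - 1))))"

definition ball_volume :: "(complex^'d) measure" where
  "ball_volume = uniform_measure lborel (ball 0 1)"

text \<open>As \<open>P[F](z) \<ge> 0\<close>, the integrand below is real and nonnegative.\<close>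

definition dirichlet_norm_sq ::
  "((complex^'d) set \<Rightarrow> 'm::complex_hilbert \<Rightarrow> 'm) \<Rightarrow> (complex^'d \<Rightarrow> 'm) \<Rightarrow> ennreal" where
  "dirichlet_norm_sq F f = hardy_norm_sq f + ennreal (1 / real CARD('d)) *
    (\<integral>\<^sup>+ z\<in>ball 0 1. ennreal (\<Sum>j\<in>UNIV. Re (cinner
        (poisson_integral F z (complex_partial j f z)) (complex_partial j f z))) \<partial>ball_volume)"

definition dirichlet_space ::
  "((complex^'d) set \<Rightarrow> 'm::complex_hilbert \<Rightarrow> 'm) \<Rightarrow> (complex^'d \<Rightarrow> 'm) set" where
  "dirichlet_space F = {f. holomorphic_on_ball f \<and> dirichlet_norm_sq F f < \<infinity>}"

text \<open>The inner product on \<open>dirichlet_space F\<close> obtained from its norm by polarization;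
  it is meaningful only for arguments in that space.\<close>

definition dirichlet_inner ::
  "((complex^'d) set \<Rightarrow> 'm::complex_hilbert \<Rightarrow> 'm) \<Rightarrow>
    (complex^'d \<Rightarrow> 'm) \<Rightarrow> (complex^'d \<Rightarrow> 'm) \<Rightarrow> complex" where
  "dirichlet_inner F f g = (\<Sum>k<4. \<i> ^ k *
    complex_of_real (enn2real (dirichlet_norm_sq F (\<lambda>z. f z + \<i> ^ k *\<^sub>C g z)))) / 4"

end

theory Submission
  imports Defs
begin

text \<open>
  Put \<open>D(h, k) = \<Sum>\<^sub>j \<langle>T\<^sub>j h, T\<^sub>j k\<rangle> - \<langle>h, k\<rangle>\<close>. For a joint 2-isometry \<open>D\<close> is a positive semidefinite form,
  \<open>\<Sum>\<^sub>j D(T\<^sub>j h, T\<^sub>j k) = D(h, k)\<close> and \<open>\<langle>Q\<^sup>k(I) h, h'\<rangle> = \<langle>h, h'\<rangle> + k D(h, h')\<close>: with respect to \<open>D\<close>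
  the tuple is a spherical isometry. Such a tuple has a positive functional calculus
  \<open>L h k\<close> on continuous functions on the sphere with
  \<open>L h k (z\<^sup>\<alpha> (cnj z)\<^sup>\<beta>) = D(T\<^sup>\<alpha> h, T\<^sup>\<beta> k)\<close>. It is the limit of averages of point evaluations: up to a small
  error, the vectors \<open>T\<^sup>p h\<close> with \<open>p\<close> in a large window, superposed with characters of a finite torus,
  are joint approximate eigenvectors. The Riesz representation theorem turns \<open>L\<close> into a
  form-valued measure, and compression to \<open>\<ell>\<^sup>2(I)\<close> through the basis gives \<open>F\<close>.

  For the right-hand side let \<open>R(\<alpha>, \<beta>)\<close> be the Dirichlet inner product of \<open>z\<^sup>\<alpha> x\<close> and \<open>z\<^sup>\<beta> y\<close>. By the
  multinomial Pascal rule it suffices that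
  \<open>\<Sum>\<^sub>l R(\<alpha> + e\<^sub>l, \<beta> + e\<^sub>l) - R(\<alpha>, \<beta>) = D(T\<^sup>\<alpha> x, T\<^sup>\<beta> y)\<close>. The Hardy parts cancel. In the Dirichlet parts
  the integrand becomes the Poisson kernel with pole \<open>\<zeta>\<close> times a combination of \<open>u = z\<^sup>\<alpha> (cnj z)\<^sup>\<beta>\<close>, its
  radial derivative and its Laplacian, and a Green identity shows that its integral over the ball
  is \<open>d u(\<zeta>)\<close> times the volume.
\<close>

section \<open>Integrals over the unit ball\<close>

text \<open>\<open>D\<close> may be degenerate and the tuple need not be normal with respect to it,
  so everything is phrased for semidefinite forms; neither a quotient space nor a normal extension
  is formed. Approximants that are finite sums of point evaluations with nonnegative diagonal
  weights are positive by construction and have exactly the right total mass. Only one property is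
  approximate: that multiplication by a coordinate of z acts as \<open>T j\<close>. Its error comes
  from the edges of the finite index sets and from the variation of p_j / |p| across a window, so
  windows must be wide and yet small compared with |p|. The exponent 2d of the Poisson kernel is the
  real dimension of the ball, hence the kernel is harmonic in z. At the pole the kernel itself is
  integrable, but its gradient is too singular to be integrated. This is why its mean value is
  computed for dilated arguments first, and why the Green identity is derived with a regularized
  denominator.\<close>

lemma has_real_derivative_integral:
  fixes \<Phi> :: "real \<Rightarrow> 'a \<Rightarrow> real"
  assumes d: "0 < \<delta>"
    and int: "\<And>t. \<bar>t - t0\<bar> < \<delta> \<Longrightarrow> integrable M (\<Phi> t)"
    and der: "AE z in M. ((\<lambda>t. \<Phi> t z) has_real_derivative \<Phi>' z) (at t0)"
    and meas: "\<Phi>' \<in> borel_measurable M"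
    and w: "integrable M w"
    and lip: "\<And>t z. \<lbrakk>\<bar>t - t0\<bar> < \<delta>; z \<in> space M\<rbrakk> \<Longrightarrow> \<bar>\<Phi> t z - \<Phi> t0 z\<bar> \<le> w z * \<bar>t - t0\<bar>"
  shows "((\<lambda>t. \<integral>z. \<Phi> t z \<partial>M) has_real_derivative (\<integral>z. \<Phi>' z \<partial>M)) (at t0)"
  unfolding has_field_derivative_iff tendsto_at_iff_sequentially comp_def
proof (intro allI impI)
  fix X :: "nat \<Rightarrow> real"
  assume X: "\<forall>i. X i \<in> UNIV - {t0}" and lim: "X \<longlonglongrightarrow> t0"
  obtain N where N: "\<And>n. n \<ge> N \<Longrightarrow> \<bar>X n - t0\<bar> < \<delta>"
    using LIMSEQ_D[OF lim d] by (auto simp: real_norm_def)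
  let ?Y = "\<lambda>n. X (n + N)"
  have Y: "\<bar>?Y n - t0\<bar> < \<delta>" "?Y n \<noteq> t0" for n using N X by auto
  have Ylim: "?Y \<longlonglongrightarrow> t0" by (rule LIMSEQ_ignore_initial_segment[OF lim])
  have eq: "(integral\<^sup>L M (\<Phi> (?Y n)) - integral\<^sup>L M (\<Phi> t0)) / (?Y n - t0)
      = (\<integral>z. (\<Phi> (?Y n) z - \<Phi> t0 z) / (?Y n - t0) \<partial>M)" for n
    using int[OF Y(1)] int[of t0] d by simp
  have "(\<lambda>n. \<integral>z. (\<Phi> (?Y n) z - \<Phi> t0 z) / (?Y n - t0) \<partial>M) \<longlonglongrightarrow> (\<integral>z. \<Phi>' z \<partial>M)"
  proof (rule integral_dominated_convergence[where w=w])
    show "(\<lambda>z. (\<Phi> (?Y n) z - \<Phi> t0 z) / (?Y n - t0)) \<in> borel_measurable M" for n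
      using int[OF Y(1)[of n]] int[of t0] d by (intro borel_measurable_divide borel_measurable_diff) auto
    show "AE z in M. (\<lambda>n. (\<Phi> (?Y n) z - \<Phi> t0 z) / (?Y n - t0)) \<longlonglongrightarrow> \<Phi>' z"
      using der
    proof eventually_elim
      case (elim z)
      then show ?case
        unfolding has_field_derivative_iff tendsto_at_iff_sequentially comp_def
        using Y(2) Ylim by auto
    qed
    show "AE z in M. norm ((\<Phi> (?Y n) z - \<Phi> t0 z) / (?Y n - t0)) \<le> w z" for n
      using lip[OF Y(1)[of n]] Y(2)[of n] by (auto simp: divide_simps)
  qed (use meas w in auto)
  then have "(\<lambda>n. (integral\<^sup>L M (\<Phi> (?Y n)) - integral\<^sup>L M (\<Phi> t0)) / (?Y n - t0)) \<longlonglongrightarrow> (\<integral>z. \<Phi>' z \<partial>M)"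
    by (simp add: eq)
  then show "(\<lambda>n. (integral\<^sup>L M (\<Phi> (X n)) - integral\<^sup>L M (\<Phi> t0)) / (X n - t0)) \<longlonglongrightarrow> (\<integral>z. \<Phi>' z \<partial>M)"
    by (rule LIMSEQ_offset)
qed

lemma DERIV_line_shift:
  fixes g :: "'a::real_normed_vector \<Rightarrow> real"
  assumes "((\<lambda>t. g ((z + a *\<^sub>R b) + t *\<^sub>R b)) has_real_derivative D) (at 0)"
  shows "((\<lambda>t. g (z + t *\<^sub>R b)) has_real_derivative D) (at a)"
proof -
  have "((\<lambda>t. g (z + (t + a) *\<^sub>R b)) has_real_derivative D) (at 0)"
    using assms by (simp add: scaleR_left_distrib add.assoc add.commute[of "a *\<^sub>R b"])
  then have "((\<lambda>t. (\<lambda>t. g (z + t *\<^sub>R b)) (t + a)) has_real_derivative D) (at 0)" .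
  then show ?thesis
    using DERIV_shift[of "\<lambda>t. g (z + t *\<^sub>R b)" D 0 a] by simp
qed

lemma line_lipschitz:
  fixes g D :: "'a::real_normed_vector \<Rightarrow> real"
  assumes der: "\<And>z. z \<in> cball 0 1 \<Longrightarrow> ((\<lambda>t. g (z + t *\<^sub>R b)) has_real_derivative D z) (at 0)"
    and C: "\<And>z. z \<in> cball 0 1 \<Longrightarrow> \<bar>D z\<bar> \<le> C"
    and p: "z \<in> cball 0 1" and q: "z + t *\<^sub>R b \<in> cball 0 1"
  shows "\<bar>g (z + t *\<^sub>R b) - g z\<bar> \<le> C * \<bar>t\<bar>"
proof -
  have mem: "z + \<tau> *\<^sub>R b \<in> cball 0 1" if \<tau>: "\<tau> \<in> closed_segment 0 t" for \<tau>
  proof -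
    obtain u where u: "0 \<le> u" "u \<le> 1" "\<tau> = (1 - u) *\<^sub>R 0 + u *\<^sub>R t"
      using \<tau> unfolding in_segment by blast
    have "(1 - u) *\<^sub>R z + u *\<^sub>R (z + t *\<^sub>R b) \<in> cball 0 1"
      by (rule convexD[OF convex_cball p q]) (use u in auto)
    moreover have "(1 - u) *\<^sub>R z + u *\<^sub>R (z + t *\<^sub>R b) = z + \<tau> *\<^sub>R b"
      by (simp add: u(3) algebra_simps)
    ultimately show ?thesis by simp
  qed
  have "norm (g (z + t *\<^sub>R b) - g (z + 0 *\<^sub>R b)) \<le> C * norm (t - 0)"
    by (rule field_differentiable_bound[where S="closed_segment 0 t" and f'="\<lambda>\<tau>. D (z + \<tau> *\<^sub>R b)"])
       (auto simp: convex_closed_segment simp del: mem_cball_0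
         intro: C[OF mem] has_field_derivative_at_within[OF DERIV_line_shift[OF der[OF mem]]])
  then show ?thesis by simp
qed

text \<open>Translation invariance in place of the divergence theorem: extend \<open>g\<close> by
  zero to \<open>\<phi>\<close>. The integral of \<open>\<phi> (z + t *\<^sub>R b)\<close> does not
  depend on t, so its derivative at 0 vanishes, and differentiation under the integral turns it into
  the integral of \<open>D\<close> over the ball. The kink of \<open>\<phi>\<close> on the sphere is
  harmless because the sphere is a null set.\<close>

lemma integral_directional_derivative_ball:
  fixes g D :: "'a::euclidean_space \<Rightarrow> real"
  assumes der: "\<And>z. z \<in> cball 0 1 \<Longrightarrow> ((\<lambda>t. g (z + t *\<^sub>R b)) has_real_derivative D z) (at 0)"
    and contg: "continuous_on (cball 0 1) g"
    and contD: "continuous_on (cball 0 1) D"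
    and zero: "\<And>z. norm z = 1 \<Longrightarrow> g z = 0"
  shows "(LINT z:ball 0 1|lborel. D z) = 0"
proof -
  define \<phi> where "\<phi> z = (if z \<in> cball 0 1 then g z else 0)" for z
  obtain C where C: "\<And>z. z \<in> cball 0 1 \<Longrightarrow> \<bar>D z\<bar> \<le> C"
    using compact_imp_bounded[OF compact_continuous_image[OF contD compact_cball]]
    unfolding bounded_iff real_norm_def by blast
  have C0: "0 \<le> C" using C[of 0] by auto
  \<comment> \<open>A segment that leaves the closed ball meets the sphere, where \<open>g\<close>
    vanishes; the Lipschitz bound up to that point already controls \<open>g z\<close>.\<close>
  have out: "\<bar>\<phi> (z + t *\<^sub>R b) - \<phi> z\<bar> \<le> C * \<bar>t\<bar>" if p: "z \<in> cball 0 1" and q: "z + t *\<^sub>R b \<notin> cball 0 1" for z t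
  proof -
    have "\<exists>\<tau>\<in>closed_segment 0 t. norm (z + \<tau> *\<^sub>R b) = 1"
    proof -
      let ?S = "(\<lambda>\<tau>. norm (z + \<tau> *\<^sub>R b)) ` closed_segment 0 t"
      have "connected ?S"
        by (intro connected_continuous_image continuous_intros) auto
      moreover have "norm (z + 0 *\<^sub>R b) \<in> ?S" "norm (z + t *\<^sub>R b) \<in> ?S"
        by (intro imageI ends_in_segment)+
      ultimately have "{norm (z + 0 *\<^sub>R b)..norm (z + t *\<^sub>R b)} \<subseteq> ?S"
        by (rule connected_contains_Icc)
      moreover have "1 \<in> {norm (z + 0 *\<^sub>R b)..norm (z + t *\<^sub>R b)}" using p q by simp
      ultimately have "1 \<in> ?S" by (rule subsetD)
      then show ?thesis unfolding image_iff by metis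
    qed
    then obtain \<tau> where \<tau>: "\<tau> \<in> closed_segment 0 t" "norm (z + \<tau> *\<^sub>R b) = 1" by blast
    have "\<bar>g (z + \<tau> *\<^sub>R b) - g z\<bar> \<le> C * \<bar>\<tau>\<bar>"
      by (rule line_lipschitz[where g=g and D=D and b=b]) (use der C p \<tau> in auto)
    moreover have "\<bar>\<tau>\<bar> \<le> \<bar>t\<bar>" using \<tau>(1) by (auto simp: closed_segment_eq_real_ivl split: if_splits)
    ultimately have "\<bar>g z\<bar> \<le> C * \<bar>t\<bar>" using zero[OF \<tau>(2)] C0
      by (smt (verit) mult_left_mono)
    then show ?thesis using p q by (simp add: \<phi>_def)
  qed
  have lip: "\<bar>\<phi> (z + t *\<^sub>R b) - \<phi> z\<bar> \<le> C * \<bar>t\<bar>" for z t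
  proof (cases "z \<in> cball 0 1"; cases "z + t *\<^sub>R b \<in> cball 0 1")
    assume "z \<in> cball 0 1" "z + t *\<^sub>R b \<in> cball 0 1"
    then show ?thesis using line_lipschitz[where g=g and D=D and b=b, OF der C]
      by (simp add: \<phi>_def del: mem_cball_0)
  next
    assume "z \<in> cball 0 1" "z + t *\<^sub>R b \<notin> cball 0 1"
    then show ?thesis by (rule out)
  next
    assume "z \<notin> cball 0 1" "z + t *\<^sub>R b \<in> cball 0 1"
    then show ?thesis using out[of "z + t *\<^sub>R b" "-t"] by (simp add: abs_minus_commute)
  next
    assume "z \<notin> cball 0 1" "z + t *\<^sub>R b \<notin> cball 0 1"
    then show ?thesis using C0 by (simp add: \<phi>_def)
  qed
  have meas_\<phi>: "\<phi> \<in> borel_measurable borel"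
    unfolding \<phi>_def by (rule borel_measurable_continuous_on_if) (use contg in auto)
  obtain G where G: "\<And>z. z \<in> cball 0 1 \<Longrightarrow> \<bar>g z\<bar> \<le> G"
    using compact_imp_bounded[OF compact_continuous_image[OF contg compact_cball]]
    unfolding bounded_iff real_norm_def by blast
  have int_\<phi>: "integrable lborel \<phi>"
  proof (rule Bochner_Integration.integrable_bound)
    show "integrable lborel (\<lambda>z. indicator (cball 0 1) z * G)"
      by (intro integrable_mult_left integrable_real_indicator) (auto simp: emeasure_cball)
    show "AE x in lborel. norm (\<phi> x) \<le> norm (indicator (cball 0 1) x * G)"
      using G by (intro AE_I2) (auto simp: \<phi>_def indicator_def intro: order_trans[OF _ abs_ge_self])
  qed (use meas_\<phi> in simp)
  have dist: "distr lborel borel (\<lambda>z. z + a) = (lborel :: 'a measure)" for a :: 'a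
  proof -
    have "(\<lambda>z. z + a) = (+) a" by (auto simp: add.commute)
    then show ?thesis using lborel_distr_plus[of a] by simp
  qed
  have int_t: "integrable lborel (\<lambda>z. \<phi> (z + a))" for a
    using int_\<phi> integrable_distr_eq[of "\<lambda>z. z + a" lborel borel \<phi>] meas_\<phi> by (simp add: dist)
  have const: "(\<integral>z. \<phi> (z + a) \<partial>lborel) = (\<integral>z. \<phi> z \<partial>lborel)" for a
    using integral_distr[of "\<lambda>z. z + a" lborel borel \<phi>] meas_\<phi> by (simp add: dist)
  \<comment> \<open>For |t| < 1 and |z| at least this radius, both z and z + t b lie outside the
    closed unit ball, so all difference quotients live on one fixed bounded set.\<close>
  let ?R = "2 + norm b"
  have D_meas: "(\<lambda>z. indicator (ball 0 1) z * D z) \<in> borel_measurable lborel"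
  proof -
    have "(\<lambda>z. indicator (ball 0 1) z *\<^sub>R D z) \<in> borel_measurable borel"
      by (rule borel_measurable_continuous_on_indicator) (auto intro: continuous_on_subset[OF contD])
    then show ?thesis by simp
  qed
  have "((\<lambda>t. \<integral>z. \<phi> (z + t *\<^sub>R b) \<partial>lborel) has_real_derivative
      (\<integral>z. indicator (ball 0 1) z * D z \<partial>lborel)) (at 0)"
  proof (rule has_real_derivative_integral[where \<delta>=1 and w="\<lambda>z. C * indicator (ball 0 ?R) z"])
    show "integrable lborel (\<lambda>z. \<phi> (z + t *\<^sub>R b))" for t by (rule int_t)
    show "(\<lambda>z. indicator (ball 0 1) z * D z) \<in> borel_measurable lborel" by (rule D_meas)
    show "integrable lborel (\<lambda>z. C * indicator (ball 0 ?R) z)"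
      by (intro integrable_mult_right integrable_real_indicator) (auto simp: emeasure_ball)
    have "AE z in lborel. (z :: 'a) \<notin> sphere 0 1"
      using negligible_sphere[of "0::'a" 1] by (intro AE_not_in) (auto simp: negligible_iff_null_sets null_sets_completion_iff)
    then show "AE z in lborel. ((\<lambda>t. \<phi> (z + t *\<^sub>R b)) has_real_derivative indicator (ball 0 1) z * D z) (at 0)"
    proof eventually_elim
      case (elim z)
      have "((\<lambda>t. z + t *\<^sub>R b) \<longlongrightarrow> z + 0 *\<^sub>R b) (nhds 0)"
        by (intro tendsto_add tendsto_const tendsto_scaleR filterlim_ident)
      then have lim: "((\<lambda>t. z + t *\<^sub>R b) \<longlongrightarrow> z) (nhds 0)" by simp
      show ?case
      proof (cases "z \<in> ball 0 1")
        case True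
        have "\<forall>\<^sub>F t in nhds 0. z + t *\<^sub>R b \<in> ball 0 1"
          using True by (rule topological_tendstoD[OF lim open_ball])
        then have "\<forall>\<^sub>F t in nhds 0. \<phi> (z + t *\<^sub>R b) = g (z + t *\<^sub>R b)"
          by eventually_elim (auto simp: \<phi>_def)
        then show ?thesis using der[of z] True
          by (subst DERIV_cong_ev[OF refl _ refl]) auto
      next
        case False
        then have z: "z \<in> - cball 0 1" using elim by auto
        have "\<forall>\<^sub>F t in nhds 0. z + t *\<^sub>R b \<in> - cball 0 1"
          using z by (rule topological_tendstoD[OF lim open_Compl[OF closed_cball]])
        then have "\<forall>\<^sub>F t in nhds 0. \<phi> (z + t *\<^sub>R b) = 0"
          by eventually_elim (auto simp: \<phi>_def)
        then show ?thesis using False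
          by (subst DERIV_cong_ev[OF refl _ refl]) auto
      qed
    qed
    fix t z assume t: "\<bar>t - 0\<bar> < (1::real)"
    show "\<bar>\<phi> (z + t *\<^sub>R b) - \<phi> (z + 0 *\<^sub>R b)\<bar> \<le> C * indicator (ball 0 ?R) z * \<bar>t - 0\<bar>"
    proof (cases "z \<in> ball 0 ?R")
      case True then show ?thesis using lip[of z t] by simp
    next
      case False
      then have "norm z \<ge> 2 + norm b" by simp
      moreover have "norm z \<le> norm (z + t *\<^sub>R b) + \<bar>t\<bar> * norm b"
        using norm_triangle_ineq4[of "z + t *\<^sub>R b" "t *\<^sub>R b"] by simp
      moreover have "\<bar>t\<bar> * norm b \<le> 1 * norm b" using t by (intro mult_right_mono) auto
      ultimately have "norm (z + t *\<^sub>R b) > 1" "norm z > 1" using norm_ge_zero[of b] by linarith+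
      then show ?thesis using C0 by (simp add: \<phi>_def)
    qed
  qed simp
  moreover have "((\<lambda>t. \<integral>z. \<phi> (z + t *\<^sub>R b) \<partial>lborel) has_real_derivative 0) (at 0)"
    by (simp add: const)
  ultimately have "(\<integral>z. indicator (ball 0 1) z * D z \<partial>lborel) = 0"
    by (rule DERIV_unique)
  then show ?thesis by (simp add: set_lebesgue_integral_def)
qed

text \<open>Dyadic shells: where (1/2)^k <= |z - a| < 2 (1/2)^k the integrand is at most 2^(k m),
  while the ball of radius 2 (1/2)^k has volume proportional to (1/2)^(k (m + 1)); the k-th term is
  geometric in k. An exponent one below the dimension is the order of the Poisson kernel at its
  pole, and the radius 2 makes a ball about a boundary point cover the unit ball.\<close>

lemma set_integrable_inverse_norm_power:
  fixes a :: "'a::euclidean_space"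
  assumes m: "DIM('a) = Suc m"
  shows "set_integrable lborel (ball a 2) (\<lambda>z. 1 / norm (z - a) ^ m)"
proof -
  let ?V = "unit_ball_vol (real DIM('a))"
  let ?h = "\<lambda>k z. ennreal (2 ^ (k * m)) * indicator (ball a (2 * (1/2) ^ k)) z"
  have bound: "ennreal (1 / norm (z - a) ^ m) * indicator (ball a 2) z \<le> (\<Sum>k. ?h k z)" (is "?l \<le> _")
    if "z \<noteq> a" for z
  proof (cases "z \<in> ball a 2")
    case True
    have single: "sum f {k} = f k" for f :: "nat \<Rightarrow> ennreal" and k by simp
    let ?P = "\<lambda>k. (1/2) ^ k \<le> norm (z - a)"
    define k where "k = (LEAST k. ?P k)"
    obtain k0 where "(1/2) ^ k0 < norm (z - a)"
      using real_arch_pow_inv[of "norm (z - a)" "1/2"] \<open>z \<noteq> a\<close> by auto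
    then have k: "?P k" unfolding k_def by (intro LeastI[of ?P k0]) simp
    have less: "norm (z - a) < 2 * (1/2) ^ k"
    proof (cases k)
      case 0 then show ?thesis using True by (simp add: dist_norm norm_minus_commute)
    next
      case (Suc j)
      then have "\<not> ?P j" unfolding k_def by (intro not_less_Least) simp
      then show ?thesis using Suc by simp
    qed
    have "1 / norm (z - a) ^ m \<le> 1 / ((1/2) ^ k) ^ m"
      using k \<open>z \<noteq> a\<close> by (intro divide_left_mono power_mono mult_pos_pos) auto
    also have "\<dots> = 2 ^ (k * m)" by (simp add: power_mult power_one_over)
    finally have "?l \<le> ?h k z"
      using less True by (auto simp: dist_norm norm_minus_commute intro: ennreal_leI)
    also have "\<dots> = sum (\<lambda>k. ?h k z) {k}" by (simp only: single)
    also have "\<dots> \<le> (\<Sum>k. ?h k z)"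
      by (rule sum_le_suminf) auto
    finally show ?thesis .
  qed auto
  have "AE z in lborel. z \<noteq> a" by (rule AE_lborel_singleton)
  then have "(\<integral>\<^sup>+z. ennreal (1 / norm (z - a) ^ m) * indicator (ball a 2) z \<partial>lborel) \<le> (\<integral>\<^sup>+z. (\<Sum>k. ?h k z) \<partial>lborel)"
    by (intro nn_integral_mono_AE) (auto intro: bound)
  also have "\<dots> = (\<Sum>k. \<integral>\<^sup>+z. ?h k z \<partial>lborel)"
    by (intro nn_integral_suminf borel_measurable_times_ennreal borel_measurable_const borel_measurable_indicator) simp
  also have "\<dots> = (\<Sum>k. ennreal (?V * 2 ^ Suc m * (1/2) ^ k))"
  proof (intro arg_cong[where f=suminf] ext)
    fix k
    have "(\<integral>\<^sup>+z. ?h k z \<partial>lborel) = ennreal (2 ^ (k * m)) * ennreal (?V * (2 * (1/2) ^ k) ^ Suc m)"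
      by (subst nn_integral_cmult_indicator) (auto simp: emeasure_ball m)
    also have "\<dots> = ennreal (?V * 2 ^ Suc m * (1/2) ^ k)"
      by (simp add: ennreal_mult[symmetric] power_mult_distrib power_mult power_one_over field_simps)
    finally show "(\<integral>\<^sup>+z. ?h k z \<partial>lborel) = ennreal (?V * 2 ^ Suc m * (1/2) ^ k)" .
  qed
  also have "\<dots> < \<infinity>"
  proof -
    have "(\<lambda>k. ?V * 2 ^ Suc m * (1/2) ^ k) sums (?V * 2 ^ Suc m * (1 / (1 - 1/2)))"
      by (intro sums_mult geometric_sums) simp
    then have "(\<Sum>k. ennreal (?V * 2 ^ Suc m * (1/2) ^ k)) = ennreal (?V * 2 ^ Suc m * (1 / (1 - 1/2)))"
      by (intro suminf_ennreal_eq) (auto simp: unit_ball_vol_nonneg)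
    then show ?thesis by (simp only: infinity_ennreal_def ennreal_less_top)
  qed
  finally have fin: "(\<integral>\<^sup>+z. ennreal (1 / norm (z - a) ^ m) * indicator (ball a 2) z \<partial>lborel) < \<infinity>" .
  show ?thesis unfolding set_integrable_def
  proof (rule integrableI_nonneg)
    show "(\<integral>\<^sup>+z. ennreal (indicat_real (ball a 2) z *\<^sub>R (1 / norm (z - a) ^ m)) \<partial>lborel) < \<infinity>"
    proof -
      have "ennreal (indicat_real (ball a 2) z *\<^sub>R (1 / norm (z - a) ^ m)) =
          ennreal (1 / norm (z - a) ^ m) * indicator (ball a 2) z" for z
        by (cases "z \<in> ball a 2") auto
      then show ?thesis using fin by simp
    qed
  next
    show "(\<lambda>z. indicat_real (ball a 2) z *\<^sub>R (1 / norm (z - a) ^ m)) \<in> borel_measurable lborel"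
      by (intro borel_measurable_scaleR borel_measurable_indicator borel_measurable_divide
          borel_measurable_power borel_measurable_norm borel_measurable_diff borel_measurable_const) simp_all
  qed (auto simp: zero_le_divide_iff)
qed

section \<open>The Poisson kernel\<close>

lemma DERIV_line_inner: "((\<lambda>t. (z + t *\<^sub>R b) \<bullet> c) has_real_derivative b \<bullet> c) (at 0)"
  unfolding inner_add_left inner_scaleR_left by (auto intro!: derivative_eq_intros)

lemma DERIV_line_inner_self:
  "((\<lambda>t. (z + t *\<^sub>R b) \<bullet> (z + t *\<^sub>R b)) has_real_derivative 2 * (z \<bullet> b)) (at 0)"
  unfolding inner_add_left inner_scaleR_left inner_add_right inner_scaleR_right
  by (auto intro!: derivative_eq_intros simp: inner_commute)

text \<open>At \<epsilon> = 0 this is |z - \<zeta>|^(-2n). A positive \<epsilon> removes the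
  singularity, so that derivatives can be integrated over the whole ball.\<close>

definition inv_kernel :: "'a::euclidean_space \<Rightarrow> real \<Rightarrow> nat \<Rightarrow> 'a \<Rightarrow> real" where
  "inv_kernel \<zeta> \<epsilon> n z = 1 / ((z - \<zeta>) \<bullet> (z - \<zeta>) + \<epsilon>) ^ n"

lemma DERIV_inverse_power:
  assumes "(X has_real_derivative X') (at t)" and "X t \<noteq> 0"
  shows "((\<lambda>t. 1 / X t ^ n) has_real_derivative - (real n * X' / X t ^ Suc n)) (at t)"
proof -
  have "real n * X t ^ (n - Suc 0) * (X t * X t ^ n) = real n * (X t ^ n * X t ^ n)"
    by (cases n) (auto simp: algebra_simps)
  then show ?thesis using assms(2)
    by (intro DERIV_cong[OF DERIV_divide[OF DERIV_const DERIV_power[OF assms(1)]]])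
       (auto simp: field_simps)
qed

lemma DERIV_inv_kernel:
  assumes "(w - \<zeta>) \<bullet> (w - \<zeta>) + \<epsilon> \<noteq> 0"
  shows "((\<lambda>t. inv_kernel \<zeta> \<epsilon> n (w + t *\<^sub>R b)) has_real_derivative
    - (2 * real n * ((w - \<zeta>) \<bullet> b) * inv_kernel \<zeta> \<epsilon> (Suc n) w)) (at 0)"
proof -
  have "((\<lambda>t. ((w - \<zeta>) + t *\<^sub>R b) \<bullet> ((w - \<zeta>) + t *\<^sub>R b) + \<epsilon>) has_real_derivative 2 * ((w - \<zeta>) \<bullet> b) + 0) (at 0)"
    by (intro DERIV_add DERIV_line_inner_self DERIV_const)
  from DERIV_inverse_power[OF this, of n] assms
  show ?thesis by (simp add: inv_kernel_def algebra_simps)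
qed

lemma inv_kernel_Suc:
  "(w - \<zeta>) \<bullet> (w - \<zeta>) + \<epsilon> \<noteq> 0 \<Longrightarrow> ((w - \<zeta>) \<bullet> (w - \<zeta>) + \<epsilon>) * inv_kernel \<zeta> \<epsilon> (Suc n) w = inv_kernel \<zeta> \<epsilon> n w"
  by (simp add: inv_kernel_def)

lemma continuous_on_inv_kernel:
  assumes "continuous_on S f" "\<And>x. x \<in> S \<Longrightarrow> (f x - \<zeta>) \<bullet> (f x - \<zeta>) + \<epsilon> \<noteq> 0"
  shows "continuous_on S (\<lambda>x. inv_kernel \<zeta> \<epsilon> n (f x))"
  unfolding inv_kernel_def by (intro continuous_intros assms) (use assms(2) in auto)

lemma sum_Basis_inner: "(\<Sum>b\<in>Basis. (x \<bullet> b) * (y \<bullet> b)) = (x :: 'a::euclidean_space) \<bullet> y"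
  by (simp add: euclidean_inner[of x y])

text \<open>The factorization (1 - |w|) (1 + |w|) and 1 - |w| <= |w - \<zeta>| gain one power of the
  distance to the pole; this gain is what makes the Poisson kernel integrable.\<close>

lemma one_minus_inner_le:
  assumes "norm \<zeta> = 1" "norm w \<le> 1"
  shows "0 \<le> 1 - w \<bullet> w" "1 - w \<bullet> w \<le> 2 * norm (w - \<zeta>)" "1 - w \<bullet> w \<le> 1"
proof -
  have n: "1 - norm w \<le> norm (w - \<zeta>)" using assms(1) norm_triangle_ineq2[of \<zeta> w] by (simp add: norm_minus_commute)
  have e: "1 - w \<bullet> w = (1 - norm w) * (1 + norm w)" by (simp add: power2_norm_eq_inner[symmetric] power2_eq_square algebra_simps)
  show "0 \<le> 1 - w \<bullet> w" unfolding e using assms by simp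
  have "(1 - norm w) * (1 + norm w) \<le> norm (w - \<zeta>) * 2"
    by (rule mult_mono) (use n assms in auto)
  then show "1 - w \<bullet> w \<le> 2 * norm (w - \<zeta>)" by (simp add: e)
qed simp

text \<open>The real dimension 2d agrees with the exponent of |z - \<zeta>| in the kernel;
  \<open>sum_poisson_hess\<close> depends on this match.\<close>

locale sphere_pole =
  fixes \<zeta> :: "'a::euclidean_space" and d :: nat
  assumes norm_pole: "norm \<zeta> = 1" and DIM: "DIM('a) = 2 * d"
begin

lemma d_pos: "0 < d" using DIM DIM_positive[where 'a='a] by simp

definition poisson :: "'a \<Rightarrow> real" where
  "poisson z = (1 - z \<bullet> z) * inv_kernel \<zeta> 0 d z"

definition poisson_grad :: "'a \<Rightarrow> 'a \<Rightarrow> real" where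
  "poisson_grad b w = - 2 * (w \<bullet> b) * inv_kernel \<zeta> 0 d w - 2 * d * (1 - w \<bullet> w) * ((w - \<zeta>) \<bullet> b) * inv_kernel \<zeta> 0 (Suc d) w"

text \<open>The second derivative in a unit direction: b \<bullet> b = 1 is built into the
  formula.\<close>

definition poisson_hess :: "'a \<Rightarrow> 'a \<Rightarrow> real" where
  "poisson_hess b w = - 2 * inv_kernel \<zeta> 0 d w + 8 * d * (w \<bullet> b) * ((w - \<zeta>) \<bullet> b) * inv_kernel \<zeta> 0 (Suc d) w
    - 2 * d * (1 - w \<bullet> w) * inv_kernel \<zeta> 0 (Suc d) w
    + 4 * d * (d + 1) * (1 - w \<bullet> w) * ((w - \<zeta>) \<bullet> b)\<^sup>2 * inv_kernel \<zeta> 0 (Suc (Suc d)) w"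

lemma pole_neq: "norm w < 1 \<Longrightarrow> (w - \<zeta>) \<bullet> (w - \<zeta>) + 0 \<noteq> 0" using norm_pole by auto

lemma DERIV_poisson_grad:
  assumes w: "norm w < 1" and b: "b \<bullet> b = 1"
  shows "((\<lambda>t. poisson_grad b (w + t *\<^sub>R (r *\<^sub>R b))) has_real_derivative r * poisson_hess b w) (at 0)"
proof -
  have *: "w + t *\<^sub>R (r *\<^sub>R b) - \<zeta> = (w - \<zeta>) + t *\<^sub>R (r *\<^sub>R b)" for t by simp
  note D = DERIV_inv_kernel[OF pole_neq[OF w]]
  show ?thesis unfolding poisson_grad_def *
    by (rule DERIV_cong, (rule DERIV_diff DERIV_mult DERIV_const D DERIV_line_inner DERIV_line_inner_self)+)
       (simp add: poisson_hess_def b algebra_simps power2_eq_square)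
qed

text \<open>Harmonicity: the recursion \<open>inv_kernel_Suc\<close> makes every term a multiple of
  \<open>inv_kernel \<zeta> 0 (Suc d) w\<close>, and the remaining bracket -|w - \<zeta>|^2 + 2 w
  \<bullet> (w - \<zeta>) + 1 - |w|^2 vanishes since |\<zeta>| = 1.\<close>

lemma sum_poisson_hess:
  assumes w: "norm w < 1"
  shows "(\<Sum>b\<in>Basis. poisson_hess b w) = 0"
proof -
  let ?K = "\<lambda>n. inv_kernel \<zeta> 0 n w" and ?q = "(w - \<zeta>) \<bullet> (w - \<zeta>)" and ?R = "1 - w \<bullet> w"
  have s1: "(\<Sum>b\<in>Basis. (w \<bullet> b) * ((w - \<zeta>) \<bullet> b)) = w \<bullet> (w - \<zeta>)" by (rule sum_Basis_inner)
  have s2: "(\<Sum>b\<in>Basis. ((w - \<zeta>) \<bullet> b)\<^sup>2) = ?q" unfolding power2_eq_square by (rule sum_Basis_inner)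
  have "(\<Sum>b\<in>Basis. poisson_hess b w) = - 2 * ?K d * real DIM('a) + 8 * d * (\<Sum>b\<in>Basis. (w \<bullet> b) * ((w - \<zeta>) \<bullet> b)) * ?K (Suc d)
      - 2 * d * ?R * ?K (Suc d) * real DIM('a) + 4 * d * (d + 1) * ?R * (\<Sum>b\<in>Basis. ((w - \<zeta>) \<bullet> b)\<^sup>2) * ?K (Suc (Suc d))"
    unfolding poisson_hess_def sum.distrib sum_subtractf
    by (simp add: sum_distrib_left sum_distrib_right mult.assoc)
  also have "\<dots> = - 4 * d * ?K d + 8 * d * (w \<bullet> (w - \<zeta>)) * ?K (Suc d) - 4 * d * d * ?R * ?K (Suc d)
       + 4 * d * (d + 1) * ?R * (?q * ?K (Suc (Suc d)))"
    unfolding s1 s2 DIM by (simp add: algebra_simps)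
  also have "?q * ?K (Suc (Suc d)) = ?K (Suc d)"
    using inv_kernel_Suc[OF pole_neq[OF w], of "Suc d"] by simp
  also have "?K d = ?q * ?K (Suc d)"
    using inv_kernel_Suc[OF pole_neq[OF w], of d] by simp
  also have "- 4 * d * (?q * ?K (Suc d)) + 8 * d * (w \<bullet> (w - \<zeta>)) * ?K (Suc d) - 4 * d * d * ?R * ?K (Suc d)
       + 4 * d * (d + 1) * ?R * ?K (Suc d) = 4 * d * ?K (Suc d) * (- ?q + 2 * (w \<bullet> (w - \<zeta>)) + ?R)"
    by (simp add: algebra_simps)
  also have "- ?q + 2 * (w \<bullet> (w - \<zeta>)) + ?R = 0"
    using norm_pole by (simp add: inner_diff_left inner_diff_right inner_commute norm_eq_1)
  finally show ?thesis by simp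
qed

lemma continuous_on_poisson_grad:
  assumes "\<bar>r\<bar> < 1" shows "continuous_on (cball 0 1) (\<lambda>z. poisson_grad b (r *\<^sub>R z))"
    and "continuous_on (cball 0 1) (\<lambda>z. poisson_hess b (r *\<^sub>R z))"
proof -
  have "norm (r *\<^sub>R z) < 1" if "z \<in> cball 0 1" for z
    using that assms mult_left_le[of "norm z" "\<bar>r\<bar>"] by simp
  then have "(r *\<^sub>R z - \<zeta>) \<bullet> (r *\<^sub>R z - \<zeta>) + 0 \<noteq> 0" if "z \<in> cball 0 1" for z
    using that by (intro pole_neq)
  then show "continuous_on (cball 0 1) (\<lambda>z. poisson_grad b (r *\<^sub>R z))"
    "continuous_on (cball 0 1) (\<lambda>z. poisson_hess b (r *\<^sub>R z))"
    unfolding poisson_grad_def poisson_hess_def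
    by (intro continuous_intros continuous_on_inv_kernel; blast)+
qed

text \<open>The field (1 - |z|^2) / 2 times the gradient of the kernel at r z vanishes on the
  sphere, and by harmonicity its divergence is minus the integrand. The dilation keeps the pole away
  from the ball.\<close>

lemma integral_poisson_radial_derivative:
  assumes r: "\<bar>r\<bar> < 1"
  shows "(LINT z:ball 0 1|lborel. (\<Sum>b\<in>Basis. (z \<bullet> b) * poisson_grad b (r *\<^sub>R z))) = 0"
proof -
  have in1: "norm (r *\<^sub>R z) < 1" if "z \<in> cball 0 1" for z
    using that r mult_left_le[of "norm z" "\<bar>r\<bar>"] by simp
  let ?D = "\<lambda>b z. - (z \<bullet> b) * poisson_grad b (r *\<^sub>R z) + (1 - z \<bullet> z) / 2 * (r * poisson_hess b (r *\<^sub>R z))"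
  have contD: "continuous_on (cball 0 1) (?D b)" for b
    by (intro continuous_on_add continuous_on_mult continuous_on_minus continuous_on_divide continuous_on_diff
        continuous_on_inner continuous_on_const continuous_on_id continuous_on_poisson_grad[OF r]) simp
  have int: "set_integrable lborel (ball 0 1) (?D b)" for b
    by (rule set_integrable_subset[OF borel_integrable_compact[OF compact_cball contD, unfolded set_integrable_def[symmetric]]])
       auto
  have zero: "(LINT z:ball 0 1|lborel. ?D b z) = 0" if b: "b \<in> Basis" for b
  proof (rule integral_directional_derivative_ball[where b=b and g="\<lambda>z. (1 - z \<bullet> z) / 2 * poisson_grad b (r *\<^sub>R z)"])
    fix z :: 'a assume z: "z \<in> cball 0 1"
    have eq: "r *\<^sub>R (z + t *\<^sub>R b) = r *\<^sub>R z + t *\<^sub>R (r *\<^sub>R b)" for t by (simp add: scaleR_add_right)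
    have bb: "b \<bullet> b = 1" using b by simp
    show "((\<lambda>t. (1 - (z + t *\<^sub>R b) \<bullet> (z + t *\<^sub>R b)) / 2 * poisson_grad b (r *\<^sub>R (z + t *\<^sub>R b))) has_real_derivative ?D b z) (at 0)"
      unfolding eq
      by (rule DERIV_cong, (rule DERIV_mult DERIV_cdivide DERIV_diff DERIV_const DERIV_line_inner_self DERIV_poisson_grad[OF in1[OF z] bb])+)
         (simp add: algebra_simps)
  next
    show "continuous_on (cball 0 1) (\<lambda>z. (1 - z \<bullet> z) / 2 * poisson_grad b (r *\<^sub>R z))"
      by (intro continuous_intros continuous_on_poisson_grad[OF r]) auto
  next
    show "continuous_on (cball 0 1) (?D b)" by (rule contD)
  qed (simp add: norm_eq_1)
  have "0 = (\<Sum>b\<in>Basis. LINT z:ball 0 1|lborel. ?D b z)" using zero by simp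
  also have "\<dots> = (LINT z:ball 0 1|lborel. (\<Sum>b\<in>Basis. ?D b z))"
    unfolding set_lebesgue_integral_def scaleR_sum_right
    by (rule Bochner_Integration.integral_sum[symmetric]) (rule int[unfolded set_integrable_def])
  also have "\<dots> = (LINT z:ball 0 1|lborel. - (\<Sum>b\<in>Basis. (z \<bullet> b) * poisson_grad b (r *\<^sub>R z)))"
  proof (rule set_lebesgue_integral_cong)
    show "\<forall>z. z \<in> ball 0 1 \<longrightarrow> (\<Sum>b\<in>Basis. ?D b z) = - (\<Sum>b\<in>Basis. (z \<bullet> b) * poisson_grad b (r *\<^sub>R z))"
    proof (intro allI impI)
      fix z :: 'a assume "z \<in> ball 0 1"
      then have "(\<Sum>b\<in>Basis. poisson_hess b (r *\<^sub>R z)) = 0" using in1[of z] by (intro sum_poisson_hess) auto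
      then show "(\<Sum>b\<in>Basis. ?D b z) = - (\<Sum>b\<in>Basis. (z \<bullet> b) * poisson_grad b (r *\<^sub>R z))"
        by (simp add: sum_subtractf sum_distrib_left[symmetric] sum_divide_distrib[symmetric])
    qed
  qed auto
  also have "\<dots> = - (LINT z:ball 0 1|lborel. (\<Sum>b\<in>Basis. (z \<bullet> b) * poisson_grad b (r *\<^sub>R z)))"
    by (simp add: set_lebesgue_integral_def)
  finally show ?thesis by simp
qed

lemma kernel_bound:
  assumes "norm w \<le> 1" "w \<noteq> \<zeta>"
  shows "\<bar>poisson w\<bar> \<le> 2 / norm (w - \<zeta>) ^ (2 * d - 1)"
proof -
  have pos: "0 < norm (w - \<zeta>)" using assms by simp
  have k: "inv_kernel \<zeta> 0 d w = 1 / norm (w - \<zeta>) ^ (2 * d)"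
    by (simp add: inv_kernel_def power_mult power2_norm_eq_inner)
  have "\<bar>poisson w\<bar> = (1 - w \<bullet> w) / norm (w - \<zeta>) ^ (2 * d)"
    using one_minus_inner_le(1)[OF norm_pole assms(1)] by (simp add: poisson_def k abs_mult)
  also have "\<dots> \<le> (2 * norm (w - \<zeta>)) / norm (w - \<zeta>) ^ (2 * d)"
    using one_minus_inner_le(2)[OF norm_pole assms(1)] by (intro divide_right_mono) auto
  also have "\<dots> = 2 / norm (w - \<zeta>) ^ (2 * d - 1)"
    using pos d_pos by (cases "2 * d") (auto simp: field_simps)
  finally show ?thesis .
qed

lemma set_integrable_bound_kernel:
  "set_integrable lborel (ball 0 1) (\<lambda>z. C / norm (z - \<zeta>) ^ (2 * d - 1))"
proof -
  have "set_integrable lborel (ball \<zeta> 2) (\<lambda>z. 1 / norm (z - \<zeta>) ^ (2 * d - 1))"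
    by (rule set_integrable_inverse_norm_power) (use DIM d_pos in simp)
  then have "set_integrable lborel (ball 0 1) (\<lambda>z. 1 / norm (z - \<zeta>) ^ (2 * d - 1))"
    by (rule set_integrable_subset) (use norm_pole in \<open>auto simp: ball_subset_ball_iff\<close>)
  from set_integrable_mult_right[OF this, of C] show ?thesis by simp
qed

lemma set_integrable_poisson: "set_integrable lborel (ball 0 1) poisson"
proof (rule set_integrable_bound[OF set_integrable_bound_kernel[of 2]])
  have "poisson \<in> borel_measurable borel" unfolding poisson_def inv_kernel_def by measurable
  then show "set_borel_measurable lborel (ball 0 1) poisson"
    unfolding set_borel_measurable_def by (intro borel_measurable_scaleR borel_measurable_indicator) simp_all
qed (use kernel_bound norm_pole in \<open>auto intro!: AE_I2 order_trans[OF kernel_bound]\<close>)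

text \<open>Supplies a dominating function uniform in r: the displacement |z - r z| is at most 1 -
  r, which in turn is at most |r z - \<zeta>|.\<close>

lemma norm_scale_pole_ge:
  assumes "1/2 \<le> r" "r \<le> 1" "norm z \<le> 1"
  shows "norm (z - \<zeta>) \<le> 2 * norm (r *\<^sub>R z - \<zeta>)"
proof -
  have "norm (z - \<zeta>) \<le> norm (z - r *\<^sub>R z) + norm (r *\<^sub>R z - \<zeta>)"
    using norm_triangle_ineq[of "z - r *\<^sub>R z" "r *\<^sub>R z - \<zeta>"] by simp
  moreover have "norm (z - r *\<^sub>R z) \<le> 1 - r"
  proof -
    have "z - r *\<^sub>R z = (1 - r) *\<^sub>R z" by (simp add: algebra_simps)
    then show ?thesis using assms mult_left_le[of "norm z" "1 - r"] by simp
  qed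
  moreover have "1 - r \<le> norm (r *\<^sub>R z - \<zeta>)"
  proof -
    have "norm (r *\<^sub>R z) \<le> r" using assms mult_left_le[of "norm z" r] by simp
    then show ?thesis using norm_triangle_ineq2[of \<zeta> "r *\<^sub>R z"] norm_pole by (simp add: norm_minus_commute)
  qed
  ultimately show ?thesis by simp
qed

lemma DERIV_poisson_radial:
  assumes "norm (r *\<^sub>R z) < 1"
  shows "((\<lambda>t. poisson (t *\<^sub>R z)) has_real_derivative (\<Sum>b\<in>Basis. (z \<bullet> b) * poisson_grad b (r *\<^sub>R z))) (at r)"
proof -
  let ?w = "r *\<^sub>R z"
  have *: "?w + t *\<^sub>R z = (t + r) *\<^sub>R z" for t by (simp add: algebra_simps)
  have "((\<lambda>t. poisson (?w + t *\<^sub>R z)) has_real_derivative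
      - 2 * (?w \<bullet> z) * inv_kernel \<zeta> 0 d ?w - 2 * d * (1 - ?w \<bullet> ?w) * ((?w - \<zeta>) \<bullet> z) * inv_kernel \<zeta> 0 (Suc d) ?w) (at 0)"
    unfolding poisson_def
    by (rule DERIV_cong, (rule DERIV_mult DERIV_diff DERIV_const DERIV_line_inner_self DERIV_inv_kernel[OF pole_neq[OF assms]])+)
       (simp add: algebra_simps)
  then have deriv: "((\<lambda>t. poisson (t *\<^sub>R z)) has_real_derivative
      - 2 * (?w \<bullet> z) * inv_kernel \<zeta> 0 d ?w - 2 * d * (1 - ?w \<bullet> ?w) * ((?w - \<zeta>) \<bullet> z) * inv_kernel \<zeta> 0 (Suc d) ?w) (at r)"
    unfolding * using DERIV_shift[of "\<lambda>t. poisson (t *\<^sub>R z)" _ 0 r] by simp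
  have "(\<Sum>b\<in>Basis. p b * (- 2 * q b * x - c * s b * y)) = - 2 * (\<Sum>b\<in>Basis. p b * q b) * x - c * (\<Sum>b\<in>Basis. p b * s b) * y"
    for p q s :: "'a \<Rightarrow> real" and x y c
    by (simp add: sum_distrib_left sum_distrib_right sum_subtractf sum_negf algebra_simps)
  from this[of "\<lambda>b. z \<bullet> b" "\<lambda>b. ?w \<bullet> b" _ "2 * d * (1 - ?w \<bullet> ?w)" "\<lambda>b. (?w - \<zeta>) \<bullet> b"]
  have "(\<Sum>b\<in>Basis. (z \<bullet> b) * poisson_grad b ?w) = - 2 * (\<Sum>b\<in>Basis. (z \<bullet> b) * (?w \<bullet> b)) * inv_kernel \<zeta> 0 d ?w
      - 2 * d * (1 - ?w \<bullet> ?w) * (\<Sum>b\<in>Basis. (z \<bullet> b) * ((?w - \<zeta>) \<bullet> b)) * inv_kernel \<zeta> 0 (Suc d) ?w"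
    unfolding poisson_grad_def .
  with deriv show ?thesis unfolding sum_Basis_inner by (simp only: inner_commute)
qed

lemma set_integrable_poisson_scaled:
  assumes "\<bar>r\<bar> < 1"
  shows "set_integrable lborel (ball 0 1) (\<lambda>z. poisson (r *\<^sub>R z))"
proof -
  have "norm (r *\<^sub>R z) < 1" if "z \<in> cball 0 1" for z
    using that assms mult_left_le[of "norm z" "\<bar>r\<bar>"] by simp
  then have "(r *\<^sub>R z - \<zeta>) \<bullet> (r *\<^sub>R z - \<zeta>) + 0 \<noteq> 0" if "z \<in> cball 0 1" for z
    using that by (intro pole_neq)
  then have "continuous_on (cball 0 1) (\<lambda>z. poisson (r *\<^sub>R z))"
    unfolding poisson_def by (intro continuous_intros continuous_on_inv_kernel) blast
  from borel_integrable_compact[OF compact_cball this]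
  show ?thesis
    by (intro set_integrable_subset[of lborel "cball 0 1" _ "ball 0 1"]) (auto simp: set_integrable_def)
qed

lemma poisson_radial_derivative_bound:
  assumes r: "\<bar>r\<bar> < 1"
  obtains C where "\<And>s z. \<lbrakk>\<bar>s\<bar> \<le> \<bar>r\<bar>; norm z \<le> 1\<rbrakk> \<Longrightarrow> \<bar>\<Sum>b\<in>Basis. (z \<bullet> b) * poisson_grad b (s *\<^sub>R z)\<bar> \<le> C"
proof -
  let ?S = "{-\<bar>r\<bar>..\<bar>r\<bar>} \<times> cball (0::'a) 1"
  have "norm (fst p *\<^sub>R snd p) < 1" if "p \<in> ?S" for p
  proof -
    have "\<bar>fst p\<bar> * norm (snd p) \<le> \<bar>r\<bar> * 1" using that by (intro mult_mono) auto
    then show ?thesis using r by simp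
  qed
  then have "(fst p *\<^sub>R snd p - \<zeta>) \<bullet> (fst p *\<^sub>R snd p - \<zeta>) + 0 \<noteq> 0" if "p \<in> ?S" for p
    using that by (intro pole_neq)
  then have "continuous_on ?S (\<lambda>p. \<Sum>b\<in>Basis. (snd p \<bullet> b) * poisson_grad b (fst p *\<^sub>R snd p))"
    unfolding poisson_grad_def by (intro continuous_intros continuous_on_inv_kernel; blast)
  then have "compact ((\<lambda>p. \<Sum>b\<in>Basis. (snd p \<bullet> b) * poisson_grad b (fst p *\<^sub>R snd p)) ` ?S)"
    by (intro compact_continuous_image compact_Times compact_cball) auto
  from compact_imp_bounded[OF this]
  obtain C where C: "\<And>p. p \<in> ?S \<Longrightarrow> \<bar>\<Sum>b\<in>Basis. (snd p \<bullet> b) * poisson_grad b (fst p *\<^sub>R snd p)\<bar> \<le> C"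
    unfolding bounded_iff real_norm_def by blast
  show ?thesis
  proof (rule that[of C])
    fix s z assume sz: "\<bar>s\<bar> \<le> \<bar>r\<bar>" "norm (z::'a) \<le> 1"
    then have "- \<bar>r\<bar> \<le> s" "s \<le> \<bar>r\<bar>" by linarith+
    then show "\<bar>\<Sum>b\<in>Basis. (z \<bullet> b) * poisson_grad b (s *\<^sub>R z)\<bar> \<le> C"
      using C[of "(s, z)"] sz(2) by simp
  qed
qed

lemma DERIV_poisson_mean:
  assumes r: "\<bar>r\<bar> < 1"
  shows "((\<lambda>t. LINT z:ball 0 1|lborel. poisson (t *\<^sub>R z)) has_real_derivative 0) (at r)"
proof -
  \<comment> \<open>The midpoint between |r| and 1: for t close to r all points t z stay in one
    compact subset of the open ball.\<close>
  define r1 where "r1 = (1 + \<bar>r\<bar>) / 2"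
  have r1: "\<bar>r1\<bar> < 1" "\<bar>r\<bar> < \<bar>r1\<bar>" using r by (auto simp: r1_def abs_if)
  obtain C where C: "\<And>s z. \<lbrakk>\<bar>s\<bar> \<le> \<bar>r1\<bar>; norm z \<le> 1\<rbrakk> \<Longrightarrow> \<bar>\<Sum>b\<in>Basis. (z \<bullet> b) * poisson_grad b (s *\<^sub>R z)\<bar> \<le> C"
    using poisson_radial_derivative_bound[OF r1(1)] by blast
  let ?D = "\<lambda>z. \<Sum>b\<in>Basis. (z \<bullet> b) * poisson_grad b (r *\<^sub>R z)"
  have small: "norm (s *\<^sub>R z) < 1" if "\<bar>s\<bar> \<le> \<bar>r1\<bar>" "norm z \<le> 1" for s and z :: 'a
  proof -
    have "\<bar>s\<bar> * norm z \<le> \<bar>r1\<bar> * 1" using that by (intro mult_mono) auto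
    then show ?thesis using r1 by simp
  qed
  have "((\<lambda>t. \<integral>z. indicator (ball 0 1) z *\<^sub>R poisson (t *\<^sub>R z) \<partial>lborel) has_real_derivative
      (\<integral>z. indicator (ball 0 1) z *\<^sub>R ?D z \<partial>lborel)) (at r)"
  proof (rule has_real_derivative_integral[where \<delta>="\<bar>r1\<bar> - \<bar>r\<bar>" and w="\<lambda>z. indicator (ball 0 1) z * C"])
    show "0 < \<bar>r1\<bar> - \<bar>r\<bar>" using r1 by simp
    show "integrable lborel (\<lambda>z. indicator (ball 0 1) z *\<^sub>R poisson (t *\<^sub>R z))" if "\<bar>t - r\<bar> < \<bar>r1\<bar> - \<bar>r\<bar>" for t
      using set_integrable_poisson_scaled[of t] that r1 unfolding set_integrable_def by simp
    show "AE z in lborel. ((\<lambda>t. indicator (ball 0 1) z *\<^sub>R poisson (t *\<^sub>R z)) has_real_derivative indicator (ball 0 1) z *\<^sub>R ?D z) (at r)"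
    proof (rule AE_I2)
      fix z :: 'a
      show "((\<lambda>t. indicator (ball 0 1) z *\<^sub>R poisson (t *\<^sub>R z)) has_real_derivative indicator (ball 0 1) z *\<^sub>R ?D z) (at r)"
        using DERIV_poisson_radial[of r z] small[of r z] r1 by (cases "z \<in> ball 0 1") auto
    qed
    show "(\<lambda>z. indicator (ball 0 1) z *\<^sub>R ?D z) \<in> borel_measurable lborel"
    proof -
      have "(\<lambda>z. indicator (ball 0 1) z *\<^sub>R ?D z) \<in> borel_measurable borel"
        by (intro borel_measurable_continuous_on_indicator continuous_intros
            continuous_on_subset[OF continuous_on_poisson_grad(1)[OF r]]) auto
      then show ?thesis by simp
    qed
    show "integrable lborel (\<lambda>z. indicator (ball 0 1) z * C)"
      by (intro integrable_mult_left integrable_real_indicator) (auto simp: emeasure_ball)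
    fix t z assume t: "\<bar>t - r\<bar> < \<bar>r1\<bar> - \<bar>r\<bar>"
    show "\<bar>indicator (ball 0 1) z *\<^sub>R poisson (t *\<^sub>R z) - indicator (ball 0 1) z *\<^sub>R poisson (r *\<^sub>R z)\<bar> \<le> indicator (ball 0 1) z * C * \<bar>t - r\<bar>"
    proof (cases "z \<in> ball 0 1")
      case True
      have seg: "\<bar>s\<bar> \<le> \<bar>r1\<bar>" if "s \<in> closed_segment r t" for s
        using that t by (auto simp: closed_segment_eq_real_ivl split: if_splits)
      have "norm (poisson (t *\<^sub>R z) - poisson (r *\<^sub>R z)) \<le> C * norm (t - r)"
      proof (rule field_differentiable_bound[where S="closed_segment r t"])
        fix s assume s: "s \<in> closed_segment r t"
        show "((\<lambda>t. poisson (t *\<^sub>R z)) has_real_derivative (\<Sum>b\<in>Basis. (z \<bullet> b) * poisson_grad b (s *\<^sub>R z))) (at s within closed_segment r t)"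
          by (rule has_field_derivative_at_within[OF DERIV_poisson_radial[OF small[OF seg[OF s]]]]) (use True in simp)
        show "norm (\<Sum>b\<in>Basis. (z \<bullet> b) * poisson_grad b (s *\<^sub>R z)) \<le> C"
          using C[OF seg[OF s], of z] True by simp
      qed auto
      then show ?thesis using True by simp
    qed simp
  qed
  then show ?thesis
    using integral_poisson_radial_derivative[OF r] by (simp add: set_lebesgue_integral_def)
qed

text \<open>The derivative in r is 0, and at r = 0 the integrand is
  \<open>poisson 0 = 1\<close>.\<close>

lemma poisson_mean_const:
  assumes "\<bar>r\<bar> < 1"
  shows "(LINT z:ball 0 1|lborel. poisson (r *\<^sub>R z)) = measure lborel (ball (0::'a) 1)"
proof -
  have "\<exists>c. \<forall>t\<in>{-1<..<1}. (LINT z:ball 0 1|lborel. poisson (t *\<^sub>R z)) = c"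
    by (rule has_field_derivative_zero_constant)
       (auto intro!: has_field_derivative_at_within[OF DERIV_poisson_mean])
  then have "(LINT z:ball 0 1|lborel. poisson (r *\<^sub>R z)) = (LINT z:ball 0 1|lborel. poisson (0 *\<^sub>R z))"
    using assms by (metis abs_less_iff abs_zero greaterThanLessThan_iff minus_less_iff zero_less_one neg_less_0_iff_less)
  also have "\<dots> = (LINT z:ball (0::'a) 1|lborel. 1)"
    using norm_pole by (simp add: poisson_def inv_kernel_def norm_eq_1)
  also have "\<dots> = measure lborel (ball (0::'a) 1)"
    by (simp add: set_lebesgue_integral_def)
  finally show ?thesis .
qed

text \<open>Let the dilation tend to 1. Dominated convergence survives the arrival of the pole on
  the sphere because the dilated kernels stay below a fixed multiple of |z - \<zeta>|^(1 -
  2d).\<close>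

lemma integral_poisson: "(LINT z:ball 0 1|lborel. poisson z) = measure lborel (ball (0::'a) 1)"
proof -
  \<comment> \<open>Starting at 1/2 keeps \<open>norm_scale_pole_ge\<close> applicable along the
    whole sequence.\<close>
  define r where "r n = 1 - inverse (real (Suc n)) / 2" for n
  have r: "1/2 \<le> r n" "r n < 1" for n by (auto simp: r_def field_simps)
  have "r \<longlonglongrightarrow> 1 - 0 / 2" unfolding r_def
    by (intro tendsto_intros LIMSEQ_inverse_real_of_nat) auto
  then have r_lim: "r \<longlonglongrightarrow> 1" by simp
  have "(\<lambda>n. \<integral>z. indicator (ball 0 1) z *\<^sub>R poisson (r n *\<^sub>R z) \<partial>lborel) \<longlonglongrightarrow> (\<integral>z. indicator (ball 0 1) z *\<^sub>R poisson z \<partial>lborel)"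
  proof (rule integral_dominated_convergence[where w="\<lambda>z. indicator (ball 0 1) z *\<^sub>R (2 ^ (2 * d) / norm (z - \<zeta>) ^ (2 * d - 1))"])
    show "(\<lambda>z. indicator (ball 0 1) z *\<^sub>R poisson z) \<in> borel_measurable lborel"
      using set_integrable_poisson unfolding set_integrable_def by simp
    show "(\<lambda>z. indicator (ball 0 1) z *\<^sub>R poisson (r n *\<^sub>R z)) \<in> borel_measurable lborel" for n
      using set_integrable_poisson_scaled[of "r n"] r[of n] unfolding set_integrable_def by simp
    show "integrable lborel (\<lambda>z. indicator (ball 0 1) z *\<^sub>R (2 ^ (2 * d) / norm (z - \<zeta>) ^ (2 * d - 1)))"
      using set_integrable_bound_kernel[of "2 ^ (2 * d)"] unfolding set_integrable_def .
    show "AE z in lborel. (\<lambda>n. indicator (ball 0 1) z *\<^sub>R poisson (r n *\<^sub>R z)) \<longlonglongrightarrow> indicator (ball 0 1) z *\<^sub>R poisson z"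
    proof (rule AE_I2)
      fix z :: 'a
      show "(\<lambda>n. indicator (ball 0 1) z *\<^sub>R poisson (r n *\<^sub>R z)) \<longlonglongrightarrow> indicator (ball 0 1) z *\<^sub>R poisson z"
      proof (cases "z \<in> ball 0 1")
        case True
        then have "((1 *\<^sub>R z - \<zeta>) \<bullet> (1 *\<^sub>R z - \<zeta>) + 0) ^ d \<noteq> 0" using pole_neq[of z] by simp
        then have "(\<lambda>n. poisson (r n *\<^sub>R z)) \<longlonglongrightarrow> poisson (1 *\<^sub>R z)"
          unfolding poisson_def inv_kernel_def by (intro tendsto_intros r_lim)
        then show ?thesis using True by simp
      qed simp
    qed
    show "AE z in lborel. norm (indicator (ball 0 1) z *\<^sub>R poisson (r n *\<^sub>R z)) \<le> indicator (ball 0 1) z *\<^sub>R (2 ^ (2 * d) / norm (z - \<zeta>) ^ (2 * d - 1))" for n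
    proof (rule AE_I2)
      fix z :: 'a
      show "norm (indicator (ball 0 1) z *\<^sub>R poisson (r n *\<^sub>R z)) \<le> indicator (ball 0 1) z *\<^sub>R (2 ^ (2 * d) / norm (z - \<zeta>) ^ (2 * d - 1))"
      proof (cases "z \<in> ball 0 1")
        case True
        have small: "norm (r n *\<^sub>R z) < 1"
          using True r[of n] mult_mono[of "r n" 1 "norm z" "norm z"] by simp
        have zn: "z \<noteq> \<zeta>" "r n *\<^sub>R z \<noteq> \<zeta>" using True small norm_pole by auto
        have "\<bar>poisson (r n *\<^sub>R z)\<bar> \<le> 2 / norm (r n *\<^sub>R z - \<zeta>) ^ (2 * d - 1)"
          using kernel_bound[of "r n *\<^sub>R z"] small zn by simp
        also have "\<dots> \<le> 2 / (norm (z - \<zeta>) / 2) ^ (2 * d - 1)"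
          using norm_scale_pole_ge[of "r n" z] r[of n] True zn
          by (intro divide_left_mono power_mono mult_pos_pos zero_less_power) auto
        also have "\<dots> = 2 ^ (2 * d) / norm (z - \<zeta>) ^ (2 * d - 1)"
          using d_pos by (simp add: power_divide power_eq_if[of 2 "2 * d"])
        finally show ?thesis using True by simp
      qed simp
    qed
  qed
  moreover have "(\<integral>z. indicator (ball 0 1) z *\<^sub>R poisson (r n *\<^sub>R z) \<partial>lborel) = measure lborel (ball (0::'a) 1)" for n
    using poisson_mean_const[of "r n"] r[of n] by (simp add: set_lebesgue_integral_def)
  ultimately show ?thesis
    by (simp add: LIMSEQ_const_iff set_lebesgue_integral_def)
qed


lemma inv_kernel_le:
  assumes "z \<noteq> \<zeta>" "0 \<le> \<epsilon>"
  shows "0 \<le> inv_kernel \<zeta> \<epsilon> n z" "inv_kernel \<zeta> \<epsilon> n z \<le> 1 / norm (z - \<zeta>) ^ (2 * n)"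
proof -
  have p: "0 < (z - \<zeta>) \<bullet> (z - \<zeta>)" using assms(1) by simp
  show "0 \<le> inv_kernel \<zeta> \<epsilon> n z" using p assms(2) by (simp add: inv_kernel_def)
  have "1 / ((z - \<zeta>) \<bullet> (z - \<zeta>) + \<epsilon>) ^ n \<le> 1 / ((z - \<zeta>) \<bullet> (z - \<zeta>)) ^ n"
    using p assms(2) by (intro divide_left_mono power_mono mult_pos_pos zero_less_power) linarith+
  then show "inv_kernel \<zeta> \<epsilon> n z \<le> 1 / norm (z - \<zeta>) ^ (2 * n)"
    by (simp add: inv_kernel_def power_mult power2_norm_eq_inner)
qed

text \<open>
  With \<open>v = u - u \<zeta>\<close> and \<open>K = inv_kernel \<zeta> \<epsilon> d\<close>, the field \<open>(1 - |z|\<^sup>2)\<^sup>2 (v \<nabla>K - K \<nabla>v)\<close> vanishes on the sphere, so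
  its divergence has integral 0. Subtracting \<open>u \<zeta>\<close> keeps the divergence dominated by
  \<open>|z - \<zeta>|\<^bsup>1 - 2d\<^esup>\<close> as \<open>\<epsilon>\<close> tends to 0.
\<close>

lemma integral_poisson_laplacian:
  fixes u :: "'a \<Rightarrow> real" and u1 u2 :: "'a \<Rightarrow> 'a \<Rightarrow> real"
  assumes u1: "\<And>b z. b \<in> Basis \<Longrightarrow> ((\<lambda>t. u (z + t *\<^sub>R b)) has_real_derivative u1 b z) (at 0)"
    and u2: "\<And>b z. b \<in> Basis \<Longrightarrow> ((\<lambda>t. u1 b (z + t *\<^sub>R b)) has_real_derivative u2 b z) (at 0)"
    and cont: "continuous_on UNIV u" "\<And>b. b \<in> Basis \<Longrightarrow> continuous_on UNIV (u1 b)"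
      "\<And>b. b \<in> Basis \<Longrightarrow> continuous_on UNIV (u2 b)"
    and lip: "\<And>z. norm z \<le> 1 \<Longrightarrow> \<bar>u z - u \<zeta>\<bar> \<le> C * norm (z - \<zeta>)"
  shows "set_integrable lborel (ball 0 1) (\<lambda>z. poisson z * (4 * d * u z + 4 * (\<Sum>b\<in>Basis. (z \<bullet> b) * u1 b z) - (1 - z \<bullet> z) * (\<Sum>b\<in>Basis. u2 b z)))" (is ?int)
    and "(LINT z:ball 0 1|lborel. poisson z * (4 * d * u z + 4 * (\<Sum>b\<in>Basis. (z \<bullet> b) * u1 b z) - (1 - z \<bullet> z) * (\<Sum>b\<in>Basis. u2 b z)))
      = 4 * d * u \<zeta> * measure lborel (ball (0::'a) 1)"  (is ?eq)
proof -
  define v where "v z = u z - u \<zeta>" for z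
  define S1 where "S1 z = (\<Sum>b\<in>Basis. (z \<bullet> b) * u1 b z)" for z
  define S2 where "S2 z = (\<Sum>b\<in>Basis. u2 b z)" for z
  let ?R = "\<lambda>z. 1 - z \<bullet> z" and ?K = "inv_kernel \<zeta>" and ?s = "\<lambda>z. (z - \<zeta>) \<bullet> (z - \<zeta>)"
  \<comment> \<open>Component of the field in direction b; \<open>dF\<close> is its derivative along
    b, and \<open>E\<close> is the divergence, the sum of \<open>dF\<close> over the basis.\<close>
  define F where "F \<epsilon> b z = (?R z * ?R z) * (v z * (- 2 * d * ((z - \<zeta>) \<bullet> b) * ?K \<epsilon> (Suc d) z) - u1 b z * ?K \<epsilon> d z)" for \<epsilon> b z
  define dF where "dF \<epsilon> b z = 8 * d * ?R z * v z * ((z \<bullet> b) * ((z - \<zeta>) \<bullet> b)) * ?K \<epsilon> (Suc d) z + 4 * ?R z * ((z \<bullet> b) * u1 b z) * ?K \<epsilon> d z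
     + (?R z)\<^sup>2 * (v z * (- 2 * d * ?K \<epsilon> (Suc d) z + 4 * d * (d + 1) * (((z - \<zeta>) \<bullet> b) * ((z - \<zeta>) \<bullet> b)) * ?K \<epsilon> (Suc (Suc d)) z) - u2 b z * ?K \<epsilon> d z)" for \<epsilon> b z
  define E where "E \<epsilon> z = 8 * d * ?R z * v z * (z \<bullet> (z - \<zeta>)) * ?K \<epsilon> (Suc d) z + 4 * ?R z * S1 z * ?K \<epsilon> d z
     + (?R z)\<^sup>2 * (v z * (- 4 * d * d * ?K \<epsilon> (Suc d) z + 4 * d * (d + 1) * ?s z * ?K \<epsilon> (Suc (Suc d)) z) - S2 z * ?K \<epsilon> d z)" for \<epsilon> z
  have cv: "continuous_on UNIV v" unfolding v_def by (intro continuous_intros cont)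
  have cS1: "continuous_on UNIV S1" unfolding S1_def by (intro continuous_intros cont)
  have cS2: "continuous_on UNIV S2" unfolding S2_def by (intro continuous_intros cont)
  have pos: "?s z + \<epsilon> \<noteq> 0" if "0 < \<epsilon>" for z \<epsilon>
    using that inner_ge_zero[of "z - \<zeta>"] by linarith
  have cK: "continuous_on S (?K \<epsilon> n)" if "0 < \<epsilon>" for S \<epsilon> n
    by (rule continuous_on_inv_kernel[OF continuous_on_id pos[OF that]])
  note cs = continuous_on_subset[OF cv subset_UNIV] continuous_on_subset[OF cS1 subset_UNIV]
    continuous_on_subset[OF cS2 subset_UNIV]
    continuous_on_subset[OF cont(2) subset_UNIV] continuous_on_subset[OF cont(3) subset_UNIV]
  note ci = continuous_on_add continuous_on_mult continuous_on_minus continuous_on_diff continuous_on_power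
        continuous_on_inner continuous_on_const continuous_on_id
  have zero: "(LINT z:ball 0 1|lborel. dF \<epsilon> b z) = 0" if e: "0 < \<epsilon>" and b: "b \<in> Basis" for \<epsilon> b
  proof (rule integral_directional_derivative_ball[where b=b and g="F \<epsilon> b"])
    fix z :: 'a
    have dv: "((\<lambda>t. v (z + t *\<^sub>R b)) has_real_derivative u1 b z) (at 0)"
      unfolding v_def by (rule DERIV_cong[OF DERIV_diff[OF u1[OF b] DERIV_const]]) simp
    have *: "z + t *\<^sub>R b - \<zeta> = (z - \<zeta>) + t *\<^sub>R b" for t by simp
    have bb: "b \<bullet> b = 1" using b by simp
    show "((\<lambda>t. F \<epsilon> b (z + t *\<^sub>R b)) has_real_derivative dF \<epsilon> b z) (at 0)"
      unfolding F_def *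
      by (rule DERIV_cong, (rule DERIV_diff DERIV_mult DERIV_const dv u2[OF b] DERIV_inv_kernel[OF pos[OF e]] DERIV_line_inner DERIV_line_inner_self)+)
         (simp add: dF_def bb algebra_simps power2_eq_square)
  next
    show "continuous_on (cball 0 1) (F \<epsilon> b)" unfolding F_def
      by (intro ci cs(1) cs(4)[OF b] cK[OF e])
    show "continuous_on (cball 0 1) (dF \<epsilon> b)" unfolding dF_def
      by (intro ci cs(1) cs(4)[OF b] cs(5)[OF b] cK[OF e])
  qed (simp add: F_def norm_eq_1)
  have intdF: "set_integrable lborel (ball 0 1) (dF \<epsilon> b)" if e: "0 < \<epsilon>" and b: "b \<in> Basis" for \<epsilon> b
  proof -
    have "continuous_on (cball 0 1) (dF \<epsilon> b)" unfolding dF_def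
      by (intro ci cs(1) cs(4)[OF b] cs(5)[OF b] cK[OF e])
    from borel_integrable_compact[OF compact_cball this]
    show ?thesis by (intro set_integrable_subset[of lborel "cball 0 1" _ "ball 0 1"]) (auto simp: set_integrable_def)
  qed
  have sumdF: "(\<Sum>b\<in>Basis. dF \<epsilon> b z) = E \<epsilon> z" for \<epsilon> z
  proof -
    have s1: "(\<Sum>b\<in>Basis. (z \<bullet> b) * ((z - \<zeta>) \<bullet> b)) = z \<bullet> (z - \<zeta>)" by (rule sum_Basis_inner)
    have s2: "(\<Sum>b\<in>Basis. ((z - \<zeta>) \<bullet> b) * ((z - \<zeta>) \<bullet> b)) = ?s z" by (rule sum_Basis_inner)
    have lin: "(\<Sum>b\<in>Basis. c1 * p b * k1 + c2 * q b * k0 + c3 * (w * (c4 * k1 + c5 * r b * k2) - t b * k0))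
        = c1 * (\<Sum>b\<in>Basis. p b) * k1 + c2 * (\<Sum>b\<in>Basis. q b) * k0
          + c3 * (w * (real DIM('a) * c4 * k1 + c5 * (\<Sum>b\<in>Basis. r b) * k2) - (\<Sum>b\<in>Basis. t b) * k0)"
      for p q r t :: "'a \<Rightarrow> real" and c1 c2 c3 c4 c5 k0 k1 k2 w :: real
      by (simp add: sum.distrib sum_subtractf sum_distrib_left sum_distrib_right algebra_simps)
    show ?thesis unfolding dF_def E_def lin s1 s2 S1_def[symmetric] S2_def[symmetric] DIM
      by (simp add: algebra_simps)
  qed
  have intE: "(LINT z:ball 0 1|lborel. E \<epsilon> z) = 0" if e: "0 < \<epsilon>" for \<epsilon>
  proof -
    have "(LINT z:ball 0 1|lborel. E \<epsilon> z) = (\<Sum>b\<in>Basis. LINT z:ball 0 1|lborel. dF \<epsilon> b z)"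
      unfolding set_lebesgue_integral_def sumdF[symmetric] scaleR_sum_right
      by (rule Bochner_Integration.integral_sum) (rule intdF[OF e, unfolded set_integrable_def])
    then show ?thesis using zero[OF e] by simp
  qed
  have measE: "(\<lambda>z. indicator (ball 0 1) z *\<^sub>R E \<epsilon> z) \<in> borel_measurable lborel" if e: "0 < \<epsilon>" for \<epsilon>
  proof -
    have "(\<lambda>z. indicator (ball 0 1) z *\<^sub>R E \<epsilon> z) \<in> borel_measurable borel"
      unfolding E_def by (intro borel_measurable_continuous_on_indicator ci cs cK[OF e]) simp
    then show ?thesis by simp
  qed
  define G where "G z = poisson z * (4 * d * v z + 4 * S1 z - ?R z * S2 z)" for z
  have measG: "(\<lambda>z. indicator (ball 0 1) z *\<^sub>R G z) \<in> borel_measurable lborel"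
  proof -
    have "continuous_on (ball 0 1) poisson"
      unfolding poisson_def by (intro ci continuous_on_inv_kernel pole_neq) simp
    then have "(\<lambda>z. indicator (ball 0 1) z *\<^sub>R G z) \<in> borel_measurable borel"
      unfolding G_def by (intro borel_measurable_continuous_on_indicator ci cs) simp_all
    then show ?thesis by simp
  qed
  \<comment> \<open>Without regularization the divergence collapses: z \<bullet> (z - \<zeta>) = (|z
    - \<zeta>|^2 - (1 - |z|^2)) / 2 splits the first term, and all multiples of
    \<open>inv_kernel \<zeta> 0 (Suc d) z\<close> cancel.\<close>
  have E0: "E 0 z = G z" if z: "norm z < 1" for z
  proof -
    have k1: "?K 0 (Suc d) z = ?s z * ?K 0 (Suc (Suc d)) z" using inv_kernel_Suc[OF pole_neq[OF z], of "Suc d"] by simp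
    have k0: "?K 0 d z = ?s z * ?K 0 (Suc d) z" using inv_kernel_Suc[OF pole_neq[OF z], of d] by simp
    have zz: "z \<bullet> (z - \<zeta>) = (?s z - ?R z) / 2"
      using norm_pole by (simp add: inner_diff_left inner_diff_right inner_commute norm_eq_1)
    have alg: "8 * d * R * w * ((q - R) / 2) * k1 + 4 * R * a * k0 + R\<^sup>2 * (w * (- 4 * d * d * k1 + 4 * d * (d + 1) * q * k2) - c * k0)
        = R * k0 * (4 * d * w + 4 * a - R * c)"
      if "k1 = q * k2" "k0 = q * k1" for R w q a c k0 k1 k2 :: real
    proof -
      have "4 * d * (d + 1) * q * k2 = 4 * d * (d + 1) * k1" using that(1) by simp
      moreover have "8 * d * R * w * ((q - R) / 2) * k1 = 4 * d * R * w * (k0 - R * k1)"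
        unfolding that(2) by (simp add: field_simps)
      ultimately show ?thesis by (simp only:) (simp add: algebra_simps power2_eq_square)
    qed
    show ?thesis
      unfolding E_def G_def poisson_def zz by (rule alg[OF k1 k0])
  qed
  obtain B1 where B1: "\<And>z. norm z \<le> 1 \<Longrightarrow> \<bar>S1 z\<bar> \<le> B1"
    using compact_imp_bounded[OF compact_continuous_image[OF cs(2) compact_cball[of 0 1]]]
    unfolding bounded_iff real_norm_def mem_cball_0[symmetric] by blast
  obtain B2 where B2: "\<And>z. norm z \<le> 1 \<Longrightarrow> \<bar>S2 z\<bar> \<le> B2"
    using compact_imp_bounded[OF compact_continuous_image[OF cs(3) compact_cball[of 0 1]]]
    unfolding bounded_iff real_norm_def mem_cball_0[symmetric] by blast
  have C0: "0 \<le> C"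
  proof -
    have "norm (- \<zeta> - \<zeta>) = 2"
      using norm_pole norm_scaleR[of "-2" \<zeta>] by (simp add: scaleR_2)
    then show ?thesis using lip[of "- \<zeta>"] norm_pole by simp
  qed
  define W where "W = 16 * d * C + 8 * B1 + 16 * d * d * C + 16 * d * (d + 1) * C + 2 * B2"
  \<comment> \<open>Power counting with r = |z - \<zeta>|: 1 - |z|^2 contributes 2 r, v contributes
    C r, and the regularized kernels are at most their values at \<epsilon> = 0. Each of the five
    terms is then a constant times r^(1 - 2d), and \<open>W\<close> collects the constants.\<close>
  have dom: "\<bar>E \<epsilon> z\<bar> \<le> W / norm (z - \<zeta>) ^ (2 * d - 1)" if z: "norm z \<le> 1" "z \<noteq> \<zeta>" and e: "0 \<le> \<epsilon>" for \<epsilon> z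
  proof -
    define r where "r = norm (z - \<zeta>)"
    have r: "0 < r" using z by (simp add: r_def)
    have s: "?s z = r ^ 2" by (simp add: r_def power2_norm_eq_inner)
    note R = one_minus_inner_le[OF norm_pole z(1), folded r_def]
    note K = inv_kernel_le[OF z(2) e, folded r_def]
    note K = K K(2)[of d] K(2)[of "Suc d"] K(2)[of "Suc (Suc d)"]
    have vb: "\<bar>v z\<bar> \<le> C * r" using lip[OF z(1)] by (simp add: v_def r_def)
    have zb: "\<bar>z \<bullet> (z - \<zeta>)\<bar> \<le> r"
      using Cauchy_Schwarz_ineq2[of z "z - \<zeta>"] z(1) mult_left_le_one_le[of r "norm z"] by (simp add: r_def)
    have B: "0 \<le> B1" "0 \<le> B2" using B1[of 0] B2[of 0] by auto
    have R2: "(?R z)\<^sup>2 \<le> ?R z" "(?R z)\<^sup>2 \<le> (2 * r)\<^sup>2" "0 \<le> (?R z)\<^sup>2"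
      using power_mono[OF R(2,1), of 2] mult_left_le[OF R(3,1)] by (simp_all add: power2_eq_square)
    define k where "k = 1 / r ^ (2 * d - 1)"
    have e1: "2 * d = Suc (2 * d - 1)" using d_pos by simp
    have k0: "r * (1 / r ^ (2 * d)) = k" unfolding k_def by (subst e1) (use r in simp)
    have k1: "r ^ 3 * (1 / r ^ (2 * Suc d)) = k" unfolding k0[symmetric] using r by (simp add: field_simps eval_nat_numeral)
    have k2: "r ^ 5 * (1 / r ^ (2 * Suc (Suc d))) = k" unfolding k0[symmetric] using r by (simp add: field_simps eval_nat_numeral)
    have t1: "\<bar>8 * d * ?R z * v z * (z \<bullet> (z - \<zeta>)) * ?K \<epsilon> (Suc d) z\<bar> \<le> 16 * d * C * k"
    proof -
      have "\<bar>8 * d * ?R z * v z * (z \<bullet> (z - \<zeta>)) * ?K \<epsilon> (Suc d) z\<bar> = 8 * d * (?R z * \<bar>v z\<bar> * \<bar>z \<bullet> (z - \<zeta>)\<bar> * ?K \<epsilon> (Suc d) z)"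
        using R K(1) by (simp add: abs_mult)
      also have "\<dots> \<le> 8 * d * ((2 * r) * (C * r) * r * (1 / r ^ (2 * Suc d)))"
        using R K vb zb r C0 by (intro mult_left_mono mult_mono mult_nonneg_nonneg) auto
      also have "\<dots> = 16 * d * C * (r ^ 3 * (1 / r ^ (2 * Suc d)))" by (simp add: algebra_simps eval_nat_numeral)
      finally show ?thesis unfolding k1 .
    qed
    have t2: "\<bar>4 * ?R z * S1 z * ?K \<epsilon> d z\<bar> \<le> 8 * B1 * k"
    proof -
      have "\<bar>4 * ?R z * S1 z * ?K \<epsilon> d z\<bar> = 4 * (?R z * \<bar>S1 z\<bar> * ?K \<epsilon> d z)"
        using R K(1) by (simp add: abs_mult)
      also have "\<dots> \<le> 4 * ((2 * r) * B1 * (1 / r ^ (2 * d)))"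
        using R K B1[OF z(1)] r B by (intro mult_left_mono mult_mono mult_nonneg_nonneg) auto
      also have "\<dots> = 8 * B1 * (r * (1 / r ^ (2 * d)))" by (simp add: algebra_simps)
      finally show ?thesis unfolding k0 .
    qed
    have t3: "\<bar>(?R z)\<^sup>2 * (v z * (4 * d * d * ?K \<epsilon> (Suc d) z))\<bar> \<le> 16 * d * d * C * k"
    proof -
      have "\<bar>(?R z)\<^sup>2 * (v z * (4 * d * d * ?K \<epsilon> (Suc d) z))\<bar> = 4 * d * d * ((?R z)\<^sup>2 * \<bar>v z\<bar> * ?K \<epsilon> (Suc d) z)"
        using R2 K(1) by (simp add: abs_mult)
      also have "\<dots> \<le> 4 * d * d * ((2 * r)\<^sup>2 * (C * r) * (1 / r ^ (2 * Suc d)))"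
        using R2 K vb r C0 by (intro mult_left_mono mult_mono mult_nonneg_nonneg) auto
      also have "\<dots> = 16 * d * d * C * (r ^ 3 * (1 / r ^ (2 * Suc d)))" by (simp add: algebra_simps eval_nat_numeral)
      finally show ?thesis unfolding k1 .
    qed
    have t4: "\<bar>(?R z)\<^sup>2 * (v z * (4 * d * (d + 1) * ?s z * ?K \<epsilon> (Suc (Suc d)) z))\<bar> \<le> 16 * d * (d + 1) * C * k"
    proof -
      have "\<bar>(?R z)\<^sup>2 * (v z * (4 * d * (d + 1) * ?s z * ?K \<epsilon> (Suc (Suc d)) z))\<bar> = 4 * d * (d + 1) * ((?R z)\<^sup>2 * \<bar>v z\<bar> * r\<^sup>2 * ?K \<epsilon> (Suc (Suc d)) z)"
        using R2 K(1) s by (simp add: abs_mult)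
      also have "\<dots> \<le> 4 * d * (d + 1) * ((2 * r)\<^sup>2 * (C * r) * r\<^sup>2 * (1 / r ^ (2 * Suc (Suc d))))"
        using R2 K vb r C0 by (intro mult_left_mono mult_mono mult_nonneg_nonneg) auto
      also have "\<dots> = 16 * d * (d + 1) * C * (r ^ 5 * (1 / r ^ (2 * Suc (Suc d))))" by (simp add: algebra_simps eval_nat_numeral)
      finally show ?thesis unfolding k2 .
    qed
    have t5: "\<bar>(?R z)\<^sup>2 * (S2 z * ?K \<epsilon> d z)\<bar> \<le> 2 * B2 * k"
    proof -
      have "\<bar>(?R z)\<^sup>2 * (S2 z * ?K \<epsilon> d z)\<bar> = (?R z)\<^sup>2 * \<bar>S2 z\<bar> * ?K \<epsilon> d z"
        using R2 K(1) by (simp add: abs_mult)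
      also have "\<dots> \<le> (2 * r) * B2 * (1 / r ^ (2 * d))"
        using R2 R K B2[OF z(1)] r B by (intro mult_mono mult_nonneg_nonneg) auto
      also have "\<dots> = 2 * B2 * (r * (1 / r ^ (2 * d)))" by (simp add: algebra_simps)
      finally show ?thesis unfolding k0 .
    qed
    have "E \<epsilon> z = 8 * d * ?R z * v z * (z \<bullet> (z - \<zeta>)) * ?K \<epsilon> (Suc d) z + 4 * ?R z * S1 z * ?K \<epsilon> d z
      - (?R z)\<^sup>2 * (v z * (4 * d * d * ?K \<epsilon> (Suc d) z)) + (?R z)\<^sup>2 * (v z * (4 * d * (d + 1) * ?s z * ?K \<epsilon> (Suc (Suc d)) z))
      - (?R z)\<^sup>2 * (S2 z * ?K \<epsilon> d z)"
      unfolding E_def by (simp only: ring_distribs minus_mult_left[symmetric] minus_mult_right[symmetric]) simp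
    then have "\<bar>E \<epsilon> z\<bar> \<le> 16 * d * C * k + 8 * B1 * k + 16 * d * d * C * k + 16 * d * (d + 1) * C * k + 2 * B2 * k"
      using t1 t2 t3 t4 t5 by linarith
    also have "\<dots> = W * k" by (simp add: W_def algebra_simps)
    finally show ?thesis by (simp add: k_def r_def)
  qed
  let ?\<epsilon> = "\<lambda>n. inverse (real (Suc n))"
  have pointwise: "(\<lambda>n. E (?\<epsilon> n) z) \<longlonglongrightarrow> E 0 z" if z: "norm z < 1" for z
  proof -
    have "(\<lambda>n. ?K (?\<epsilon> n) m z) \<longlonglongrightarrow> ?K 0 m z" for m
      unfolding inv_kernel_def
      by (intro tendsto_intros LIMSEQ_inverse_real_of_nat) (use pole_neq[OF z] in simp)
    then show ?thesis unfolding E_def by (intro tendsto_intros)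
  qed
  note dc = measG measE integrable_dominated_convergence integral_dominated_convergence
  have h1: "integrable lborel (\<lambda>z. indicator (ball 0 1) z *\<^sub>R (W / norm (z - \<zeta>) ^ (2 * d - 1)))"
    using set_integrable_bound_kernel[of W] unfolding set_integrable_def .
  have h2: "AE z in lborel. (\<lambda>n. indicator (ball 0 1) z *\<^sub>R E (?\<epsilon> n) z) \<longlonglongrightarrow> indicator (ball 0 1) z *\<^sub>R G z"
  proof (rule AE_I2)
    fix z :: 'a
    show "(\<lambda>n. indicator (ball 0 1) z *\<^sub>R E (?\<epsilon> n) z) \<longlonglongrightarrow> indicator (ball 0 1) z *\<^sub>R G z"
      using pointwise[of z] E0[of z] by (cases "z \<in> ball 0 1") auto
  qed
  have h3: "AE z in lborel. norm (indicator (ball 0 1) z *\<^sub>R E (?\<epsilon> n) z) \<le> indicator (ball 0 1) z *\<^sub>R (W / norm (z - \<zeta>) ^ (2 * d - 1))" for n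
  proof (rule AE_I2)
    fix z :: 'a
    show "norm (indicator (ball 0 1) z *\<^sub>R E (?\<epsilon> n) z) \<le> indicator (ball 0 1) z *\<^sub>R (W / norm (z - \<zeta>) ^ (2 * d - 1))"
      using dom[of z "?\<epsilon> n"] norm_pole by (cases "z \<in> ball 0 1"; cases "z = \<zeta>") auto
  qed
  have h4: "(\<lambda>z. indicator (ball 0 1) z *\<^sub>R E (?\<epsilon> n) z) \<in> borel_measurable lborel" for n
    by (rule measE) simp
  have intG: "integrable lborel (\<lambda>z. indicator (ball 0 1) z *\<^sub>R G z)"
    by (rule integrable_dominated_convergence[OF measG h4 h1 h2 h3])
  have "(\<lambda>n. \<integral>z. indicator (ball 0 1) z *\<^sub>R E (?\<epsilon> n) z \<partial>lborel) \<longlonglongrightarrow> (\<integral>z. indicator (ball 0 1) z *\<^sub>R G z \<partial>lborel)"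
    by (rule integral_dominated_convergence[OF measG h4 h1 h2 h3])
  then have G0: "(LINT z:ball 0 1|lborel. G z) = 0"
    using intE by (simp add: set_lebesgue_integral_def LIMSEQ_const_iff)
  \<comment> \<open>Restoring the subtracted constant \<open>u \<zeta>\<close> adds
    \<open>4 * d * u \<zeta> * poisson z\<close>, whose integral is known.\<close>
  have split: "poisson z * (4 * d * u z + 4 * (\<Sum>b\<in>Basis. (z \<bullet> b) * u1 b z) - (1 - z \<bullet> z) * (\<Sum>b\<in>Basis. u2 b z))
      = G z + 4 * d * u \<zeta> * poisson z" for z
    by (simp add: G_def S1_def S2_def v_def algebra_simps)
  have i1: "set_integrable lborel (ball 0 1) G" using intG by (simp add: set_integrable_def)
  have i2: "set_integrable lborel (ball 0 1) (\<lambda>z. 4 * d * u \<zeta> * poisson z)"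
    by (rule set_integrable_mult_right[OF set_integrable_poisson])
  show ?int unfolding split by (rule set_integral_add(1)[OF i1 i2])
  show ?eq unfolding split set_integral_add(2)[OF i1 i2] G0 using integral_poisson by simp
qed

end

section \<open>Hilbert space preliminaries\<close>

text \<open>Definiteness is left out on purpose: the form attached to a 2-isometry may vanish on
  nonzero vectors.\<close>

locale psd_form =
  fixes B :: "'h::complex_inner \<Rightarrow> 'h \<Rightarrow> complex"
  assumes add_left: "B (x + y) z = B x z + B y z"
    and scaleC_left: "B (c *\<^sub>C x) y = c * B x y"
    and herm: "B x y = cnj (B y x)"
    and nonneg: "0 \<le> Re (B x x)"
begin

lemma add_right: "B x (y + z) = B x y + B x z"
  by (metis add_left complex_cnj_add herm)

lemma scaleC_right: "B x (c *\<^sub>C y) = cnj c * B x y"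
  by (metis scaleC_left complex_cnj_mult herm)

lemma zero_left [simp]: "B 0 y = 0"
  using add_left[of 0 0 y] by simp

lemma zero_right [simp]: "B x 0 = 0"
  using herm[of x 0] by simp

lemma minus_left: "B (- x) y = - B x y"
  using add_left[of x "- x" y] by (simp add: eq_neg_iff_add_eq_0 add.commute)

lemma diff_left: "B (x - z) y = B x y - B z y"
  using add_left[of x "- z" y] by (simp add: minus_left)

lemma minus_right: "B x (- y) = - B x y"
  by (metis minus_left complex_cnj_minus herm)

lemma diff_right: "B x (y - z) = B x y - B x z"
  using add_right[of x y "- z"] by (simp add: minus_right)

lemma sum_left: "B (sum g A) y = (\<Sum>i\<in>A. B (g i) y)"
  by (induction A rule: infinite_finite_induct) (auto simp: add_left)

lemma sum_right: "B x (sum g A) = (\<Sum>i\<in>A. B x (g i))"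
  by (induction A rule: infinite_finite_induct) (auto simp: add_right)

lemma self_real: "B x x = complex_of_real (Re (B x x))"
  using herm[of x x] by (simp add: complex_eq_iff)

lemma Cauchy_Schwarz: "(cmod (B x y))\<^sup>2 \<le> Re (B x x) * Re (B y y)"
proof -
  let ?c = "B x y" and ?a = "Re (B x x)" and ?b = "Re (B y y)"
  \<comment> \<open>Testing positivity on x - t B(x, y) y with real t makes the cross terms real and
    gives a real quadratic in t.\<close>
  have key: "0 \<le> ?a - 2 * t * (cmod ?c)\<^sup>2 + t\<^sup>2 * (cmod ?c)\<^sup>2 * ?b" for t :: real
  proof -
    let ?s = "- (complex_of_real t * ?c)"
    have "B (x + ?s *\<^sub>C y) (x + ?s *\<^sub>C y) = B x x + cnj ?s * ?c + ?s * cnj ?c + ?s * cnj ?s * B y y"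
      unfolding add_left add_right scaleC_left scaleC_right using herm[of y x] by (simp add: algebra_simps)
    moreover have "cnj ?s * ?c + ?s * cnj ?c = complex_of_real (- 2 * t * (cmod ?c)\<^sup>2)"
      using complex_norm_square[of ?c] by (simp add: algebra_simps)
    moreover have "?s * cnj ?s * B y y = complex_of_real (t\<^sup>2 * (cmod ?c)\<^sup>2 * ?b)"
      using complex_norm_square[of ?c] self_real[of y]
      by (simp add: algebra_simps power2_eq_square)
    ultimately have "B (x + ?s *\<^sub>C y) (x + ?s *\<^sub>C y) = complex_of_real (?a - 2 * t * (cmod ?c)\<^sup>2 + t\<^sup>2 * (cmod ?c)\<^sup>2 * ?b)"
      using self_real[of x] by (simp add: add.assoc)
    then show ?thesis using nonneg[of "x + ?s *\<^sub>C y"] by simp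
  qed
  show ?thesis
  proof (cases "?b = 0")
    case True
    have "?c = 0"
    proof (rule ccontr)
      assume "?c \<noteq> 0"
      then have "0 < (cmod ?c)\<^sup>2" by simp
      \<comment> \<open>When B(y, y) = 0 the quadratic is linear in t, and at this t it equals
        -1.\<close>
      then show False using key[of "(?a + 1) / (2 * (cmod ?c)\<^sup>2)"] True nonneg[of x] by (simp add: field_simps)
    qed
    then show ?thesis using True by simp
  next
    case False
    then have b: "0 < ?b" using nonneg[of y] by simp
    have "0 \<le> ?a - (cmod ?c)\<^sup>2 / ?b"
      using key[of "1 / ?b"] b by (simp add: power2_eq_square field_simps)
    then show ?thesis using b by (simp add: field_simps)
  qed
qed

lemma Cauchy_Schwarz': "cmod (B x y) \<le> sqrt (Re (B x x)) * sqrt (Re (B y y))"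
  using real_sqrt_le_mono[OF Cauchy_Schwarz[of x y]] by (simp add: real_sqrt_mult)

lemma polarization:
  "B x y = (\<Sum>k<4. \<i> ^ k * B (x + \<i> ^ k *\<^sub>C y) (x + \<i> ^ k *\<^sub>C y)) / 4"
  by (simp add: eval_nat_numeral add_left add_right scaleC_left scaleC_right algebra_simps)

end

interpretation cinner: psd_form "cinner :: 'h::complex_inner \<Rightarrow> 'h \<Rightarrow> complex"
  by standard (rule cinner_add_left cinner_scaleC_left cinner_commute cinner_ge_zero)+

lemma cinner_self: "cinner x x = complex_of_real ((norm x)\<^sup>2)"
  using cinner.self_real[of x] norm_eq_sqrt_cinner[of x] cinner_ge_zero[of x] by simp

lemma Re_cinner_self: "Re (cinner x x) = (norm x)\<^sup>2"
  by (simp add: cinner_self)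

lemma cmod_cinner_le: "cmod (cinner x y) \<le> norm x * norm y"
  using cinner.Cauchy_Schwarz'[of x y] by (simp add: Re_cinner_self)

lemma norm_scaleC [simp]: "norm (c *\<^sub>C x) = cmod c * norm (x :: 'h::complex_inner)"
proof -
  have "complex_of_real ((norm (c *\<^sub>C x))\<^sup>2) = complex_of_real ((cmod c * norm x)\<^sup>2)"
    unfolding cinner_self[symmetric] cinner.scaleC_left cinner.scaleC_right
    unfolding cinner_self power_mult_distrib of_real_mult complex_norm_square by (simp add: algebra_simps)
  then have "(norm (c *\<^sub>C x))\<^sup>2 = (cmod c * norm x)\<^sup>2" by (simp only: of_real_eq_iff)
  then show ?thesis by (simp add: power2_eq_iff_nonneg)
qed

lemma norm_add_square:
  "(norm (x + y :: 'h::complex_inner))\<^sup>2 = (norm x)\<^sup>2 + 2 * Re (cinner x y) + (norm y)\<^sup>2"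
proof -
  have "Re (cinner (x + y) (x + y)) = Re (cinner x x) + (Re (cinner x y) + Re (cinner y x)) + Re (cinner y y)"
    by (simp add: cinner.add_left cinner.add_right)
  moreover have "Re (cinner y x) = Re (cinner x y)" using cinner_commute[of y x] by simp
  ultimately show ?thesis by (simp add: Re_cinner_self)
qed

lemma cinner_eqI: "(\<And>x. cinner x y = cinner x z) \<Longrightarrow> y = z"
proof -
  assume "\<And>x. cinner x y = cinner x z"
  then have "cinner (y - z) (y - z) = 0" by (simp add: cinner.diff_right)
  then show ?thesis by (simp add: cinner_eq_zero_iff)
qed

lemma cinner_eqI': "(\<And>y. cinner x y = cinner z y) \<Longrightarrow> x = z"
  by (rule cinner_eqI) (metis cinner_commute)

lemma bounded_bilinear_scaleC: "bounded_bilinear (scaleC :: complex \<Rightarrow> 'h \<Rightarrow> 'h::complex_inner)"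
proof
  fix r :: real and a a' :: complex and b b' :: 'h
  show "(a + a') *\<^sub>C b = a *\<^sub>C b + a' *\<^sub>C b" by (rule scaleC_add_left)
  show "a *\<^sub>C (b + b') = a *\<^sub>C b + a *\<^sub>C b'" by (rule scaleC_add_right)
  show "(r *\<^sub>R a) *\<^sub>C b = r *\<^sub>R a *\<^sub>C b" by (simp add: scaleR_scaleC scaleC_scaleC scaleR_conv_of_real)
  show "a *\<^sub>C r *\<^sub>R b = r *\<^sub>R a *\<^sub>C b" by (simp add: scaleR_scaleC scaleC_scaleC mult.commute)
  show "\<exists>K. \<forall>(a::complex) b::'h. norm (a *\<^sub>C b) \<le> norm a * norm b * K" by (intro exI[of _ 1]) simp
qed

lemma bounded_bilinear_cinner_real: "bounded_bilinear (\<lambda>x y :: 'h::complex_inner. cinner x y)"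
proof
  fix r :: real and a a' b b' :: 'h
  show "cinner (a + a') b = cinner a b + cinner a' b" by (rule cinner_add_left)
  show "cinner a (b + b') = cinner a b + cinner a b'" by (rule cinner.add_right)
  show "cinner (r *\<^sub>R a) b = r *\<^sub>R cinner a b" by (simp add: scaleR_scaleC cinner_scaleC_left scaleR_conv_of_real)
  show "cinner a (r *\<^sub>R b) = r *\<^sub>R cinner a b" by (simp add: scaleR_scaleC cinner.scaleC_right scaleR_conv_of_real)
  show "\<exists>K. \<forall>(a::'h) b. norm (cinner a b) \<le> norm a * norm b * K" using cmod_cinner_le by (intro exI[of _ 1]) auto
qed

lemmas continuous_on_cinner = bounded_bilinear.continuous_on[OF bounded_bilinear_cinner_real]
  and tendsto_cinner = bounded_bilinear.tendsto[OF bounded_bilinear_cinner_real]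

subsection \<open>Riesz representation and adjoints\<close>

text \<open>Variational proof: minimize |x|^2 - 2 Re (\<phi> x). The parallelogram identity makes a
  minimizing sequence Cauchy, and stationarity at its limit y gives Re (\<phi> x) = Re (cinner x y);
  replacing x by \<i> x gives the imaginary parts.\<close>

lemma riesz_representation:
  fixes \<phi> :: "'h::complex_hilbert \<Rightarrow> complex"
  assumes add: "\<And>x y. \<phi> (x + y) = \<phi> x + \<phi> y" and scale: "\<And>c x. \<phi> (c *\<^sub>C x) = c * \<phi> x"
    and bound: "\<And>x. cmod (\<phi> x) \<le> K * norm x"
  obtains y where "\<And>x. \<phi> x = cinner x y"
proof -
  define J where "J x = (norm x)\<^sup>2 - 2 * Re (\<phi> x)" for x
  define m where "m = Inf (range J)"
  have J_ge: "- K\<^sup>2 \<le> J x" for x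
  proof -
    have "Re (\<phi> x) \<le> norm x * K" using bound[of x] complex_Re_le_cmod[of "\<phi> x"] by (simp add: mult.commute)
    moreover have "0 \<le> (norm x - K)\<^sup>2" by simp
    ultimately show ?thesis by (simp add: J_def power2_diff)
  qed
  have bdd: "bdd_below (range J)" using J_ge by (intro bdd_belowI[of _ "- K\<^sup>2"]) auto
  have m_le: "m \<le> J x" for x unfolding m_def by (rule cInf_lower[OF _ bdd]) auto
  have "\<exists>x. J x < m + inverse (real (Suc n))" for n
  proof -
    have "Inf (range J) < m + inverse (real (Suc n))" by (simp add: m_def)
    then show ?thesis using cInf_lessD[of "range J"] by blast
  qed
  then obtain X where X: "\<And>n. J (X n) < m + inverse (real (Suc n))" by metis
  have scaleR: "\<phi> (r *\<^sub>R x) = complex_of_real r * \<phi> x" for r x by (simp add: scaleR_scaleC scale)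
  have minus: "\<phi> (- x) = - \<phi> x" for x using scaleR[of "-1" x] by simp
  have par: "(norm (x - y))\<^sup>2 = 2 * J x + 2 * J y - 4 * J ((1/2) *\<^sub>R (x + y))" for x y
  proof -
    have mid: "J ((1/2) *\<^sub>R (x + y)) = (norm (x + y))\<^sup>2 / 4 - (Re (\<phi> x) + Re (\<phi> y))"
    proof -
      have n: "norm ((1/2) *\<^sub>R (x + y)) = norm (x + y) / 2" by (simp only: norm_scaleR)
      show ?thesis unfolding J_def n scaleR add by (simp add: power_divide field_simps)
    qed
    show ?thesis unfolding mid
      using norm_add_square[of x y] norm_add_square[of x "- y"]
      by (simp add: J_def cinner.minus_right field_simps)
  qed
  have near: "(norm (X n - X k))\<^sup>2 \<le> 2 * inverse (real (Suc n)) + 2 * inverse (real (Suc k))" for n k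
    using par[of "X n" "X k"] X[of n] X[of k] m_le[of "(1/2) *\<^sub>R (X n + X k)"] by simp
  have "Cauchy X"
  proof (rule CauchyI)
    fix e :: real assume e: "0 < e"
    obtain N where N: "inverse (real (Suc N)) < e\<^sup>2 / 4" using reals_Archimedean[of "e\<^sup>2 / 4"] e by auto
    show "\<exists>M. \<forall>n\<ge>M. \<forall>k\<ge>M. norm (X n - X k) < e"
    proof (intro exI[of _ N] allI impI)
      fix n k assume "N \<le> n" "N \<le> k"
      then have "inverse (real (Suc n)) \<le> inverse (real (Suc N))" "inverse (real (Suc k)) \<le> inverse (real (Suc N))"
        by (auto intro!: le_imp_inverse_le)
      then have "(norm (X n - X k))\<^sup>2 < e\<^sup>2" using near[of n k] N by linarith
      then show "norm (X n - X k) < e" using e by (simp add: power2_less_imp_less)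
    qed
  qed
  then obtain y where y: "X \<longlonglongrightarrow> y" using Cauchy_convergent_iff convergent_def by blast
  have bl: "bounded_linear \<phi>"
    by (rule bounded_linear_intro[of _ K]) (auto simp: add scaleR scaleR_conv_of_real bound mult.commute)
  have "(\<lambda>n. J (X n)) \<longlonglongrightarrow> J y"
    unfolding J_def by (intro tendsto_intros y bounded_linear.tendsto[OF bl])
  moreover have "(\<lambda>n. m + inverse (real (Suc n))) \<longlonglongrightarrow> m + 0"
    by (intro tendsto_intros LIMSEQ_inverse_real_of_nat)
  ultimately have "J y \<le> m + 0"
    by (rule LIMSEQ_le) (use X less_imp_le in blast)
  then have Jy: "J y \<le> J x" for x using m_le[of x] by simp
  have re: "Re (\<phi> x) = Re (cinner x y)" for x
  proof -
    have key: "0 \<le> 2 * t * (Re (cinner x y) - Re (\<phi> x)) + t\<^sup>2 * (norm x)\<^sup>2" for t :: real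
    proof -
      have "Re (cinner y (t *\<^sub>R x)) = t * Re (cinner x y)"
        using cinner_commute[of y x] by (simp add: scaleR_scaleC cinner.scaleC_right)
      then have "J (y + t *\<^sub>R x) = J y + 2 * t * (Re (cinner x y) - Re (\<phi> x)) + t\<^sup>2 * (norm x)\<^sup>2"
        unfolding J_def norm_add_square add scaleR by (simp add: algebra_simps power_mult_distrib)
      then show ?thesis using Jy[of "y + t *\<^sub>R x"] by simp
    qed
    show ?thesis
    proof (cases "x = 0")
      case True
      then show ?thesis using scaleR[of 0 x] by simp
    next
      case False
      let ?d = "Re (cinner x y) - Re (\<phi> x)"
      \<comment> \<open>The inserted t minimizes the quadratic, so a nonzero difference
        \<open>?d\<close> would make it negative.\<close>
      have "0 \<le> 2 * (- ?d / (norm x)\<^sup>2) * ?d + (- ?d / (norm x)\<^sup>2)\<^sup>2 * (norm x)\<^sup>2" by (rule key)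
      also have "\<dots> = - (?d\<^sup>2) / (norm x)\<^sup>2" using False by (simp add: power2_eq_square field_simps)
      finally have "?d\<^sup>2 \<le> 0" using False by (simp add: field_simps)
      then show ?thesis by simp
    qed
  qed
  have "\<phi> x = cinner x y" for x
  proof (rule complex_eqI)
    show "Re (\<phi> x) = Re (cinner x y)" by (rule re)
    show "Im (\<phi> x) = Im (cinner x y)" using re[of "\<i> *\<^sub>C x"] by (simp add: scale cinner_scaleC_left)
  qed
  then show ?thesis by (rule that)
qed

lemma bounded_clinearI:
  assumes "\<And>x y. A (x + y) = A x + A y" "\<And>c x. A (c *\<^sub>C x) = c *\<^sub>C A x" "\<And>x. norm (A x) \<le> K * norm x"
  shows "bounded_clinear A"
  unfolding bounded_clinear_def
proof (intro conjI allI)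
  show "bounded_linear A"
    by (rule bounded_linear_intro[of _ K]) (use assms in \<open>auto simp: scaleR_scaleC mult.commute\<close>)
qed (rule assms)

lemma bounded_clinear_add: "bounded_clinear A \<Longrightarrow> A (x + y) = A x + A y"
  and bounded_clinear_scaleC: "bounded_clinear A \<Longrightarrow> A (c *\<^sub>C x) = c *\<^sub>C A x"
  by (auto simp: bounded_clinear_def bounded_linear.linear linear_add)

lemma bounded_clinear_bound:
  assumes "bounded_clinear A" obtains K where "0 < K" "\<And>x. norm (A x) \<le> K * norm x"
  using assms bounded_linear.pos_bounded[of A] by (auto simp: bounded_clinear_def mult.commute)

lemma bounded_form_operator:
  fixes B :: "'a::complex_inner \<Rightarrow> 'h::complex_hilbert \<Rightarrow> complex"
  assumes "\<And>x y z. B (x + y) z = B x z + B y z" "\<And>c x y. B (c *\<^sub>C x) y = c * B x y"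
    "\<And>x y z. B x (y + z) = B x y + B x z" "\<And>c x y. B x (c *\<^sub>C y) = cnj c * B x y"
    and bound: "\<And>x y. cmod (B x y) \<le> K * norm x * norm y" and K: "0 \<le> K"
  obtains S where "bounded_clinear S" "\<And>x y. B x y = cinner (S x) y"
proof -
  have "\<exists>s. \<forall>y. cnj (B x y) = cinner y s" for x
  proof -
    obtain s where "\<And>y. cnj (B x y) = cinner y s"
      by (rule riesz_representation[of "\<lambda>y. cnj (B x y)" "K * norm x"]) (use assms in auto)
    then show ?thesis by blast
  qed
  then obtain S where S: "\<And>x y. cnj (B x y) = cinner y (S x)" by metis
  have S': "B x y = cinner (S x) y" for x y
    using S[of x y] cinner_commute[of "S x" y] by (metis complex_cnj_cnj)
  have "bounded_clinear S"
  proof (rule bounded_clinearI[where K=K])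
    show "S (x + y) = S x + S y" for x y
      by (rule cinner_eqI') (simp add: S'[symmetric] assms cinner_add_left)
    show "S (c *\<^sub>C x) = c *\<^sub>C S x" for c x
      by (rule cinner_eqI') (simp add: S'[symmetric] assms cinner_scaleC_left)
    show "norm (S x) \<le> K * norm x" for x
    proof (cases "S x = 0")
      case True
      then show ?thesis using K by simp
    next
      case False
      have "norm (S x) * norm (S x) = cmod (B x (S x))"
        by (simp add: S' cinner_self power2_eq_square norm_mult)
      also have "\<dots> \<le> K * norm x * norm (S x)" by (rule bound)
      finally show ?thesis using False by simp
    qed
  qed
  then show ?thesis using S' by (rule that)
qed

text \<open>Existence by Riesz representation and uniqueness by \<open>cinner_eqI\<close> give the
  description in \<open>adjoint_op\<close> its meaning.\<close>

lemma cinner_adjoint_op: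
  assumes A: "bounded_clinear A"
  shows "cinner (A x) y = cinner x (adjoint_op A y)"
proof -
  obtain K where K: "0 < K" "\<And>x. norm (A x) \<le> K * norm x" using bounded_clinear_bound[OF A] by blast
  have "\<exists>s. \<forall>x. cinner (A x) y = cinner x s" for y
  proof -
    obtain s where "\<And>x. cinner (A x) y = cinner x s"
    proof (rule riesz_representation[of "\<lambda>x. cinner (A x) y" "K * norm y"])
      fix x
      have "cmod (cinner (A x) y) \<le> norm (A x) * norm y" by (rule cmod_cinner_le)
      also have "\<dots> \<le> K * norm x * norm y" using K by (intro mult_right_mono) auto
      finally show "cmod (cinner (A x) y) \<le> K * norm y * norm x" by (simp add: ac_simps)
    qed (simp_all add: bounded_clinear_add[OF A] bounded_clinear_scaleC[OF A] cinner_add_left cinner_scaleC_left)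
    then show ?thesis by blast
  qed
  then obtain C where C: "\<And>x y. cinner (A x) y = cinner x (C y)" by metis
  have "adjoint_op A = C" unfolding adjoint_op_def
  proof (rule the_equality)
    fix B assume "\<forall>x y. cinner (A x) y = cinner x (B y)"
    then show "B = C" using C by (intro ext cinner_eqI) metis
  qed (use C in blast)
  then show ?thesis using C by simp
qed

section \<open>Coordinates along an orthonormal family\<close>

locale orthonormal =
  fixes f :: "'i \<Rightarrow> 'h::complex_hilbert"
  assumes ortho: "cinner (f i) (f j) = (if i = j then 1 else 0)"
begin

text \<open>The partial sum s satisfies |s|^2 = <h, s> <= |h| |s|.\<close>

lemma bessel:
  assumes "finite J" shows "L2_set (\<lambda>i. cmod (cinner h (f i))) J \<le> norm h"
proof -
  let ?c = "\<lambda>i. cinner h (f i)"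
  define s where "s = (\<Sum>i\<in>J. ?c i *\<^sub>C f i)"
  have hs: "cinner h s = complex_of_real (\<Sum>i\<in>J. (cmod (?c i))\<^sup>2)"
    by (simp add: s_def cinner.sum_right cinner.scaleC_right complex_norm_square mult.commute del: of_real_power)
  have "cinner s s = (\<Sum>i\<in>J. \<Sum>j\<in>J. ?c i * cnj (?c j) * cinner (f i) (f j))"
    by (simp only: s_def cinner.sum_left cinner.scaleC_left)
       (simp add: cinner.sum_right cinner.scaleC_right sum_distrib_left mult.assoc)
  also have "\<dots> = (\<Sum>i\<in>J. ?c i * cnj (?c i))"
    using assms by (simp add: ortho if_distrib[of "\<lambda>x. _ * x"] cong: if_cong)
  also have "\<dots> = complex_of_real (\<Sum>i\<in>J. (cmod (?c i))\<^sup>2)"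
    by (simp add: complex_norm_square del: of_real_power)
  finally have ss: "cinner s s = complex_of_real (\<Sum>i\<in>J. (cmod (?c i))\<^sup>2)" .
  have n: "(norm s)\<^sup>2 = (\<Sum>i\<in>J. (cmod (?c i))\<^sup>2)"
    using ss unfolding cinner_self of_real_eq_iff .
  have "norm s * norm s = cmod (cinner h s)"
    unfolding hs n[symmetric] by (simp add: power2_eq_square norm_mult)
  also have "\<dots> \<le> norm h * norm s" by (rule cmod_cinner_le)
  finally have "norm s \<le> norm h" by (cases "s = 0") auto
  then show ?thesis by (simp add: L2_set_def n[symmetric])
qed

lemma coord_basis_coords: "ell2_coord (basis_coords f h) i = cinner h (f i)"
  using ell2_finite_bound(1)[OF bessel] by (simp add: basis_coords_def Abs_ell2_inverse)

lemma norm_basis_coords: "norm (basis_coords f h) \<le> norm h"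
  using ell2_finite_bound(2)[OF bessel] by (simp add: norm_ell2.rep_eq coord_basis_coords)

lemma basis_coords_add: "basis_coords f (x + y) = basis_coords f x + basis_coords f y"
  by (simp add: ell2_coord_inject[symmetric] plus_ell2.rep_eq coord_basis_coords cinner_add_left fun_eq_iff)

lemma basis_coords_scaleC: "basis_coords f (c *\<^sub>C x) = c *\<^sub>C basis_coords f x"
  by (simp add: ell2_coord_inject[symmetric] scaleC_ell2.rep_eq coord_basis_coords cinner_scaleC_left fun_eq_iff)

lemma bounded_clinear_basis_coords: "bounded_clinear (basis_coords f)"
  by (rule bounded_clinearI[of _ 1]) (simp_all add: basis_coords_add basis_coords_scaleC norm_basis_coords)

text \<open>For fixed h the vectors x that satisfy the identity form a closed subspace containing
  every \<open>f i\<close>.\<close>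

lemma cinner_basis_coords:
  assumes "x \<in> closure (complex_inner.span (range f))"
  shows "cinner (basis_coords f x) (basis_coords f h) = cinner x h"
proof -
  let ?S = "{x. cinner (basis_coords f x) (basis_coords f h) = cinner x h}"
  have bl: "continuous_on UNIV (basis_coords f)"
    using bounded_clinear_basis_coords by (auto simp: bounded_clinear_def intro: linear_continuous_on)
  have "f i \<in> ?S" for i
  proof -
    have "cinner (basis_coords f (f i)) (basis_coords f h) = (\<Sum>\<^sub>\<infinity>k. (if i = k then cnj (cinner h (f i)) else 0))"
      by (auto simp: cinner_ell2.rep_eq coord_basis_coords ortho intro!: infsum_cong)
    also have "\<dots> = (\<Sum>\<^sub>\<infinity>k\<in>{i}. (if i = k then cnj (cinner h (f i)) else 0))"
      by (rule infsum_cong_neutral) auto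
    also have "\<dots> = cinner (f i) h" using cinner_commute[of "f i" h] by simp
    finally show ?thesis by simp
  qed
  moreover have "complex_inner.subspace ?S"
    by (rule complex_inner.subspaceI)
       (auto simp: basis_coords_add basis_coords_scaleC cinner_add_left cinner_scaleC_left
         basis_coords_scaleC[of 0 0, simplified])
  ultimately have "complex_inner.span (range f) \<subseteq> ?S"
    by (intro complex_inner.span_minimal) auto
  moreover have "closed ?S"
    by (rule closed_Collect_eq) (intro continuous_on_cinner bl continuous_on_const continuous_on_id)+
  ultimately have "closure (complex_inner.span (range f)) \<subseteq> ?S" by (rule closure_minimal)
  then show ?thesis using assms by auto
qed

text \<open>\<open>V\<close> is the adjoint of the coordinate map; since that map preserves inner
  products on the closed span, its adjoint undoes it there. Being bounded on all of
  \<open>'i ell2\<close>, it allows forms on H to be pulled back to the coefficient space.\<close>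

lemma basis_coords_section:
  obtains V :: "'i ell2 \<Rightarrow> 'h" where "bounded_clinear V"
    "\<And>x. x \<in> closure (complex_inner.span (range f)) \<Longrightarrow> V (basis_coords f x) = x"
proof -
  obtain V :: "'i ell2 \<Rightarrow> 'h" where V: "bounded_clinear V" "\<And>a h. cinner a (basis_coords f h) = cinner (V a) h"
  proof (rule bounded_form_operator[of "\<lambda>a h. cinner a (basis_coords f h)" 1])
    fix a :: "'i ell2" and h
    have "cmod (cinner a (basis_coords f h)) \<le> norm a * norm (basis_coords f h)" by (rule cmod_cinner_le)
    also have "\<dots> \<le> norm a * norm h" by (intro mult_left_mono norm_basis_coords) simp
    finally show "cmod (cinner a (basis_coords f h)) \<le> 1 * norm a * norm h" by simp
  qed (simp_all add: cinner_add_left cinner_scaleC_left basis_coords_add basis_coords_scaleC cinner.add_right cinner.scaleC_right)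
  show ?thesis
  proof (rule that[OF V(1)])
    fix x assume "x \<in> closure (complex_inner.span (range f))"
    then show "V (basis_coords f x) = x"
      by (intro cinner_eqI') (simp add: V(2)[symmetric] cinner_basis_coords)
  qed
qed

end

section \<open>Multi-indices\<close>

definition inc :: "'d \<Rightarrow> ('d \<Rightarrow> nat) \<Rightarrow> 'd \<Rightarrow> nat" where
  "inc j \<alpha> = \<alpha>(j := Suc (\<alpha> j))"

lemma inc_simps: "inc j \<alpha> j = Suc (\<alpha> j)" "i \<noteq> j \<Longrightarrow> inc j \<alpha> i = \<alpha> i"
  by (auto simp: inc_def)

lemma inc_apply: "inc j \<alpha> i = \<alpha> i + (if i = j then 1 else 0)"
  by (simp add: inc_def)

lemma mindex_norm_inc: "mindex_norm (inc j \<alpha>) = Suc (mindex_norm \<alpha>)"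
  by (simp add: mindex_norm_def inc_apply sum.distrib)

lemma mindex_fact_inc: "mindex_fact (inc j \<alpha>) = Suc (\<alpha> j) * mindex_fact \<alpha>"
proof -
  have "(\<Prod>i\<in>UNIV - {j}. fact (inc j \<alpha> i)) = (\<Prod>i\<in>UNIV - {j}. fact (\<alpha> i) :: nat)"
    by (intro prod.cong) (auto simp: inc_simps)
  then show ?thesis
    by (simp add: mindex_fact_def prod.remove[of UNIV j] inc_simps algebra_simps)
qed

lemma inc_inj: "inc j \<alpha> = inc j \<beta> \<longleftrightarrow> \<alpha> = \<beta>"
  by (metis add_right_cancel ext inc_apply)

lemma inc_obtain: assumes "0 < \<alpha> j" obtains \<beta> where "\<alpha> = inc j \<beta>"
  using that[of "\<alpha>(j := \<alpha> j - 1)"] assms by (auto simp: inc_def)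

lemma mindex_fact_pos: "0 < mindex_fact \<alpha>"
  by (simp add: mindex_fact_def)

lemma le_mindex_norm: "\<alpha> j \<le> mindex_norm \<alpha>"
  unfolding mindex_norm_def by (rule member_le_sum) auto

lemma finite_bounded_mindex: "finite {\<alpha> :: 'd::finite \<Rightarrow> nat. \<forall>j. \<alpha> j \<in> A j}" if "\<And>j. finite (A j)"
proof -
  have "{\<alpha> :: 'd \<Rightarrow> nat. \<forall>j. \<alpha> j \<in> A j} = PiE UNIV A" by auto
  then show ?thesis using that by (simp add: finite_PiE)
qed

lemma card_bounded_mindex: "card {\<alpha> :: 'd::finite \<Rightarrow> nat. \<forall>j. \<alpha> j \<in> A j} = (\<Prod>j\<in>UNIV. card (A j))"
proof -
  have "{\<alpha> :: 'd \<Rightarrow> nat. \<forall>j. \<alpha> j \<in> A j} = PiE UNIV A" by auto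
  then show ?thesis by (simp add: card_PiE)
qed

lemma finite_mindex_norm_le: "finite {\<alpha> :: 'd::finite \<Rightarrow> nat. mindex_norm \<alpha> \<le> n}"
  by (rule finite_subset[OF _ finite_bounded_mindex[of "\<lambda>_. {..n}"]]) (auto intro: order_trans[OF le_mindex_norm])

lemma finite_mindex_norm_eq: "finite {\<alpha> :: 'd::finite \<Rightarrow> nat. mindex_norm \<alpha> = n}"
  by (rule finite_subset[OF _ finite_mindex_norm_le[of n]]) auto

definition multinomial :: "('d::finite \<Rightarrow> nat) \<Rightarrow> 'a::field_char_0" where
  "multinomial \<gamma> = of_nat (fact (mindex_norm \<gamma>)) / of_nat (mindex_fact \<gamma>)"

lemma mindex_norm_0: "mindex_norm \<alpha> = 0 \<longleftrightarrow> \<alpha> = (\<lambda>_. 0)"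
  by (auto simp: mindex_norm_def)

lemma multinomial_inc:
  "multinomial \<gamma> = (of_nat (inc j \<gamma> j) / of_nat (mindex_norm (inc j \<gamma>))) * (multinomial (inc j \<gamma>) :: 'a::field_char_0)"
proof -
  have "(of_nat (mindex_fact \<gamma>) :: 'a) \<noteq> 0" "(of_nat (Suc (\<gamma> j)) :: 'a) \<noteq> 0" "(of_nat (Suc (mindex_norm \<gamma>)) :: 'a) \<noteq> 0"
    using mindex_fact_pos[of \<gamma>] by (simp_all del: of_nat_Suc)
  moreover have "F / m = (a / b) * (b * F / (a * m))" if "m \<noteq> 0" "a \<noteq> 0" "b \<noteq> 0" for F m a b :: 'a
    using that by simp
  ultimately show ?thesis
    unfolding multinomial_def mindex_fact_inc mindex_norm_inc inc_simps fact_Suc of_nat_mult of_nat_id by blast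
qed

text \<open>Multinomial Pascal rule: each \<gamma> of level n + 1 is split over the directions j
  with weights \<gamma>_j / |\<gamma>|, which add up to 1. The share of direction j is reindexed by
  \<open>inc j\<close>, and \<open>multinomial_inc\<close> turns its weight into the one of level
  n.\<close>

lemma sum_multinomial_Suc:
  fixes \<phi> :: "('d::finite \<Rightarrow> nat) \<Rightarrow> 'a::field_char_0"
  shows "(\<Sum>\<gamma> | mindex_norm \<gamma> = Suc n. multinomial \<gamma> * \<phi> \<gamma>)
    = (\<Sum>j\<in>UNIV. \<Sum>\<gamma> | mindex_norm \<gamma> = n. multinomial \<gamma> * \<phi> (inc j \<gamma>))"
proof -
  let ?S = "{\<gamma> :: 'd \<Rightarrow> nat. mindex_norm \<gamma> = Suc n}"
  have "(\<Sum>\<gamma>\<in>?S. multinomial \<gamma> * \<phi> \<gamma>) = (\<Sum>\<gamma>\<in>?S. \<Sum>j\<in>UNIV. of_nat (\<gamma> j) / of_nat (mindex_norm \<gamma>) * multinomial \<gamma> * \<phi> \<gamma>)"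
  proof (rule sum.cong[OF refl])
    fix \<gamma> :: "'d \<Rightarrow> nat" assume g: "\<gamma> \<in> ?S"
    have "(\<Sum>j\<in>UNIV. of_nat (\<gamma> j) / of_nat (mindex_norm \<gamma>) :: 'a) = 1"
      using g by (simp add: sum_divide_distrib[symmetric] mindex_norm_def flip: of_nat_sum del: of_nat_Suc)
    then show "multinomial \<gamma> * \<phi> \<gamma> = (\<Sum>j\<in>UNIV. of_nat (\<gamma> j) / of_nat (mindex_norm \<gamma>) * multinomial \<gamma> * \<phi> \<gamma>)"
      by (simp only: sum_distrib_right[symmetric]) simp
  qed
  also have "\<dots> = (\<Sum>j\<in>UNIV. \<Sum>\<gamma>\<in>?S. of_nat (\<gamma> j) / of_nat (mindex_norm \<gamma>) * multinomial \<gamma> * \<phi> \<gamma>)"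
    by (rule sum.swap)
  also have "\<dots> = (\<Sum>j\<in>UNIV. \<Sum>\<gamma> | mindex_norm \<gamma> = n. multinomial \<gamma> * \<phi> (inc j \<gamma>))"
  proof (rule sum.cong[OF refl])
    fix j :: 'd
    have im: "inc j ` {\<gamma>. mindex_norm \<gamma> = n} = {\<gamma> \<in> ?S. 0 < \<gamma> j}"
    proof (intro equalityI subsetI)
      fix \<gamma> assume g: "\<gamma> \<in> {\<gamma> \<in> ?S. 0 < \<gamma> j}"
      then obtain \<beta> where "\<gamma> = inc j \<beta>" using inc_obtain[of \<gamma> j] by blast
      then show "\<gamma> \<in> inc j ` {\<gamma>. mindex_norm \<gamma> = n}" using g by (simp add: mindex_norm_inc)
    qed (auto simp: mindex_norm_inc inc_simps)
    have "(\<Sum>\<gamma>\<in>?S. of_nat (\<gamma> j) / of_nat (mindex_norm \<gamma>) * multinomial \<gamma> * \<phi> \<gamma>)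
      = (\<Sum>\<gamma>\<in>inc j ` {\<gamma>. mindex_norm \<gamma> = n}. of_nat (\<gamma> j) / of_nat (mindex_norm \<gamma>) * multinomial \<gamma> * \<phi> \<gamma>)"
      unfolding im by (rule sum.mono_neutral_right) (auto simp: finite_mindex_norm_eq)
    also have "\<dots> = (\<Sum>\<gamma> | mindex_norm \<gamma> = n. multinomial \<gamma> * \<phi> (inc j \<gamma>))"
      by (subst sum.reindex, simp add: inj_on_def inc_inj) (simp only: o_def multinomial_inc[where j=j, symmetric])
    finally show "(\<Sum>\<gamma>\<in>?S. of_nat (\<gamma> j) / of_nat (mindex_norm \<gamma>) * multinomial \<gamma> * \<phi> \<gamma>)
      = (\<Sum>\<gamma> | mindex_norm \<gamma> = n. multinomial \<gamma> * \<phi> (inc j \<gamma>))" .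
  qed
  finally show ?thesis .
qed

lemma sum_multinomial_0:
  "(\<Sum>\<gamma> | mindex_norm (\<gamma> :: 'd::finite \<Rightarrow> nat) = 0. multinomial \<gamma> * \<phi> \<gamma>) = (\<phi> (\<lambda>_. 0) :: 'a::field_char_0)"
proof -
  have "{\<gamma> :: 'd \<Rightarrow> nat. mindex_norm \<gamma> = 0} = {\<lambda>_. 0}" by (auto simp: mindex_norm_0)
  then show ?thesis by (simp add: multinomial_def mindex_fact_def mindex_norm_def)
qed

text \<open>The counterpart on level sums of Q^n(I) = I + n (Q(I) - I): one step adds
  \<open>c\<close>, a further step leaves \<open>c\<close> unchanged, so the growth is linear in
  n.\<close>

lemma sum_multinomial_shift:
  fixes R c :: "('d::finite \<Rightarrow> nat) \<Rightarrow> 'a::field_char_0"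
  assumes "\<And>\<gamma>. (\<Sum>j\<in>UNIV. R (inc j \<gamma>)) = R \<gamma> + c \<gamma>" and "\<And>\<gamma>. (\<Sum>j\<in>UNIV. c (inc j \<gamma>)) = c \<gamma>"
  shows "(\<Sum>\<gamma> | mindex_norm \<gamma> = n. multinomial \<gamma> * R \<gamma>) = R (\<lambda>_. 0) + of_nat n * c (\<lambda>_. 0)"
proof -
  have c: "(\<Sum>\<gamma> | mindex_norm \<gamma> = n. multinomial \<gamma> * c \<gamma>) = c (\<lambda>_. 0)" for n
  proof (induction n)
    case (Suc n)
    have "(\<Sum>\<gamma> | mindex_norm \<gamma> = Suc n. multinomial \<gamma> * c \<gamma>) = (\<Sum>\<gamma> | mindex_norm \<gamma> = n. multinomial \<gamma> * (\<Sum>j\<in>UNIV. c (inc j \<gamma>)))"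
      unfolding sum_multinomial_Suc by (subst sum.swap) (simp add: sum_distrib_left)
    then show ?case using Suc assms(2) by simp
  qed (simp only: sum_multinomial_0)
  show ?thesis
  proof (induction n)
    case (Suc n)
    have "(\<Sum>\<gamma> | mindex_norm \<gamma> = Suc n. multinomial \<gamma> * R \<gamma>) = (\<Sum>\<gamma> | mindex_norm \<gamma> = n. multinomial \<gamma> * (\<Sum>j\<in>UNIV. R (inc j \<gamma>)))"
      unfolding sum_multinomial_Suc by (subst sum.swap) (simp add: sum_distrib_left)
    also have "\<dots> = (\<Sum>\<gamma> | mindex_norm \<gamma> = n. multinomial \<gamma> * R \<gamma>) + (\<Sum>\<gamma> | mindex_norm \<gamma> = n. multinomial \<gamma> * c \<gamma>)"
      by (simp add: assms(1) ring_distribs sum.distrib)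
    finally show ?case using Suc c by (simp add: algebra_simps)
  qed (simp add: sum_multinomial_0)
qed

lemma mindex_induct [case_names zero inc]:
  assumes "P (\<lambda>_. 0)" "\<And>\<alpha> j. P \<alpha> \<Longrightarrow> P (inc j \<alpha>)"
  shows "P (\<alpha> :: 'd::finite \<Rightarrow> nat)"
proof (induction "mindex_norm \<alpha>" arbitrary: \<alpha>)
  case 0
  then have "\<alpha> = (\<lambda>_. 0)" using mindex_norm_0[of \<alpha>] by simp
  then show ?case using assms(1) by simp
next
  case (Suc n)
  then have "mindex_norm \<alpha> \<noteq> 0" by simp
  then obtain j where "0 < \<alpha> j" using mindex_norm_0[of \<alpha>] by auto
  then obtain \<beta> where "\<alpha> = inc j \<beta>" by (rule inc_obtain)
  then show ?case using Suc assms(2) by (simp add: mindex_norm_inc)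
qed

section \<open>Scalar monomials and powers of the tuple\<close>

definition mpow :: "('d::finite \<Rightarrow> nat) \<Rightarrow> complex^'d \<Rightarrow> complex" where
  "mpow \<alpha> z = (\<Prod>j\<in>UNIV. (z $ j) ^ \<alpha> j)"

lemma mpow_upd: "mpow (\<alpha>(j := n)) z = (z $ j) ^ n * (\<Prod>i\<in>UNIV - {j}. (z $ i) ^ \<alpha> i)"
proof -
  have "(\<Prod>i\<in>UNIV - {j}. (z $ i) ^ (\<alpha>(j := n)) i) = (\<Prod>i\<in>UNIV - {j}. (z $ i) ^ \<alpha> i)"
    by (intro prod.cong) auto
  then show ?thesis by (simp add: mpow_def prod.remove[of UNIV j])
qed

lemma mpow_inc: "mpow (inc j \<alpha>) z = z $ j * mpow \<alpha> z"
  using mpow_upd[of \<alpha> j "\<alpha> j" z] by (simp add: inc_def mpow_upd mult.assoc)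

lemma mpow_0: "mpow (\<lambda>_. 0) z = 1"
  by (simp add: mpow_def)

text \<open>The fold over the index type is split at j. \<open>fold_insert\<close> applies because
  powers of commuting maps commute, and the factors other than j are not affected by the
  increment.\<close>

lemma tuple_power_inc:
  fixes T :: "'a::finite \<Rightarrow> 'h \<Rightarrow> 'h"
  assumes comm: "\<And>i j. T i \<circ> T j = T j \<circ> T i"
  shows "tuple_power T (inc j \<alpha>) x = T j (tuple_power T \<alpha> x)"
proof -
  have c1: "(T i ^^ a) \<circ> T j = T j \<circ> (T i ^^ a)" for i j a
  proof (induction a)
    case (Suc a)
    then show ?case using comm[of i j] by (metis comp_assoc funpow.simps(2))
  qed simp
  have c2: "(T i ^^ a) \<circ> (T j ^^ b) = (T j ^^ b) \<circ> (T i ^^ a)" for i j a b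
  proof (induction b)
    case (Suc b)
    then show ?case using c1[where i=i and j=j and a=a] by (metis comp_assoc funpow.simps(2))
  qed simp
  have cf: "comp_fun_commute (\<lambda>j (S :: 'h \<Rightarrow> 'h). (T j ^^ \<alpha> j) \<circ> S)" for \<alpha> :: "'a \<Rightarrow> nat"
  proof
    fix i j
    show "(\<lambda>S. (T j ^^ \<alpha> j) \<circ> S) \<circ> (\<lambda>S. (T i ^^ \<alpha> i) \<circ> S) = (\<lambda>S. (T i ^^ \<alpha> i) \<circ> S) \<circ> (\<lambda>S. (T j ^^ \<alpha> j) \<circ> (S :: 'h \<Rightarrow> 'h))"
      using c2[where i=i and j=j and a="\<alpha> i" and b="\<alpha> j"] by (simp add: fun_eq_iff)
  qed
  have fi: "Finite_Set.fold (\<lambda>j S. (T j ^^ \<alpha> j) \<circ> S) id (insert x A) = (T x ^^ \<alpha> x) \<circ> Finite_Set.fold (\<lambda>j S. (T j ^^ \<alpha> j) \<circ> S) id A"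
    if "finite A" "x \<notin> A" for \<alpha> x A
  proof -
    interpret comp_fun_commute "\<lambda>j (S :: 'h \<Rightarrow> 'h). (T j ^^ \<alpha> j) \<circ> S" by (rule cf)
    show ?thesis using that by (rule fold_insert)
  qed
  have split: "tuple_power T \<alpha> = (T j ^^ \<alpha> j) \<circ> Finite_Set.fold (\<lambda>j S. (T j ^^ \<alpha> j) \<circ> S) id (UNIV - {j})" for \<alpha> :: "'a \<Rightarrow> nat"
    unfolding tuple_power_def using fi[of "UNIV - {j}" j \<alpha>] by (simp add: insert_UNIV)
  have "Finite_Set.fold (\<lambda>i S. (T i ^^ inc j \<alpha> i) \<circ> S) id (UNIV - {j}) = Finite_Set.fold (\<lambda>i S. (T i ^^ \<alpha> i) \<circ> S) id (UNIV - {j})"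
  proof -
    have "Finite_Set.fold (\<lambda>i S. (T i ^^ inc j \<alpha> i) \<circ> S) id A = Finite_Set.fold (\<lambda>i S. (T i ^^ \<alpha> i) \<circ> S) id A" if "j \<notin> A" for A
      using finite[of A] that
    proof (induction A rule: finite_induct)
      case (insert x A)
      then have "x \<noteq> j" "j \<notin> A" by auto
      then show ?case
        unfolding fi[OF insert.hyps] by (simp only: insert.IH inc_simps(2) not_False_eq_True)
    qed simp
    then show ?thesis by simp
  qed
  then show ?thesis by (simp add: split[of "inc j \<alpha>"] split[of \<alpha>] inc_simps)
qed

lemma tuple_power_0: "tuple_power (T :: 'a::finite \<Rightarrow> 'b \<Rightarrow> 'b) (\<lambda>_. 0) = id"
proof -
  have "Finite_Set.fold (\<lambda>(j::'a) S. id \<circ> S) id A = (id :: 'b \<Rightarrow> 'b)" for A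
  proof -
    interpret comp_fun_commute "\<lambda>(j::'a) (S :: 'b \<Rightarrow> 'b). id \<circ> S" by standard (simp add: fun_eq_iff)
    show ?thesis using finite[of A]
    proof (induction A rule: finite_induct)
      case (insert x F)
      have "Finite_Set.fold (\<lambda>(j::'a) S. id \<circ> S) id (insert x F) = id \<circ> Finite_Set.fold (\<lambda>(j::'a) S. id \<circ> S) (id :: 'b \<Rightarrow> 'b) F"
        by (rule fold_insert) (use insert in auto)
      then show ?case using insert.IH by (simp only: id_comp)
    qed simp
  qed
  then show ?thesis by (simp add: tuple_power_def id_def[symmetric])
qed

section \<open>Functional calculus of spherical isometries\<close>

definition torus_char :: "nat \<Rightarrow> ('d::finite \<Rightarrow> nat) \<Rightarrow> ('d \<Rightarrow> nat) \<Rightarrow> complex" where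
  "torus_char R t p = (\<Prod>i\<in>UNIV. cis (- (2 * pi * real (t i) * real (p i) / real R)))"

definition torus :: "nat \<Rightarrow> ('d::finite \<Rightarrow> nat) set" where
  "torus R = {t. \<forall>j. t j \<in> {..<R}}"

lemma finite_torus: "finite (torus R)"
  unfolding torus_def by (rule finite_bounded_mindex) simp

text \<open>The sign in \<open>torus_char\<close> is chosen so that passing from
  \<open>inc j p\<close> to \<open>p\<close> produces exactly the phase of the j-th coordinate of
  the point \<open>pt R \<eta> t\<close> introduced below.\<close>

lemma torus_char_inc: "torus_char R t p = cis (2 * pi * real (t j) / real R) * torus_char R t (inc j p)"
proof -
  have "(\<Prod>i\<in>UNIV - {j}. cis (- (2 * pi * real (t i) * real (inc j p i) / real R)))
      = (\<Prod>i\<in>UNIV - {j}. cis (- (2 * pi * real (t i) * real (p i) / real R)))"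
    by (intro prod.cong) (auto simp: inc_simps)
  then show ?thesis
    by (simp add: torus_char_def prod.remove[of UNIV j] inc_simps mult.assoc[symmetric] cis_mult add_divide_distrib[symmetric] diff_divide_distrib[symmetric])
       (simp add: algebra_simps)
qed

lemma sum_cis_geometric:
  fixes k :: int
  assumes "\<bar>k\<bar> < int R"
  shows "(\<Sum>s<R. cis (2 * pi * real s * real_of_int k / real R)) = (if k = 0 then of_nat R else 0)"
proof (cases "k = 0")
  case False
  let ?z = "cis (2 * pi * real_of_int k / real R)"
  have R: "0 < R" using assms by linarith
  have z1: "?z \<noteq> 1"
  proof
    assume "?z = 1"
    then have "cos (2 * pi * real_of_int k / real R) = 1" by (simp add: complex_eq_iff)
    then obtain n :: int where "2 * pi * real_of_int k / real R = of_int n * 2 * pi"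
      by (auto simp: cos_one_2pi_int)
    then have "real_of_int k = real_of_int (n * int R)" using R by (simp add: field_simps)
    then have k: "k = n * int R" by (simp only: of_int_eq_iff)
    then have "n \<noteq> 0" using False by auto
    then have "1 * int R \<le> \<bar>n\<bar> * int R" by (intro mult_right_mono) auto
    then have "int R \<le> \<bar>k\<bar>" using k by (simp add: abs_mult)
    then show False using assms by simp
  qed
  have "(\<Sum>s<R. cis (2 * pi * real s * real_of_int k / real R)) = (\<Sum>s<R. ?z ^ s)"
    by (intro sum.cong refl) (simp only: Complex.DeMoivre, simp add: algebra_simps)
  also have "\<dots> = (?z ^ R - 1) / (?z - 1)" by (rule geometric_sum[OF z1])
  also have "?z ^ R = 1"
  proof -
    have "?z ^ R = cis (2 * pi * real_of_int k)" using R by (simp add: Complex.DeMoivre)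
    then show ?thesis by (simp add: cis_multiple_2pi[OF Ints_of_int])
  qed
  finally show ?thesis using False by simp
qed simp

text \<open>Different indices that are closer than R in every coordinate differ modulo R in some
  coordinate, and there the geometric sum of roots of unity vanishes.\<close>

lemma torus_char_orthogonal:
  fixes p q :: "'d::finite \<Rightarrow> nat"
  assumes "\<And>i. \<bar>int (p i) - int (q i)\<bar> < int R"
  shows "(\<Sum>t\<in>torus R. torus_char R t p * cnj (torus_char R t q)) = (if p = q then of_nat (R ^ CARD('d)) else 0)"
proof -
  have tor: "torus R = PiE UNIV (\<lambda>_::'d. {..<R})" by (auto simp: torus_def)
  let ?k = "\<lambda>i. int (q i) - int (p i)"
  have "torus_char R t p * cnj (torus_char R t q) = (\<Prod>i\<in>UNIV. cis (2 * pi * real (t i) * real_of_int (?k i) / real R))" for t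
    by (simp add: torus_char_def prod.distrib[symmetric] cis_mult cis_cnj add_divide_distrib[symmetric] diff_divide_distrib[symmetric] algebra_simps)
  then have "(\<Sum>t\<in>torus R. torus_char R t p * cnj (torus_char R t q)) = (\<Sum>t\<in>PiE UNIV (\<lambda>_. {..<R}). \<Prod>i\<in>UNIV. cis (2 * pi * real (t i) * real_of_int (?k i) / real R))"
    by (simp only: tor)
  also have "\<dots> = (\<Prod>i\<in>UNIV. \<Sum>s<R. cis (2 * pi * real s * real_of_int (?k i) / real R))"
    by (subst prod_sum_PiE) auto
  also have "\<dots> = (\<Prod>i\<in>UNIV. if p i = q i then of_nat R else 0)"
  proof (rule prod.cong[OF refl])
    fix i
    have "\<bar>?k i\<bar> < int R" using assms[of i] by linarith
    from sum_cis_geometric[OF this]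
    show "(\<Sum>s<R. cis (2 * pi * real s * real_of_int (?k i) / real R)) = (if p i = q i then of_nat R else 0)"
      by (simp only: eq_iff_diff_eq_0[of "int (q i)" "int (p i)", symmetric] of_nat_eq_iff eq_commute[of "q i" "p i"])
  qed
  also have "\<dots> = (if p = q then of_nat (R ^ CARD('d)) else 0)"
  proof (cases "p = q")
    case False
    then obtain i where "p i \<noteq> q i" by auto
    then show ?thesis using False by (auto intro!: prod_zero)
  qed simp
  finally show ?thesis .
qed

context psd_form
begin

text \<open>Averaging over t removes all mixed terms, so a superposition over a window behaves like
  an orthogonal sum although the vectors \<open>g p\<close> need not be orthogonal for
  \<open>B\<close>.\<close>

lemma sum_torus_form:
  fixes P :: "('d::finite \<Rightarrow> nat) set" and g g' :: "('d \<Rightarrow> nat) \<Rightarrow> 'h"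
  assumes P: "finite P" "\<And>p q i. \<lbrakk>p \<in> P; q \<in> P\<rbrakk> \<Longrightarrow> \<bar>int (p i) - int (q i)\<bar> < int R"
  shows "(\<Sum>t\<in>torus R. B (\<Sum>p\<in>P. torus_char R t p *\<^sub>C g p) (\<Sum>p\<in>P. torus_char R t p *\<^sub>C g' p))
    = of_nat (R ^ CARD('d)) * (\<Sum>p\<in>P. B (g p) (g' p))"
proof -
  have "(\<Sum>t\<in>torus R. B (\<Sum>p\<in>P. torus_char R t p *\<^sub>C g p) (\<Sum>p\<in>P. torus_char R t p *\<^sub>C g' p))
    = (\<Sum>t\<in>torus R. \<Sum>p\<in>P. \<Sum>q\<in>P. torus_char R t p * cnj (torus_char R t q) * B (g p) (g' q))"
    by (simp only: sum_left scaleC_left) (simp add: sum_right scaleC_right sum_distrib_left mult.assoc)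
  also have "\<dots> = (\<Sum>p\<in>P. \<Sum>q\<in>P. \<Sum>t\<in>torus R. torus_char R t p * cnj (torus_char R t q) * B (g p) (g' q))"
    by (subst sum.swap, rule sum.cong[OF refl], rule sum.swap)
  also have "\<dots> = (\<Sum>p\<in>P. \<Sum>q\<in>P. if p = q then of_nat (R ^ CARD('d)) * B (g p) (g' q) else 0)"
    by (intro sum.cong refl) (simp add: sum_distrib_right[symmetric] torus_char_orthogonal P)
  also have "\<dots> = of_nat (R ^ CARD('d)) * (\<Sum>p\<in>P. B (g p) (g' p))"
    using P(1) by (simp add: sum_distrib_left)
  finally show ?thesis .
qed

lemma sum_Cauchy_Schwarz:
  fixes f :: "'i \<Rightarrow> complex" and a b :: "'i \<Rightarrow> 'h"
  assumes f: "\<And>i. i \<in> I \<Longrightarrow> cmod (f i) \<le> C" and C: "0 \<le> C"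
  shows "cmod (\<Sum>i\<in>I. f i * B (a i) (b i)) \<le> C * (sqrt (\<Sum>i\<in>I. Re (B (a i) (a i))) * sqrt (\<Sum>i\<in>I. Re (B (b i) (b i))))"
proof -
  have "cmod (\<Sum>i\<in>I. f i * B (a i) (b i)) \<le> (\<Sum>i\<in>I. C * (\<bar>sqrt (Re (B (a i) (a i)))\<bar> * \<bar>sqrt (Re (B (b i) (b i)))\<bar>))"
  proof (rule sum_norm_le)
    fix i assume i: "i \<in> I"
    show "cmod (f i * B (a i) (b i)) \<le> C * (\<bar>sqrt (Re (B (a i) (a i)))\<bar> * \<bar>sqrt (Re (B (b i) (b i)))\<bar>)"
      using Cauchy_Schwarz'[of "a i" "b i"] f[OF i] C nonneg
      by (simp add: norm_mult) (intro mult_mono; simp)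
  qed
  also have "\<dots> \<le> C * (L2_set (\<lambda>i. sqrt (Re (B (a i) (a i)))) I * L2_set (\<lambda>i. sqrt (Re (B (b i) (b i)))) I)"
    unfolding sum_distrib_left[symmetric] using C by (intro mult_left_mono L2_set_mult_ineq) auto
  finally show ?thesis by (simp add: L2_set_def nonneg)
qed

end

section \<open>Spherical isometries with respect to a semidefinite form, and their window
  vectors\<close>

locale spherical_isometry = psd_form B
  for B :: "'h::complex_inner \<Rightarrow> 'h \<Rightarrow> complex" +
  fixes T :: "'d::finite \<Rightarrow> 'h \<Rightarrow> 'h"
  assumes T_add: "T j (x + y) = T j x + T j y"
    and T_scaleC: "T j (c *\<^sub>C x) = c *\<^sub>C T j x"
    and T_comm: "T i \<circ> T j = T j \<circ> T i"
    and T_iso: "(\<Sum>j\<in>UNIV. B (T j x) (T j y)) = B x y"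
begin

abbreviation Tp :: "('d \<Rightarrow> nat) \<Rightarrow> 'h \<Rightarrow> 'h" where "Tp \<equiv> tuple_power T"

lemma Tp_inc: "Tp (inc j \<alpha>) x = T j (Tp \<alpha> x)"
  by (rule tuple_power_inc[OF T_comm])

lemma Tp_linear: "Tp \<alpha> (x + y) = Tp \<alpha> x + Tp \<alpha> y" "Tp \<alpha> (c *\<^sub>C x) = c *\<^sub>C Tp \<alpha> x"
  by (induction \<alpha> rule: mindex_induct) (simp_all add: tuple_power_0 Tp_inc T_add T_scaleC)

lemma Tp_T: "Tp \<alpha> (T j x) = Tp (inc j \<alpha>) x"
proof (induction \<alpha> rule: mindex_induct)
  case zero
  then show ?case by (simp add: Tp_inc tuple_power_0)
next
  case (inc \<alpha> i)
  then show ?case using fun_cong[OF T_comm[of i j], of "Tp \<alpha> x"] by (simp add: Tp_inc)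
qed

text \<open>The shift lemma with increment 0: every level carries the same total, which is the
  reason for collecting whole levels in a shell.\<close>

lemma sum_multinomial_form:
  "(\<Sum>\<gamma> | mindex_norm \<gamma> = n. multinomial \<gamma> * B (Tp \<gamma> x) (Tp \<gamma> y)) = B x y"
  using sum_multinomial_shift[of "\<lambda>\<gamma>. B (Tp \<gamma> x) (Tp \<gamma> y)" "\<lambda>_. 0" n]
  by (simp add: Tp_inc T_iso tuple_power_0)

text \<open>The square root, because the weight enters through both arguments of the form.\<close>

definition mweight :: "('d \<Rightarrow> nat) \<Rightarrow> real" where "mweight p = sqrt (multinomial p)"

text \<open>The square root of the factor in \<open>multinomial_inc\<close>: it is the quotient of
  the weights of neighbouring indices and, at the same time, the modulus of a coordinate of the
  sphere point attached to p.\<close>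

definition ratio :: "'d \<Rightarrow> ('d \<Rightarrow> nat) \<Rightarrow> real" where
  "ratio j p = sqrt (real (p j) / real (mindex_norm p))"

lemma mweight_inc: "mweight p = ratio j (inc j p) * mweight (inc j p)"
  unfolding mweight_def ratio_def real_sqrt_mult[symmetric] by (simp only: multinomial_inc[of p j])

lemma mweight_square: "(complex_of_real (mweight p))\<^sup>2 = multinomial p"
proof -
  have "0 \<le> (multinomial p :: real)" by (simp add: multinomial_def)
  then have "complex_of_real ((mweight p)\<^sup>2) = complex_of_real (multinomial p)" by (simp add: mweight_def)
  then show ?thesis by (simp add: multinomial_def)
qed

text \<open>
  The point with parameters \<open>\<eta>\<close>, \<open>t\<close> has coordinates of modulus \<open>sqrt (\<eta>\<^sub>j / |\<eta>|)\<close>. As \<open>\<eta>\<close> varies slowly on the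
  scale of the window below it, applying \<open>T\<^sub>j\<close> to the vector attached to \<open>(\<eta>, t)\<close> multiplies it by
  the \<open>j\<close>-th coordinate up to the boundary of window and shell.
\<close>

definition window :: "nat \<Rightarrow> ('d \<Rightarrow> nat) \<Rightarrow> ('d \<Rightarrow> nat) set" where
  "window M \<eta> = {p. \<forall>j. p j \<le> \<eta> j \<and> \<eta> j < p j + M}"

definition shell :: "nat \<Rightarrow> ('d \<Rightarrow> nat) set" where
  "shell N = {p. N \<le> mindex_norm p \<and> mindex_norm p < 2 * N}"

text \<open>\<open>\<eta>\<close> is the upper corner of its window. The box contains every nonzero
  corner whose window meets an index of level at most 2 N; the origin is excluded because
  \<open>pt\<close> would not lie on the sphere there.\<close>

definition window_bases :: "nat \<Rightarrow> nat \<Rightarrow> ('d \<Rightarrow> nat) set" where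
  "window_bases N M = {\<eta>. (\<forall>j. \<eta> j \<in> {..<2 * N + M + 1}) \<and> 0 < mindex_norm \<eta>}"

lemma finite_window_bases: "finite (window_bases N M)"
  by (rule finite_subset[OF _ finite_bounded_mindex[of "\<lambda>_. {..<2 * N + M + 1}"]]) (auto simp: window_bases_def)

lemma finite_shell: "finite (shell N)"
  by (rule finite_subset[OF _ finite_mindex_norm_le[of "2 * N"]]) (auto simp: shell_def)

text \<open>All indices of level N to 2 N lie in equally many windows, so the overlapping windows
  count them with the same multiplicity.\<close>

lemma card_window:
  assumes "N \<le> mindex_norm p" "mindex_norm p \<le> 2 * N" "0 < N"
  shows "{\<eta> \<in> window_bases N M. p \<in> window M \<eta>} = {\<eta>. \<forall>j. \<eta> j \<in> {p j..<p j + M}}" (is "?A = ?B")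
    and "card {\<eta> \<in> window_bases N M. p \<in> window M \<eta>} = M ^ CARD('d)"
proof -
  show e: "?A = ?B"
  proof (intro equalityI subsetI)
    fix \<eta> assume \<eta>: "\<eta> \<in> ?B"
    have "\<eta> j < 2 * N + M + 1" for j
      using \<eta> le_mindex_norm[of p j] assms(2) by (auto dest!: spec[of _ j])
    moreover have "mindex_norm p \<le> mindex_norm \<eta>"
      unfolding mindex_norm_def using \<eta> by (intro sum_mono) auto
    ultimately show "\<eta> \<in> ?A" using \<eta> assms by (auto simp: window_bases_def window_def)
  qed (auto simp: window_def)
  show "card ?A = M ^ CARD('d)" unfolding e card_bounded_mindex by simp
qed

definition block_vector :: "nat \<Rightarrow> nat \<Rightarrow> nat \<Rightarrow> ('d \<Rightarrow> nat) \<Rightarrow> ('d \<Rightarrow> nat) \<Rightarrow> 'h \<Rightarrow> 'h" where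
  "block_vector N M R \<eta> t h = (\<Sum>p\<in>window M \<eta> \<inter> shell N. torus_char R t p *\<^sub>C complex_of_real (mweight p) *\<^sub>C Tp p h)"

definition pt :: "nat \<Rightarrow> ('d \<Rightarrow> nat) \<Rightarrow> ('d \<Rightarrow> nat) \<Rightarrow> complex^'d" where
  "pt R \<eta> t = (\<chi> j. complex_of_real (ratio j \<eta>) * cis (2 * pi * real (t j) / real R))"

lemma norm_pt: assumes "0 < mindex_norm \<eta>" shows "norm (pt R \<eta> t) = 1"
proof -
  have "(\<Sum>j\<in>UNIV. (norm (pt R \<eta> t $ j))\<^sup>2) = (\<Sum>j\<in>UNIV. real (\<eta> j) / real (mindex_norm \<eta>))"
    by (simp add: pt_def ratio_def norm_mult)
  also have "\<dots> = real (mindex_norm \<eta>) / real (mindex_norm \<eta>)"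
    unfolding sum_divide_distrib[symmetric] by (simp add: mindex_norm_def)
  also have "\<dots> = 1" using assms by simp
  finally show ?thesis by (simp add: norm_vec_def L2_set_def)
qed

lemma block_vector_linear: "block_vector N M R \<eta> t (x + y) = block_vector N M R \<eta> t x + block_vector N M R \<eta> t y"
  "block_vector N M R \<eta> t (c *\<^sub>C x) = c *\<^sub>C block_vector N M R \<eta> t x"
  unfolding block_vector_def
  by (simp_all add: Tp_linear scaleC_add_right sum.distrib complex_inner.scale_sum_right scaleC_scaleC ac_simps)

text \<open>Three exact counts: the torus average leaves the diagonal, each index lies in M^d
  windows, and each of the N levels of the shell contributes \<open>B h k\<close>. The total mass of
  the approximants is therefore correct before any limit is taken.\<close>

lemma sum_block_vector_form:
  assumes N: "0 < N" and R: "M < R"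
  shows "(\<Sum>\<eta>\<in>window_bases N M. \<Sum>t\<in>torus R. B (block_vector N M R \<eta> t h) (block_vector N M R \<eta> t k)) = of_nat (N * M ^ CARD('d) * R ^ CARD('d)) * B h k"
proof -
  let ?b = "\<lambda>p. multinomial p * B (Tp p h) (Tp p k)"
  have inner: "(\<Sum>t\<in>torus R. B (block_vector N M R \<eta> t h) (block_vector N M R \<eta> t k)) = of_nat (R ^ CARD('d)) * (\<Sum>p\<in>window M \<eta> \<inter> shell N. ?b p)" for \<eta>
  proof -
    have "(\<Sum>t\<in>torus R. B (block_vector N M R \<eta> t h) (block_vector N M R \<eta> t k))
      = of_nat (R ^ CARD('d)) * (\<Sum>p\<in>window M \<eta> \<inter> shell N. B (complex_of_real (mweight p) *\<^sub>C Tp p h) (complex_of_real (mweight p) *\<^sub>C Tp p k))"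
      unfolding block_vector_def
    proof (rule sum_torus_form)
      fix p q i assume "p \<in> window M \<eta> \<inter> shell N" "q \<in> window M \<eta> \<inter> shell N"
      then have "p i \<le> \<eta> i" "\<eta> i < p i + M" "q i \<le> \<eta> i" "\<eta> i < q i + M" by (auto simp: window_def)
      then show "\<bar>int (p i) - int (q i)\<bar> < int R" using R by linarith
    qed (simp add: finite_shell)
    also have "(\<Sum>p\<in>window M \<eta> \<inter> shell N. B (complex_of_real (mweight p) *\<^sub>C Tp p h) (complex_of_real (mweight p) *\<^sub>C Tp p k)) = (\<Sum>p\<in>window M \<eta> \<inter> shell N. ?b p)"
      by (intro sum.cong refl) (simp add: scaleC_left scaleC_right mult.assoc[symmetric] mweight_square flip: power2_eq_square)
    finally show ?thesis .
  qed
  have "(\<Sum>\<eta>\<in>window_bases N M. \<Sum>t\<in>torus R. B (block_vector N M R \<eta> t h) (block_vector N M R \<eta> t k))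
      = of_nat (R ^ CARD('d)) * (\<Sum>\<eta>\<in>window_bases N M. \<Sum>p\<in>{p \<in> shell N. p \<in> window M \<eta>}. ?b p)"
    unfolding inner sum_distrib_left[symmetric] by (intro arg_cong2[where f="(*)"] sum.cong) auto
  also have "(\<Sum>\<eta>\<in>window_bases N M. \<Sum>p\<in>{p \<in> shell N. p \<in> window M \<eta>}. ?b p) = (\<Sum>p\<in>shell N. \<Sum>\<eta>\<in>{\<eta> \<in> window_bases N M. p \<in> window M \<eta>}. ?b p)"
    by (rule sum.swap_restrict[OF finite_window_bases finite_shell])
  also have "\<dots> = (\<Sum>p\<in>shell N. of_nat (M ^ CARD('d)) * ?b p)"
    using N by (intro sum.cong refl) (simp add: card_window(2) shell_def)
  also have "\<dots> = of_nat (M ^ CARD('d)) * (\<Sum>n\<in>{N..<2 * N}. \<Sum>p\<in>{p \<in> shell N. mindex_norm p = n}. ?b p)"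
    by (subst sum.group[of "shell N" "{N..<2 * N}" mindex_norm]) (auto simp: shell_def finite_shell[unfolded shell_def] sum_distrib_left)
  also have "(\<Sum>n\<in>{N..<2 * N}. \<Sum>p\<in>{p \<in> shell N. mindex_norm p = n}. ?b p) = (\<Sum>n\<in>{N..<2 * N}. \<Sum>p | mindex_norm p = n. ?b p)"
    by (intro sum.cong) (auto simp: shell_def)
  also have "\<dots> = of_nat N * B h k" by (simp add: sum_multinomial_form)
  finally show ?thesis by (simp add: algebra_simps)
qed

end

section \<open>The distance of window vectors from joint eigenvectors\<close>

context spherical_isometry
begin

lemma ratio_le: "0 \<le> ratio j p" "ratio j p \<le> 1"
  using le_mindex_norm[of p j] by (auto simp: ratio_def divide_le_eq_1)

text \<open>Inside a window each entry changes by less than M and the sum of entries by at most d M,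
  while that sum is at least N; then (sqrt a - sqrt b)^2 <= |a - b|.\<close>

lemma ratio_diff:
  assumes p: "p \<in> window M \<eta>" and N: "0 < N" "N \<le> mindex_norm p"
  shows "(ratio j \<eta> - ratio j p)\<^sup>2 \<le> real (CARD('d) * M) / real N"
proof -
  let ?a = "real (\<eta> j) / real (mindex_norm \<eta>)" and ?b = "real (p j) / real (mindex_norm p)"
  have pe: "p i \<le> \<eta> i" "\<eta> i < p i + M" for i using p by (auto simp: window_def)
  have le: "mindex_norm p \<le> mindex_norm \<eta>" unfolding mindex_norm_def using pe by (intro sum_mono) auto
  have "mindex_norm \<eta> \<le> (\<Sum>i\<in>UNIV. p i + M)" unfolding mindex_norm_def using pe(2) less_imp_le by (intro sum_mono) blast
  also have "\<dots> = mindex_norm p + CARD('d) * M" by (simp add: mindex_norm_def sum.distrib)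
  finally have le2: "real (mindex_norm \<eta>) \<le> real (mindex_norm p) + real (CARD('d) * M)"
    by (metis of_nat_add of_nat_le_iff)
  have pos: "0 < real (mindex_norm p)" "0 < real (mindex_norm \<eta>)" using N le by auto
  have "1 * M \<le> CARD('d) * M" by (intro mult_right_mono) (simp_all add: Suc_leI)
  then have dM: "real M \<le> real (CARD('d) * M)" by (simp only: of_nat_le_iff mult_1)
  have "?a \<le> real (\<eta> j) / real (mindex_norm p)" using le pos by (intro divide_left_mono) auto
  also have "\<dots> \<le> (real (p j) + real M) / real (mindex_norm p)" using pe[of j] by (intro divide_right_mono) auto
  finally have u: "?a - ?b \<le> real M / real (mindex_norm p)" by (simp add: add_divide_distrib)
  have "?b - ?a \<le> ?b - real (p j) / real (mindex_norm \<eta>)"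
    using pe[of j] by (simp add: divide_right_mono)
  also have "\<dots> = ?b * ((real (mindex_norm \<eta>) - real (mindex_norm p)) / real (mindex_norm \<eta>))"
    using pos by (simp add: field_simps)
  also have "\<dots> \<le> 1 * (real (CARD('d) * M) / real (mindex_norm p))"
  proof (rule mult_mono)
    show "?b \<le> 1" using le_mindex_norm[of p j] pos by (simp add: divide_le_eq_1)
    show "(real (mindex_norm \<eta>) - real (mindex_norm p)) / real (mindex_norm \<eta>) \<le> real (CARD('d) * M) / real (mindex_norm p)"
      using le2 le pos by (intro frac_le) auto
    show "0 \<le> (real (mindex_norm \<eta>) - real (mindex_norm p)) / real (mindex_norm \<eta>)" using le by simp
  qed simp
  finally have l: "?b - ?a \<le> real (CARD('d) * M) / real (mindex_norm p)" by simp
  have "real M / real (mindex_norm p) \<le> real (CARD('d) * M) / real (mindex_norm p)"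
    using dM by (rule divide_right_mono) simp
  then have "\<bar>?a - ?b\<bar> \<le> real (CARD('d) * M) / real (mindex_norm p)" using u l by (simp add: abs_le_iff)
  also have "\<dots> \<le> real (CARD('d) * M) / real N" using N by (intro divide_left_mono) auto
  finally have ab: "\<bar>?a - ?b\<bar> \<le> real (CARD('d) * M) / real N" .
  have "(sqrt ?a - sqrt ?b)\<^sup>2 \<le> \<bar>sqrt ?a - sqrt ?b\<bar> * (sqrt ?a + sqrt ?b)"
  proof -
    have "(sqrt ?a - sqrt ?b)\<^sup>2 = \<bar>sqrt ?a - sqrt ?b\<bar> * \<bar>sqrt ?a - sqrt ?b\<bar>" by (simp add: power2_eq_square)
    also have "\<dots> \<le> \<bar>sqrt ?a - sqrt ?b\<bar> * (sqrt ?a + sqrt ?b)"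
      by (intro mult_left_mono) (auto simp: abs_le_iff)
    finally show ?thesis .
  qed
  also have "\<dots> = \<bar>(sqrt ?a - sqrt ?b) * (sqrt ?a + sqrt ?b)\<bar>" by (simp add: abs_mult)
  also have "(sqrt ?a - sqrt ?b) * (sqrt ?a + sqrt ?b) = ?a - ?b"
    by (simp add: algebra_simps)
  finally show ?thesis using ab by (simp add: ratio_def)
qed

text \<open>Counts a face of a box of corners; multiplied by M so that the exponent d - 1 does not
  occur.\<close>

lemma card_slice:
  "real M * real (card {\<eta> :: 'd \<Rightarrow> nat. \<forall>i. \<eta> i \<in> (if i = j then {c} else {p i..<p i + M})}) = real (M ^ CARD('d))"
proof -
  have "card {\<eta> :: 'd \<Rightarrow> nat. \<forall>i. \<eta> i \<in> (if i = j then {c} else {p i..<p i + M})} = (\<Prod>i\<in>UNIV. if i = j then 1 else M)"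
    unfolding card_bounded_mindex by (intro prod.cong) auto
  also have "\<dots> = (\<Prod>i\<in>UNIV - {j}. M)" by (subst prod.remove[of UNIV j]) (auto intro!: prod.cong)
  finally have c: "card {\<eta> :: 'd \<Rightarrow> nat. \<forall>i. \<eta> i \<in> (if i = j then {c} else {p i..<p i + M})} = (\<Prod>i\<in>UNIV - {j}. M)" .
  have "(\<Prod>i\<in>(UNIV::'d set). M) = M * (\<Prod>i\<in>UNIV - {j}. M)" by (rule prod.remove) auto
  then have "M * (\<Prod>i\<in>UNIV - {j}. M) = M ^ CARD('d)" by simp
  then show ?thesis unfolding c by (simp only: of_nat_mult[symmetric])
qed

lemma card_window_le: "card {\<eta> \<in> window_bases N M. p \<in> window M \<eta>} \<le> M ^ CARD('d)"
proof -
  have "card {\<eta> \<in> window_bases N M. p \<in> window M \<eta>} \<le> card {\<eta> :: 'd \<Rightarrow> nat. \<forall>j. \<eta> j \<in> {p j..<p j + M}}"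
    by (intro card_mono finite_bounded_mindex) (auto simp: window_def)
  then show ?thesis unfolding card_bounded_mindex by simp
qed

text \<open>The indices at which the block, or the block raised by \<open>T j\<close>, has a
  component.\<close>

definition cells :: "'d \<Rightarrow> nat \<Rightarrow> nat \<Rightarrow> ('d \<Rightarrow> nat) \<Rightarrow> ('d \<Rightarrow> nat) set" where
  "cells j N M \<eta> = (window M \<eta> \<inter> shell N) \<union> inc j ` (window M \<eta> \<inter> shell N)"

definition coef :: "'d \<Rightarrow> nat \<Rightarrow> nat \<Rightarrow> ('d \<Rightarrow> nat) \<Rightarrow> ('d \<Rightarrow> nat) \<Rightarrow> real" where
  "coef j N M \<eta> p = ratio j \<eta> * of_bool (p \<in> window M \<eta> \<inter> shell N) - ratio j p * of_bool (p \<in> inc j ` (window M \<eta> \<inter> shell N))"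

definition shift_defect :: "'d \<Rightarrow> nat \<Rightarrow> nat \<Rightarrow> nat \<Rightarrow> ('d \<Rightarrow> nat) \<Rightarrow> ('d \<Rightarrow> nat) \<Rightarrow> 'h \<Rightarrow> 'h" where
  "shift_defect j N M R \<eta> t h = pt R \<eta> t $ j *\<^sub>C block_vector N M R \<eta> t h - block_vector N M R \<eta> t (T j h)"

lemma finite_cells: "finite (cells j N M \<eta>)"
  by (simp add: cells_def finite_shell)

text \<open>\<open>T j\<close> raises the indices by \<open>inc j\<close>. By
  \<open>torus_char_inc\<close> and \<open>mweight_inc\<close> both vectors carry the same phase,
  and the coefficient of \<open>Tp p h\<close> becomes the difference \<open>coef\<close>.\<close>

lemma shift_defect_eq:
  "shift_defect j N M R \<eta> t h = cis (2 * pi * real (t j) / real R) *\<^sub>C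
    (\<Sum>p\<in>cells j N M \<eta>. torus_char R t p *\<^sub>C complex_of_real (coef j N M \<eta> p * mweight p) *\<^sub>C Tp p h)"
proof -
  let ?c = "cis (2 * pi * real (t j) / real R)" and ?P = "window M \<eta> \<inter> shell N"
  have 1: "pt R \<eta> t $ j *\<^sub>C block_vector N M R \<eta> t h = ?c *\<^sub>C (\<Sum>p\<in>cells j N M \<eta>. torus_char R t p *\<^sub>C complex_of_real (ratio j \<eta> * of_bool (p \<in> ?P) * mweight p) *\<^sub>C Tp p h)"
  proof -
    have "(\<Sum>p\<in>cells j N M \<eta>. torus_char R t p *\<^sub>C complex_of_real (ratio j \<eta> * of_bool (p \<in> ?P) * mweight p) *\<^sub>C Tp p h)
      = (\<Sum>p\<in>?P. torus_char R t p *\<^sub>C complex_of_real (ratio j \<eta> * mweight p) *\<^sub>C Tp p h)"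
      by (rule sum.mono_neutral_cong_right) (auto simp: finite_shell cells_def)
    then show ?thesis
      by (simp add: pt_def block_vector_def complex_inner.scale_sum_right scaleC_scaleC ac_simps)
  qed
  have 2: "block_vector N M R \<eta> t (T j h) = ?c *\<^sub>C (\<Sum>p\<in>cells j N M \<eta>. torus_char R t p *\<^sub>C complex_of_real (ratio j p * of_bool (p \<in> inc j ` ?P) * mweight p) *\<^sub>C Tp p h)"
  proof -
    have "(\<Sum>p\<in>cells j N M \<eta>. torus_char R t p *\<^sub>C complex_of_real (ratio j p * of_bool (p \<in> inc j ` ?P) * mweight p) *\<^sub>C Tp p h)
      = (\<Sum>p\<in>inc j ` ?P. torus_char R t p *\<^sub>C complex_of_real (ratio j p * mweight p) *\<^sub>C Tp p h)"
      by (rule sum.mono_neutral_cong_right) (auto simp: finite_shell cells_def)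
    also have "\<dots> = (\<Sum>p\<in>?P. torus_char R t (inc j p) *\<^sub>C complex_of_real (mweight p) *\<^sub>C Tp (inc j p) h)"
      by (subst sum.reindex, simp add: inj_on_def inc_inj) (simp only: o_def mweight_inc[of _ j, symmetric])
    finally have e: "(\<Sum>p\<in>cells j N M \<eta>. torus_char R t p *\<^sub>C complex_of_real (ratio j p * of_bool (p \<in> inc j ` ?P) * mweight p) *\<^sub>C Tp p h)
      = (\<Sum>p\<in>?P. torus_char R t (inc j p) *\<^sub>C complex_of_real (mweight p) *\<^sub>C Tp (inc j p) h)" .
    show ?thesis
      unfolding e block_vector_def complex_inner.scale_sum_right Tp_T
      by (intro sum.cong refl, subst torus_char_inc[of _ _ _ j]) (simp add: scaleC_scaleC mult.assoc)
  qed
  show ?thesis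
    unfolding shift_defect_def 1 2 coef_def left_diff_distrib of_real_diff
    by (simp only: complex_inner.scale_left_diff_distrib complex_inner.scale_right_diff_distrib sum_subtractf)
qed

text \<open>Four sources of a nonzero coefficient: in the interior two nearly equal ratios are
  subtracted, see \<open>ratio_diff\<close>; otherwise the corner is on the face \<eta>_j = p_j + M
  - 1 or on the face \<eta>_j = p_j - 1, or p has level N or 2 N, where the shell can cut off one of
  the two terms.\<close>

lemma coef_bound:
  assumes N: "0 < N" and p: "p \<in> cells j N M \<eta>"
  shows "(coef j N M \<eta> p)\<^sup>2 \<le> real (CARD('d) * M) / real N * of_bool (p \<in> window M \<eta>)
     + of_bool (\<eta> \<in> {\<eta>. \<forall>i. \<eta> i \<in> (if i = j then {p j + M - 1} else {p i..<p i + M})})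
     + of_bool (\<eta> \<in> {\<eta>. \<forall>i. \<eta> i \<in> (if i = j then {p j - 1} else {p i..<p i + M})})
     + of_bool (mindex_norm p = N \<or> mindex_norm p = 2 * N) * (of_bool (p \<in> window M \<eta>) + of_bool (p(j := p j - 1) \<in> window M \<eta>))"
    (is "_ \<le> ?\<delta> * _ + of_bool (_ \<in> ?X) + of_bool (_ \<in> ?Y) + _")
proof -
  have d0: "0 \<le> ?\<delta>" by simp
  have nonnegs: "0 \<le> ?\<delta> * of_bool (p \<in> window M \<eta>)" "0 \<le> (of_bool (\<eta> \<in> ?X) :: real)" "0 \<le> (of_bool (\<eta> \<in> ?Y) :: real)"
    "0 \<le> of_bool (mindex_norm p = N \<or> mindex_norm p = 2 * N) * (of_bool (p \<in> window M \<eta>) + of_bool (p(j := p j - 1) \<in> window M \<eta>) :: real)"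
    using d0 by (simp_all del: mem_Collect_eq)
  have one: "(coef j N M \<eta> p)\<^sup>2 \<le> 1"
    using ratio_le[of j p] ratio_le[of j \<eta>] by (intro power_le_one_iff[THEN iffD2] abs_square_le_1[THEN iffD2]) (auto simp: coef_def)
  have incp: "p \<in> inc j ` A \<longleftrightarrow> 0 < p j \<and> p(j := p j - 1) \<in> A" for A
  proof
    assume "p \<in> inc j ` A"
    then obtain q where "q \<in> A" "p = inc j q" by blast
    then show "0 < p j \<and> p(j := p j - 1) \<in> A" by (simp add: inc_def)
  next
    assume *: "0 < p j \<and> p(j := p j - 1) \<in> A"
    then have "p = inc j (p(j := p j - 1))" by (simp add: inc_def)
    then show "p \<in> inc j ` A" using * by blast
  qed
  have nrm: "mindex_norm (p(j := p j - 1)) = mindex_norm p - 1 \<and> 0 < mindex_norm p" if "0 < p j"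
  proof -
    have "p = inc j (p(j := p j - 1))" using that by (simp add: inc_def)
    then have "mindex_norm p = Suc (mindex_norm (p(j := p j - 1)))" by (metis mindex_norm_inc)
    then show ?thesis by simp
  qed
  show ?thesis
  proof (cases "mindex_norm p = N \<or> mindex_norm p = 2 * N")
    case True
    have "p \<in> window M \<eta> \<or> p(j := p j - 1) \<in> window M \<eta>"
      using p unfolding cells_def Un_iff incp Int_iff by blast
    then have "(1::real) \<le> of_bool (p \<in> window M \<eta>) + of_bool (p(j := p j - 1) \<in> window M \<eta>)" by auto
    moreover have "of_bool (mindex_norm p = N \<or> mindex_norm p = 2 * N) * x = x" for x :: real using True by simp
    ultimately show ?thesis using one nonnegs by (smt (verit))
  next
    case edge: False
    have inP: "p \<in> window M \<eta> \<inter> shell N \<longleftrightarrow> p \<in> window M \<eta>" and inI: "p \<in> inc j ` (window M \<eta> \<inter> shell N) \<longleftrightarrow> p \<in> inc j ` window M \<eta>"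
    proof -
      consider (a) "N < mindex_norm p" "mindex_norm p < 2 * N"
        | (b) "p j = 0" "mindex_norm p < N \<or> 2 * N < mindex_norm p"
        | (c) "0 < p j" "mindex_norm p < N \<or> 2 * N < mindex_norm p"
        using edge by linarith
      then have "N < mindex_norm p \<and> mindex_norm p < 2 * N"
      proof cases
        case b then show ?thesis using p unfolding cells_def incp Un_iff Int_iff shell_def by simp
      next
        case c then show ?thesis using p conjunct1[OF nrm[OF c(1)]] conjunct2[OF nrm[OF c(1)]]
          unfolding cells_def incp Un_iff Int_iff shell_def mem_Collect_eq by linarith
      qed simp
      then have sh: "p \<in> shell N" "0 < p j \<Longrightarrow> p(j := p j - 1) \<in> shell N"
        using nrm by (auto simp only: shell_def mem_Collect_eq)
      show "p \<in> window M \<eta> \<inter> shell N \<longleftrightarrow> p \<in> window M \<eta>" using sh(1) by blast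
      show "p \<in> inc j ` (window M \<eta> \<inter> shell N) \<longleftrightarrow> p \<in> inc j ` window M \<eta>"
        unfolding incp using sh(2) by blast
    qed
    have Np: "N \<le> mindex_norm p"
    proof (cases "0 < p j")
      case True
      then show ?thesis using p conjunct1[OF nrm[OF True]] conjunct2[OF nrm[OF True]]
        unfolding cells_def incp Un_iff Int_iff shell_def mem_Collect_eq by linarith
    next
      case False
      then show ?thesis using p unfolding cells_def incp Un_iff Int_iff shell_def by simp
    qed
    have c: "coef j N M \<eta> p = ratio j \<eta> * of_bool (p \<in> window M \<eta>) - ratio j p * of_bool (0 < p j \<and> p(j := p j - 1) \<in> window M \<eta>)"
      unfolding coef_def inP inI by (simp only: incp)
    have "p \<in> window M \<eta> \<or> 0 < p j \<and> p(j := p j - 1) \<in> window M \<eta>"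
      using p unfolding cells_def incp Un_iff Int_iff by blast
    then consider (both) "p \<in> window M \<eta>" "p j = 0 \<or> p(j := p j - 1) \<in> window M \<eta>"
      | (left) "p \<in> window M \<eta>" "0 < p j" "p(j := p j - 1) \<notin> window M \<eta>"
      | (right) "p \<notin> window M \<eta>" "0 < p j" "p(j := p j - 1) \<in> window M \<eta>"
      by (cases "p j = 0") auto
    then show ?thesis
    proof cases
      case both
      \<comment> \<open>For p_j = 0 the second term is absent from \<open>coef\<close>, but it may
        be written in because its ratio is 0.\<close>
      have "ratio j p = 0" if "p j = 0" using that by (simp add: ratio_def)
      then have "coef j N M \<eta> p = ratio j \<eta> - ratio j p" unfolding c using both by auto
      then show ?thesis using ratio_diff[OF both(1) N Np, of j] both(1) by simp
    next
      case left
      have lb: "p i \<le> \<eta> i" "\<eta> i < p i + M" for i using left(1) by (auto simp: window_def)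
      obtain i where "\<not> ((p(j := p j - 1)) i \<le> \<eta> i \<and> \<eta> i < (p(j := p j - 1)) i + M)"
        using left(3) by (auto simp: window_def)
      then have "\<eta> j = p j + M - 1" using lb[of i] lb[of j] left(2) by (cases "i = j") auto
      then have "\<eta> \<in> ?X" using lb by auto
      then have "of_bool (\<eta> \<in> ?X) = (1::real)" by (simp only: of_bool_eq)
      then show ?thesis using one nonnegs by linarith
    next
      case right
      have lb: "(p(j := p j - 1)) i \<le> \<eta> i" "\<eta> i < (p(j := p j - 1)) i + M" for i using right(3) unfolding window_def by blast+
      obtain i where "\<not> (p i \<le> \<eta> i \<and> \<eta> i < p i + M)"
        using right(1) by (auto simp: window_def)
      then have "\<eta> j = p j - 1" using lb[of i] lb[of j] right(2) by (cases "i = j") auto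
      moreover have "p i \<le> \<eta> i" "\<eta> i < p i + M" if "i \<noteq> j" for i using lb[of i] that by auto
      ultimately have "\<eta> \<in> ?Y" by auto
      then have "of_bool (\<eta> \<in> ?Y) = (1::real)" by (simp only: of_bool_eq)
      then show ?thesis using one nonnegs by linarith
    qed
  qed
qed

text \<open>Among the M^d corners around p each of the two faces accounts for the fraction 1 / M,
  which gives 2 / M; only the two extreme levels pay a constant.\<close>

lemma sum_coef_bound:
  assumes N: "0 < N" and M: "0 < M"
  shows "(\<Sum>\<eta>\<in>{\<eta> \<in> window_bases N M. p \<in> cells j N M \<eta>}. (coef j N M \<eta> p)\<^sup>2)
    \<le> real (M ^ CARD('d)) * (real (CARD('d) * M) / real N + 2 / real M + 2 * of_bool (mindex_norm p = N \<or> mindex_norm p = 2 * N))"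
proof -
  let ?\<delta> = "real (CARD('d) * M) / real N" and ?e = "of_bool (mindex_norm p = N \<or> mindex_norm p = 2 * N) :: real"
  let ?X = "{\<eta> :: 'd \<Rightarrow> nat. \<forall>i. \<eta> i \<in> (if i = j then {p j + M - 1} else {p i..<p i + M})}"
  let ?Y = "{\<eta> :: 'd \<Rightarrow> nat. \<forall>i. \<eta> i \<in> (if i = j then {p j - 1} else {p i..<p i + M})}"
  let ?W = "\<lambda>q. {\<eta> \<in> window_bases N M. q \<in> window M \<eta>}" and ?q = "p(j := p j - 1)"
  have fX: "finite ?X" "finite ?Y" by (rule finite_bounded_mindex; simp)+
  have fin: "finite (window_bases N M)" by (rule finite_window_bases)
  have ind: "(\<Sum>\<eta>\<in>window_bases N M. of_bool (\<eta> \<in> A)) \<le> real (card A)" if "finite A" for A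
  proof -
    have "(\<Sum>\<eta>\<in>window_bases N M. of_bool (\<eta> \<in> A)) = real (card (window_bases N M \<inter> A))"
      using fin by (simp add: of_bool_def sum.If_cases)
    also have "\<dots> \<le> real (card A)" using that by (intro of_nat_mono card_mono) auto
    finally show ?thesis .
  qed
  have winc: "(\<Sum>\<eta>\<in>window_bases N M. of_bool (q \<in> window M \<eta>)) \<le> real (M ^ CARD('d))" for q
  proof -
    have "(\<Sum>\<eta>\<in>window_bases N M. of_bool (q \<in> window M \<eta>)) = real (card (?W q))"
      using fin by (simp add: of_bool_def sum.If_cases Int_def)
    also have "\<dots> \<le> real (M ^ CARD('d))" by (intro of_nat_mono card_window_le)
    finally show ?thesis .
  qed
  have "(\<Sum>\<eta>\<in>{\<eta> \<in> window_bases N M. p \<in> cells j N M \<eta>}. (coef j N M \<eta> p)\<^sup>2)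
    \<le> (\<Sum>\<eta>\<in>{\<eta> \<in> window_bases N M. p \<in> cells j N M \<eta>}. ?\<delta> * of_bool (p \<in> window M \<eta>) + of_bool (\<eta> \<in> ?X) + of_bool (\<eta> \<in> ?Y)
       + ?e * (of_bool (p \<in> window M \<eta>) + of_bool (?q \<in> window M \<eta>)))"
    by (rule sum_mono) (use coef_bound[OF N] in blast)
  also have "\<dots> \<le> (\<Sum>\<eta>\<in>window_bases N M. ?\<delta> * of_bool (p \<in> window M \<eta>) + of_bool (\<eta> \<in> ?X) + of_bool (\<eta> \<in> ?Y)
       + ?e * (of_bool (p \<in> window M \<eta>) + of_bool (?q \<in> window M \<eta>)))"
    by (rule sum_mono2[OF fin]) auto
  also have "\<dots> = ?\<delta> * (\<Sum>\<eta>\<in>window_bases N M. of_bool (p \<in> window M \<eta>)) + (\<Sum>\<eta>\<in>window_bases N M. of_bool (\<eta> \<in> ?X)) + (\<Sum>\<eta>\<in>window_bases N M. of_bool (\<eta> \<in> ?Y))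
       + ?e * ((\<Sum>\<eta>\<in>window_bases N M. of_bool (p \<in> window M \<eta>)) + (\<Sum>\<eta>\<in>window_bases N M. of_bool (?q \<in> window M \<eta>)))"
    by (simp only: sum.distrib sum_distrib_left[symmetric])
  also have "\<dots> \<le> ?\<delta> * real (M ^ CARD('d)) + real (card ?X) + real (card ?Y) + ?e * (real (M ^ CARD('d)) + real (M ^ CARD('d)))"
    by (intro add_mono mult_left_mono ind fX winc) auto
  also have "real (card ?X) = real (M ^ CARD('d)) / real M" using card_slice[of M j "p j + M - 1" p] M by (simp add: field_simps)
  also have "real (card ?Y) = real (M ^ CARD('d)) / real M" using card_slice[of M j "p j - 1" p] M by (simp add: field_simps)
  finally show ?thesis by (simp add: algebra_simps)
qed

text \<open>Relative to the total mass N M^d R^d the bound is of order d M / N + 2 / M + 4 /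
  N.\<close>

lemma sum_shift_defect:
  assumes N: "0 < N" and M: "0 < M" and R: "M < R"
  shows "(\<Sum>\<eta>\<in>window_bases N M. \<Sum>t\<in>torus R. Re (B (shift_defect j N M R \<eta> t h) (shift_defect j N M R \<eta> t h)))
    \<le> real (R ^ CARD('d) * M ^ CARD('d)) * ((real N + 1) * (real (CARD('d) * M) / real N + 2 / real M) + 4) * Re (B h h)"
proof -
  let ?b = "\<lambda>p. Re (B (Tp p h) (Tp p h))" and ?w = "\<lambda>p :: 'd \<Rightarrow> nat. multinomial p :: real"
  let ?S = "{p :: 'd \<Rightarrow> nat. N \<le> mindex_norm p \<and> mindex_norm p \<le> 2 * N}"
  let ?A = "real (CARD('d) * M) / real N + 2 / real M"
  define e where "e n = (of_bool (n = N \<or> n = 2 * N) :: real)" for n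
  let ?e = "\<lambda>p :: 'd \<Rightarrow> nat. e (mindex_norm p)"
  have finS: "finite ?S" by (rule finite_subset[OF _ finite_mindex_norm_le[of "2 * N"]]) auto
  have cellsS: "cells j N M \<eta> \<subseteq> ?S" for \<eta> by (auto simp: cells_def shell_def mindex_norm_inc)
  have w0: "0 \<le> ?w p" for p by (simp add: multinomial_def)
  have level: "(\<Sum>p | mindex_norm p = n. ?w p * ?b p) = Re (B h h)" for n
  proof -
    have "Re (\<Sum>p | mindex_norm p = n. multinomial p * B (Tp p h) (Tp p h)) = Re (B h h)"
      by (simp add: sum_multinomial_form)
    moreover have "(multinomial p :: complex) = complex_of_real (?w p)" for p :: "'d \<Rightarrow> nat"
      by (simp add: multinomial_def)
    ultimately show ?thesis by (simp del: of_nat_fact add: Re_complex_of_real)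
  qed
  have torus: "(\<Sum>t\<in>torus R. Re (B (shift_defect j N M R \<eta> t h) (shift_defect j N M R \<eta> t h)))
      = real (R ^ CARD('d)) * (\<Sum>p\<in>cells j N M \<eta>. (coef j N M \<eta> p)\<^sup>2 * (?w p * ?b p))" for \<eta>
  proof -
    let ?g = "\<lambda>p. complex_of_real (coef j N M \<eta> p * mweight p) *\<^sub>C Tp p h"
    have unit: "B (cis x *\<^sub>C u) (cis x *\<^sub>C u) = B u u" for x u
      by (simp add: scaleC_left scaleC_right cis_cnj mult.assoc[symmetric] cis_mult)
    have "(\<Sum>t\<in>torus R. B (shift_defect j N M R \<eta> t h) (shift_defect j N M R \<eta> t h))
      = (\<Sum>t\<in>torus R. B (\<Sum>p\<in>cells j N M \<eta>. torus_char R t p *\<^sub>C ?g p) (\<Sum>p\<in>cells j N M \<eta>. torus_char R t p *\<^sub>C ?g p))"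
      unfolding shift_defect_eq unit ..
    also have "\<dots> = of_nat (R ^ CARD('d)) * (\<Sum>p\<in>cells j N M \<eta>. B (?g p) (?g p))"
    proof (rule sum_torus_form[OF finite_cells])
      \<comment> \<open>Adding the shifted block lengthens the range of a coordinate by one, so
        differences may reach M; hence R has to exceed M.\<close>
      fix p q i assume pq: "p \<in> cells j N M \<eta>" "q \<in> cells j N M \<eta>"
      have "p i \<le> \<eta> i + 1 \<and> \<eta> i < p i + M" if "p \<in> cells j N M \<eta>" for p
      proof -
        consider "p \<in> window M \<eta>" | q where "q \<in> window M \<eta>" "p = inc j q" using \<open>p \<in> cells j N M \<eta>\<close> by (auto simp: cells_def)
        then show ?thesis
        proof cases
          case 1
          then have "p i \<le> \<eta> i \<and> \<eta> i < p i + M" by (simp add: window_def)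
          then show ?thesis by simp
        next
          case 2
          then have "q i \<le> \<eta> i \<and> \<eta> i < q i + M" by (simp add: window_def)
          then show ?thesis using 2(2) by (auto simp: inc_apply)
        qed
      qed
      from this[OF pq(1)] this[OF pq(2)] show "\<bar>int (p i) - int (q i)\<bar> < int R" using R by linarith
    qed
    finally have "Re (\<Sum>t\<in>torus R. B (shift_defect j N M R \<eta> t h) (shift_defect j N M R \<eta> t h)) = real (R ^ CARD('d)) * (\<Sum>p\<in>cells j N M \<eta>. Re (B (?g p) (?g p)))"
      by (simp add: Re_sum del: of_nat_power)
    moreover have "Re (B (?g p) (?g p)) = (coef j N M \<eta> p)\<^sup>2 * (?w p * ?b p)" for p
    proof -
      have "Re (B (?g p) (?g p)) = (coef j N M \<eta> p * mweight p) * (coef j N M \<eta> p * mweight p) * ?b p"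
        by (simp add: scaleC_left scaleC_right mult.assoc flip: of_real_mult)
      also have "\<dots> = (coef j N M \<eta> p)\<^sup>2 * ((mweight p)\<^sup>2 * ?b p)" by (simp add: power2_eq_square algebra_simps)
      finally show ?thesis using w0[of p] by (simp add: mweight_def)
    qed
    ultimately show ?thesis by simp
  qed
  have outer: "(\<Sum>\<eta>\<in>window_bases N M. \<Sum>t\<in>torus R. Re (B (shift_defect j N M R \<eta> t h) (shift_defect j N M R \<eta> t h)))
      = real (R ^ CARD('d)) * (\<Sum>\<eta>\<in>window_bases N M. \<Sum>p\<in>{p \<in> ?S. p \<in> cells j N M \<eta>}. (coef j N M \<eta> p)\<^sup>2 * (?w p * ?b p))"
    unfolding torus sum_distrib_left[symmetric]
    using cellsS by (intro arg_cong2[where f="(*)"] sum.cong refl) blast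
  have "(\<Sum>\<eta>\<in>window_bases N M. \<Sum>p\<in>{p \<in> ?S. p \<in> cells j N M \<eta>}. (coef j N M \<eta> p)\<^sup>2 * (?w p * ?b p))
      = (\<Sum>p\<in>?S. \<Sum>\<eta>\<in>{\<eta> \<in> window_bases N M. p \<in> cells j N M \<eta>}. (coef j N M \<eta> p)\<^sup>2 * (?w p * ?b p))"
    by (rule sum.swap_restrict[OF finite_window_bases finS])
  also have "\<dots> \<le> (\<Sum>p\<in>?S. real (M ^ CARD('d)) * (?A + 2 * ?e p) * (?w p * ?b p))"
    unfolding sum_distrib_right[symmetric]
    unfolding e_def by (intro sum_mono mult_right_mono sum_coef_bound N M mult_nonneg_nonneg w0 nonneg)
  also have "\<dots> = real (M ^ CARD('d)) * (\<Sum>n\<in>{N..2 * N}. \<Sum>p | mindex_norm p = n. (?A + 2 * ?e p) * (?w p * ?b p))"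
  proof -
    have "(\<Sum>p\<in>?S. (?A + 2 * ?e p) * (?w p * ?b p)) = (\<Sum>n\<in>{N..2 * N}. \<Sum>p\<in>{p \<in> ?S. mindex_norm p = n}. (?A + 2 * ?e p) * (?w p * ?b p))"
      by (rule sum.group[symmetric, OF finS, where T="{N..2 * N}" and g=mindex_norm and h="\<lambda>p. (?A + 2 * ?e p) * (?w p * ?b p)"]) auto
    also have "\<dots> = (\<Sum>n\<in>{N..2 * N}. \<Sum>p | mindex_norm p = n. (?A + 2 * ?e p) * (?w p * ?b p))"
      by (intro sum.cong) auto
    finally have g: "(\<Sum>p\<in>?S. (?A + 2 * ?e p) * (?w p * ?b p)) = (\<Sum>n\<in>{N..2 * N}. \<Sum>p | mindex_norm p = n. (?A + 2 * ?e p) * (?w p * ?b p))" .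
    show ?thesis unfolding g[symmetric] sum_distrib_left by (simp only: mult.assoc)
  qed
  finally have mid: "(\<Sum>\<eta>\<in>window_bases N M. \<Sum>p\<in>{p \<in> ?S. p \<in> cells j N M \<eta>}. (coef j N M \<eta> p)\<^sup>2 * (?w p * ?b p))
      \<le> real (M ^ CARD('d)) * (\<Sum>n\<in>{N..2 * N}. \<Sum>p | mindex_norm p = n. (?A + 2 * ?e p) * (?w p * ?b p))" .
  have "(\<Sum>n\<in>{N..2 * N}. \<Sum>p | mindex_norm p = n. (?A + 2 * ?e p) * (?w p * ?b p))
      = (\<Sum>n\<in>{N..2 * N}. (?A + 2 * e n) * Re (B h h))"
  proof (rule sum.cong[OF refl])
    fix n
    have "(\<Sum>p | mindex_norm p = n. (?A + 2 * ?e p) * (?w p * ?b p)) = (\<Sum>p | mindex_norm p = n. (?A + 2 * e n) * (?w p * ?b p))"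
      by (rule sum.cong[OF refl]) (simp only: mem_Collect_eq)
    then show "(\<Sum>p | mindex_norm p = n. (?A + 2 * ?e p) * (?w p * ?b p)) = (?A + 2 * e n) * Re (B h h)"
      unfolding sum_distrib_left[symmetric] level .
  qed
  \<comment> \<open>The cells meet N + 1 levels, and the levels N and 2 N contribute 2 each to the
    summand 4.\<close>
  also have "\<dots> = ((real N + 1) * ?A + 4) * Re (B h h)"
  proof -
    have "(\<Sum>n\<in>{N..2 * N}. e n) = (\<Sum>n\<in>{N, 2 * N}. 1)"
      unfolding e_def using N by (intro sum.mono_neutral_cong_right) auto
    also have "\<dots> = 2" using N by simp
    finally have "(\<Sum>n\<in>{N..2 * N}. x + 2 * e n) = (real N + 1) * x + 4" for x
      by (simp add: sum.distrib sum_distrib_left[symmetric])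
    then show ?thesis unfolding sum_distrib_right[symmetric] by (simp only:)
  qed
  finally have "(\<Sum>\<eta>\<in>window_bases N M. \<Sum>p\<in>{p \<in> ?S. p \<in> cells j N M \<eta>}. (coef j N M \<eta> p)\<^sup>2 * (?w p * ?b p))
      \<le> real (M ^ CARD('d)) * (((real N + 1) * ?A + 4) * Re (B h h))" using mid by (simp only:)
  then have "real (R ^ CARD('d)) * (\<Sum>\<eta>\<in>window_bases N M. \<Sum>p\<in>{p \<in> ?S. p \<in> cells j N M \<eta>}. (coef j N M \<eta> p)\<^sup>2 * (?w p * ?b p))
      \<le> real (R ^ CARD('d)) * (real (M ^ CARD('d)) * (((real N + 1) * ?A + 4) * Re (B h h)))"
    by (rule mult_left_mono) simp
  then show ?thesis unfolding outer by (simp only: mult.assoc of_nat_mult)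
qed

end

section \<open>The limiting functional on the sphere\<close>

context spherical_isometry
begin

text \<open>With width M, shell size N and torus size R the relative error is of order M / N + 1 /
  M. The choice N = M^2 sends both parts to 0, and R = M + 1 is the smallest torus that separates
  the shifted windows.\<close>

definition window_width :: "nat \<Rightarrow> nat" where "window_width m = Suc m"
definition shell_size :: "nat \<Rightarrow> nat" where "shell_size m = Suc m * Suc m"
definition torus_size :: "nat \<Rightarrow> nat" where "torus_size m = Suc (Suc m)"
definition total_mass :: "nat \<Rightarrow> nat" where "total_mass m = shell_size m * window_width m ^ CARD('d) * torus_size m ^ CARD('d)"

definition nodes :: "nat \<Rightarrow> (('d \<Rightarrow> nat) \<times> ('d \<Rightarrow> nat)) set" where
  "nodes m = window_bases (shell_size m) (window_width m) \<times> torus (torus_size m)"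

definition node :: "nat \<Rightarrow> ('d \<Rightarrow> nat) \<times> ('d \<Rightarrow> nat) \<Rightarrow> complex^'d" where
  "node m i = pt (torus_size m) (fst i) (snd i)"

definition wave :: "nat \<Rightarrow> ('d \<Rightarrow> nat) \<times> ('d \<Rightarrow> nat) \<Rightarrow> 'h \<Rightarrow> 'h" where
  "wave m i h = block_vector (shell_size m) (window_width m) (torus_size m) (fst i) (snd i) h"

text \<open>For h = k the weights are nonnegative, so each approximant is a positive functional on
  the diagonal.\<close>

definition L_approx :: "nat \<Rightarrow> 'h \<Rightarrow> 'h \<Rightarrow> (complex^'d \<Rightarrow> complex) \<Rightarrow> complex" where
  "L_approx m h k f = (\<Sum>i\<in>nodes m. f (node m i) * B (wave m i h) (wave m i k)) / of_nat (total_mass m)"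

lemma w_pos: "0 < window_width m" "0 < shell_size m" "window_width m < torus_size m" "0 < total_mass m"
  by (simp_all add: window_width_def shell_size_def torus_size_def total_mass_def)

lemma norm_node: "i \<in> nodes m \<Longrightarrow> norm (node m i) = 1"
  by (auto simp: nodes_def node_def window_bases_def intro!: norm_pt)

lemma wave_linear: "wave m i (x + y) = wave m i x + wave m i y" "wave m i (c *\<^sub>C x) = c *\<^sub>C wave m i x"
  by (simp_all add: wave_def block_vector_linear)

lemma sum_wave: "(\<Sum>i\<in>nodes m. B (wave m i h) (wave m i k)) = of_nat (total_mass m) * B h k"
  using sum_block_vector_form[OF w_pos(2)[of m] w_pos(3)[of m], where h=h and k=k]
  by (simp add: nodes_def wave_def total_mass_def sum.cartesian_product case_prod_beta)

lemma L_approx_one: "L_approx m h k (\<lambda>_. 1) = B h k"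
  using w_pos(4)[of m] by (simp add: L_approx_def sum_wave)

lemma sum_wave_Re: "(\<Sum>i\<in>nodes m. Re (B (wave m i h) (wave m i h))) = real (total_mass m) * Re (B h h)"
  using arg_cong[OF sum_wave[of m h h], of Re] by (simp add: Re_sum)

lemma L_approx_bound:
  assumes f: "\<And>z. norm z = 1 \<Longrightarrow> cmod (f z) \<le> C" and C: "0 \<le> C"
  shows "cmod (L_approx m h k f) \<le> C * sqrt (Re (B h h)) * sqrt (Re (B k k))"
proof -
  have "cmod (\<Sum>i\<in>nodes m. f (node m i) * B (wave m i h) (wave m i k)) \<le>
     C * (sqrt (real (total_mass m) * Re (B h h)) * sqrt (real (total_mass m) * Re (B k k)))"
    using sum_Cauchy_Schwarz[of "nodes m" "\<lambda>i. f (node m i)" C "\<lambda>i. wave m i h" "\<lambda>i. wave m i k"] f norm_node C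
    unfolding sum_wave_Re by blast
  also have "\<dots> = real (total_mass m) * (C * sqrt (Re (B h h)) * sqrt (Re (B k k)))"
    by (simp add: real_sqrt_mult)
  finally show ?thesis using w_pos(4)[of m] by (simp add: L_approx_def norm_divide divide_le_eq mult.commute)
qed

lemma L_approx_add: "L_approx m h k (\<lambda>z. f z + g z) = L_approx m h k f + L_approx m h k g"
  by (simp add: L_approx_def ring_distribs sum.distrib add_divide_distrib)

lemma L_approx_cmult: "L_approx m h k (\<lambda>z. c * f z) = c * L_approx m h k f"
  by (simp add: L_approx_def sum_distrib_left mult.assoc)

lemma L_approx_diff: "L_approx m h k (\<lambda>z. f z - g z) = L_approx m h k f - L_approx m h k g"
  using L_approx_add[of m h k f "\<lambda>z. - 1 * g z"] unfolding L_approx_cmult by simp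

lemma L_approx_add_left: "L_approx m (h + h') k f = L_approx m h k f + L_approx m h' k f"
  by (simp add: L_approx_def wave_linear add_left ring_distribs sum.distrib add_divide_distrib)

lemma L_approx_scaleC_left: "L_approx m (c *\<^sub>C h) k f = c * L_approx m h k f"
  by (simp add: L_approx_def wave_linear scaleC_left sum_distrib_left ac_simps)

lemma L_approx_cnj: "L_approx m h k f = cnj (L_approx m k h (\<lambda>z. cnj (f z)))"
  by (simp add: L_approx_def cnj_sum herm[of "wave m _ h"])

lemma L_approx_nonneg:
  assumes "\<And>z. norm z = 1 \<Longrightarrow> 0 \<le> f z"
  shows "0 \<le> Re (L_approx m h h (\<lambda>z. complex_of_real (f z)))"
proof -
  have "L_approx m h h (\<lambda>z. complex_of_real (f z)) = complex_of_real ((\<Sum>i\<in>nodes m. f (node m i) * Re (B (wave m i h) (wave m i h))) / real (total_mass m))"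
    unfolding L_approx_def by (subst (1) self_real) simp
  then show ?thesis
    by (simp add: divide_nonneg_nonneg sum_nonneg assms norm_node nonneg)
qed

text \<open>The bound of \<open>sum_shift_defect\<close> divided by the total mass and by B(h,
  h).\<close>

definition L_error :: "nat \<Rightarrow> real" where
  "L_error m = ((real (shell_size m) + 1) * (real (CARD('d) * window_width m) / real (shell_size m) + 2 / real (window_width m)) + 4) / real (shell_size m)"

lemma L_error_tendsto: "L_error \<longlonglongrightarrow> 0"
proof -
  let ?x = "\<lambda>m. inverse (real (Suc m))"
  have L_error: "L_error m = (1 + ?x m * ?x m) * (real CARD('d) * ?x m + 2 * ?x m) + 4 * (?x m * ?x m)" for m
  proof -
    have "((s * s + 1) * (c * s / (s * s) + 2 / s) + 4) / (s * s) = (1 + inverse s * inverse s) * (c * inverse s + 2 * inverse s) + 4 * (inverse s * inverse s)"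
      if "s \<noteq> 0" for s c :: real
      using that by (simp add: field_simps)
    from this[of "real (Suc m)" "real CARD('d)"] show ?thesis
      unfolding L_error_def shell_size_def window_width_def of_nat_mult by linarith
  qed
  then have "L_error = (\<lambda>m. (1 + ?x m * ?x m) * (real CARD('d) * ?x m + 2 * ?x m) + 4 * (?x m * ?x m))"
    by (rule ext)
  moreover have "(\<lambda>m. (1 + ?x m * ?x m) * (real CARD('d) * ?x m + 2 * ?x m) + 4 * (?x m * ?x m)) \<longlonglongrightarrow> (1 + 0 * 0) * (real CARD('d) * 0 + 2 * 0) + 4 * (0 * 0)"
    by (intro tendsto_intros LIMSEQ_inverse_real_of_nat)
  ultimately show ?thesis by (simp only: mult_zero_right add_0_right mult_zero_left)
qed

text \<open>The difference is a sum of values of f times the pairing of a defect vector with a wave,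
  so the Cauchy-Schwarz inequality bounds it through the total squared defect.\<close>

lemma L_approx_step:
  assumes f: "\<And>z. norm z = 1 \<Longrightarrow> cmod (f z) \<le> C" and C: "0 \<le> C"
  shows "cmod (L_approx m h k (\<lambda>z. z $ j * f z) - L_approx m (T j h) k f) \<le> C * sqrt (L_error m * Re (B h h)) * sqrt (Re (B k k))"
proof -
  let ?D = "\<lambda>i. shift_defect j (shell_size m) (window_width m) (torus_size m) (fst i) (snd i) h"
  let ?Z = "real (total_mass m)"
  have Z: "0 < ?Z" using w_pos(4)[of m] by simp
  have D: "(\<Sum>i\<in>nodes m. Re (B (?D i) (?D i))) \<le> ?Z * (L_error m * Re (B h h))"
  proof -
    have "(\<Sum>i\<in>nodes m. Re (B (?D i) (?D i))) \<le> real (torus_size m ^ CARD('d) * window_width m ^ CARD('d)) * ((real (shell_size m) + 1) * (real (CARD('d) * window_width m) / real (shell_size m) + 2 / real (window_width m)) + 4) * Re (B h h)"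
      using sum_shift_defect[OF w_pos(2)[of m] w_pos(1)[of m] w_pos(3)[of m], where j=j and h=h] by (simp add: nodes_def sum.cartesian_product case_prod_beta)
    also have "\<dots> = ?Z * (L_error m * Re (B h h))"
      using w_pos(2)[of m] unfolding total_mass_def L_error_def by (simp add: field_simps)
    finally show ?thesis .
  qed
  have "L_approx m h k (\<lambda>z. z $ j * f z) - L_approx m (T j h) k f = (\<Sum>i\<in>nodes m. f (node m i) * B (?D i) (wave m i k)) / of_nat (total_mass m)"
    unfolding L_approx_def diff_divide_distrib[symmetric] sum_subtractf[symmetric] shift_defect_def node_def wave_def
    by (simp add: diff_left scaleC_left algebra_simps)
  moreover have "cmod (\<Sum>i\<in>nodes m. f (node m i) * B (?D i) (wave m i k)) \<le> ?Z * (C * sqrt (L_error m * Re (B h h)) * sqrt (Re (B k k)))"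
  proof -
    have "cmod (\<Sum>i\<in>nodes m. f (node m i) * B (?D i) (wave m i k)) \<le>
       C * (sqrt (\<Sum>i\<in>nodes m. Re (B (?D i) (?D i))) * sqrt (?Z * Re (B k k)))"
      using sum_Cauchy_Schwarz[of "nodes m" "\<lambda>i. f (node m i)" C ?D "\<lambda>i. wave m i k"] f norm_node C
      unfolding sum_wave_Re by blast
    also have "\<dots> \<le> C * (sqrt (?Z * (L_error m * Re (B h h))) * sqrt (?Z * Re (B k k)))"
      using D C nonneg Z by (intro mult_left_mono mult_right_mono real_sqrt_le_mono) auto
    also have "\<dots> = ?Z * (C * sqrt (L_error m * Re (B h h)) * sqrt (Re (B k k)))"
      using Z by (simp add: real_sqrt_mult)
    finally show ?thesis .
  qed
  ultimately show ?thesis using Z by (simp add: norm_divide divide_le_eq mult.commute)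
qed

text \<open>Boundedness on the sphere is part of the definition because the error in
  \<open>L_approx_step\<close> is proportional to a bound of |f|.\<close>

definition L_domain :: "(complex^'d \<Rightarrow> complex) set" where
  "L_domain = {f. (\<exists>C. \<forall>z. norm z = 1 \<longrightarrow> cmod (f z) \<le> C) \<and> (\<forall>h k. convergent (\<lambda>m. L_approx m h k f))}"

definition L :: "'h \<Rightarrow> 'h \<Rightarrow> (complex^'d \<Rightarrow> complex) \<Rightarrow> complex" where
  "L h k f = lim (\<lambda>m. L_approx m h k f)"

lemma L_tendsto: "f \<in> L_domain \<Longrightarrow> (\<lambda>m. L_approx m h k f) \<longlonglongrightarrow> L h k f"
  by (simp add: L_domain_def L_def convergent_LIMSEQ_iff)

lemma L_eqI: "(\<lambda>m. L_approx m h k f) \<longlonglongrightarrow> l \<Longrightarrow> L h k f = l"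
  by (simp add: L_def limI)

lemma L_domain_bound:
  assumes "f \<in> L_domain" obtains C where "0 \<le> C" "\<And>z. norm z = 1 \<Longrightarrow> cmod (f z) \<le> C"
proof -
  obtain C where "\<And>z. norm z = 1 \<Longrightarrow> cmod (f z) \<le> C" using assms by (auto simp: L_domain_def)
  then show ?thesis by (intro that[of "max 0 C"]) (auto simp: le_max_iff_disj)
qed

lemma LcI:
  assumes "\<And>z. norm z = 1 \<Longrightarrow> cmod (f z) \<le> C" "\<And>h k. (\<lambda>m. L_approx m h k f) \<longlonglongrightarrow> l h k"
  shows "f \<in> L_domain"
  using assms unfolding L_domain_def convergent_def by blast

lemma L_domain_const: "(\<lambda>_. c) \<in> L_domain"
proof (rule LcI[where l="\<lambda>h k. c * B h k" and C="cmod c"])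
  show "(\<lambda>m. L_approx m h k (\<lambda>_. c)) \<longlonglongrightarrow> c * B h k" for h k
    using L_approx_cmult[where h=h and k=k and c=c and f="\<lambda>_. 1"] by (simp add: L_approx_one)
qed simp

lemma L_one: "L h k (\<lambda>_. 1) = B h k"
  by (rule L_eqI) (simp add: L_approx_one)

lemma L_domain_add: assumes "f \<in> L_domain" "g \<in> L_domain"
  shows "(\<lambda>z. f z + g z) \<in> L_domain" "L h k (\<lambda>z. f z + g z) = L h k f + L h k g"
proof -
  have lim: "(\<lambda>m. L_approx m h k (\<lambda>z. f z + g z)) \<longlonglongrightarrow> L h k f + L h k g" for h k
    unfolding L_approx_add by (intro tendsto_add L_tendsto assms)
  obtain C C' where "\<And>z. norm z = 1 \<Longrightarrow> cmod (f z) \<le> C" "\<And>z. norm z = 1 \<Longrightarrow> cmod (g z) \<le> C'"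
    using L_domain_bound assms by metis
  then show "(\<lambda>z. f z + g z) \<in> L_domain"
    by (intro LcI[where C="C + C'", OF _ lim]) (auto intro!: norm_triangle_le add_mono)
  show "L h k (\<lambda>z. f z + g z) = L h k f + L h k g" by (rule L_eqI[OF lim])
qed

lemma L_domain_cmult: assumes "f \<in> L_domain"
  shows "(\<lambda>z. c * f z) \<in> L_domain" "L h k (\<lambda>z. c * f z) = c * L h k f"
proof -
  have lim: "(\<lambda>m. L_approx m h k (\<lambda>z. c * f z)) \<longlonglongrightarrow> c * L h k f" for h k
    unfolding L_approx_cmult by (intro tendsto_mult_left L_tendsto assms)
  obtain C where "\<And>z. norm z = 1 \<Longrightarrow> cmod (f z) \<le> C" using L_domain_bound assms by metis
  then show "(\<lambda>z. c * f z) \<in> L_domain"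
    by (intro LcI[where C="cmod c * C", OF _ lim]) (auto simp: norm_mult intro!: mult_left_mono)
  show "L h k (\<lambda>z. c * f z) = c * L h k f" by (rule L_eqI[OF lim])
qed

lemma L_domain_sum: "(\<And>i. i \<in> A \<Longrightarrow> f i \<in> L_domain) \<Longrightarrow> (\<lambda>z. \<Sum>i\<in>A. f i z) \<in> L_domain"
  by (induction A rule: infinite_finite_induct) (auto simp: L_domain_const intro: L_domain_add)

lemma L_domain_cnj: assumes "f \<in> L_domain"
  shows "(\<lambda>z. cnj (f z)) \<in> L_domain" "L h k (\<lambda>z. cnj (f z)) = cnj (L k h f)"
proof -
  have lim: "(\<lambda>m. L_approx m h k (\<lambda>z. cnj (f z))) \<longlonglongrightarrow> cnj (L k h f)" for h k
    unfolding L_approx_cnj[of _ h k] complex_cnj_cnj by (intro tendsto_cnj L_tendsto assms)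
  obtain C where "\<And>z. norm z = 1 \<Longrightarrow> cmod (f z) \<le> C" using L_domain_bound assms by metis
  then show "(\<lambda>z. cnj (f z)) \<in> L_domain" by (intro LcI[where C=C, OF _ lim]) auto
  show "L h k (\<lambda>z. cnj (f z)) = cnj (L k h f)" by (rule L_eqI[OF lim])
qed

text \<open>As \<open>L_error\<close> tends to 0, the approximate eigenvalue relation becomes an
  exact rule, and membership in \<open>L_domain\<close> propagates to the product with a
  coordinate.\<close>

lemma L_domain_coord: assumes "f \<in> L_domain"
  shows "(\<lambda>z. z $ j * f z) \<in> L_domain" "L h k (\<lambda>z. z $ j * f z) = L (T j h) k f"
proof -
  obtain C where C: "0 \<le> C" "\<And>z. norm z = 1 \<Longrightarrow> cmod (f z) \<le> C" using L_domain_bound assms by metis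
  have lim: "(\<lambda>m. L_approx m h k (\<lambda>z. z $ j * f z)) \<longlonglongrightarrow> L (T j h) k f" for h k
  proof (rule Lim_transform[OF L_tendsto[OF assms]])
    have "(\<lambda>m. C * sqrt (L_error m * Re (B h h)) * sqrt (Re (B k k))) \<longlonglongrightarrow> C * sqrt (0 * Re (B h h)) * sqrt (Re (B k k))"
      by (intro tendsto_intros L_error_tendsto)
    then have "(\<lambda>m. C * sqrt (L_error m * Re (B h h)) * sqrt (Re (B k k))) \<longlonglongrightarrow> 0" by simp
    then show "(\<lambda>m. L_approx m h k (\<lambda>z. z $ j * f z) - L_approx m (T j h) k f) \<longlonglongrightarrow> 0"
      by (rule Lim_null_comparison[rotated]) (use L_approx_step[OF C(2,1)] in auto)
  qed
  have "cmod (z $ j * f z) \<le> 1 * C" if "norm z = 1" for z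
    unfolding norm_mult using C(2)[OF that] Finite_Cartesian_Product.norm_nth_le[of z j] that by (intro mult_mono) auto
  then show "(\<lambda>z. z $ j * f z) \<in> L_domain" by (intro LcI[where C="1 * C", OF _ lim])
  show "L h k (\<lambda>z. z $ j * f z) = L (T j h) k f" by (rule L_eqI[OF lim])
qed

text \<open>The conjugate of the previous rule: hermitian symmetry exchanges the two vector
  arguments.\<close>

lemma L_domain_cnj_coord: assumes "f \<in> L_domain"
  shows "(\<lambda>z. cnj (z $ j) * f z) \<in> L_domain" "L h k (\<lambda>z. cnj (z $ j) * f z) = L h (T j k) f"
proof -
  have "(\<lambda>z. cnj (z $ j * cnj (f z))) \<in> L_domain" by (intro L_domain_cnj L_domain_coord assms)
  then show "(\<lambda>z. cnj (z $ j) * f z) \<in> L_domain" by simp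
  have "L h k (\<lambda>z. cnj (z $ j * cnj (f z))) = cnj (L (T j k) h (\<lambda>z. cnj (f z)))"
    using L_domain_cnj(2)[OF L_domain_coord(1)[OF L_domain_cnj(1)[OF assms]]] L_domain_coord(2)[OF L_domain_cnj(1)[OF assms]] by simp
  also have "\<dots> = L h (T j k) f" using L_domain_cnj(2)[OF assms] by simp
  finally show "L h k (\<lambda>z. cnj (z $ j) * f z) = L h (T j k) f" by simp
qed

text \<open>Rewrites Re z_j and Im z_j through z_j and its conjugate, which connects real
  polynomials with the two coordinate rules.\<close>

lemma real_linear_coords:
  fixes p :: "complex^'d \<Rightarrow> real"
  assumes "bounded_linear p"
  shows "complex_of_real (p z) = (\<Sum>j\<in>UNIV. Complex (p (axis j 1)) (- p (axis j \<i>)) / 2 * z $ j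
     + Complex (p (axis j 1)) (p (axis j \<i>)) / 2 * cnj (z $ j))"
proof -
  have lin: "linear p" using assms by (rule bounded_linear.linear)
  have "z = (\<Sum>j\<in>UNIV. Re (z $ j) *\<^sub>R axis j 1 + Im (z $ j) *\<^sub>R axis j \<i>)"
    by (simp add: vec_eq_iff axis_def if_distrib if_distribR complex_eq_iff cong: if_cong)
  then have "p z = p (\<Sum>j\<in>UNIV. Re (z $ j) *\<^sub>R axis j 1 + Im (z $ j) *\<^sub>R axis j \<i>)" by simp
  also have "\<dots> = (\<Sum>j\<in>UNIV. Re (z $ j) * p (axis j 1) + Im (z $ j) * p (axis j \<i>))"
    by (simp add: linear_sum[OF lin] linear_add[OF lin] linear_scale[OF lin])
  finally have "complex_of_real (p z) = (\<Sum>j\<in>UNIV. complex_of_real (Re (z $ j) * p (axis j 1) + Im (z $ j) * p (axis j \<i>)))"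
    by simp
  also have "\<dots> = (\<Sum>j\<in>UNIV. Complex (p (axis j 1)) (- p (axis j \<i>)) / 2 * z $ j
     + Complex (p (axis j 1)) (p (axis j \<i>)) / 2 * cnj (z $ j))"
    by (intro sum.cong refl) (simp add: complex_eq_iff field_simps)
  finally show ?thesis .
qed

text \<open>A second factor from \<open>L_domain\<close> is carried along so that the product case
  of the induction closes.\<close>

lemma L_domain_polynomial:
  assumes "real_polynomial_function p" and "f \<in> L_domain"
  shows "(\<lambda>z. complex_of_real (p z) * f z) \<in> L_domain"
  using assms
proof (induction p arbitrary: f rule: real_polynomial_function.induct)
  case (linear p)
  have "(\<lambda>z. \<Sum>j\<in>UNIV. Complex (p (axis j 1)) (- p (axis j \<i>)) / 2 * (z $ j * f z)
     + Complex (p (axis j 1)) (p (axis j \<i>)) / 2 * (cnj (z $ j) * f z)) \<in> L_domain"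
    by (intro L_domain_sum L_domain_add L_domain_cmult L_domain_coord L_domain_cnj_coord linear)
  then show ?case unfolding real_linear_coords[OF linear(1)] sum_distrib_right ring_distribs mult.assoc .
next
  case (const c)
  then show ?case by (intro L_domain_cmult)
next
  case (add p q)
  then show ?case using L_domain_add(1) by (simp add: ring_distribs)
next
  case (mult p q)
  then show ?case by (simp add: mult.assoc)
qed

lemma norm_three_eps:
  fixes a b c d :: complex
  assumes "norm (b - c) < e / 3" "norm (a - b) < e / 3" "norm (d - c) < e / 3"
  shows "norm (a - d) < e"
proof -
  have "norm (a - d) = norm ((a - b) + (b - c) - (d - c))" by simp
  also have "\<dots> \<le> norm ((a - b) + (b - c)) + norm (d - c)" by (rule norm_triangle_ineq4)
  also have "\<dots> \<le> norm (a - b) + norm (b - c) + norm (d - c)" using norm_triangle_ineq[of "a - b" "b - c"] by simp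
  finally show ?thesis using assms by simp
qed

text \<open>By Stone-Weierstrass polynomials are uniformly close on the sphere, and
  \<open>L_approx_bound\<close> is uniform in m; so the approximants of f form a Cauchy
  sequence.\<close>

lemma L_domain_continuous_real:
  fixes f :: "complex^'d \<Rightarrow> real"
  assumes f: "continuous_on (sphere 0 1) f"
  shows "(\<lambda>z. complex_of_real (f z)) \<in> L_domain"
proof -
  have "convergent (\<lambda>m. L_approx m h k (\<lambda>z. complex_of_real (f z)))" for h k
    unfolding Cauchy_convergent_iff[symmetric]
  proof (rule CauchyI)
    fix e :: real assume e: "0 < e"
    let ?K = "sqrt (Re (B h h)) * sqrt (Re (B k k))"
    have K: "0 \<le> ?K" by (simp add: nonneg)
    \<comment> \<open>\<open>?K\<close> may be 0, hence the denominator with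
      \<open>?K + 1\<close>.\<close>
    define \<delta> where "\<delta> = e / (3 * (?K + 1))"
    have d: "0 < \<delta>" using e K by (simp add: \<delta>_def)
    have dK: "\<delta> * ?K < e / 3" using e K by (simp add: \<delta>_def field_simps)
    obtain g where g: "polynomial_function g" "\<And>z. z \<in> sphere 0 1 \<Longrightarrow> norm (f z - g z) < \<delta>"
      using Stone_Weierstrass_polynomial_function[OF compact_sphere f d] by blast
    have "real_polynomial_function g" using g(1) by (simp add: real_polynomial_function_eq)
    from L_domain_polynomial[OF this L_domain_const[of 1]] have gL: "(\<lambda>z. complex_of_real (g z)) \<in> L_domain" by simp
    have near: "cmod (L_approx m h k (\<lambda>z. complex_of_real (f z)) - L_approx m h k (\<lambda>z. complex_of_real (g z))) < e / 3" for m
    proof -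
      have "cmod (L_approx m h k (\<lambda>z. complex_of_real (f z) - complex_of_real (g z))) \<le> \<delta> * sqrt (Re (B h h)) * sqrt (Re (B k k))"
        using g(2) d by (intro L_approx_bound) (auto simp flip: of_real_diff intro: less_imp_le)
      then show ?thesis using dK by (simp add: L_approx_diff mult.assoc)
    qed
    have "Cauchy (\<lambda>m. L_approx m h k (\<lambda>z. complex_of_real (g z)))"
      using L_tendsto[OF gL] by (rule LIMSEQ_imp_Cauchy)
    from CauchyD[OF this, of "e / 3"] e obtain N where N: "\<And>m n. \<lbrakk>N \<le> m; N \<le> n\<rbrakk> \<Longrightarrow>
        norm (L_approx m h k (\<lambda>z. complex_of_real (g z)) - L_approx n h k (\<lambda>z. complex_of_real (g z))) < e / 3" by auto
    show "\<exists>M. \<forall>m\<ge>M. \<forall>n\<ge>M. norm (L_approx m h k (\<lambda>z. complex_of_real (f z)) - L_approx n h k (\<lambda>z. complex_of_real (f z))) < e"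
    proof (intro exI[of _ N] allI impI)
      fix m n assume "N \<le> m" "N \<le> n"
      from N[OF this] near[of m] near[of n]
      show "norm (L_approx m h k (\<lambda>z. complex_of_real (f z)) - L_approx n h k (\<lambda>z. complex_of_real (f z))) < e"
        by (rule norm_three_eps)
    qed
  qed
  moreover have "\<exists>C. \<forall>z. norm z = 1 \<longrightarrow> cmod (complex_of_real (f z)) \<le> C"
  proof -
    obtain C where "\<And>z. z \<in> sphere 0 1 \<Longrightarrow> \<bar>f z\<bar> \<le> C"
      using compact_imp_bounded[OF compact_continuous_image[OF f compact_sphere]]
      unfolding bounded_iff real_norm_def by blast
    then show ?thesis by (intro exI[of _ C]) simp
  qed
  ultimately show ?thesis by (simp add: L_domain_def)
qed

lemma L_add_left: "f \<in> L_domain \<Longrightarrow> L (h + h') k f = L h k f + L h' k f"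
  by (rule L_eqI) (simp add: L_approx_add_left tendsto_add L_tendsto)

lemma L_scaleC_left: "f \<in> L_domain \<Longrightarrow> L (c *\<^sub>C h) k f = c * L h k f"
  by (rule L_eqI) (simp add: L_approx_scaleC_left tendsto_mult_left L_tendsto)

lemma L_nonneg:
  assumes "(\<lambda>z. complex_of_real (f z)) \<in> L_domain" "\<And>z. norm z = 1 \<Longrightarrow> 0 \<le> f z"
  shows "0 \<le> Re (L h h (\<lambda>z. complex_of_real (f z)))"
  by (rule LIMSEQ_le_const[OF tendsto_Re[OF L_tendsto[OF assms(1)]]]) (use L_approx_nonneg[OF assms(2)] in auto)

lemma psd_form_L:
  assumes f: "continuous_on (sphere 0 1) f" "\<And>z. norm z = 1 \<Longrightarrow> 0 \<le> f z"
  shows "psd_form (\<lambda>h k. L h k (\<lambda>z. complex_of_real (f z)))"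
proof -
  have c: "(\<lambda>z. complex_of_real (f z)) \<in> L_domain" by (rule L_domain_continuous_real[OF f(1)])
  show ?thesis
  proof
    show "L h k (\<lambda>z. complex_of_real (f z)) = cnj (L k h (\<lambda>z. complex_of_real (f z)))" for h k
      using L_domain_cnj(2)[OF c, of h k] by simp
  qed (use c f(2) in \<open>auto intro: L_add_left L_scaleC_left L_nonneg\<close>)
qed

lemma L_monomial: "(\<lambda>z. mpow \<alpha> z * cnj (mpow \<beta> z)) \<in> L_domain \<and>
  (\<forall>h k. L h k (\<lambda>z. mpow \<alpha> z * cnj (mpow \<beta> z)) = B (Tp \<alpha> h) (Tp \<beta> k))"
proof (induction \<alpha> rule: mindex_induct)
  case zero
  show ?case
  proof (induction \<beta> rule: mindex_induct)
    case zero
    have "mpow (\<lambda>_. 0) z * cnj (mpow (\<lambda>_. 0) z) = 1" for z :: "complex^'d" by (simp add: mpow_0)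
    then show ?case using L_domain_const[of 1] L_one by (simp add: tuple_power_0)
  next
    case (inc \<beta> j)
    have e: "mpow (\<lambda>_. 0) z * cnj (mpow (inc j \<beta>) z) = cnj (z $ j) * (mpow (\<lambda>_. 0) z * cnj (mpow \<beta> z))" for z
      by (simp add: mpow_inc)
    show ?case unfolding e using inc L_domain_cnj_coord by (auto simp: Tp_T)
  qed
next
  case (inc \<alpha> j)
  have e: "mpow (inc j \<alpha>) z * cnj (mpow \<beta> z) = z $ j * (mpow \<alpha> z * cnj (mpow \<beta> z))" for z
    by (simp add: mpow_inc)
  show ?case unfolding e using inc L_domain_coord by (auto simp: Tp_T)
qed

end

section \<open>The Riesz representation theorem on a compact set\<close>

text \<open>\<open>\<Lambda>\<close> takes functions defined on the whole space;
  \<open>eq_on\<close> shows that for functions continuous on \<open>S\<close> only the values on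
  \<open>S\<close> matter.\<close>

locale positive_functional =
  fixes S :: "'a::euclidean_space set" and \<Lambda> :: "('a \<Rightarrow> real) \<Rightarrow> real"
  assumes S: "compact S"
    and add: "\<lbrakk>continuous_on S f; continuous_on S g\<rbrakk> \<Longrightarrow> \<Lambda> (\<lambda>x. f x + g x) = \<Lambda> f + \<Lambda> g"
    and scale: "continuous_on S f \<Longrightarrow> \<Lambda> (\<lambda>x. c * f x) = c * \<Lambda> f"
    and pos: "\<lbrakk>continuous_on S f; \<And>x. x \<in> S \<Longrightarrow> 0 \<le> f x\<rbrakk> \<Longrightarrow> 0 \<le> \<Lambda> f"
begin

lemma mono:
  assumes "continuous_on S f" "continuous_on S g" "\<And>x. x \<in> S \<Longrightarrow> f x \<le> g x"
  shows "\<Lambda> f \<le> \<Lambda> g"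
proof -
  have c: "continuous_on S (\<lambda>x. g x - f x)" by (intro continuous_intros assms)
  have "\<Lambda> (\<lambda>x. f x + (g x - f x)) = \<Lambda> f + \<Lambda> (\<lambda>x. g x - f x)" by (rule add[OF assms(1) c])
  moreover have "0 \<le> \<Lambda> (\<lambda>x. g x - f x)" using assms(3) by (intro pos[OF c]) simp
  ultimately show ?thesis by simp
qed

lemma zero: "\<Lambda> (\<lambda>_. 0) = 0"
  using scale[of "\<lambda>_. 0" 0] by simp

lemma eq_on: "\<lbrakk>continuous_on S f; continuous_on S g; \<And>x. x \<in> S \<Longrightarrow> f x = g x\<rbrakk> \<Longrightarrow> \<Lambda> f = \<Lambda> g"
  by (intro antisym mono) auto

lemma sum: "(\<And>i. i \<in> A \<Longrightarrow> continuous_on S (f i)) \<Longrightarrow> \<Lambda> (\<lambda>x. \<Sum>i\<in>A. f i x) = (\<Sum>i\<in>A. \<Lambda> (f i))"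
  by (induction A rule: infinite_finite_induct) (auto simp: zero add continuous_on_sum)

definition mass :: real where "mass = \<Lambda> (\<lambda>_. 1)"

lemma mass_nonneg: "0 \<le> mass" unfolding mass_def by (rule pos) auto

lemma const: "\<Lambda> (\<lambda>_. c) = c * mass"
  using scale[of "\<lambda>_. 1" c] by (simp add: mass_def)

text \<open>Vanishing outside U stands in for the usual compact support inside U;
  \<open>trunc\<close> recovers a compact set inside U where one is needed.\<close>

definition admissible :: "'a set \<Rightarrow> ('a \<Rightarrow> real) \<Rightarrow> bool" where
  "admissible U f \<longleftrightarrow> continuous_on S f \<and> (\<forall>x\<in>S. 0 \<le> f x \<and> f x \<le> 1) \<and> (\<forall>x\<in>S. x \<notin> U \<longrightarrow> f x = 0)"

definition mu :: "'a set \<Rightarrow> ennreal" where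
  "mu U = (SUP f\<in>{f. admissible U f}. ennreal (\<Lambda> f))"

definition outer :: "'a set \<Rightarrow> ennreal" where
  "outer E = (INF U\<in>{U. open U \<and> E \<subseteq> U}. mu U)"

lemma admissible_zero: "admissible U (\<lambda>_. 0)" by (simp add: admissible_def)

lemma admissible_le: "admissible U f \<Longrightarrow> ennreal (\<Lambda> f) \<le> mu U"
  unfolding mu_def by (rule SUP_upper) simp

lemma mu_mono: "U \<subseteq> V \<Longrightarrow> mu U \<le> mu V"
proof -
  assume "U \<subseteq> V"
  then have "{f. admissible U f} \<subseteq> {f. admissible V f}" unfolding admissible_def by blast
  then show ?thesis unfolding mu_def by (intro SUP_subset_mono) auto
qed

lemma mu_le_mass: "mu U \<le> ennreal mass"
  unfolding mu_def mass_def by (rule SUP_least) (auto simp: admissible_def intro!: ennreal_leI mono)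

lemma outer_open: "open U \<Longrightarrow> outer U = mu U"
  unfolding outer_def by (intro antisym INF_lower INF_greatest) (auto intro: mu_mono)

lemma outer_le_mass: "outer E \<le> ennreal mass"
  using mu_le_mass[of UNIV] unfolding outer_def by (intro INF_lower2[of UNIV]) auto

lemma outer_mono: "E \<subseteq> F \<Longrightarrow> outer E \<le> outer F"
  unfolding outer_def by (rule INF_superset_mono) auto

lemma mu_disjoint: assumes "U \<inter> S = {}" shows "mu U = 0"
proof -
  have "ennreal (\<Lambda> f) \<le> 0" if "admissible U f" for f
  proof -
    have "f x = 0" if "x \<in> S" for x using \<open>admissible U f\<close> assms that by (auto simp: admissible_def)
    then have "\<Lambda> f = \<Lambda> (\<lambda>_. 0)" using that by (intro eq_on) (auto simp: admissible_def)
    then show ?thesis by (simp add: zero)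
  qed
  then have "mu U \<le> 0" unfolding mu_def by (intro SUP_least) auto
  then show ?thesis by simp
qed

text \<open>Lowering f by \<epsilon> costs at most \<epsilon> times the mass and confines f to the
  compact set where f >= \<epsilon>, which lies inside U.\<close>

lemma trunc:
  assumes "admissible U f" "0 < \<epsilon>"
  shows "continuous_on S (\<lambda>x. max 0 (f x - \<epsilon>))" "\<Lambda> f \<le> \<Lambda> (\<lambda>x. max 0 (f x - \<epsilon>)) + \<epsilon> * mass"
proof -
  have cf: "continuous_on S f" using assms by (simp add: admissible_def)
  show c: "continuous_on S (\<lambda>x. max 0 (f x - \<epsilon>))" by (intro continuous_intros cf)
  have "\<Lambda> f \<le> \<Lambda> (\<lambda>x. max 0 (f x - \<epsilon>) + \<epsilon>)" by (rule mono[OF cf]) (intro continuous_intros cf, simp)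
  also have "\<dots> = \<Lambda> (\<lambda>x. max 0 (f x - \<epsilon>)) + \<epsilon> * mass"
    using add[OF c, of "\<lambda>_. \<epsilon>"] by (simp add: const)
  finally show "\<Lambda> f \<le> \<Lambda> (\<lambda>x. max 0 (f x - \<epsilon>)) + \<epsilon> * mass" .
qed

lemma compact_superlevel:
  fixes f :: "'a \<Rightarrow> real"
  assumes "continuous_on S f" shows "compact {x \<in> S. \<epsilon> \<le> f x}"
proof -
  have "closedin (top_of_set S) (S \<inter> f -` {\<epsilon>..})"
    by (rule continuous_closedin_preimage[OF assms closed_atLeast])
  then have "compact (S \<inter> f -` {\<epsilon>..})" using S closedin_compact by blast
  moreover have "S \<inter> f -` {\<epsilon>..} = {x \<in> S. \<epsilon> \<le> f x}" by auto
  ultimately show ?thesis by simp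
qed

lemma small_eps:
  assumes "0 < e" obtains \<epsilon> where "0 < \<epsilon>" "\<epsilon> * mass \<le> e"
proof (rule that[of "e / (mass + 1)"])
  show "0 < e / (mass + 1)" "e / (mass + 1) * mass \<le> e"
    using assms mass_nonneg by (auto simp: field_simps)
qed

text \<open>The compact set where f >= \<epsilon> is covered by finitely many U_i, and the truncated
  f is split by a partition of unity built from the distances to their complements.\<close>

lemma mu_subadditive:
  fixes U :: "nat \<Rightarrow> 'a set"
  assumes U: "\<And>i. open (U i)"
  shows "mu (\<Union>i. U i) \<le> (\<Sum>i. mu (U i))"
proof -
  have "ennreal (\<Lambda> f) \<le> (\<Sum>i. mu (U i))" if f: "admissible (\<Union>i. U i) f" for f
  proof (rule ennreal_le_epsilon)
    fix e :: real assume "0 < e"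
    obtain \<epsilon> where e: "0 < \<epsilon>" "\<epsilon> * mass \<le> e" using small_eps[OF \<open>0 < e\<close>] by blast
    let ?f = "\<lambda>x. max 0 (f x - \<epsilon>)"
    note t = trunc[OF f e(1)]
    have cf: "continuous_on S f" and f01: "\<And>x. x \<in> S \<Longrightarrow> 0 \<le> f x \<and> f x \<le> 1" and fU: "\<And>x. \<lbrakk>x \<in> S; x \<notin> (\<Union>i. U i)\<rbrakk> \<Longrightarrow> f x = 0"
      using f by (auto simp: admissible_def)
    let ?K = "{x \<in> S. \<epsilon> \<le> f x}"
    have K: "compact ?K" by (rule compact_superlevel[OF cf])
    have KU: "?K \<subseteq> (\<Union>i. U i)"
    proof
      fix x assume "x \<in> ?K"
      then show "x \<in> (\<Union>i. U i)" using fU[of x] e(1) by (cases "x \<in> (\<Union>i. U i)") auto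
    qed
    obtain C where C: "finite C" "?K \<subseteq> (\<Union>i\<in>C. U i)"
      using compactE_image[OF K, of UNIV U] U KU by auto
    \<comment> \<open>\<open>infdist\<close> to the empty set is 0, so the case U_i = UNIV gets its
      own value.\<close>
    define d where "d i x = (if U i = UNIV then 1 else infdist x (- U i))" for i x
    have cd: "continuous_on S (d i)" for i unfolding d_def by (cases "U i = UNIV") (auto intro!: continuous_intros)
    have d0: "0 \<le> d i x" for i x by (simp add: d_def infdist_nonneg)
    have d_pos: "0 < d i x \<longleftrightarrow> x \<in> U i" for i x
    proof (cases "U i = UNIV")
      case False
      have "closed (- U i)" using U by (simp add: closed_def)
      then show ?thesis using False in_closed_iff_infdist_zero[of "- U i" x] infdist_nonneg[of x "- U i"]
        by (auto simp: d_def less_le)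
    qed (simp add: d_def)
    define D where "D x = (\<Sum>i\<in>C. d i x)" for x
    have cD: "continuous_on S D" unfolding D_def by (intro continuous_intros cd)
    have D_pos: "0 < D x" if "x \<in> ?K" for x
    proof -
      obtain i where "i \<in> C" "x \<in> U i" using C(2) \<open>x \<in> ?K\<close> by blast
      then show ?thesis unfolding D_def using C(1) d_pos d0 by (intro sum_pos2[of C i]) auto
    qed
    obtain c where c: "0 < c" "\<And>x. x \<in> ?K \<Longrightarrow> c \<le> D x"
    proof (cases "?K = {}")
      case True
      show ?thesis by (rule that[of 1], simp) (use True in blast)
    next
      case False
      have "continuous_on ?K D" by (rule continuous_on_subset[OF cD]) auto
      from continuous_attains_inf[OF K False this] obtain x where "x \<in> ?K" "\<forall>y\<in>?K. D x \<le> D y" by blast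
      then show ?thesis using that[of "D x"] D_pos by blast
    qed
    \<comment> \<open>On \<open>?K\<close> the denominator equals D; elsewhere on S the factor
      \<open>?f\<close> vanishes, and c merely keeps the quotient continuous.\<close>
    define g where "g i x = ?f x * (d i x / max (D x) c)" for i x
    have m0: "0 < max (D x) c" for x using c(1) by simp
    have cg: "continuous_on S (g i)" for i
      unfolding g_def using m0 by (intro continuous_intros t(1) cd cD) (metis less_irrefl)
    have admissible_g: "admissible (U i) (g i)" if i: "i \<in> C" for i
      unfolding admissible_def
    proof (intro conjI ballI impI)
      fix x assume x: "x \<in> S"
      show "0 \<le> g i x" using d0[of i x] m0[of x] by (simp add: g_def)
      have "d i x \<le> D x" unfolding D_def using i C(1) d0 by (intro member_le_sum) auto
      then have "d i x / max (D x) c \<le> 1" using m0[of x] by (simp add: divide_le_eq_1 le_max_iff_disj)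
      moreover have "?f x \<le> 1" "0 \<le> ?f x" using f01[OF x] e(1) by auto
      ultimately show "g i x \<le> 1" unfolding g_def using d0[of i x] m0[of x]
        by (intro mult_le_one) (auto intro!: divide_nonneg_pos)
      assume "x \<notin> U i"
      then have "d i x = 0" using d_pos[of i x] d0[of i x] by simp
      then show "g i x = 0" by (simp add: g_def)
    qed (rule cg)
    have gsum: "(\<Sum>i\<in>C. g i x) = ?f x" if x: "x \<in> S" for x
    proof (cases "x \<in> ?K")
      case True
      then have m: "max (D x) c = D x" by (intro max_absorb1 c(2))
      have "(\<Sum>i\<in>C. g i x) = ?f x * ((\<Sum>i\<in>C. d i x) / D x)"
        unfolding g_def m by (simp only: sum_distrib_left[symmetric] sum_divide_distrib[symmetric])
      also have "(\<Sum>i\<in>C. d i x) = D x" by (simp add: D_def)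
      finally show ?thesis using D_pos[OF True] by simp
    next
      case False
      then show ?thesis using x by (simp add: g_def)
    qed
    have "\<Lambda> ?f = (\<Sum>i\<in>C. \<Lambda> (g i))"
    proof -
      have "\<Lambda> ?f = \<Lambda> (\<lambda>x. \<Sum>i\<in>C. g i x)"
        by (rule eq_on[OF t(1) continuous_on_sum[OF cg]]) (rule gsum[symmetric])
      then show ?thesis unfolding sum[OF cg] .
    qed
    then have "\<Lambda> f \<le> (\<Sum>i\<in>C. \<Lambda> (g i)) + e" using t(2) e(2) by linarith
    then have "ennreal (\<Lambda> f) \<le> ennreal ((\<Sum>i\<in>C. \<Lambda> (g i)) + e)" by (rule ennreal_leI)
    also have "\<dots> = (\<Sum>i\<in>C. ennreal (\<Lambda> (g i))) + ennreal e"
    proof -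
      have "0 \<le> \<Lambda> (g i)" if "i \<in> C" for i using admissible_g[OF that] by (intro pos) (auto simp: admissible_def)
      then show ?thesis using \<open>0 < e\<close> by (subst ennreal_plus) (auto intro!: sum_nonneg sum_ennreal[symmetric])
    qed
    also have "\<dots> \<le> (\<Sum>i. mu (U i)) + ennreal e"
      using C(1) by (intro add_right_mono order_trans[OF sum_mono[OF admissible_le[OF admissible_g]] sum_le_suminf]) auto
    finally show "ennreal (\<Lambda> f) \<le> (\<Sum>i. mu (U i)) + ennreal e" .
  qed
  then show ?thesis unfolding mu_def[of "\<Union>i. U i"] by (intro SUP_least) auto
qed

lemma outer_measure: "outer_measure_space (Pow UNIV) outer"
  unfolding outer_measure_space_def
proof (intro conjI)
  show "positive (Pow UNIV) outer"
    using mu_disjoint[of "{}"] by (simp add: positive_def outer_open)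
  show "increasing (Pow UNIV) outer" by (auto simp: increasing_def outer_mono)
  show "countably_subadditive (Pow UNIV) outer"
  proof (unfold countably_subadditive_def, intro allI impI)
    fix A :: "nat \<Rightarrow> 'a set"
    show "outer (\<Union>i. A i) \<le> (\<Sum>i. outer (A i))"
    proof (rule ennreal_le_epsilon)
      fix e :: real assume e: "0 < e"
      have "\<exists>U. open U \<and> A i \<subseteq> U \<and> mu U < outer (A i) + ennreal (e * (1/2) ^ Suc i)" for i
      proof -
        have "outer (A i) < outer (A i) + ennreal (e * (1/2) ^ Suc i)"
        proof -
          have "outer (A i) < top" using outer_le_mass[of "A i"] ennreal_less_top by (rule le_less_trans)
          then show ?thesis
            using e ennreal_add_left_cancel_less[of "outer (A i)" 0 "ennreal (e * (1/2) ^ Suc i)"] by simp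
        qed
        then show ?thesis unfolding outer_def INF_less_iff by auto
      qed
      then obtain U where U: "\<And>i. open (U i)" "\<And>i. A i \<subseteq> U i" "\<And>i. mu (U i) < outer (A i) + ennreal (e * (1/2) ^ Suc i)"
        by metis
      have "outer (\<Union>i. A i) \<le> mu (\<Union>i. U i)"
        using U unfolding outer_def by (intro INF_lower) auto
      also have "\<dots> \<le> (\<Sum>i. mu (U i))" by (rule mu_subadditive[OF U(1)])
      also have "\<dots> \<le> (\<Sum>i. outer (A i) + ennreal (e * (1/2) ^ Suc i))"
        using U(3) less_imp_le by (intro suminf_le) blast+
      also have "\<dots> = (\<Sum>i. outer (A i)) + ennreal e"
      proof -
        have "(\<Sum>i. ennreal (e * (1/2) ^ Suc i)) = ennreal (e * 1)"
          using e by (intro suminf_ennreal_eq sums_mult power_half_series) simp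
        then show ?thesis by (subst suminf_add[symmetric]) auto
      qed
      finally show "outer (\<Union>i. A i) \<le> (\<Sum>i. outer (A i)) + ennreal e" .
    qed
  qed
qed

text \<open>Caratheodory's inequality for an open test set: after truncation a function admissible
  for G \<inter> U lives on a compact set. A function admissible for G minus that set vanishes on
  it, so the sum of the two is admissible for G.\<close>

lemma open_split:
  assumes G: "open G" and U: "open U"
  shows "outer (G \<inter> U) + outer (G - U) \<le> mu G"
proof -
  have key: "ennreal (\<Lambda> f) + outer (G - U) \<le> mu G" if f: "admissible (G \<inter> U) f" for f
  proof (rule ennreal_le_epsilon)
    fix e :: real assume "0 < e"
    obtain \<epsilon> where e: "0 < \<epsilon>" "\<epsilon> * mass \<le> e" using small_eps[OF \<open>0 < e\<close>] by blast
    let ?f = "\<lambda>x. max 0 (f x - \<epsilon>)"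
    note t = trunc[OF f e(1)]
    have cf: "continuous_on S f" using f by (simp add: admissible_def)
    let ?K = "{x \<in> S. \<epsilon> \<le> f x}"
    have K: "closed ?K" using compact_superlevel[OF cf] compact_imp_closed by blast
    have V: "open (G - ?K)" using G K by (rule open_Diff)
    have "x \<in> G - ?K" if "x \<in> G - U" for x
      using that f e(1) by (auto simp: admissible_def)
    then have le: "outer (G - U) \<le> mu (G - ?K)" unfolding outer_open[OF V, symmetric] by (intro outer_mono) auto
    have "ennreal (\<Lambda> ?f) + ennreal (\<Lambda> g) \<le> mu G" if g: "admissible (G - ?K) g" for g
    proof -
      have cg: "continuous_on S g" using g by (simp add: admissible_def)
      have "admissible G (\<lambda>x. ?f x + g x)" unfolding admissible_def
      proof (intro conjI ballI impI)
        show "continuous_on S (\<lambda>x. ?f x + g x)" by (intro continuous_intros t(1) cg)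
        fix x assume x: "x \<in> S"
        show "0 \<le> ?f x + g x" using g x by (simp add: admissible_def)
        show "?f x + g x \<le> 1"
        proof (cases "x \<in> ?K")
          case True
          then have "g x = 0" using g x by (simp add: admissible_def)
          then show ?thesis using f x e(1) by (auto simp: admissible_def)
        next
          case False
          then have "?f x = 0" using x by simp
          then show ?thesis using g x by (simp add: admissible_def)
        qed
        assume "x \<notin> G"
        then show "?f x + g x = 0" using f g x e(1) by (simp add: admissible_def)
      qed
      then have "ennreal (\<Lambda> (\<lambda>x. ?f x + g x)) \<le> mu G" by (rule admissible_le)
      moreover have "0 \<le> \<Lambda> ?f" "0 \<le> \<Lambda> g" using g by (auto intro!: pos t(1) cg simp: admissible_def)
      ultimately show ?thesis by (simp add: add[OF t(1) cg])
    qed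
    then have "(SUP g\<in>{g. admissible (G - ?K) g}. ennreal (\<Lambda> ?f) + ennreal (\<Lambda> g)) \<le> mu G" by (intro SUP_least) auto
    moreover have ne: "{g. admissible (G - ?K) g} \<noteq> {}" using admissible_zero by blast
    have "ennreal (\<Lambda> ?f) + mu (G - ?K) = (SUP g\<in>{g. admissible (G - ?K) g}. ennreal (\<Lambda> ?f) + ennreal (\<Lambda> g))"
      unfolding mu_def[of "G - ?K"] by (rule ennreal_SUP_add_right[OF ne])
    ultimately have sup: "ennreal (\<Lambda> ?f) + mu (G - ?K) \<le> mu G" by (simp only:)
    have "ennreal (\<Lambda> f) \<le> ennreal (\<Lambda> ?f + e)" using t(2) e(2) by (intro ennreal_leI) linarith
    also have "\<dots> = ennreal (\<Lambda> ?f) + ennreal e"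
      using \<open>0 < e\<close> by (intro ennreal_plus pos t(1)) auto
    finally have "ennreal (\<Lambda> f) + outer (G - U) \<le> (ennreal (\<Lambda> ?f) + ennreal e) + mu (G - ?K)"
      using le by (rule add_mono)
    also have "\<dots> = (ennreal (\<Lambda> ?f) + mu (G - ?K)) + ennreal e" by (simp add: ac_simps)
    also have "\<dots> \<le> mu G + ennreal e" using sup by (rule add_right_mono)
    finally show "ennreal (\<Lambda> f) + outer (G - U) \<le> mu G + ennreal e" .
  qed
  have "outer (G - U) + outer (G \<inter> U) = (SUP f\<in>{f. admissible (G \<inter> U) f}. outer (G - U) + ennreal (\<Lambda> f))"
  proof -
    have ne: "{f. admissible (G \<inter> U) f} \<noteq> {}" using admissible_zero by blast
    show ?thesis unfolding outer_open[OF open_Int[OF G U]] mu_def by (rule ennreal_SUP_add_right[OF ne])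
  qed
  also have "\<dots> \<le> mu G" using key by (intro SUP_least) (auto simp: add.commute)
  finally show ?thesis by (simp add: add.commute)
qed

text \<open>Subadditivity gives one inequality; the other follows from \<open>open_split\<close> by
  taking the infimum over open sets G containing E.\<close>

lemma open_lambda: assumes U: "open U" shows "U \<in> lambda_system UNIV (Pow UNIV) outer"
proof -
  interpret sigma_algebra UNIV "Pow UNIV :: 'a set set" by (rule sigma_algebra_Pow)
  have sub: "outer E \<le> outer (E \<inter> U) + outer (E - U)" for E
  proof -
    have "subadditive (Pow UNIV) outer"
      using outer_measure by (intro countably_subadditive_subadditive) (auto simp: outer_measure_space_def)
    then have "outer ((E \<inter> U) \<union> (E - U)) \<le> outer (E \<inter> U) + outer (E - U)"
      by (rule subadditiveD) auto
    then show ?thesis by (simp only: Int_Diff_Un)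
  qed
  have "outer (E \<inter> U) + outer (E - U) \<le> outer E" for E
    unfolding outer_def[of E]
  proof (rule INF_greatest)
    fix G assume G: "G \<in> {G. open G \<and> E \<subseteq> G}"
    then have "outer (E \<inter> U) + outer (E - U) \<le> outer (G \<inter> U) + outer (G - U)" by (intro add_mono outer_mono) auto
    also have "\<dots> \<le> mu G" using G U by (intro open_split) auto
    finally show "outer (E \<inter> U) + outer (E - U) \<le> mu G" .
  qed
  then have "outer (E \<inter> U) + outer (E - U) = outer E" for E using sub by (rule antisym)
  then show ?thesis unfolding lambda_system_eq by simp
qed

definition riesz_measure :: "'a measure" where "riesz_measure = measure_of UNIV (sets borel) outer"

lemma sets_riesz_measure [simp]: "sets riesz_measure = sets borel" and space_riesz_measure [simp]: "space riesz_measure = UNIV"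
  by (simp_all add: riesz_measure_def sets.sigma_sets_eq[of borel, simplified])

lemma emeasure_riesz_measure: assumes "A \<in> sets borel" shows "emeasure riesz_measure A = outer A"
proof -
  interpret sigma_algebra UNIV "Pow UNIV :: 'a set set" by (rule sigma_algebra_Pow)
  have ms: "measure_space UNIV (lambda_system UNIV (Pow UNIV) outer) outer"
    by (rule caratheodory_lemma[OF outer_measure])
  then have "sigma_algebra UNIV (lambda_system UNIV (Pow UNIV) outer)" by (simp add: measure_space_def)
  then have "sigma_sets UNIV {U. open U} \<subseteq> lambda_system UNIV (Pow UNIV) outer"
    using open_lambda by (intro sigma_algebra.sigma_sets_subset) auto
  then have sub: "sets borel \<subseteq> lambda_system UNIV (Pow UNIV) outer" by (simp add: borel_def)
  show ?thesis
  proof (rule emeasure_measure_of[OF riesz_measure_def])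
    show "countably_additive (sets riesz_measure) outer" "positive (sets riesz_measure) outer"
      using ms sub by (auto simp: measure_space_def countably_additive_def positive_def)
  qed (use assms in auto)
qed

lemma emeasure_UNIV: "emeasure riesz_measure UNIV = ennreal mass"
proof -
  have "mu UNIV = ennreal mass"
    by (intro antisym mu_le_mass) (use admissible_le[of UNIV "\<lambda>_. 1"] in \<open>simp add: admissible_def mass_def\<close>)
  then show ?thesis by (simp add: emeasure_riesz_measure outer_open)
qed

lemma finite_riesz_measure: "finite_measure riesz_measure"
  by (rule finite_measureI) (simp add: emeasure_UNIV)

lemma closed_S: "closed S" using S by (rule compact_imp_closed)

lemma emeasure_Compl_S: "emeasure riesz_measure (- S) = 0"
  using mu_disjoint[of "- S"] closed_S by (simp add: emeasure_riesz_measure outer_open open_Compl)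

lemma measure_S: "measure riesz_measure S = mass"
proof -
  interpret finite_measure riesz_measure by (rule finite_riesz_measure)
  have "measure riesz_measure (UNIV - S) = measure riesz_measure UNIV - measure riesz_measure S"
    using finite_measure_compl[of S] closed_S by simp
  moreover have "measure riesz_measure (UNIV - S) = 0" using emeasure_Compl_S by (simp add: measure_def Compl_eq_Diff_UNIV)
  moreover have "measure riesz_measure UNIV = mass" using emeasure_UNIV mass_nonneg by (simp add: measure_def)
  ultimately show ?thesis by simp
qed

lemma integrable_cont:
  fixes f :: "'a \<Rightarrow> real"
  assumes "continuous_on S f"
  shows "set_integrable riesz_measure S f"
proof -
  interpret finite_measure riesz_measure by (rule finite_riesz_measure)
  obtain C where C: "\<And>x. x \<in> S \<Longrightarrow> \<bar>f x\<bar> \<le> C"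
    using compact_imp_bounded[OF compact_continuous_image[OF assms S]] unfolding bounded_iff real_norm_def by blast
  have "(\<lambda>x. indicator S x *\<^sub>R f x) \<in> borel_measurable borel"
    by (rule borel_measurable_continuous_on_indicator[OF _ assms]) (use closed_S in simp)
  then have m: "(\<lambda>x. indicator S x *\<^sub>R f x) \<in> borel_measurable riesz_measure" by (simp cong: measurable_cong_sets)
  show ?thesis unfolding set_integrable_def
    by (rule integrable_const_bound[of _ "max 0 C", OF _ m]) (use C in \<open>auto simp: indicator_def le_max_iff_disj\<close>)
qed

lemma sum_layers: "0 \<le> y \<Longrightarrow> 0 < n \<Longrightarrow> (\<Sum>i<k. min (1 / real n) (max 0 (y - real i / real n))) = min (real k / real n) y"
proof (induction k)
  case (Suc k)
  have "min a y + min b (max 0 (y - a)) = min (a + b) y" if "0 \<le> a" "0 \<le> b" for a b :: real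
    using that Suc.prems by (auto simp: min_def max_def)
  from this[of "real k / real n" "1 / real n"] Suc show ?case by (simp add: add_divide_distrib)
qed (simp add: min_def)

text \<open>Layer cake: f is cut into n slices \<open>g i\<close> of height 1 / n. A rescaled slice
  is admissible for \<open>U i\<close>, which meets S where f > i / n, so the functional is at most
  an upper sum of the measures of these sets. The same sum shifted by one index is a lower sum for
  the integral, and the shift costs at most mass / n.\<close>

lemma functional_le_integral:
  assumes f: "continuous_on S f" "\<And>x. x \<in> S \<Longrightarrow> 0 \<le> f x \<and> f x \<le> 1"
  shows "\<Lambda> f \<le> (LINT x:S|riesz_measure. f x)"
proof -
  interpret finite_measure riesz_measure by (rule finite_riesz_measure)
  have le: "\<Lambda> f \<le> (LINT x:S|riesz_measure. f x) + mass / real n" if n: "0 < n" for n :: nat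
  proof -
    define g where "g i x = min (1 / real n) (max 0 (f x - real i / real n))" for i x
    define U where "U i = - {x \<in> S. f x \<le> real i / real n}" for i :: nat
    have cg: "continuous_on S (g i)" for i unfolding g_def by (intro continuous_intros f)
    have U: "open (U i)" for i
    proof -
      have "closed {x \<in> S. - (real i / real n) \<le> - f x}"
        by (intro compact_imp_closed compact_superlevel continuous_intros f)
      then show ?thesis by (simp add: U_def open_Compl)
    qed
    have admissible_g: "admissible (U i) (\<lambda>x. real n * g i x)" for i
      unfolding admissible_def
    proof (intro conjI ballI impI)
      show "continuous_on S (\<lambda>x. real n * g i x)" by (intro continuous_intros cg)
      fix x assume x: "x \<in> S"
      show "0 \<le> real n * g i x" by (simp add: g_def)
      have "real n * g i x \<le> real n * (1 / real n)" unfolding g_def by (intro mult_left_mono) auto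
      then show "real n * g i x \<le> 1" using n by simp
      assume "x \<notin> U i"
      then show "real n * g i x = 0" using x by (simp add: U_def g_def)
    qed
    have bound: "\<Lambda> (g i) \<le> measure riesz_measure (U i) / real n" for i
    proof -
      have "ennreal (real n * \<Lambda> (g i)) \<le> emeasure riesz_measure (U i)"
        using admissible_le[OF admissible_g[of i]] U[of i] scale[OF cg] by (simp add: emeasure_riesz_measure outer_open)
      then have "real n * \<Lambda> (g i) \<le> measure riesz_measure (U i)" by (simp add: emeasure_eq_measure)
      then show ?thesis using n by (simp add: field_simps)
    qed
    have "\<Lambda> f = \<Lambda> (\<lambda>x. \<Sum>i<n. g i x)"
      by (rule eq_on) (use f n in \<open>auto intro!: continuous_on_sum cg simp: g_def sum_layers\<close>)
    moreover have "\<Lambda> (\<lambda>x. \<Sum>i<n. g i x) = (\<Sum>i<n. \<Lambda> (g i))" by (rule sum[OF cg])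
    moreover have "(\<Sum>i<n. \<Lambda> (g i)) \<le> (\<Sum>i<n. measure riesz_measure (U i) / real n)" by (intro sum_mono bound)
    moreover have "(\<Sum>i<n. measure riesz_measure (U i) / real n) \<le> (\<Sum>i<Suc n. measure riesz_measure (U i) / real n)" by simp
    moreover have "(\<Sum>i<Suc n. measure riesz_measure (U i) / real n) = measure riesz_measure (U 0) / real n + (\<Sum>i<n. measure riesz_measure (U (Suc i)) / real n)"
      by (rule sum.lessThan_Suc_shift)
    ultimately have total: "\<Lambda> f \<le> measure riesz_measure (U 0) / real n + (\<Sum>i<n. measure riesz_measure (U (Suc i)) / real n)" by linarith
    have first: "measure riesz_measure (U 0) / real n \<le> mass / real n"
    proof -
      have "measure riesz_measure (U 0) \<le> measure riesz_measure UNIV" using U[of 0] by (intro finite_measure_mono) auto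
      also have "measure riesz_measure UNIV = mass" using emeasure_UNIV mass_nonneg by (simp add: measure_def)
      finally show ?thesis by (simp add: divide_right_mono)
    qed
    have "(\<Sum>i<n. measure riesz_measure (U (Suc i)) / real n) = (LINT x|riesz_measure. (\<Sum>i<n. indicator (U (Suc i) \<inter> S) x / real n))"
    proof -
      have "measure riesz_measure (U (Suc i)) = (LINT x|riesz_measure. indicator (U (Suc i) \<inter> S) x)" for i
      proof -
        have "measure riesz_measure (U (Suc i)) = measure riesz_measure (U (Suc i) \<inter> S)"
          using emeasure_Compl_S U[of "Suc i"] closed_S
          by (intro measure_eq_AE AE_I[of _ _ "- S"]) (auto simp: borel_open borel_closed)
        then show ?thesis using U[of "Suc i"] closed_S by simp
      qed
      moreover have "integrable riesz_measure (\<lambda>x. indicator (U (Suc i) \<inter> S) x :: real)" for i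
        using U[of "Suc i"] closed_S by (intro integrable_real_indicator) (auto simp: emeasure_eq_measure)
      ultimately show ?thesis by (subst Bochner_Integration.integral_sum) auto
    qed
    also have "\<dots> \<le> (LINT x:S|riesz_measure. f x)"
      unfolding set_lebesgue_integral_def
    proof (rule integral_mono)
      show "integrable riesz_measure (\<lambda>x. indicator S x *\<^sub>R f x)" using integrable_cont[OF f(1)] by (simp add: set_integrable_def)
      show "integrable riesz_measure (\<lambda>x. \<Sum>i<n. indicator (U (Suc i) \<inter> S) x / real n)"
        using U closed_S by (intro Bochner_Integration.integrable_sum integrable_divide_zero impI integrable_real_indicator) (auto simp: emeasure_eq_measure)
      fix x
      show "(\<Sum>i<n. indicator (U (Suc i) \<inter> S) x / real n) \<le> indicator S x *\<^sub>R f x"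
      proof (cases "x \<in> S")
        case True
        have "(\<Sum>i<n. indicator (U (Suc i) \<inter> S) x / real n) \<le> (\<Sum>i<n. g i x)"
        proof (rule sum_mono)
          fix i
          show "indicator (U (Suc i) \<inter> S) x / real n \<le> g i x"
          proof (cases "f x \<le> real (Suc i) / real n")
            case True
            then have "x \<notin> U (Suc i)" using \<open>x \<in> S\<close> by (simp add: U_def)
            then show ?thesis by (simp add: g_def)
          next
            case False
            then have "1 / real n \<le> f x - real i / real n" by (simp add: add_divide_distrib)
            then have "g i x = 1 / real n" using n by (simp add: g_def)
            then show ?thesis by (simp add: indicator_def)
          qed
        qed
        also have "\<dots> = f x" using f(2)[OF True] n by (simp add: g_def sum_layers)
        finally show ?thesis using True by simp
      qed simp
    qed
    finally show ?thesis using total first by linarith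
  qed
  have "(\<lambda>n. (LINT x:S|riesz_measure. f x) + mass * inverse (real (Suc n))) \<longlonglongrightarrow> (LINT x:S|riesz_measure. f x) + mass * 0"
    by (intro tendsto_intros LIMSEQ_inverse_real_of_nat)
  then have "\<Lambda> f \<le> (LINT x:S|riesz_measure. f x) + mass * 0"
    by (rule LIMSEQ_le_const) (use le[of "Suc _"] in \<open>auto simp: divide_inverse\<close>)
  then show ?thesis by simp
qed

text \<open>The inequality for 1 - g is the reverse inequality for g when g has values in [0, 1]; an
  affine map reduces every continuous f to this case.\<close>

theorem functional_eq_integral:
  assumes f: "continuous_on S f"
  shows "(LINT x:S|riesz_measure. f x) = \<Lambda> f"
proof -
  interpret finite_measure riesz_measure by (rule finite_riesz_measure)
  have one: "(LINT x:S|riesz_measure. c) = c * mass" for c :: real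
    using closed_S measure_S by (simp add: set_lebesgue_integral_def)
  have unit: "(LINT x:S|riesz_measure. g x) = \<Lambda> g" if g: "continuous_on S g" "\<And>x. x \<in> S \<Longrightarrow> 0 \<le> g x \<and> g x \<le> 1" for g
  proof (rule antisym[OF _ functional_le_integral[OF g]])
    have c1: "continuous_on S (\<lambda>x. 1 + -1 * g x)" by (intro continuous_intros g)
    have "\<Lambda> (\<lambda>x. 1 + -1 * g x) \<le> (LINT x:S|riesz_measure. 1 + -1 * g x)"
      by (rule functional_le_integral[OF c1]) (use g(2) in auto)
    also have "\<dots> = mass - (LINT x:S|riesz_measure. g x)"
      using set_integral_diff(2)[OF integrable_cont[of "\<lambda>_. 1"] integrable_cont[OF g(1)]] one[of 1] by simp
    also have "\<Lambda> (\<lambda>x. 1 + -1 * g x) = mass - \<Lambda> g"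
      using add[of "\<lambda>_. 1" "\<lambda>x. -1 * g x"] scale[OF g(1), of "-1"] g(1) by (simp add: mass_def continuous_on_minus)
    finally show "(LINT x:S|riesz_measure. g x) \<le> \<Lambda> g" by simp
  qed
  obtain C where C: "0 < C" "\<And>x. x \<in> S \<Longrightarrow> \<bar>f x\<bar> \<le> C"
  proof -
    obtain C where "\<And>x. x \<in> S \<Longrightarrow> \<bar>f x\<bar> \<le> C"
      using compact_imp_bounded[OF compact_continuous_image[OF f S]] unfolding bounded_iff real_norm_def by blast
    then show ?thesis by (intro that[of "max 1 C"]) (auto simp: le_max_iff_disj)
  qed
  let ?g = "\<lambda>x. 1 / 2 + (1 / (2 * C)) * f x"
  have cg: "continuous_on S ?g" by (intro continuous_intros f)
  have "0 \<le> ?g x \<and> ?g x \<le> 1" if "x \<in> S" for x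
    using C(2)[OF that] C(1) by (auto simp: field_simps abs_le_iff)
  from unit[OF cg this] have "(LINT x:S|riesz_measure. ?g x) = \<Lambda> ?g" by blast
  moreover have "(LINT x:S|riesz_measure. ?g x) = 1 / 2 * mass + (1 / (2 * C)) * (LINT x:S|riesz_measure. f x)"
    using set_integral_add(2)[OF integrable_cont[of "\<lambda>_. 1/2"] set_integrable_mult_right[OF integrable_cont[OF f], of "1 / (2 * C)"]] one[of "1/2"]
    by simp
  moreover have "\<Lambda> ?g = 1 / 2 * mass + (1 / (2 * C)) * \<Lambda> f"
  proof -
    have c: "continuous_on S (\<lambda>x. (1 / (2 * C)) * f x)" by (intro continuous_intros f)
    show ?thesis unfolding add[OF continuous_on_const c] scale[OF f] const ..
  qed
  ultimately have "(1 / (2 * C)) * (LINT x:S|riesz_measure. f x) = (1 / (2 * C)) * \<Lambda> f" by linarith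
  then show ?thesis using C(1) by simp
qed

end

lemma riesz_markov:
  fixes S :: "'a::euclidean_space set"
  assumes "positive_functional S \<Lambda>"
  obtains \<nu> where "finite_measure \<nu>" "sets \<nu> = sets (restrict_space borel S)"
    "\<And>f :: 'a \<Rightarrow> real. continuous_on S f \<Longrightarrow> integrable \<nu> f" "\<And>f. continuous_on S f \<Longrightarrow> integral\<^sup>L \<nu> f = \<Lambda> f"
proof -
  interpret positive_functional S \<Lambda> by (rule assms)
  have S': "S \<inter> space riesz_measure \<in> sets riesz_measure" using closed_S by simp
  show ?thesis
  proof (rule that[of "restrict_space riesz_measure S"])
    show "finite_measure (restrict_space riesz_measure S)"
      using finite_measure.emeasure_finite[OF finite_riesz_measure, of S] closed_S
      by (intro finite_measureI) (simp add: emeasure_restrict_space space_restrict_space)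
    show "sets (restrict_space riesz_measure S) = sets (restrict_space borel S)" by (rule sets_restrict_space_cong) simp
    show "integrable (restrict_space riesz_measure S) f" if "continuous_on S f" for f :: "'a \<Rightarrow> real"
      using integrable_cont[OF that] integrable_restrict_space[OF S', of f] by (simp add: set_integrable_def)
    show "integral\<^sup>L (restrict_space riesz_measure S) f = \<Lambda> f" if "continuous_on S f" for f
      using functional_eq_integral[OF that] integral_restrict_space[OF S', of f] by (simp add: set_lebesgue_integral_def)
  qed
qed

section \<open>Semispectral measures\<close>

lemma sets_sphere_borel: "A \<in> sets sphere_borel \<longleftrightarrow> A \<in> sets borel \<and> A \<subseteq> sphere 0 1"
proof -
  have "sphere (0::complex^'d) 1 \<in> sets borel" by (intro borel_closed closed_sphere)
  then show ?thesis by (auto simp: sphere_borel_def sets_restrict_space_iff)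
qed

lemma space_sphere_borel [simp]: "space sphere_borel = sphere 0 1"
  by (simp add: sphere_borel_def space_restrict_space)

lemma sets_eq_sphere_borel:
  assumes "sets \<nu> = sets sphere_borel"
  shows "space \<nu> = sphere 0 1" "A \<in> sets \<nu> \<longleftrightarrow> A \<in> sets borel \<and> A \<subseteq> sphere 0 1"
  using sets_eq_imp_space_eq[OF assms] assms by (simp_all add: sets_sphere_borel)

text \<open>Tents of slope n around C. The empty set is treated apart: \<open>infdist\<close> to it
  is 0, and the formula would give the constant 1.\<close>

lemma closed_indicator_approx:
  fixes C :: "(complex^'d) set"
  assumes C: "closed C"
  obtains f :: "nat \<Rightarrow> complex^'d \<Rightarrow> real" where
    "\<And>n. continuous_on UNIV (f n)" "\<And>n x. 0 \<le> f n x \<and> f n x \<le> 1" "\<And>x. (\<lambda>n. f n x) \<longlonglongrightarrow> indicator C x"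
proof (cases "C = {}")
  case True
  show ?thesis by (rule that[of "\<lambda>_ _. 0"]) (use True in auto)
next
  case False
  show ?thesis
  proof (rule that[of "\<lambda>n x. max 0 (1 - real n * infdist x C)"])
    show "continuous_on UNIV (\<lambda>x. max 0 (1 - real n * infdist x C))" for n by (intro continuous_intros)
    show "0 \<le> max 0 (1 - real n * infdist x C) \<and> max 0 (1 - real n * infdist x C) \<le> 1" for n x
      by (simp add: infdist_nonneg)
    fix x
    show "(\<lambda>n. max 0 (1 - real n * infdist x C)) \<longlonglongrightarrow> indicator C x"
    proof (cases "x \<in> C")
      case True then show ?thesis by simp
    next
      case out: False
      then have p: "0 < infdist x C"
        using in_closed_iff_infdist_zero[OF C False, of x] infdist_nonneg[of x C] by (simp add: less_le)
      obtain N where N: "1 < real N * infdist x C" using reals_Archimedean3[OF p] by blast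
      have "\<forall>\<^sub>F n in sequentially. max 0 (1 - real n * infdist x C) = 0"
        unfolding eventually_sequentially
      proof (intro exI[of _ N] allI impI)
        fix n assume "N \<le> n"
        then have "real N * infdist x C \<le> real n * infdist x C" using p by (intro mult_right_mono) auto
        then show "max 0 (1 - real n * infdist x C) = 0" using N by simp
      qed
      then show ?thesis using out by (simp add: tendsto_eventually)
    qed
  qed
qed

lemma closed_measure_limit:
  fixes C :: "(complex^'d) set"
  assumes C: "closed C" and f: "\<And>n. continuous_on UNIV (f n)" "\<And>n x. 0 \<le> f n x \<and> f n x \<le> 1"
    "\<And>x. (\<lambda>n. f n x) \<longlonglongrightarrow> indicator C x"
    and \<nu>: "finite_measure \<nu>" "sets \<nu> = sets sphere_borel"
  shows "(\<lambda>n. \<integral>x. f n x \<partial>\<nu>) \<longlonglongrightarrow> measure \<nu> (sphere 0 1 \<inter> C)"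
proof -
  interpret finite_measure \<nu> by (rule \<nu>)
  have m: "f n \<in> borel_measurable \<nu>" for n
    using measurable_restrict_space1[OF borel_measurable_continuous_onI[OF f(1)], of n "sphere 0 1"]
    by (simp add: measurable_cong_sets[OF \<nu>(2) refl] sphere_borel_def)
  have Cs: "sphere 0 1 \<inter> C \<in> sets \<nu>" using C by (simp add: sets_eq_sphere_borel[OF \<nu>(2)] borel_closed closed_Int)
  have "(\<lambda>n. \<integral>x. f n x \<partial>\<nu>) \<longlonglongrightarrow> (\<integral>x. indicator (sphere 0 1 \<inter> C) x \<partial>\<nu>)"
  proof (rule integral_dominated_convergence[where w="\<lambda>_. 1"])
    show "AE x in \<nu>. (\<lambda>n. f n x) \<longlonglongrightarrow> indicator (sphere 0 1 \<inter> C) x"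
    proof (rule AE_I2)
      fix x assume "x \<in> space \<nu>"
      then have "indicator (sphere 0 1 \<inter> C) x = (indicator C x :: real)"
        by (simp add: sets_eq_sphere_borel[OF \<nu>(2)] indicator_def)
      then show "(\<lambda>n. f n x) \<longlonglongrightarrow> indicator (sphere 0 1 \<inter> C) x" using f(3) by simp
    qed
    show "AE x in \<nu>. norm (f n x) \<le> 1" for n using f(2)[of n] by (intro AE_I2) (simp add: abs_le_iff order_trans[of _ 0])
  qed (use m Cs in simp_all)
  then show ?thesis using Cs by simp
qed

section \<open>Spectral measures and their polarized form\<close>

context spherical_isometry
begin

definition L_diag :: "'h \<Rightarrow> (complex^'d \<Rightarrow> real) \<Rightarrow> real" where
  "L_diag h f = Re (L h h (\<lambda>z. complex_of_real (f z)))"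

lemma positive_functional_L_diag: "positive_functional (sphere 0 1) (L_diag h)"
proof
  fix f g :: "complex^'d \<Rightarrow> real" and c :: real
  assume f: "continuous_on (sphere 0 1) f"
  note cf = L_domain_continuous_real[OF f]
  show "L_diag h (\<lambda>x. c * f x) = c * L_diag h f"
    using L_domain_cmult(2)[OF cf, of h h "complex_of_real c"] by (simp add: L_diag_def)
  show "0 \<le> L_diag h f" if "\<And>x. x \<in> sphere 0 1 \<Longrightarrow> 0 \<le> f x"
    unfolding L_diag_def by (rule L_nonneg[OF cf]) (use that in simp)
  assume g: "continuous_on (sphere 0 1) g"
  show "L_diag h (\<lambda>x. f x + g x) = L_diag h f + L_diag h g"
    using L_domain_add(2)[OF cf L_domain_continuous_real[OF g], of h h] by (simp add: L_diag_def)
qed simp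

definition spectral_measure :: "'h \<Rightarrow> (complex^'d) measure" where
  "spectral_measure h = (SOME \<nu>. finite_measure \<nu> \<and> sets \<nu> = sets sphere_borel \<and>
    (\<forall>f :: complex^'d \<Rightarrow> real. continuous_on (sphere 0 1) f \<longrightarrow> integrable \<nu> f \<and> integral\<^sup>L \<nu> f = L_diag h f))"

lemma spectral_measure_spec: "finite_measure (spectral_measure h) \<and> sets (spectral_measure h) = sets sphere_borel \<and>
    (\<forall>f :: complex^'d \<Rightarrow> real. continuous_on (sphere 0 1) f \<longrightarrow> integrable (spectral_measure h) f \<and> integral\<^sup>L (spectral_measure h) f = L_diag h f)"
  unfolding spectral_measure_def
proof (rule someI_ex)
  show "\<exists>\<nu>. finite_measure \<nu> \<and> sets \<nu> = sets sphere_borel \<and>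
    (\<forall>f :: complex^'d \<Rightarrow> real. continuous_on (sphere 0 1) f \<longrightarrow> integrable \<nu> f \<and> integral\<^sup>L \<nu> f = L_diag h f)"
    using riesz_markov[OF positive_functional_L_diag[of h]] unfolding sphere_borel_def by metis
qed

lemma finite_spectral_measure: "finite_measure (spectral_measure h)" and sets_spectral_measure: "sets (spectral_measure h) = sets sphere_borel"
  and integrable_spectral_measure: "continuous_on (sphere 0 1) (f :: _ \<Rightarrow> real) \<Longrightarrow> integrable (spectral_measure h) f"
  and integral_spectral_measure: "continuous_on (sphere 0 1) f \<Longrightarrow> integral\<^sup>L (spectral_measure h) f = L_diag h f"
  using spectral_measure_spec[of h] by auto

lemma space_spectral_measure: "space (spectral_measure h) = sphere 0 1" by (rule sets_eq_sphere_borel(1)[OF sets_spectral_measure])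

lemma L_real:
  assumes "continuous_on (sphere 0 1) f" "\<And>z. norm z = 1 \<Longrightarrow> 0 \<le> f z"
  shows "L h h (\<lambda>z. complex_of_real (f z)) = complex_of_real (L_diag h f)"
proof -
  interpret l: psd_form "\<lambda>h k. L h k (\<lambda>z. complex_of_real (f z))" by (rule psd_form_L[OF assms])
  show ?thesis using l.self_real[of h] by (simp add: L_diag_def)
qed

definition spectral_form :: "(complex^'d) set \<Rightarrow> 'h \<Rightarrow> 'h \<Rightarrow> complex" where
  "spectral_form A h k = (\<Sum>j<4. \<i> ^ j * complex_of_real (measure (spectral_measure (h + \<i> ^ j *\<^sub>C k)) A)) / 4"

lemma L_polar:
  assumes "continuous_on (sphere 0 1) f" "\<And>z. norm z = 1 \<Longrightarrow> 0 \<le> f z"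
  shows "(\<Sum>j<4. \<i> ^ j * complex_of_real (integral\<^sup>L (spectral_measure (h + \<i> ^ j *\<^sub>C k)) f)) / 4 = L h k (\<lambda>z. complex_of_real (f z))"
proof -
  interpret l: psd_form "\<lambda>h k. L h k (\<lambda>z. complex_of_real (f z))" by (rule psd_form_L[OF assms])
  show ?thesis using l.polarization[of h k] by (simp only: integral_spectral_measure[OF assms(1)] L_real[OF assms])
qed

text \<open>The measures of different vectors come from separate applications of the representation
  theorem, so sesquilinearity of their polarization has to be proved set by set.\<close>

definition psd_spectral :: "(complex^'d) set \<Rightarrow> bool" where
  "psd_spectral A \<longleftrightarrow> (\<forall>x y z. spectral_form A (x + y) z = spectral_form A x z + spectral_form A y z) \<and> (\<forall>c x y. spectral_form A (c *\<^sub>C x) y = c * spectral_form A x y)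
    \<and> (\<forall>x y. spectral_form A x y = cnj (spectral_form A y x)) \<and> (\<forall>x. spectral_form A x x = complex_of_real (measure (spectral_measure x) A))"

text \<open>The indicator of a closed set is a bounded pointwise limit of continuous functions, and
  for those the polarized integral is the sesquilinear form \<open>L\<close>.\<close>

lemma psd_spectral_closed: assumes C: "closed C" shows "psd_spectral (sphere 0 1 \<inter> C)"
proof -
  obtain f where f: "\<And>n. continuous_on UNIV (f n)" "\<And>n x. 0 \<le> f n x \<and> f n x \<le> 1"
    "\<And>x::complex^'d. (\<lambda>n. f n x) \<longlonglongrightarrow> (indicator C x :: real)"
    using closed_indicator_approx[OF C] by metis
  note lim = closed_measure_limit[OF C f finite_spectral_measure sets_spectral_measure]
  have cf: "continuous_on (sphere 0 1) (f n)" for n using f(1) continuous_on_subset by blast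
  have Blim: "(\<lambda>n. L h k (\<lambda>z. complex_of_real (f n z))) \<longlonglongrightarrow> spectral_form (sphere 0 1 \<inter> C) h k" for h k
    unfolding spectral_form_def L_polar[OF cf conjunct1[OF f(2)], symmetric]
    by (intro tendsto_intros lim) simp
  have form: "psd_form (\<lambda>h k. L h k (\<lambda>z. complex_of_real (f n z)))" for n
    by (rule psd_form_L[OF cf]) (use f(2) in auto)
  show ?thesis unfolding psd_spectral_def
  proof (intro conjI allI)
    fix x y z c
    show "spectral_form (sphere 0 1 \<inter> C) (x + y) z = spectral_form (sphere 0 1 \<inter> C) x z + spectral_form (sphere 0 1 \<inter> C) y z"
      using LIMSEQ_unique[OF Blim[of "x + y" z]] tendsto_add[OF Blim[of x z] Blim[of y z]]
      by (simp add: psd_form.add_left[OF form])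
    show "spectral_form (sphere 0 1 \<inter> C) (c *\<^sub>C x) y = c * spectral_form (sphere 0 1 \<inter> C) x y"
      using LIMSEQ_unique[OF Blim[of "c *\<^sub>C x" y]] tendsto_mult_left[OF Blim[of x y], of c]
      by (simp add: psd_form.scaleC_left[OF form])
    show "spectral_form (sphere 0 1 \<inter> C) x y = cnj (spectral_form (sphere 0 1 \<inter> C) y x)"
      using LIMSEQ_unique[OF Blim[of x y]] tendsto_cnj[OF Blim[of y x]]
      by (simp add: psd_form.herm[OF form, of y x])
    show "spectral_form (sphere 0 1 \<inter> C) x x = complex_of_real (measure (spectral_measure x) (sphere 0 1 \<inter> C))"
      using LIMSEQ_unique[OF Blim[of x x]] tendsto_of_real[OF lim[of x]]
      by (simp add: L_real[OF cf conjunct1[OF f(2)]] integral_spectral_measure[OF cf])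
  qed
qed

lemma spectral_form_compl: assumes "A \<in> sets sphere_borel" shows "spectral_form (sphere 0 1 - A) h k = spectral_form (sphere 0 1) h k - spectral_form A h k"
proof -
  have "measure (spectral_measure x) (sphere 0 1 - A) = measure (spectral_measure x) (sphere 0 1) - measure (spectral_measure x) A" for x
    using finite_measure.finite_measure_compl[OF finite_spectral_measure, of A x] assms sets_spectral_measure[of x] space_spectral_measure[of x] by simp
  then show ?thesis by (simp add: spectral_form_def ring_distribs sum_subtractf diff_divide_distrib)
qed

lemma spectral_form_sums:
  assumes "range A \<subseteq> sets sphere_borel" "disjoint_family A"
  shows "(\<lambda>n. spectral_form (A n) h k) sums spectral_form (\<Union>n. A n) h k"
  unfolding spectral_form_def
  by (rule sums_divide, rule sums_sum, rule sums_mult, rule sums_of_real,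
      rule finite_measure.finite_measure_UNION[OF finite_spectral_measure]) (simp_all only: assms sets_spectral_measure)

text \<open>Dynkin argument: closed sets are stable under intersection and generate the Borel sets,
  and the property passes to complements and to countable disjoint unions.\<close>

lemma psd_spectral_sets: assumes "A \<in> sets sphere_borel" shows "psd_spectral A"
proof -
  have sb: "sigma_sets UNIV {C :: (complex^'d) set. closed C} = sets borel"
    by (simp add: borel_eq_closed)
  have sE: "sphere 0 1 \<inter> E \<in> sets sphere_borel" if "E \<in> sigma_sets UNIV {C :: (complex^'d) set. closed C}" for E
    using that unfolding sb sets_sphere_borel by (auto intro!: sets.Int borel_closed)
  have stable: "Int_stable {C :: (complex^'d) set. closed C}" and sub: "{C :: (complex^'d) set. closed C} \<subseteq> Pow UNIV"
    by (auto simp: Int_stable_def)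
  have "psd_spectral (sphere 0 1 \<inter> E)" if E: "E \<in> sigma_sets UNIV {C :: (complex^'d) set. closed C}" for E
    using stable sub E
  proof (induction rule: sigma_sets_induct_disjoint[consumes 3, case_names basic empty compl union])
    case (basic E)
    then show ?case by (simp add: psd_spectral_closed)
  next
    case empty
    then show ?case using psd_spectral_closed[of "{}"] by simp
  next
    case (compl E)
    have E: "sphere 0 1 \<inter> E \<in> sets sphere_borel" using compl(1) by (rule sE)
    have S: "psd_spectral (sphere 0 1)" using psd_spectral_closed[of UNIV] by simp
    have "sphere 0 1 \<inter> (UNIV - E) = sphere 0 1 - (sphere 0 1 \<inter> E)" by auto
    moreover have "psd_spectral (sphere 0 1 - (sphere 0 1 \<inter> E))"
    proof -
      note g = compl(2)[unfolded psd_spectral_def] and g' = S[unfolded psd_spectral_def]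
      have m: "measure (spectral_measure x) (sphere 0 1 - (sphere 0 1 \<inter> E)) = measure (spectral_measure x) (sphere 0 1) - measure (spectral_measure x) (sphere 0 1 \<inter> E)" for x
        using finite_measure.finite_measure_compl[OF finite_spectral_measure, of "sphere 0 1 \<inter> E" x] E by (simp only: sets_spectral_measure space_spectral_measure)
      show ?thesis unfolding psd_spectral_def spectral_form_compl[OF E] m
      proof (intro conjI allI)
        fix x y z c
        show "spectral_form (sphere 0 1) (x + y) z - spectral_form (sphere 0 1 \<inter> E) (x + y) z = spectral_form (sphere 0 1) x z - spectral_form (sphere 0 1 \<inter> E) x z + (spectral_form (sphere 0 1) y z - spectral_form (sphere 0 1 \<inter> E) y z)"
          using g[THEN conjunct1] g'[THEN conjunct1] by simp
        show "spectral_form (sphere 0 1) (c *\<^sub>C x) y - spectral_form (sphere 0 1 \<inter> E) (c *\<^sub>C x) y = c * (spectral_form (sphere 0 1) x y - spectral_form (sphere 0 1 \<inter> E) x y)"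
          using g[THEN conjunct2, THEN conjunct1] g'[THEN conjunct2, THEN conjunct1] by (simp add: right_diff_distrib)
        show "spectral_form (sphere 0 1) x y - spectral_form (sphere 0 1 \<inter> E) x y = cnj (spectral_form (sphere 0 1) y x - spectral_form (sphere 0 1 \<inter> E) y x)"
          unfolding complex_cnj_diff using g g' by metis
        show "spectral_form (sphere 0 1) x x - spectral_form (sphere 0 1 \<inter> E) x x = complex_of_real (measure (spectral_measure x) (sphere 0 1) - measure (spectral_measure x) (sphere 0 1 \<inter> E))"
          using g[THEN conjunct2, THEN conjunct2, THEN conjunct2] g'[THEN conjunct2, THEN conjunct2, THEN conjunct2] by simp
      qed
    qed
    ultimately show ?case by simp
  next
    case (union E)
    have E: "range (\<lambda>i. sphere 0 1 \<inter> E i) \<subseteq> sets sphere_borel"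
      using union(2) sE by blast
    have D: "disjoint_family (\<lambda>i. sphere 0 1 \<inter> E i)"
      using union(1) by (auto simp: disjoint_family_on_def)
    have U: "sphere 0 1 \<inter> (\<Union>i. E i) = (\<Union>i. sphere 0 1 \<inter> E i)" by auto
    note s = spectral_form_sums[OF E D]
    have g1: "spectral_form (sphere 0 1 \<inter> E n) (x + y) z = spectral_form (sphere 0 1 \<inter> E n) x z + spectral_form (sphere 0 1 \<inter> E n) y z"
      and g2: "spectral_form (sphere 0 1 \<inter> E n) (c *\<^sub>C x) y = c * spectral_form (sphere 0 1 \<inter> E n) x y"
      and g4: "spectral_form (sphere 0 1 \<inter> E n) x x = complex_of_real (measure (spectral_measure x) (sphere 0 1 \<inter> E n))" for n x y z c
      using union(3)[of n] unfolding psd_spectral_def by blast+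
    show ?case unfolding U psd_spectral_def
    proof (intro conjI allI)
      fix x y z c
      show "spectral_form (\<Union>i. sphere 0 1 \<inter> E i) (x + y) z = spectral_form (\<Union>i. sphere 0 1 \<inter> E i) x z + spectral_form (\<Union>i. sphere 0 1 \<inter> E i) y z"
        using sums_unique2[OF s[of "x + y" z]] sums_add[OF s[of x z] s[of y z]] g1 by simp
      show "spectral_form (\<Union>i. sphere 0 1 \<inter> E i) (c *\<^sub>C x) y = c * spectral_form (\<Union>i. sphere 0 1 \<inter> E i) x y"
        using sums_unique2[OF s[of "c *\<^sub>C x" y]] sums_mult[OF s[of x y], of c] g2 by simp
      have h: "(\<lambda>n. spectral_form (sphere 0 1 \<inter> E n) x y) = (\<lambda>n. cnj (spectral_form (sphere 0 1 \<inter> E n) y x))"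
        using union(3) unfolding psd_spectral_def by (intro ext) blast
      show "spectral_form (\<Union>i. sphere 0 1 \<inter> E i) x y = cnj (spectral_form (\<Union>i. sphere 0 1 \<inter> E i) y x)"
        using s[of x y] sums_cnj[THEN iffD2, OF s[of y x]] unfolding h by (rule sums_unique2)
      have "(\<lambda>n. complex_of_real (measure (spectral_measure x) (sphere 0 1 \<inter> E n))) sums complex_of_real (measure (spectral_measure x) (\<Union>i. sphere 0 1 \<inter> E i))"
        by (rule sums_of_real, rule finite_measure.finite_measure_UNION[OF finite_spectral_measure]) (simp_all only: E D sets_spectral_measure)
      then show "spectral_form (\<Union>i. sphere 0 1 \<inter> E i) x x = complex_of_real (measure (spectral_measure x) (\<Union>i. sphere 0 1 \<inter> E i))"
        using sums_unique2[OF s[of x x]] g4 by simp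
    qed
  qed
  moreover have "A \<in> sigma_sets UNIV {C. closed C}" "sphere 0 1 \<inter> A = A"
    using assms unfolding sb sets_sphere_borel by blast+
  ultimately show ?thesis by metis
qed

lemma psd_form_spectral_form: assumes "A \<in> sets sphere_borel" shows "psd_form (spectral_form A)"
proof -
  note g = psd_spectral_sets[OF assms, unfolded psd_spectral_def]
  show ?thesis
  proof
    show "0 \<le> Re (spectral_form A x x)" for x using g[THEN conjunct2, THEN conjunct2, THEN conjunct2] by simp
  qed (use g in blast)+
qed

lemma spectral_form_self: "A \<in> sets sphere_borel \<Longrightarrow> spectral_form A x x = complex_of_real (measure (spectral_measure x) A)"
  using psd_spectral_sets unfolding psd_spectral_def by blast

lemma mass_spectral_measure: "measure (spectral_measure x) (sphere 0 1) = Re (B x x)"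
proof -
  have "integral\<^sup>L (spectral_measure x) (\<lambda>_. 1 :: real) = L_diag x (\<lambda>_. 1)" by (rule integral_spectral_measure) simp
  then show ?thesis by (simp add: L_diag_def L_one space_spectral_measure)
qed

lemma measure_spectral_measure_le: "measure (spectral_measure x) A \<le> Re (B x x)"
  using finite_measure.bounded_measure[OF finite_spectral_measure, of x A] by (simp add: space_spectral_measure mass_spectral_measure)

text \<open>The first bound produces bounded operators. The second one dominates the complex measure
  by a finite positive measure, from which regularity will be inherited.\<close>

lemma spectral_form_bound:
  assumes "A \<in> sets sphere_borel"
  shows "cmod (spectral_form A x y) \<le> sqrt (Re (B x x)) * sqrt (Re (B y y))"
    and "cmod (spectral_form A x y) \<le> measure (spectral_measure x) A + measure (spectral_measure y) A"
proof -
  interpret b: psd_form "spectral_form A" by (rule psd_form_spectral_form[OF assms])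
  have cs: "cmod (spectral_form A x y) \<le> sqrt (measure (spectral_measure x) A) * sqrt (measure (spectral_measure y) A)"
    using b.Cauchy_Schwarz'[of x y] by (simp add: spectral_form_self[OF assms])
  also have "\<dots> \<le> sqrt (Re (B x x)) * sqrt (Re (B y y))"
    by (intro mult_mono real_sqrt_le_mono measure_spectral_measure_le) (auto simp: nonneg)
  finally show "cmod (spectral_form A x y) \<le> sqrt (Re (B x x)) * sqrt (Re (B y y))" .
  have "2 * (sqrt (measure (spectral_measure x) A) * sqrt (measure (spectral_measure y) A)) \<le> (sqrt (measure (spectral_measure x) A))\<^sup>2 + (sqrt (measure (spectral_measure y) A))\<^sup>2"
    using sum_squares_bound[of "sqrt (measure (spectral_measure x) A)" "sqrt (measure (spectral_measure y) A)"] by simp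
  then have "2 * (sqrt (measure (spectral_measure x) A) * sqrt (measure (spectral_measure y) A)) \<le> measure (spectral_measure x) A + measure (spectral_measure y) A" by simp
  moreover have "0 \<le> sqrt (measure (spectral_measure x) A) * sqrt (measure (spectral_measure y) A)" by simp
  ultimately show "cmod (spectral_form A x y) \<le> measure (spectral_measure x) A + measure (spectral_measure y) A" using cs by linarith
qed

end

section \<open>Regularity of complex measures dominated by a finite positive measure\<close>

lemma sphere_inner_regular:
  fixes \<nu> :: "(complex^'d) measure"
  assumes \<nu>: "finite_measure \<nu>" "sets \<nu> = sets sphere_borel" and E: "E \<in> sets sphere_borel" and e: "0 < e"
  obtains K where "compact K" "K \<subseteq> E" "measure \<nu> (E - K) < e"
proof -
  interpret finite_measure \<nu> by (rule \<nu>)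
  define M where "M = distr \<nu> borel (\<lambda>x. x)"
  have meas: "(\<lambda>x. x) \<in> measurable \<nu> borel"
    unfolding measurable_cong_sets[OF \<nu>(2) refl] sphere_borel_def by (rule measurable_restrict_space1) simp
  have EE: "E \<in> sets borel" "E \<subseteq> sphere 0 1" "E \<in> sets \<nu>" using E \<nu>(2) by (auto simp: sets_sphere_borel)
  have eM: "emeasure M A = emeasure \<nu> A" if "A \<in> sets borel" "A \<subseteq> sphere 0 1" for A
  proof -
    have "(\<lambda>x. x) -` A \<inter> space \<nu> = A" using that(2) sets_eq_sphere_borel(1)[OF \<nu>(2)] by auto
    then show ?thesis unfolding M_def using emeasure_distr[OF meas that(1)] by simp
  qed
  have fin: "emeasure M (space M) \<noteq> \<infinity>"
    unfolding M_def using finite_measure.finite_emeasure_space[OF finite_measure_distr[OF meas]] by simp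
  have reg: "emeasure M E = (SUP K\<in>{K. K \<subseteq> E \<and> compact K}. emeasure M K)"
    by (rule inner_regular[OF _ fin EE(1)]) (simp add: M_def)
  show ?thesis
  proof (cases "measure \<nu> E < e")
    case True
    then show ?thesis by (intro that[of "{}"]) auto
  next
    case False
    have "ennreal (measure \<nu> E - e / 2) < ennreal (measure \<nu> E)"
      using e False by (intro ennreal_lessI) auto
    also have "\<dots> = emeasure M E" using eM[OF EE(1,2)] by (simp add: emeasure_eq_measure)
    finally obtain K where K: "K \<subseteq> E" "compact K" "ennreal (measure \<nu> E - e / 2) < emeasure M K"
      unfolding reg less_SUP_iff by auto
    have Kb: "K \<in> sets borel" using K(2) by (intro borel_closed compact_imp_closed)
    have Ks: "K \<in> sets \<nu>" using Kb K(1) EE by (simp add: sets_eq_sphere_borel[OF \<nu>(2)])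
    have "ennreal (measure \<nu> E - e / 2) < ennreal (measure \<nu> K)"
      using K(3) eM[OF Kb] K(1) EE(2) by (simp add: emeasure_eq_measure)
    then have "measure \<nu> E - e / 2 < measure \<nu> K" by (rule ennreal_less_iff[THEN iffD1, rotated]) (use False e in simp)
    moreover have "measure \<nu> (E - K) = measure \<nu> E - measure \<nu> K"
      using EE(3) Ks K(1) by (intro finite_measure_Diff) auto
    ultimately show ?thesis using K e by (intro that[of K]) auto
  qed
qed

text \<open>Every partition of E is cut along K: the parts inside K are counted by the variation of
  K, and the parts outside are dominated by \<nu>.\<close>

lemma total_variation_split:
  assumes dom: "\<And>A. A \<in> sets M \<Longrightarrow> cmod (\<mu> A) \<le> measure \<nu> A" and \<nu>: "finite_measure \<nu>" "sets \<nu> = sets M"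
    and E: "E \<in> sets M" "K \<in> sets M" "K \<subseteq> E" and add: "\<And>A. A \<in> sets M \<Longrightarrow> \<mu> A = \<mu> (A \<inter> K) + \<mu> (A - K)"
  shows "total_variation M \<mu> E \<le> total_variation M \<mu> K + ennreal (measure \<nu> (E - K))"
  unfolding total_variation_def[of M \<mu> E]
proof (rule SUP_least)
  interpret finite_measure \<nu> by (rule \<nu>)
  fix A :: "nat \<Rightarrow> 'a set"
  assume "A \<in> {A. range A \<subseteq> sets M \<and> disjoint_family A \<and> (\<Union>n. A n) = E}"
  then have A: "\<And>n. A n \<in> sets M" "disjoint_family A" "(\<Union>n. A n) = E" by auto
  have "(\<Sum>n. ennreal (cmod (\<mu> (A n)))) \<le> (\<Sum>n. ennreal (cmod (\<mu> (A n \<inter> K))) + emeasure \<nu> (A n - K))"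
  proof (rule suminf_le[OF _ summableI summableI])
    fix n
    have "cmod (\<mu> (A n)) \<le> cmod (\<mu> (A n \<inter> K)) + cmod (\<mu> (A n - K))"
      using add[OF A(1)[of n]] norm_triangle_ineq by metis
    also have "\<dots> \<le> cmod (\<mu> (A n \<inter> K)) + measure \<nu> (A n - K)"
      using dom[of "A n - K"] A(1)[of n] E(2) by simp
    finally show "ennreal (cmod (\<mu> (A n))) \<le> ennreal (cmod (\<mu> (A n \<inter> K))) + emeasure \<nu> (A n - K)"
      by (simp add: emeasure_eq_measure ennreal_leI flip: ennreal_plus)
  qed
  also have "\<dots> = (\<Sum>n. ennreal (cmod (\<mu> (A n \<inter> K)))) + (\<Sum>n. emeasure \<nu> (A n - K))"
    by (rule suminf_add[symmetric]) auto
  also have "(\<Sum>n. emeasure \<nu> (A n - K)) = emeasure \<nu> (\<Union>n. A n - K)"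
    using A E \<nu>(2) by (intro suminf_emeasure) (auto simp: disjoint_family_on_def)
  also have "(\<Union>n. A n - K) = E - K" using A(3) by auto
  also have "emeasure \<nu> (E - K) = ennreal (measure \<nu> (E - K))" by (rule emeasure_eq_measure)
  also have "(\<Sum>n. ennreal (cmod (\<mu> (A n \<inter> K)))) + ennreal (measure \<nu> (E - K)) \<le> total_variation M \<mu> K + ennreal (measure \<nu> (E - K))"
    unfolding total_variation_def using A E
    by (intro add_right_mono SUP_upper2[of "\<lambda>n. A n \<inter> K"]) (auto simp: disjoint_family_on_def)
  finally show "(\<Sum>n. ennreal (cmod (\<mu> (A n)))) \<le> total_variation M \<mu> K + ennreal (measure \<nu> (E - K))" .
qed

text \<open>A partition of K becomes a partition of E when E - K is put in front of it.\<close>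

lemma total_variation_mono:
  assumes E: "E \<in> sets M" "K \<in> sets M" "K \<subseteq> E"
  shows "total_variation M \<mu> K \<le> total_variation M \<mu> E"
  unfolding total_variation_def[of M \<mu> K]
proof (rule SUP_least)
  fix A :: "nat \<Rightarrow> 'a set"
  assume "A \<in> {A. range A \<subseteq> sets M \<and> disjoint_family A \<and> (\<Union>n. A n) = K}"
  then have A: "\<And>n. A n \<in> sets M" "disjoint_family A" "(\<Union>n. A n) = K" by auto
  define A' where "A' n = (case n of 0 \<Rightarrow> E - K | Suc k \<Rightarrow> A k)" for n
  have "(\<Sum>n. ennreal (cmod (\<mu> (A n)))) = (\<Sum>n. ennreal (cmod (\<mu> (A' (Suc n)))))" by (simp add: A'_def)
  also have "\<dots> \<le> (\<Sum>n. ennreal (cmod (\<mu> (A' n))))"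
  proof (rule suminf_le_const[OF summableI])
    fix n
    have "(\<Sum>i<n. ennreal (cmod (\<mu> (A' (Suc i))))) = (\<Sum>i\<in>Suc ` {..<n}. ennreal (cmod (\<mu> (A' i))))"
      by (simp add: sum.reindex)
    also have "\<dots> \<le> (\<Sum>n. ennreal (cmod (\<mu> (A' n))))" by (rule sum_le_suminf) auto
    finally show "(\<Sum>i<n. ennreal (cmod (\<mu> (A' (Suc i))))) \<le> (\<Sum>n. ennreal (cmod (\<mu> (A' n))))" .
  qed
  also have "\<dots> \<le> total_variation M \<mu> E"
    unfolding total_variation_def
  proof (rule SUP_upper)
    have r: "A' n \<in> sets M" for n using A(1) E by (cases n) (auto simp: A'_def)
    have d: "A' m \<inter> A' n = {}" if "m < n" for m n
      using that A(2,3) by (cases m; cases n) (auto simp: A'_def disjoint_family_on_def)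
    have "disjoint_family A'" unfolding disjoint_family_on_def
      using d by (metis Int_commute linorder_neqE_nat)
    moreover have "(\<Union>n. A' n) = E"
    proof -
      have "x \<in> E" if "x \<in> A' n" for x n
        using that A(3) E(3) by (cases n) (auto simp: A'_def)
      moreover have "\<exists>n. x \<in> A' n" if "x \<in> E" for x
      proof (cases "x \<in> K")
        case True
        then obtain k where "x \<in> A k" using A(3) by blast
        then show ?thesis by (intro exI[of _ "Suc k"]) (simp add: A'_def)
      next
        case False
        then show ?thesis using that by (intro exI[of _ 0]) (simp add: A'_def)
      qed
      ultimately show ?thesis by blast
    qed
    ultimately show "A' \<in> {A. range A \<subseteq> sets M \<and> disjoint_family A \<and> (\<Union>n. A n) = E}" using r by auto
  qed
  finally show "(\<Sum>n. ennreal (cmod (\<mu> (A n)))) \<le> total_variation M \<mu> E" .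
qed

text \<open>E is approximated with respect to \<nu> from inside by compact sets, and from outside by
  removing from the sphere a compact subset of the complement of E.\<close>

lemma regular_if_dominated:
  fixes \<mu> :: "(complex^'d) set \<Rightarrow> complex"
  assumes cm: "complex_measure sphere_borel \<mu>"
    and dom: "\<And>A. A \<in> sets sphere_borel \<Longrightarrow> cmod (\<mu> A) \<le> measure \<nu> A"
    and \<nu>: "finite_measure \<nu>" "sets \<nu> = sets sphere_borel"
    and add: "\<And>A K. \<lbrakk>A \<in> sets sphere_borel; K \<in> sets sphere_borel\<rbrakk> \<Longrightarrow> \<mu> A = \<mu> (A \<inter> K) + \<mu> (A - K)"
  shows "regular_complex_measure sphere_borel \<mu>"
  unfolding regular_complex_measure_def
proof (intro conjI ballI cm)
  fix E :: "(complex^'d) set" assume E: "E \<in> sets sphere_borel"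
  let ?TV = "total_variation sphere_borel \<mu>"
  have Ks: "K \<in> sets sphere_borel" if "compact K" "K \<subseteq> E" for K
    using that E by (auto simp: sets_sphere_borel intro: borel_closed compact_imp_closed)
  show "?TV E = (SUP K\<in>{K. compact K \<and> K \<subseteq> E}. ?TV K)"
  proof (rule antisym)
    show "?TV E \<le> (SUP K\<in>{K. compact K \<and> K \<subseteq> E}. ?TV K)"
    proof (rule ennreal_le_epsilon)
      fix e :: real assume "0 < e"
      obtain K where K: "compact K" "K \<subseteq> E" "measure \<nu> (E - K) < e" using sphere_inner_regular[OF \<nu> E \<open>0 < e\<close>] by blast
      have "?TV E \<le> ?TV K + ennreal (measure \<nu> (E - K))"
        by (rule total_variation_split[OF dom \<nu> E Ks[OF K(1,2)] K(2)]) (assumption | rule add[OF _ Ks[OF K(1,2)]])+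
      also have "\<dots> \<le> (SUP K\<in>{K. compact K \<and> K \<subseteq> E}. ?TV K) + ennreal e"
        using K by (intro add_mono SUP_upper ennreal_leI) auto
      finally show "?TV E \<le> (SUP K\<in>{K. compact K \<and> K \<subseteq> E}. ?TV K) + ennreal e" .
    qed
    show "(SUP K\<in>{K. compact K \<and> K \<subseteq> E}. ?TV K) \<le> ?TV E"
      by (rule SUP_least) (use E Ks in \<open>auto intro: total_variation_mono\<close>)
  qed
  have Us: "U \<in> sets sphere_borel" if U: "openin (top_of_set (space sphere_borel)) U" for U :: "(complex^'d) set"
  proof -
    obtain T where "open T" "U = sphere 0 1 \<inter> T" using U by (auto simp: openin_open)
    then show ?thesis by (auto simp: sets_sphere_borel intro: borel_closed borel_open sets.Int)
  qed
  show "?TV E = (INF U\<in>{U. openin (top_of_set (space sphere_borel)) U \<and> E \<subseteq> U}. ?TV U)"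
  proof (rule antisym)
    show "?TV E \<le> (INF U\<in>{U. openin (top_of_set (space sphere_borel)) U \<and> E \<subseteq> U}. ?TV U)"
      by (rule INF_greatest) (use E Us in \<open>auto intro: total_variation_mono\<close>)
    show "(INF U\<in>{U. openin (top_of_set (space sphere_borel)) U \<and> E \<subseteq> U}. ?TV U) \<le> ?TV E"
    proof (rule ennreal_le_epsilon)
      fix e :: real assume "0 < e"
      have E': "sphere 0 1 - E \<in> sets sphere_borel" using sets.compl_sets[OF E] by simp
      obtain K where K: "compact K" "K \<subseteq> sphere 0 1 - E" "measure \<nu> ((sphere 0 1 - E) - K) < e"
        using sphere_inner_regular[OF \<nu> E' \<open>0 < e\<close>] by blast
      let ?U = "sphere 0 1 \<inter> (- K)"
      have U: "openin (top_of_set (space sphere_borel)) ?U"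
        using K(1) by (auto simp: openin_open intro!: exI[of _ "- K"] open_Compl compact_imp_closed)
      have EU: "E \<subseteq> ?U" using K(2) E by (auto simp: sets_sphere_borel)
      have "(INF U\<in>{U. openin (top_of_set (space sphere_borel)) U \<and> E \<subseteq> U}. ?TV U) \<le> ?TV ?U"
        using U EU by (intro INF_lower) auto
      also have "\<dots> \<le> ?TV E + ennreal (measure \<nu> (?U - E))"
        by (rule total_variation_split[OF dom \<nu> Us[OF U] E EU]) (assumption | rule add[OF _ E])+
      also have "?U - E = (sphere 0 1 - E) - K" by auto
      also have "?TV E + ennreal (measure \<nu> ((sphere 0 1 - E) - K)) \<le> ?TV E + ennreal e"
        using K(3) by (intro add_left_mono ennreal_leI) simp
      finally show "(INF U\<in>{U. openin (top_of_set (space sphere_borel)) U \<and> E \<subseteq> U}. ?TV U) \<le> ?TV E + ennreal e" .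
    qed
  qed
qed

text \<open>Equality of two differences of measures, written with sums so that it can be proved for
  nonnegative functions by the standard induction.\<close>

lemma nn_integral_sum_eq:
  assumes s: "sets a = sets M" "sets b = sets M" "sets c = sets M" "sets d = sets M"
    and eq: "\<And>A. A \<in> sets M \<Longrightarrow> emeasure a A + emeasure b A = emeasure c A + emeasure d A"
    and g: "g \<in> borel_measurable M"
  shows "(\<integral>\<^sup>+x. g x \<partial>a) + (\<integral>\<^sup>+x. g x \<partial>b) = (\<integral>\<^sup>+x. g x \<partial>c) + (\<integral>\<^sup>+x. g x \<partial>d)"
  using g
proof (induction rule: borel_measurable_induct)
  case (cong f g)
  have "(\<integral>\<^sup>+x. f x \<partial>N) = (\<integral>\<^sup>+x. g x \<partial>N)" if "sets N = sets M" for N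
    using cong(3) sets_eq_imp_space_eq[OF that] by (intro nn_integral_cong) simp
  then show ?case using cong s by simp
next
  case (set A)
  then show ?case using eq s by simp
next
  case (mult u c')
  have "u \<in> borel_measurable N" if "sets N = sets M" for N using mult(2) by (simp add: measurable_cong_sets[OF that refl])
  then show ?case using mult s by (simp add: nn_integral_cmult flip: distrib_left)
next
  case (add u v)
  have m: "u \<in> borel_measurable N" "v \<in> borel_measurable N" if "sets N = sets M" for N
    using add by (simp_all add: measurable_cong_sets[OF that refl])
  have "(\<integral>\<^sup>+x. v x + u x \<partial>N) = (\<integral>\<^sup>+x. v x \<partial>N) + (\<integral>\<^sup>+x. u x \<partial>N)" if "sets N = sets M" for N
    by (rule nn_integral_add) (use m[OF that] in auto)
  then show ?case using add.IH s by (simp add: ac_simps)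
next
  case (seq U)
  have m: "U i \<in> borel_measurable N" if "sets N = sets M" for N i
    using seq(1) by (simp add: measurable_cong_sets[OF that refl])
  have lim: "(\<integral>\<^sup>+x. (SUP i. U i) x \<partial>N) = (SUP i. \<integral>\<^sup>+x. U i x \<partial>N)" if "sets N = sets M" for N
    unfolding SUP_apply by (rule nn_integral_monotone_convergence_SUP) (use seq m[OF that] in auto)
  have inc: "incseq (\<lambda>i. \<integral>\<^sup>+x. U i x \<partial>N)" for N
    using seq by (auto simp: incseq_def le_fun_def intro!: nn_integral_mono)
  show ?case using seq.IH
    unfolding lim[OF s(1)] lim[OF s(2)] lim[OF s(3)] lim[OF s(4)]
    by (simp add: ennreal_SUP_add[OF inc inc, symmetric])
qed

text \<open>The real and imaginary parts of \<mu> determine \<nu>_0 - \<nu>_2 and \<nu>_1 - \<nu>_3,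
  hence the integrals of p against these differences. This makes the description in
  \<open>poisson_integral\<close> unambiguous.\<close>

lemma complex_measure_integral_unique:
  assumes c: "has_complex_measure_integral M \<mu> (\<lambda>x. complex_of_real (p x)) c"
    and c': "has_complex_measure_integral M \<mu> (\<lambda>x. complex_of_real (p x)) c'"
    and p: "p \<in> borel_measurable M" "\<And>x. x \<in> space M \<Longrightarrow> 0 \<le> p x"
  shows "c = c'"
proof -
  obtain \<nu> :: "nat \<Rightarrow> 'a measure" where n: "\<And>k. k < 4 \<Longrightarrow> finite_measure (\<nu> k) \<and> sets (\<nu> k) = sets M \<and> integrable (\<nu> k) (\<lambda>x. complex_of_real (p x))"
    "\<And>A. A \<in> sets M \<Longrightarrow> \<mu> A = (\<Sum>k<4. \<i> ^ k * complex_of_real (measure (\<nu> k) A))"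
    "c = (\<Sum>k<4. \<i> ^ k * integral\<^sup>L (\<nu> k) (\<lambda>x. complex_of_real (p x)))"
    using c unfolding has_complex_measure_integral_def by blast
  obtain \<nu>' :: "nat \<Rightarrow> 'a measure" where n': "\<And>k. k < 4 \<Longrightarrow> finite_measure (\<nu>' k) \<and> sets (\<nu>' k) = sets M \<and> integrable (\<nu>' k) (\<lambda>x. complex_of_real (p x))"
    "\<And>A. A \<in> sets M \<Longrightarrow> \<mu> A = (\<Sum>k<4. \<i> ^ k * complex_of_real (measure (\<nu>' k) A))"
    "c' = (\<Sum>k<4. \<i> ^ k * integral\<^sup>L (\<nu>' k) (\<lambda>x. complex_of_real (p x)))"
    using c' unfolding has_complex_measure_integral_def by blast
  have key: "integral\<^sup>L (\<nu> k) p - integral\<^sup>L (\<nu> l) p = integral\<^sup>L (\<nu>' k) p - integral\<^sup>L (\<nu>' l) p"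
    if kl: "k < 4" "l < 4" and eq: "\<And>A. A \<in> sets M \<Longrightarrow> measure (\<nu> k) A - measure (\<nu> l) A = measure (\<nu>' k) A - measure (\<nu>' l) A" for k l
  proof -
    have nn: "(\<integral>\<^sup>+x. ennreal (p x) \<partial>N) = ennreal (integral\<^sup>L N p) \<and> 0 \<le> integral\<^sup>L N p"
      if "sets N = sets M" "integrable N (\<lambda>x. complex_of_real (p x))" for N
    proof -
      have i: "integrable N p" using integrable_Re[OF that(2)] by simp
      have "0 \<le> p x" if "x \<in> space N" for x using p(2) that sets_eq_imp_space_eq[OF \<open>sets N = sets M\<close>] by simp
      then show ?thesis using nn_integral_eq_integral[OF i] by (auto intro!: Bochner_Integration.integral_nonneg)
    qed
    have "(\<integral>\<^sup>+x. ennreal (p x) \<partial>\<nu> k) + (\<integral>\<^sup>+x. ennreal (p x) \<partial>\<nu>' l) = (\<integral>\<^sup>+x. ennreal (p x) \<partial>\<nu>' k) + (\<integral>\<^sup>+x. ennreal (p x) \<partial>\<nu> l)"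
    proof (rule nn_integral_sum_eq[where M=M])
      fix A assume "A \<in> sets M"
      have e: "emeasure N A = ennreal (measure N A)" if "finite_measure N" for N :: "'a measure"
        using that by (rule finite_measure.emeasure_eq_measure)
      show "emeasure (\<nu> k) A + emeasure (\<nu>' l) A = emeasure (\<nu>' k) A + emeasure (\<nu> l) A"
        using eq[OF \<open>A \<in> sets M\<close>] n(1)[OF kl(1)] n(1)[OF kl(2)] n'(1)[OF kl(1)] n'(1)[OF kl(2)]
        by (simp add: e algebra_simps flip: ennreal_plus)
    qed (use n(1) n'(1) kl p(1) in auto)
    then show ?thesis using nn n(1)[OF kl(1)] n(1)[OF kl(2)] n'(1)[OF kl(1)] n'(1)[OF kl(2)]
      by (simp add: algebra_simps flip: ennreal_plus)
  qed
  have s4: "(\<Sum>k<4. \<i> ^ k * complex_of_real (f k)) = Complex (f 0 - f 2) (f 1 - f 3)" for f :: "nat \<Rightarrow> real"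
    by (simp add: eval_nat_numeral complex_eq_iff)
  have eqs: "measure (\<nu> 0) A - measure (\<nu> 2) A = measure (\<nu>' 0) A - measure (\<nu>' 2) A"
    "measure (\<nu> 1) A - measure (\<nu> 3) A = measure (\<nu>' 1) A - measure (\<nu>' 3) A" if "A \<in> sets M" for A
    using n(2)[OF that] n'(2)[OF that] unfolding s4 by simp_all
  have "c = Complex (integral\<^sup>L (\<nu> 0) p - integral\<^sup>L (\<nu> 2) p) (integral\<^sup>L (\<nu> 1) p - integral\<^sup>L (\<nu> 3) p)"
    unfolding n(3) integral_complex_of_real s4 ..
  moreover have "c' = Complex (integral\<^sup>L (\<nu>' 0) p - integral\<^sup>L (\<nu>' 2) p) (integral\<^sup>L (\<nu>' 1) p - integral\<^sup>L (\<nu>' 3) p)"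
    unfolding n'(3) integral_complex_of_real s4 ..
  ultimately show ?thesis using key[of 0 2] key[of 1 3] eqs by simp
qed

lemma poisson_kernel_nonneg: "norm z < 1 \<Longrightarrow> 0 \<le> poisson_kernel z \<zeta>"
  by (simp add: poisson_kernel_def power_le_one)

lemma continuous_on_poisson_kernel:
  assumes "norm z < 1" shows "continuous_on (sphere 0 1) (poisson_kernel z)"
proof -
  have "norm (z - \<zeta>) ^ (2 * CARD('a)) \<noteq> 0" if "\<zeta> \<in> sphere 0 1" for \<zeta> :: "complex^'a"
    using assms that by auto
  then show ?thesis unfolding poisson_kernel_def by (intro continuous_intros) auto
qed

section \<open>Compression to the coefficient space and the semispectral measure\<close>

locale bounded_spherical_isometry = spherical_isometry B T
  for B :: "'h::complex_inner \<Rightarrow> 'h \<Rightarrow> complex" and T :: "'d::finite \<Rightarrow> 'h \<Rightarrow> 'h" +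
  fixes C :: real and V :: "'m::complex_hilbert \<Rightarrow> 'h"
  assumes C: "0 \<le> C" "\<And>h. Re (B h h) \<le> C * (norm h)\<^sup>2" and V: "bounded_clinear V"
begin

lemma V_add: "V (a + b) = V a + V b" and V_scaleC: "V (c *\<^sub>C a) = c *\<^sub>C V a"
  using V by (simp_all add: bounded_clinear_add bounded_clinear_scaleC)

lemma sqrt_bound:
  obtains K where "0 \<le> K" "\<And>a. sqrt (Re (B (V a) (V a))) \<le> K * norm a"
proof -
  obtain k where k: "0 < k" "\<And>x. norm (V x) \<le> k * norm x" using bounded_clinear_bound[OF V] by blast
  show ?thesis
  proof (rule that[of "sqrt C * k"])
    show "0 \<le> sqrt C * k" using C(1) k(1) by simp
    fix a
    have "sqrt (Re (B (V a) (V a))) \<le> sqrt (C * (norm (V a))\<^sup>2)" using C(2) by (rule real_sqrt_le_mono)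
    also have "\<dots> = sqrt C * norm (V a)" by (simp add: real_sqrt_mult)
    also have "\<dots> \<le> sqrt C * (k * norm a)" using k(2) C(1) by (intro mult_left_mono) auto
    finally show "sqrt (Re (B (V a) (V a))) \<le> sqrt C * k * norm a" by simp
  qed
qed

lemma form_operator:
  assumes f: "psd_form G" and bd: "\<And>h k. cmod (G h k) \<le> c * (sqrt (Re (B h h)) * sqrt (Re (B k k)))" "0 \<le> c"
  obtains S where "bounded_clinear S" "\<And>a b. G (V a) (V b) = cinner (S a) b"
proof -
  interpret g: psd_form G by (rule f)
  obtain K where K: "0 \<le> K" "\<And>a. sqrt (Re (B (V a) (V a))) \<le> K * norm a" using sqrt_bound by blast
  have "\<exists>S. bounded_clinear S \<and> (\<forall>a b. G (V a) (V b) = cinner (S a) b)"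
  proof -
    obtain S where "bounded_clinear S" "\<And>a b. G (V a) (V b) = cinner (S a) b"
    proof (rule bounded_form_operator[of "\<lambda>a b. G (V a) (V b)" "c * K * K"])
      fix a b
      have "cmod (G (V a) (V b)) \<le> c * (sqrt (Re (B (V a) (V a))) * sqrt (Re (B (V b) (V b))))" by (rule bd(1))
      also have "\<dots> \<le> c * ((K * norm a) * (K * norm b))"
        using K bd(2) by (intro mult_left_mono mult_mono) (auto simp: nonneg)
      finally show "cmod (G (V a) (V b)) \<le> c * K * K * norm a * norm b" by (simp add: ac_simps)
    qed (use K bd(2) in \<open>auto simp: V_add V_scaleC g.add_left g.add_right g.scaleC_left g.scaleC_right\<close>)
    then show ?thesis by blast
  qed
  then show ?thesis using that by blast
qed

lemma semispectral_exists:
  obtains F where "semispectral_measure F" "\<And>A a b. A \<in> sets sphere_borel \<Longrightarrow> cinner (F A a) b = spectral_form A (V a) (V b)"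
proof -
  have "\<exists>S. bounded_clinear S \<and> (\<forall>a b. spectral_form A (V a) (V b) = cinner (S a) b)" if A: "A \<in> sets sphere_borel" for A
  proof -
    obtain S where "bounded_clinear S" "\<And>a b. spectral_form A (V a) (V b) = cinner (S a) b"
      using form_operator[OF psd_form_spectral_form[OF A], of 1] spectral_form_bound(1)[OF A] by auto
    then show ?thesis by blast
  qed
  then obtain F where F: "\<And>A. A \<in> sets sphere_borel \<Longrightarrow> bounded_clinear (F A)"
    "\<And>A a b. A \<in> sets sphere_borel \<Longrightarrow> spectral_form A (V a) (V b) = cinner (F A a) b"
    by metis
  have mu2: "measure (spectral_measure x) A = measure (spectral_measure x) (A \<inter> K) + measure (spectral_measure x) (A - K)"
    if "A \<in> sets sphere_borel" "K \<in> sets sphere_borel" for x A K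
    using finite_measure.finite_measure_Union[OF finite_spectral_measure, of "A \<inter> K" x "A - K"] that
    by (simp add: sets_spectral_measure sets.Int sets.Diff Int_Diff_Un Int_Diff_disjoint)
  have split: "spectral_form A h k = spectral_form (A \<inter> K) h k + spectral_form (A - K) h k"
    if "A \<in> sets sphere_borel" "K \<in> sets sphere_borel" for h k A K
    unfolding spectral_form_def mu2[OF that] by (simp add: ring_distribs sum.distrib add_divide_distrib)
  have "semispectral_measure F" unfolding semispectral_measure_def
  proof (intro conjI ballI allI impI)
    fix A :: "(complex^'d) set" assume A: "A \<in> sets sphere_borel"
    show "positive_op (F A)" unfolding positive_op_def
      using F(1)[OF A] by (auto simp: F(2)[OF A, symmetric] spectral_form_self[OF A])
    fix D x assume D: "D \<in> sets sphere_borel" "A \<inter> D = {}"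
    have "(A \<union> D) \<inter> A = A" "(A \<union> D) - A = D" using D(2) by auto
    then have "spectral_form (A \<union> D) h k = spectral_form A h k + spectral_form D h k" for h k
      using split[of "A \<union> D" A h k] A D by simp
    then show "F (A \<union> D) x = F A x + F D x"
      by (intro cinner_eqI') (simp add: cinner_add_left F(2)[symmetric] A D(1) sets.Un)
  next
    fix x y
    define h where "h = V x" define k where "k = V y"
    have dom: "cmod (cinner (F A x) y) \<le> measure (spectral_measure h) A + measure (spectral_measure k) A" if "A \<in> sets sphere_borel" for A
      unfolding F(2)[OF that, symmetric] h_def k_def by (rule spectral_form_bound(2)[OF that])
    \<comment> \<open>The sum of the spectral measures of h and k is the finite measure that
      dominates the complex measure at hand.\<close>
    define N where "N = measure_of (sphere 0 1) (sets sphere_borel) (\<lambda>A. emeasure (spectral_measure h) A + emeasure (spectral_measure k) A)"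
    have ss: "sets (sphere_borel :: (complex^'d) measure) \<subseteq> Pow (sphere 0 1)"
      using sets.space_closed[of "sphere_borel :: (complex^'d) measure"] by simp
    have sg: "sigma_sets (sphere 0 1) (sets (sphere_borel :: (complex^'d) measure)) = sets sphere_borel"
      using sets.sigma_sets_eq[of "sphere_borel :: (complex^'d) measure"] by simp
    have sN: "sets N = sets sphere_borel"
      unfolding N_def by (simp only: sets_measure_of[OF ss] sg)
    have N: "emeasure N A = emeasure (spectral_measure h) A + emeasure (spectral_measure k) A" if "A \<in> sets sphere_borel" for A
    proof (rule emeasure_measure_of[OF N_def])
      show "sets (sphere_borel :: (complex^'d) measure) \<subseteq> Pow (sphere 0 1)" by (rule ss)
      show "A \<in> sets N" using that sN by simp
      show "positive (sets N) (\<lambda>A. emeasure (spectral_measure h) A + emeasure (spectral_measure k) A)" by (simp add: positive_def)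
      show "countably_additive (sets N) (\<lambda>A. emeasure (spectral_measure h) A + emeasure (spectral_measure k) A)"
        unfolding countably_additive_def
      proof (intro allI impI)
        fix A :: "nat \<Rightarrow> (complex^'d) set"
        assume A: "range A \<subseteq> sets N" "disjoint_family A"
        then have "(\<Sum>i. emeasure (spectral_measure x) (A i)) = emeasure (spectral_measure x) (\<Union>i. A i)" for x
          by (intro suminf_emeasure) (simp_all add: sets_spectral_measure sN)
        then show "(\<Sum>i. emeasure (spectral_measure h) (A i) + emeasure (spectral_measure k) (A i)) = emeasure (spectral_measure h) (\<Union>i. A i) + emeasure (spectral_measure k) (\<Union>i. A i)"
          by (subst suminf_add[symmetric]) auto
      qed
    qed
    have em: "emeasure (spectral_measure u) A = ennreal (measure (spectral_measure u) A)" for u A by (rule finite_measure.emeasure_eq_measure[OF finite_spectral_measure])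
    have fN: "finite_measure N"
    proof (rule finite_measureI)
      have "space N \<in> sets sphere_borel" using sets.top[of N] sN by simp
      then show "emeasure N (space N) \<noteq> \<infinity>" by (simp add: N em flip: ennreal_plus)
    qed
    have mN: "measure N A = measure (spectral_measure h) A + measure (spectral_measure k) A" if "A \<in> sets sphere_borel" for A
      unfolding measure_def[of N] N[OF that] em by (simp flip: ennreal_plus)
    show "regular_complex_measure sphere_borel (\<lambda>A. cinner (F A x) y)"
    proof (rule regular_if_dominated[OF _ _ fN sN])
      show "complex_measure sphere_borel (\<lambda>A. cinner (F A x) y)" unfolding complex_measure_def
      proof (intro allI impI, elim conjE)
        fix A :: "nat \<Rightarrow> (complex^'d) set" assume A: "range A \<subseteq> sets sphere_borel" "disjoint_family A"
        have "(\<Union>n. A n) \<in> sets sphere_borel" using A(1) by (intro sets.countable_UN) auto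
        moreover have "A n \<in> sets sphere_borel" for n using A(1) by auto
        ultimately show "(\<lambda>n. cinner (F (A n) x) y) sums cinner (F (\<Union>n. A n) x) y"
          using spectral_form_sums[OF A, of "V x" "V y"] by (simp add: F(2)[symmetric])
      qed
      show "cmod (cinner (F A x) y) \<le> measure N A" if "A \<in> sets sphere_borel" for A
        using dom[OF that] mN[OF that] by simp
      show "cinner (F A x) y = cinner (F (A \<inter> K) x) y + cinner (F (A - K) x) y"
        if "A \<in> sets sphere_borel" "K \<in> sets sphere_borel" for A K
        using split[OF that] that by (simp add: F(2)[symmetric] sets.Int sets.Diff)
    qed
  qed
  then show ?thesis using F(2) by (intro that[of F]) auto
qed

text \<open>For |z| < 1 the kernel is continuous and nonnegative on the sphere, so \<open>L\<close>
  applied to it is a bounded semidefinite form; its compression by \<open>V\<close> is the operator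
  singled out by \<open>poisson_integral\<close>.\<close>

lemma poisson_integral_form:
  assumes F: "\<And>A a b. A \<in> sets sphere_borel \<Longrightarrow> cinner (F A a) b = spectral_form A (V a) (V b)" and z: "norm z < 1"
  shows "cinner (poisson_integral F z a) b = L (V a) (V b) (\<lambda>\<zeta>. complex_of_real (poisson_kernel z \<zeta>))"
proof -
  let ?p = "poisson_kernel z" and ?G = "\<lambda>h k. L h k (\<lambda>\<zeta>. complex_of_real (poisson_kernel z \<zeta>))"
  note cp = continuous_on_poisson_kernel[OF z] and p0 = poisson_kernel_nonneg[OF z]
  have form: "psd_form ?G" by (rule psd_form_L[OF cp p0])
  interpret g: psd_form ?G by (rule form)
  obtain c where c: "0 \<le> c" "\<And>\<zeta>. norm \<zeta> = 1 \<Longrightarrow> cmod (complex_of_real (?p \<zeta>)) \<le> c"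
    using L_domain_bound[OF L_domain_continuous_real[OF cp]] by blast
  have "cmod (?G h k) \<le> c * (sqrt (Re (B h h)) * sqrt (Re (B k k)))" for h k
    by (rule LIMSEQ_le_const2[OF tendsto_norm[OF L_tendsto[OF L_domain_continuous_real[OF cp]]]])
       (use L_approx_bound[OF c(2,1)] in \<open>auto simp: mult.assoc\<close>)
  then obtain S where S: "bounded_clinear S" "\<And>a b. ?G (V a) (V b) = cinner (S a) b"
    using form_operator[OF form _ c(1)] by blast
  have scale_m: "measure (spectral_measure (u *\<^sub>C x)) A = (cmod u)\<^sup>2 * measure (spectral_measure x) A" if A: "A \<in> sets sphere_borel" for u x A
  proof -
    interpret b: psd_form "spectral_form A" by (rule psd_form_spectral_form[OF A])
    have "complex_of_real (measure (spectral_measure (u *\<^sub>C x)) A) = complex_of_real ((cmod u)\<^sup>2 * measure (spectral_measure x) A)"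
      unfolding spectral_form_self[OF A, symmetric] b.scaleC_left b.scaleC_right
      by (simp add: spectral_form_self[OF A] complex_norm_square mult.assoc del: of_real_power)
    then show ?thesis by (simp only: of_real_eq_iff)
  qed
  have scale_i: "integral\<^sup>L (spectral_measure (u *\<^sub>C x)) ?p = (cmod u)\<^sup>2 * integral\<^sup>L (spectral_measure x) ?p" for u x
  proof -
    have "complex_of_real (L_diag (u *\<^sub>C x) ?p) = complex_of_real ((cmod u)\<^sup>2 * L_diag x ?p)"
      unfolding L_real[OF cp p0, symmetric] g.scaleC_left g.scaleC_right
      by (simp add: L_real[OF cp p0] complex_norm_square mult.assoc del: of_real_power)
    then show ?thesis unfolding integral_spectral_measure[OF cp] by (simp only: of_real_eq_iff)
  qed
  have has: "has_complex_measure_integral sphere_borel (\<lambda>A. cinner (F A a) b) (\<lambda>\<zeta>. complex_of_real (?p \<zeta>)) (?G (V a) (V b))" for a b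
    unfolding has_complex_measure_integral_def
  \<comment> \<open>The integral against a complex measure has no prefactor, so the 1 / 4 of
    polarization is absorbed by scaling the vectors by 1 / 2, which scales their measures by 1 /
    4.\<close>
  proof (intro exI[of _ "\<lambda>k. spectral_measure ((1/2) *\<^sub>C (V a + \<i> ^ k *\<^sub>C V b))"] conjI allI impI ballI)
    fix k :: nat
    show "finite_measure (spectral_measure ((1/2) *\<^sub>C (V a + \<i> ^ k *\<^sub>C V b)))" by (rule finite_spectral_measure)
    show "sets (spectral_measure ((1/2) *\<^sub>C (V a + \<i> ^ k *\<^sub>C V b))) = sets sphere_borel" by (rule sets_spectral_measure)
    show "integrable (spectral_measure ((1/2) *\<^sub>C (V a + \<i> ^ k *\<^sub>C V b))) (\<lambda>\<zeta>. complex_of_real (?p \<zeta>))"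
      by (rule integrable_of_real[OF integrable_spectral_measure[OF cp]])
  next
    fix A :: "(complex^'d) set" assume A: "A \<in> sets sphere_borel"
    show "cinner (F A a) b = (\<Sum>k<4. \<i> ^ k * complex_of_real (measure (spectral_measure ((1/2) *\<^sub>C (V a + \<i> ^ k *\<^sub>C V b))) A))"
      unfolding F[OF A] spectral_form_def scale_m[OF A] by (simp add: sum_divide_distrib power2_eq_square)
  next
    show "?G (V a) (V b) = (\<Sum>k<4. \<i> ^ k * integral\<^sup>L (spectral_measure ((1/2) *\<^sub>C (V a + \<i> ^ k *\<^sub>C V b))) (\<lambda>\<zeta>. complex_of_real (?p \<zeta>)))"
      unfolding integral_complex_of_real scale_i L_polar[OF cp p0, symmetric] by (simp add: sum_divide_distrib power2_eq_square)
  qed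
  have pm: "?p \<in> borel_measurable sphere_borel"
    unfolding sphere_borel_def by (rule borel_measurable_continuous_on_restrict[OF cp])
  have "poisson_integral F z = S" unfolding poisson_integral_def
  proof (rule the_equality)
    show "bounded_clinear S \<and> (\<forall>x y. has_complex_measure_integral sphere_borel (\<lambda>A. cinner (F A x) y) (\<lambda>\<zeta>. complex_of_real (?p \<zeta>)) (cinner (S x) y))"
      using S(1) has unfolding S(2) by blast
    fix S' assume "bounded_clinear S' \<and> (\<forall>x y. has_complex_measure_integral sphere_borel (\<lambda>A. cinner (F A x) y) (\<lambda>\<zeta>. complex_of_real (?p \<zeta>)) (cinner (S' x) y))"
    then have S': "has_complex_measure_integral sphere_borel (\<lambda>A. cinner (F A x) y) (\<lambda>\<zeta>. complex_of_real (?p \<zeta>)) (cinner (S' x) y)" for x y by blast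
    show "S' = S"
    proof (rule ext, rule cinner_eqI')
      fix x y
      show "cinner (S' x) y = cinner (S x) y"
        using complex_measure_integral_unique[OF S' has pm p0] by (simp add: S(2))
    qed
  qed
  then show ?thesis by (simp add: S(2))
qed

end

section \<open>Monomials and the Poisson kernel\<close>

text \<open>At \<alpha> j = 0 the truncated subtraction is harmless because the leading factor is
  0.\<close>

definition mpow_partial :: "'d::finite \<Rightarrow> ('d \<Rightarrow> nat) \<Rightarrow> complex^'d \<Rightarrow> complex" where
  "mpow_partial j \<alpha> z = of_nat (\<alpha> j) * mpow (\<alpha>(j := \<alpha> j - 1)) z"

text \<open>The complex factor c covers both real directions, 1 and \<i>, of a coordinate.\<close>

lemma mpow_line:
  "((\<lambda>t. mpow \<alpha> (z + t *\<^sub>R axis j c)) has_vector_derivative c * mpow_partial j \<alpha> z) (at 0)"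
proof -
  let ?r = "\<Prod>i\<in>UNIV - {j}. (z $ i) ^ \<alpha> i"
  have r: "(\<Prod>i\<in>UNIV - {j}. ((z + t *\<^sub>R axis j c) $ i) ^ \<alpha> i) = ?r" for t
    by (intro prod.cong) (auto simp: axis_def)
  have e: "mpow \<alpha> (z + t *\<^sub>R axis j c) = (z $ j + complex_of_real t * c) ^ \<alpha> j * ?r" for t
  proof -
    have "(z + t *\<^sub>R axis j c) $ j = z $ j + complex_of_real t * c" by (simp add: axis_def) (simp add: scaleR_conv_of_real)
    then show ?thesis using mpow_upd[of \<alpha> j "\<alpha> j" "z + t *\<^sub>R axis j c"] by (simp only: r fun_upd_triv)
  qed
  have "((\<lambda>w. (z $ j + w * c) ^ \<alpha> j * ?r) has_field_derivative of_nat (\<alpha> j) * (z $ j) ^ (\<alpha> j - 1) * c * ?r) (at (complex_of_real 0))"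
    by (auto intro!: derivative_eq_intros)
  from has_vector_derivative_real_field[OF this, of UNIV]
  have "((\<lambda>t. (z $ j + complex_of_real t * c) ^ \<alpha> j * ?r) has_vector_derivative of_nat (\<alpha> j) * (z $ j) ^ (\<alpha> j - 1) * c * ?r) (at 0)"
    by simp
  then show ?thesis unfolding e by (simp add: mpow_partial_def mpow_upd ac_simps)
qed

lemma mpow_partial_line:
  "((\<lambda>t. mpow_partial j \<alpha> (z + t *\<^sub>R axis j c)) has_vector_derivative c * (of_nat (\<alpha> j) * mpow_partial j (\<alpha>(j := \<alpha> j - 1)) z)) (at 0)"
proof -
  have "((\<lambda>t. of_nat (\<alpha> j) * mpow (\<alpha>(j := \<alpha> j - 1)) (z + t *\<^sub>R axis j c)) has_vector_derivative
      of_nat (\<alpha> j) * (c * mpow_partial j (\<alpha>(j := \<alpha> j - 1)) z)) (at 0)"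
    by (rule bounded_linear.has_vector_derivative[OF bounded_linear_mult_right mpow_line])
  then show ?thesis by (simp add: mpow_partial_def[of j \<alpha>] mult.left_commute)
qed

lemma mpow_partial_inc: "mpow_partial j (inc l \<alpha>) z = (if j = l then mpow \<alpha> z else 0) + z $ l * mpow_partial j \<alpha> z"
proof (cases "j = l")
  case True
  have "z $ l * mpow_partial l \<alpha> z = of_nat (\<alpha> l) * mpow \<alpha> z"
  proof (cases "\<alpha> l")
    case (Suc n)
    have "z $ l * mpow (\<alpha>(l := n)) z = mpow (\<alpha>(l := Suc n)) z" by (simp add: mpow_upd mult.assoc del: fun_upd_apply)
    also have "\<alpha>(l := Suc n) = \<alpha>" using Suc by (simp add: fun_upd_idem)
    finally have "z $ l * mpow (\<alpha>(l := n)) z = mpow \<alpha> z" .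
    then show ?thesis unfolding mpow_partial_def Suc diff_Suc_1 by (simp only: mult.left_commute[of "z $ l"])
  qed (simp add: mpow_partial_def)
  moreover have "mpow_partial l (inc l \<alpha>) z = of_nat (Suc (\<alpha> l)) * mpow \<alpha> z"
    unfolding mpow_partial_def by (simp add: inc_def)
  ultimately show ?thesis unfolding True by (simp add: ring_distribs)
next
  case False
  have "(inc l \<alpha>)(j := inc l \<alpha> j - 1) = inc l (\<alpha>(j := \<alpha> j - 1))"
    using False by (auto simp: inc_def fun_eq_iff)
  then show ?thesis using False by (simp add: mpow_partial_def inc_simps mpow_inc mult.left_commute)
qed

lemma continuous_on_mpow: "continuous_on S (mpow \<alpha>)"
  unfolding mpow_def by (intro continuous_intros)

lemma continuous_on_mpow_partial: "continuous_on S (mpow_partial j \<alpha>)"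
  unfolding mpow_partial_def by (intro continuous_intros continuous_on_mpow)

lemma mpow_bound: "norm z \<le> 1 \<Longrightarrow> cmod (mpow \<alpha> z) \<le> 1"
proof (induction \<alpha> rule: mindex_induct)
  case (inc \<alpha> j)
  then show ?case using Finite_Cartesian_Product.norm_nth_le[of z j]
    by (simp add: mpow_inc norm_mult mult_le_one)
qed (simp add: mpow_0)

lemma mpow_lipschitz:
  assumes "norm x \<le> 1" "norm y \<le> 1"
  shows "cmod (mpow \<alpha> x - mpow \<alpha> y) \<le> real (mindex_norm \<alpha>) * norm (x - y)"
proof (induction \<alpha> rule: mindex_induct)
  case (inc \<alpha> j)
  have "mpow (inc j \<alpha>) x - mpow (inc j \<alpha>) y = x $ j * (mpow \<alpha> x - mpow \<alpha> y) + (x - y) $ j * mpow \<alpha> y"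
    by (simp add: mpow_inc algebra_simps)
  also have "cmod \<dots> \<le> cmod (x $ j * (mpow \<alpha> x - mpow \<alpha> y)) + cmod ((x - y) $ j * mpow \<alpha> y)"
    by (rule norm_triangle_ineq)
  also have "\<dots> \<le> 1 * (real (mindex_norm \<alpha>) * norm (x - y)) + norm (x - y) * 1"
    unfolding norm_mult
    using inc assms Finite_Cartesian_Product.norm_nth_le[of x j] Finite_Cartesian_Product.norm_nth_le[of "x - y" j] mpow_bound[OF assms(2)]
    by (intro add_mono mult_mono) auto
  finally show ?case by (simp add: mindex_norm_inc algebra_simps)
qed (simp add: mpow_0)

lemma sum_Basis_vec:
  fixes g :: "complex^'d \<Rightarrow> 'b::comm_monoid_add"
  shows "(\<Sum>b\<in>Basis. g b) = (\<Sum>j\<in>UNIV. g (axis j 1) + g (axis j \<i>))"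
proof -
  have B: "(Basis :: (complex^'d) set) = (\<lambda>(j, c). axis j c) ` (UNIV \<times> {1, \<i>})"
    by (auto simp: Basis_vec_def Basis_complex_def)
  have inj: "inj_on (\<lambda>(j, c). axis j c) (UNIV \<times> {1, \<i>} :: ('d \<times> complex) set)"
    by (auto simp: inj_on_def axis_eq_axis)
  have "(\<Sum>b\<in>Basis. g b) = (\<Sum>(j, c)\<in>UNIV \<times> {1, \<i>}. g (axis j c))"
    unfolding B by (subst sum.reindex[OF inj]) (simp add: case_prod_beta)
  also have "\<dots> = (\<Sum>j\<in>UNIV. \<Sum>c\<in>{1, \<i>}. g (axis j c))" by (rule sum.cartesian_product[symmetric])
  finally show ?thesis by simp
qed

lemma sphere_pole_complex: "norm (\<zeta> :: complex^'d) = 1 \<Longrightarrow> sphere_pole \<zeta> CARD('d)"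
  by standard (auto simp: DIM_cart)

text \<open>The real derivative of z^\<alpha> times the conjugate of z^\<beta> in the radial
  direction z.\<close>

definition radial_part :: "('d::finite \<Rightarrow> nat) \<Rightarrow> ('d \<Rightarrow> nat) \<Rightarrow> complex^'d \<Rightarrow> complex" where
  "radial_part \<alpha> \<beta> z = (\<Sum>j\<in>UNIV. z $ j * mpow_partial j \<alpha> z * cnj (mpow \<beta> z) + mpow \<alpha> z * cnj (z $ j * mpow_partial j \<beta> z))"

text \<open>A quarter of the real Laplacian of z^\<alpha> times the conjugate of z^\<beta>; also the
  Dirichlet integrand of two monomials without its Poisson factor.\<close>

definition energy :: "('d::finite \<Rightarrow> nat) \<Rightarrow> ('d \<Rightarrow> nat) \<Rightarrow> complex^'d \<Rightarrow> complex" where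
  "energy \<alpha> \<beta> z = (\<Sum>j\<in>UNIV. mpow_partial j \<alpha> z * cnj (mpow_partial j \<beta> z))"

text \<open>The right-hand side is, up to a factor, the combination of a function, its radial derivative and
  its Laplacian that occurs in the Green identity for the Poisson kernel.\<close>

lemma sum_energy_inc:
  "(\<Sum>l\<in>UNIV. energy (inc l \<alpha>) (inc l \<beta>) z) - energy \<alpha> \<beta> z =
    of_nat CARD('d) * (mpow \<alpha> z * cnj (mpow \<beta> z)) + radial_part \<alpha> \<beta> z
      - complex_of_real (1 - z \<bullet> z) * energy \<alpha> (\<beta> :: 'd::finite \<Rightarrow> nat) z"
proof -
  let ?f = "mpow \<alpha> z" and ?k = "mpow \<beta> z" and ?a = "\<lambda>j. mpow_partial j \<alpha> z" and ?b = "\<lambda>j. mpow_partial j \<beta> z"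
  have zz: "complex_of_real (z \<bullet> z) = (\<Sum>l\<in>UNIV. z $ l * cnj (z $ l))"
    by (simp add: inner_vec_def complex_norm_square[symmetric] power2_norm_eq_inner[symmetric] del: of_real_power)
  have "energy (inc l \<alpha>) (inc l \<beta>) z = ?f * cnj ?k + ?f * cnj (z $ l * ?b l) + z $ l * ?a l * cnj ?k + z $ l * cnj (z $ l) * energy \<alpha> \<beta> z" for l
  proof -
    have "mpow_partial j (inc l \<alpha>) z * cnj (mpow_partial j (inc l \<beta>) z) =
       (if j = l then ?f * cnj ?k + ?f * cnj (z $ l * ?b l) + z $ l * ?a l * cnj ?k else 0) + z $ l * cnj (z $ l) * (?a j * cnj (?b j))" for j
      by (simp add: mpow_partial_inc algebra_simps)
    then show ?thesis by (simp add: energy_def sum.distrib sum_distrib_left)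
  qed
  then have "(\<Sum>l\<in>UNIV. energy (inc l \<alpha>) (inc l \<beta>) z) = of_nat CARD('d) * (?f * cnj ?k) + radial_part \<alpha> \<beta> z + (\<Sum>l\<in>UNIV. z $ l * cnj (z $ l)) * energy \<alpha> \<beta> z"
    by (simp add: radial_part_def sum.distrib sum_distrib_right)
  then show ?thesis unfolding of_real_diff zz by (simp add: algebra_simps)
qed

text \<open>The Green identity is about real functions; it is applied to the real part of \<kappa>
  z^\<alpha> (cnj z)^\<beta> with \<kappa> = 1 and \<kappa> = -\<i>, which gives the real and the
  imaginary part.\<close>

lemma integral_poisson_laplacian_mpow:
  fixes \<zeta> :: "complex^'d" and \<alpha> \<beta> :: "'d \<Rightarrow> nat"
  assumes \<zeta>: "norm \<zeta> = 1"
  defines "G \<equiv> \<lambda>z. of_nat CARD('d) * (mpow \<alpha> z * cnj (mpow \<beta> z)) + radial_part \<alpha> \<beta> z - complex_of_real (1 - z \<bullet> z) * energy \<alpha> \<beta> z"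
  shows "set_integrable lborel (ball 0 1) (\<lambda>z. complex_of_real (sphere_pole.poisson \<zeta> CARD('d) z) * G z)"
    and "(LINT z:ball 0 1|lborel. complex_of_real (sphere_pole.poisson \<zeta> CARD('d) z) * G z)
      = of_nat CARD('d) * (mpow \<alpha> \<zeta> * cnj (mpow \<beta> \<zeta>)) * complex_of_real (measure lborel (ball (0::complex^'d) 1))"
proof -
  interpret sphere_pole \<zeta> "CARD('d)" by (rule sphere_pole_complex[OF \<zeta>])
  let ?f = "mpow \<alpha>" and ?k = "mpow \<beta>" and ?a = "\<lambda>j. mpow_partial j \<alpha>" and ?b = "\<lambda>j. mpow_partial j \<beta>"
  let ?a2 = "\<lambda>j z. of_nat (\<alpha> j) * mpow_partial j (\<alpha>(j := \<alpha> j - 1)) z" and ?b2 = "\<lambda>j z. of_nat (\<beta> j) * mpow_partial j (\<beta>(j := \<beta> j - 1)) z"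
  define m where "m z = ?f z * cnj (?k z)" for z
  define m1 where "m1 j c z = c * ?a j z * cnj (?k z) + ?f z * cnj (c * ?b j z)" for j c z
  define m2 where "m2 j c z = c * (c * ?a2 j z) * cnj (?k z) + 2 * (c * cnj c) * ?a j z * cnj (?b j z) + ?f z * cnj (c * (c * ?b2 j z))" for j c z
  \<comment> \<open>The sum over all i makes this a function of the vector b; on
    \<open>axis j c\<close> only the term i = j survives.\<close>
  define M1 where "M1 b z = (\<Sum>i\<in>UNIV. m1 i (b $ i) z)" for b z
  define M2 where "M2 b z = (\<Sum>i\<in>UNIV. m2 i (b $ i) z)" for b z
  have M1: "M1 (axis j c) z = m1 j c z" for j c z
  proof -
    have "m1 i (axis j c $ i) z = (if i = j then m1 j c z else 0)" for i by (simp add: m1_def axis_def)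
    then show ?thesis by (simp add: M1_def)
  qed
  have M2: "M2 (axis j c) z = m2 j c z" for j c z
  proof -
    have "m2 i (axis j c $ i) z = (if i = j then m2 j c z else 0)" for i by (simp add: m2_def axis_def)
    then show ?thesis by (simp add: M2_def)
  qed
  have d1: "((\<lambda>t. m (z + t *\<^sub>R axis j c)) has_vector_derivative m1 j c z) (at 0)" for j c z
    unfolding m_def m1_def
    by (rule has_vector_derivative_eq_rhs[OF has_vector_derivative_mult[OF mpow_line bounded_linear.has_vector_derivative[OF bounded_linear_cnj mpow_line]]])
       (simp add: algebra_simps)
  have d2: "((\<lambda>t. m1 j c (z + t *\<^sub>R axis j c)) has_vector_derivative m2 j c z) (at 0)" for j c z
  proof -
    have A: "((\<lambda>t. c * ?a j (z + t *\<^sub>R axis j c)) has_vector_derivative c * (c * ?a2 j z)) (at 0)"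
      by (rule bounded_linear.has_vector_derivative[OF bounded_linear_mult_right mpow_partial_line])
    have Bd: "((\<lambda>t. c * ?b j (z + t *\<^sub>R axis j c)) has_vector_derivative c * (c * ?b2 j z)) (at 0)"
      by (rule bounded_linear.has_vector_derivative[OF bounded_linear_mult_right mpow_partial_line])
    show ?thesis unfolding m1_def m2_def
      by (rule has_vector_derivative_eq_rhs[OF has_vector_derivative_add[OF
            has_vector_derivative_mult[OF A bounded_linear.has_vector_derivative[OF bounded_linear_cnj mpow_line]]
            has_vector_derivative_mult[OF mpow_line bounded_linear.has_vector_derivative[OF bounded_linear_cnj Bd]]]])
         (simp add: algebra_simps)
  qed
  have cm: "continuous_on UNIV m" unfolding m_def by (intro continuous_intros continuous_on_mpow)
  have cM1: "continuous_on UNIV (M1 b)" for b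
    unfolding M1_def m1_def by (intro continuous_intros continuous_on_mpow continuous_on_mpow_partial)
  have cM2: "continuous_on UNIV (M2 b)" for b
    unfolding M2_def m2_def by (intro continuous_intros continuous_on_mpow continuous_on_mpow_partial)
  have rad: "(\<Sum>b\<in>Basis. complex_of_real (z \<bullet> b) * M1 b z) = radial_part \<alpha> \<beta> z" for z
    unfolding sum_Basis_vec M1 radial_part_def
  proof (intro sum.cong refl)
    fix j
    have e: "z $ j = complex_of_real (Re (z $ j)) + \<i> * complex_of_real (Im (z $ j))" by (rule complex_eq)
    have c: "cnj (z $ j * w) = (complex_of_real (Re (z $ j)) - \<i> * complex_of_real (Im (z $ j))) * cnj w" for w
      by (subst e) simp
    show "complex_of_real (z \<bullet> axis j 1) * m1 j 1 z + complex_of_real (z \<bullet> axis j \<i>) * m1 j \<i> z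
      = z $ j * ?a j z * cnj (?k z) + ?f z * cnj (z $ j * ?b j z)"
    proof -
      define x y where "x = Re (z $ j)" and "y = Im (z $ j)"
      have e': "z $ j = complex_of_real x + \<i> * complex_of_real y" unfolding x_def y_def by (rule e)
      have i: "z \<bullet> axis j 1 = x" "z \<bullet> axis j \<i> = y" by (simp_all add: inner_axis x_def y_def)
      show ?thesis unfolding i m1_def unfolding e' by (simp add: algebra_simps)
    qed
  qed
  \<comment> \<open>For c = 1 and c = \<i> the squares c^2 cancel, so the pure second derivatives
    drop out; the mixed terms, 2 from each direction, add up to the factor 4.\<close>
  have lap: "(\<Sum>b\<in>Basis. M2 b z) = 4 * energy \<alpha> \<beta> z" for z
    unfolding sum_Basis_vec M2 energy_def sum_distrib_left
    by (intro sum.cong refl) (simp add: m2_def algebra_simps)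
  have real_case: "set_integrable lborel (ball 0 1) (\<lambda>z. poisson z * Re (\<kappa> * (4 * G z))) \<and>
      (LINT z:ball 0 1|lborel. poisson z * Re (\<kappa> * (4 * G z))) = 4 * CARD('d) * Re (\<kappa> * m \<zeta>) * measure lborel (ball (0::complex^'d) 1)" if k: "cmod \<kappa> = 1" for \<kappa>
  proof -
    have e: "real (4 * CARD('d)) * Re (\<kappa> * m z) + 4 * (\<Sum>b\<in>Basis. (z \<bullet> b) * Re (\<kappa> * M1 b z)) - (1 - z \<bullet> z) * (\<Sum>b\<in>Basis. Re (\<kappa> * M2 b z))
        = Re (\<kappa> * (4 * G z))" for z
    proof -
      have s1: "(\<Sum>b\<in>Basis. (z \<bullet> b) * Re (\<kappa> * M1 b z)) = Re (\<kappa> * radial_part \<alpha> \<beta> z)"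
      proof -
        have "(z \<bullet> b) * Re (\<kappa> * M1 b z) = Re (\<kappa> * (complex_of_real (z \<bullet> b) * M1 b z))" for b by (simp add: algebra_simps)
        then show ?thesis unfolding rad[symmetric] sum_distrib_left Re_sum by simp
      qed
      have s2: "(\<Sum>b\<in>Basis. Re (\<kappa> * M2 b z)) = Re (\<kappa> * (4 * energy \<alpha> \<beta> z))"
        unfolding lap[symmetric] sum_distrib_left Re_sum ..
      show ?thesis unfolding s1 s2 G_def m_def by (simp add: algebra_simps)
    qed
    have blin: "bounded_linear (\<lambda>w. Re (\<kappa> * w))"
      by (rule bounded_linear_compose[OF bounded_linear_Re bounded_linear_mult_right])
    have basis: "\<exists>j c. b = axis j c" if "b \<in> Basis" for b :: "complex^'d" using that by (auto simp: Basis_vec_def)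
    have D1: "((\<lambda>t. Re (\<kappa> * m (z + t *\<^sub>R b))) has_real_derivative Re (\<kappa> * M1 b z)) (at 0)" if "b \<in> Basis" for b z
      using basis[OF that] bounded_linear.has_vector_derivative[OF blin d1]
      by (auto simp: M1 has_real_derivative_iff_has_vector_derivative)
    have D2: "((\<lambda>t. Re (\<kappa> * M1 b (z + t *\<^sub>R b))) has_real_derivative Re (\<kappa> * M2 b z)) (at 0)" if "b \<in> Basis" for b z
      using basis[OF that] bounded_linear.has_vector_derivative[OF blin d2]
      by (auto simp: M1 M2 has_real_derivative_iff_has_vector_derivative)
    have lip: "\<bar>Re (\<kappa> * m z) - Re (\<kappa> * m \<zeta>)\<bar> \<le> real (mindex_norm \<alpha> + mindex_norm \<beta>) * norm (z - \<zeta>)" if z: "norm z \<le> 1" for z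
    proof -
      have z1: "norm \<zeta> \<le> 1" using \<zeta> by simp
      have "\<bar>Re (\<kappa> * m z) - Re (\<kappa> * m \<zeta>)\<bar> \<le> cmod (\<kappa> * (m z - m \<zeta>))"
        using abs_Re_le_cmod[of "\<kappa> * (m z - m \<zeta>)"] by (simp add: right_diff_distrib)
      also have "\<dots> = cmod ((?f z - ?f \<zeta>) * cnj (?k z) + ?f \<zeta> * cnj (?k z - ?k \<zeta>))"
        unfolding norm_mult k m_def by (simp add: algebra_simps)
      also have "\<dots> \<le> cmod ((?f z - ?f \<zeta>) * cnj (?k z)) + cmod (?f \<zeta> * cnj (?k z - ?k \<zeta>))" by (rule norm_triangle_ineq)
      also have "\<dots> \<le> (real (mindex_norm \<alpha>) * norm (z - \<zeta>)) * 1 + 1 * (real (mindex_norm \<beta>) * norm (z - \<zeta>))"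
        unfolding norm_mult complex_mod_cnj
        by (intro add_mono mult_mono mpow_lipschitz mpow_bound z z1) auto
      finally show ?thesis by (simp add: algebra_simps)
    qed
    have c0: "continuous_on UNIV (\<lambda>z. Re (\<kappa> * m z))" by (intro continuous_intros cm)
    have c1: "continuous_on UNIV (\<lambda>z. Re (\<kappa> * M1 b z))" and c2: "continuous_on UNIV (\<lambda>z. Re (\<kappa> * M2 b z))" for b
      by (intro continuous_intros cM1 cM2)+
    note r = integral_poisson_laplacian[where u="\<lambda>z. Re (\<kappa> * m z)" and ?u1.0="\<lambda>b z. Re (\<kappa> * M1 b z)" and ?u2.0="\<lambda>b z. Re (\<kappa> * M2 b z)",
        OF D1 D2 c0 c1 c2 lip, unfolded e]
    show ?thesis using r by blast
  qed
  let ?P = "\<lambda>z. complex_of_real (poisson z) * G z" and ?v = "measure lborel (ball (0::complex^'d) 1)"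
  have re: "set_integrable lborel (ball 0 1) (\<lambda>z. Re (?P z))" "(LINT z:ball 0 1|lborel. Re (?P z)) = CARD('d) * Re (m \<zeta>) * ?v"
  proof -
    have e4: "poisson z * Re (1 * (4 * G z)) = 4 * Re (?P z)" for z by simp
    show "set_integrable lborel (ball 0 1) (\<lambda>z. Re (?P z))" "(LINT z:ball 0 1|lborel. Re (?P z)) = CARD('d) * Re (m \<zeta>) * ?v"
      using real_case[OF norm_one] unfolding e4 by (simp_all add: set_integral_mult_right)
  qed
  have im: "set_integrable lborel (ball 0 1) (\<lambda>z. Im (?P z))" "(LINT z:ball 0 1|lborel. Im (?P z)) = CARD('d) * Im (m \<zeta>) * ?v"
  proof -
    have e4: "poisson z * Re (- \<i> * (4 * G z)) = 4 * Im (?P z)" for z by simp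
    have n1: "cmod (- \<i>) = 1" by simp
    show "set_integrable lborel (ball 0 1) (\<lambda>z. Im (?P z))" "(LINT z:ball 0 1|lborel. Im (?P z)) = CARD('d) * Im (m \<zeta>) * ?v"
      using real_case[OF n1] unfolding e4 by (simp_all add: set_integral_mult_right)
  qed
  have e: "indicator (ball 0 1) z *\<^sub>R ?P z = complex_of_real (indicator (ball 0 1) z *\<^sub>R Re (?P z)) + \<i> * complex_of_real (indicator (ball 0 1) z *\<^sub>R Im (?P z))" for z
    by (cases "z \<in> ball 0 1") (simp_all add: complex_eq_iff)
  have i: "integrable lborel (\<lambda>z. complex_of_real (indicator (ball 0 1) z *\<^sub>R Re (?P z)))" "integrable lborel (\<lambda>z. \<i> * complex_of_real (indicator (ball 0 1) z *\<^sub>R Im (?P z)))"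
    by (rule integrable_of_real[OF re(1)[unfolded set_integrable_def]],
        rule integrable_mult_right[OF integrable_of_real[OF im(1)[unfolded set_integrable_def]]])
  show "set_integrable lborel (ball 0 1) ?P"
    unfolding set_integrable_def e by (rule Bochner_Integration.integrable_add[OF i])
  have "(LINT z:ball 0 1|lborel. ?P z) = complex_of_real (CARD('d) * Re (m \<zeta>) * ?v) + \<i> * complex_of_real (CARD('d) * Im (m \<zeta>) * ?v)"
    unfolding re(2)[symmetric] im(2)[symmetric] unfolding set_lebesgue_integral_def e Bochner_Integration.integral_add[OF i]
    by (simp only: integral_mult_right_zero integral_complex_of_real)
  also have "\<dots> = of_nat CARD('d) * m \<zeta> * complex_of_real ?v"
    by (simp add: complex_eq_iff)
  finally show "(LINT z:ball 0 1|lborel. ?P z) = of_nat CARD('d) * (mpow \<alpha> \<zeta> * cnj (mpow \<beta> \<zeta>)) * complex_of_real ?v"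
    unfolding m_def .
qed

section \<open>The Hardy norm\<close>

lemma monomial_eq: "monomial \<alpha> x z = mpow \<alpha> z *\<^sub>C x"
  by (simp add: monomial_def mpow_def)

lemma mpow_torus:
  fixes \<alpha> :: "'d::finite \<Rightarrow> nat"
  shows "mpow \<alpha> (\<chi> j. complex_of_real r * cis (2 * pi * real (t j) / real R)) = complex_of_real r ^ mindex_norm \<alpha> * cnj (torus_char R t \<alpha>)"
proof -
  have "mpow \<alpha> (\<chi> j. complex_of_real r * cis (2 * pi * real (t j) / real R))
    = (\<Prod>j\<in>UNIV. complex_of_real r ^ \<alpha> j) * (\<Prod>j\<in>UNIV. cis (2 * pi * real (t j) / real R) ^ \<alpha> j)"
    by (simp add: mpow_def power_mult_distrib prod.distrib)
  also have "(\<Prod>j\<in>UNIV. cis (2 * pi * real (t j) / real R) ^ \<alpha> j) = cnj (torus_char R t \<alpha>)"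
    by (simp add: torus_char_def Complex.DeMoivre cis_cnj ac_simps)
  finally show ?thesis by (simp add: mindex_norm_def power_sum)
qed

text \<open>The coefficient is isolated by averaging over a finite grid on a torus.\<close>

lemma power_series_coeff_zero:
  fixes g :: "('d::finite \<Rightarrow> nat) \<Rightarrow> complex"
  assumes sum0: "\<And>z::complex^'d. norm z < 1 \<Longrightarrow> ((\<lambda>\<alpha>. g \<alpha> * mpow \<alpha> z) has_sum 0) UNIV"
  shows "g \<beta> = 0"
proof -
  \<comment> \<open>If all d coordinates have modulus r, then |z| <= d r = 1 / 2, so the torus lies
    inside the ball.\<close>
  define r :: real where "r = 1 / (2 * real CARD('d))"
  have r: "0 < r" by (simp add: r_def)
  define pt :: "nat \<Rightarrow> ('d \<Rightarrow> nat) \<Rightarrow> complex^'d" where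
    "pt R t = (\<chi> j. complex_of_real r * cis (2 * pi * real (t j) / real R))" for R t
  have pt: "norm (pt R t) < 1" for R t
  proof -
    have "norm (pt R t) \<le> (\<Sum>j\<in>UNIV. norm (pt R t $ j))"
      unfolding norm_vec_def by (rule L2_set_le_sum) simp
    also have "\<dots> = 1 / 2" using r by (simp add: pt_def norm_mult) (simp add: r_def)
    finally show ?thesis by simp
  qed
  define a where "a \<alpha> = cmod (g \<alpha>) * r ^ mindex_norm \<alpha>" for \<alpha>
  have "(\<lambda>\<alpha>. g \<alpha> * mpow \<alpha> (pt 1 (\<lambda>_. 0))) summable_on UNIV"
    using sum0[OF pt] has_sum_imp_summable by blast
  then have "(\<lambda>\<alpha>. norm (g \<alpha> * mpow \<alpha> (pt 1 (\<lambda>_. 0)))) summable_on UNIV"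
    by (simp only: summable_on_iff_abs_summable_on_complex)
  moreover have "norm (g \<alpha> * mpow \<alpha> (pt 1 (\<lambda>_. 0))) = a \<alpha>" for \<alpha>
    unfolding pt_def mpow_torus using r by (simp add: a_def torus_char_def norm_mult norm_power)
  ultimately have as: "a summable_on UNIV" by simp
  have a0: "0 \<le> a \<alpha>" for \<alpha> using r by (simp add: a_def)
  have "a \<beta> \<le> e" if e: "0 < e" for e
  proof -
    have hs: "(a has_sum infsum a UNIV) UNIV" using as by simp
    then obtain F where F: "finite F" "dist (sum a F) (infsum a UNIV) \<le> e"
      using has_sum_finite_approximation[OF hs e] by blast
    define G where "G = insert \<beta> F"
    have fG: "finite G" and bG: "\<beta> \<in> G" using F by (simp_all add: G_def)
    have tail: "(a has_sum (infsum a UNIV - sum a G)) (UNIV - G)"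
      using fG by (intro has_sum_Diff hs has_sum_finite) auto
    have "sum a F \<le> sum a G" using F a0 by (intro sum_mono2) (auto simp: G_def)
    then have tail_le: "infsum a UNIV - sum a G \<le> e" using F(2) by (auto simp: dist_real_def)
    \<comment> \<open>R exceeds every entry of an index in G, so on G the average isolates \<beta>.
      Indices outside G may alias with \<beta>, but their contribution is controlled by the tail of
      the series.\<close>
    define R where "R = Suc (\<Sum>p\<in>G. \<Sum>i\<in>UNIV. p i)"
    have R: "p i < R" if "p \<in> G" for p i
    proof -
      have "p i \<le> (\<Sum>i\<in>UNIV. p i)" by (rule member_le_sum) auto
      also have "\<dots> \<le> (\<Sum>p\<in>G. \<Sum>i\<in>UNIV. p i)" using that fG by (intro member_le_sum[of p G "\<lambda>p. \<Sum>i\<in>UNIV. p i"]) auto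
      finally show ?thesis by (simp add: R_def)
    qed
    define h where "h \<alpha> = (\<Sum>t\<in>torus R. torus_char R t \<beta> * (g \<alpha> * mpow \<alpha> (pt R t)))" for \<alpha>
    have h: "h \<alpha> = (\<Sum>t\<in>torus R. torus_char R t \<beta> * cnj (torus_char R t \<alpha>)) * (g \<alpha> * complex_of_real r ^ mindex_norm \<alpha>)" for \<alpha>
      unfolding h_def pt_def mpow_torus sum_distrib_right by (simp add: ac_simps)
    have "((\<lambda>\<alpha>. \<Sum>t\<in>S. torus_char R t \<beta> * (g \<alpha> * mpow \<alpha> (pt R t))) has_sum (\<Sum>t\<in>S. torus_char R t \<beta> * 0)) UNIV" if "finite S" for S
      using that
    proof (induction S)
      case (insert t S)
      then show ?case using has_sum_add[OF has_sum_cmult_right[OF sum0[OF pt]] insert.IH, of "torus_char R t \<beta>" R t] by simp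
    qed simp
    from this[OF finite_torus] have h0: "(h has_sum 0) UNIV" unfolding h_def by simp
    have sep: "\<bar>int (p i) - int (q i)\<bar> < int R" if "p \<in> G" "q \<in> G" for p q i
      using R[OF that(1), of i] R[OF that(2), of i] by linarith
    have hG: "h \<alpha> = (if \<alpha> = \<beta> then of_nat (R ^ CARD('d)) * (g \<beta> * complex_of_real r ^ mindex_norm \<beta>) else 0)" if "\<alpha> \<in> G" for \<alpha>
      unfolding h using torus_char_orthogonal[of \<beta> \<alpha> R] sep[OF bG that] by auto
    have "sum h G = (\<Sum>\<alpha>\<in>G. if \<alpha> = \<beta> then of_nat (R ^ CARD('d)) * (g \<beta> * complex_of_real r ^ mindex_norm \<beta>) else 0)"
      by (rule sum.cong[OF refl hG])
    also have "\<dots> = of_nat (R ^ CARD('d)) * (g \<beta> * complex_of_real r ^ mindex_norm \<beta>)" using fG bG by simp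
    finally have sG: "cmod (sum h G) = real (R ^ CARD('d)) * a \<beta>"
      using r by (simp add: a_def norm_mult norm_power)
    have "(h has_sum (0 - sum h G)) (UNIV - G)"
      using fG by (intro has_sum_Diff h0 has_sum_finite) auto
    then have hd: "(h has_sum (- sum h G)) (UNIV - G)" by simp
    have hb: "cmod (h \<alpha>) \<le> real (R ^ CARD('d)) * a \<alpha>" for \<alpha>
    proof -
      have "cmod (\<Sum>t\<in>torus R. torus_char R t \<beta> * cnj (torus_char R t \<alpha>)) \<le> (\<Sum>t\<in>(torus R :: ('d \<Rightarrow> nat) set). 1)"
        by (rule sum_norm_le) (simp add: norm_mult torus_char_def prod_norm[symmetric])
      also have "\<dots> = real (R ^ CARD('d))"
      proof -
        have "(torus R :: ('d \<Rightarrow> nat) set) = PiE UNIV (\<lambda>_. {..<R})" by (auto simp: torus_def)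
        then show ?thesis by (simp add: card_PiE)
      qed
      finally show ?thesis unfolding h norm_mult a_def using r by (simp add: norm_power mult_right_mono)
    qed
    have hs1: "(\<lambda>\<alpha>. real (R ^ CARD('d)) * a \<alpha>) summable_on (UNIV - G)"
      by (intro summable_on_cmult_right has_sum_imp_summable[OF tail])
    have hs2: "(\<lambda>\<alpha>. norm (h \<alpha>)) summable_on (UNIV - G)"
      by (rule summable_on_comparison_test[OF hs1]) (use hb in auto)
    have "cmod (- sum h G) \<le> infsum (\<lambda>\<alpha>. norm (h \<alpha>)) (UNIV - G)"
      by (rule norm_has_sum_bound[OF _ hd]) (use hs2 in simp)
    also have "\<dots> \<le> infsum (\<lambda>\<alpha>. real (R ^ CARD('d)) * a \<alpha>) (UNIV - G)"
      by (rule infsum_mono[OF hs2 hs1 hb])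
    also have "\<dots> = real (R ^ CARD('d)) * (infsum a UNIV - sum a G)"
      by (rule infsumI[OF has_sum_cmult_right[OF tail]])
    also have "\<dots> \<le> real (R ^ CARD('d)) * e" using tail_le by (intro mult_left_mono) auto
    finally have "real (R ^ CARD('d)) * a \<beta> \<le> real (R ^ CARD('d)) * e" using sG by simp
    moreover have "0 < R" by (simp add: R_def)
    then have "0 < real (R ^ CARD('d))" by simp
    ultimately show ?thesis by (simp only: mult_le_cancel_left_pos)
  qed
  then have "a \<beta> \<le> 0" using field_le_epsilon[of "a \<beta>" 0] by auto
  then have "a \<beta> = 0" using a0[of \<beta>] by linarith
  then show ?thesis using r by (simp add: a_def)
qed

text \<open>Uniqueness gives \<open>power_coeff\<close> its meaning; pairing with a vector y reduces
  it to scalar series.\<close>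

lemma power_coeff_eqI:
  fixes f :: "complex^'d \<Rightarrow> 'm::complex_inner"
  assumes a: "\<And>z. norm z < 1 \<Longrightarrow> ((\<lambda>\<alpha>. monomial \<alpha> (a \<alpha>) z) has_sum f z) UNIV"
  shows "power_coeff f = a"
  unfolding power_coeff_def
proof (rule the_equality)
  show "\<forall>z\<in>ball 0 1. ((\<lambda>\<alpha>. monomial \<alpha> (a \<alpha>) z) has_sum f z) UNIV" using a by simp
  fix b assume b: "\<forall>z\<in>ball 0 1. ((\<lambda>\<alpha>. monomial \<alpha> (b \<alpha>) z) has_sum f z) UNIV"
  have "cinner (b \<beta>) y = cinner (a \<beta>) y" for \<beta> y
  proof -
    have "cinner (b \<beta>) y - cinner (a \<beta>) y = 0"
    proof (rule power_series_coeff_zero[where g="\<lambda>\<alpha>. cinner (b \<alpha>) y - cinner (a \<alpha>) y"])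
      fix z :: "complex^'d" assume z: "norm z < 1"
      have bl: "bounded_linear (\<lambda>x :: 'm. cinner x y)"
        by (rule bounded_bilinear.bounded_linear_left[OF bounded_bilinear_cinner_real])
      have "((\<lambda>\<alpha>. cinner (monomial \<alpha> (c \<alpha>) z) y) has_sum cinner (f z) y) UNIV"
        if "((\<lambda>\<alpha>. monomial \<alpha> (c \<alpha>) z) has_sum f z) UNIV" for c
        using has_sum_bounded_linear[OF bl that] by (simp add: o_def)
      from has_sum_add[OF this[of b] has_sum_cmult_right[OF this[of a], of "- 1"]]
      have "((\<lambda>\<alpha>. cinner (monomial \<alpha> (b \<alpha>) z) y - cinner (monomial \<alpha> (a \<alpha>) z) y) has_sum 0) UNIV"
        using a b z by simp
      then show "((\<lambda>\<alpha>. (cinner (b \<alpha>) y - cinner (a \<alpha>) y) * mpow \<alpha> z) has_sum 0) UNIV"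
        by (simp add: monomial_eq cinner_scaleC_left algebra_simps)
    qed
    then show ?thesis by simp
  qed
  then show "b = a" using cinner_eqI' by blast
qed

text \<open>The squared norm of z^\<alpha> in the scalar Hardy space of the ball.\<close>

definition hardy_weight :: "('d::finite \<Rightarrow> nat) \<Rightarrow> real" where
  "hardy_weight \<alpha> = real (mindex_fact \<alpha>) * fact (CARD('d) - 1) / fact (mindex_norm \<alpha> + CARD('d) - 1)"

lemma hardy_weight_nonneg: "0 \<le> hardy_weight \<alpha>"
  by (simp add: hardy_weight_def)

text \<open>The factors \<alpha>_l + 1 from \<open>mindex_fact_inc\<close> add up to |\<alpha>| + d,
  which cancels the last factor of the factorial in the denominator. This is why the Hardy parts
  disappear from the shift identity.\<close>

lemma sum_hardy_weight_inc: "(\<Sum>l\<in>UNIV. hardy_weight (inc l \<alpha>)) = hardy_weight (\<alpha> :: 'd::finite \<Rightarrow> nat)"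
proof -
  obtain n where n: "CARD('d) = Suc n" using zero_less_card_finite[where 'a='d] by (metis gr0_implies_Suc)
  define c :: real where "c = real (mindex_fact \<alpha>) * fact n / fact (Suc (mindex_norm \<alpha> + n))"
  have "hardy_weight (inc l \<alpha>) = (1 + real (\<alpha> l)) * c" for l
    by (simp add: hardy_weight_def mindex_fact_inc mindex_norm_inc n c_def ring_distribs del: fact_Suc)
  then have "(\<Sum>l\<in>UNIV. hardy_weight (inc l \<alpha>)) = (real CARD('d) + real (mindex_norm \<alpha>)) * c"
    by (simp add: sum_distrib_right[symmetric] sum.distrib mindex_norm_def)
  also have "\<dots> = hardy_weight \<alpha>"
    unfolding n by (simp add: c_def hardy_weight_def n divide_simps del: of_nat_Suc)
  finally show ?thesis .
qed

lemma hardy_norm_sq_two_monomials: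
  fixes \<alpha> \<beta> :: "'d::finite \<Rightarrow> nat"
  shows "hardy_norm_sq (\<lambda>z. monomial \<alpha> u z + c *\<^sub>C monomial \<beta> v z) = ennreal
    (if \<alpha> = \<beta> then (norm (u + c *\<^sub>C v))\<^sup>2 * hardy_weight \<alpha>
     else (norm u)\<^sup>2 * hardy_weight \<alpha> + (norm (c *\<^sub>C v))\<^sup>2 * hardy_weight \<beta>)"
proof -
  let ?a = "\<lambda>\<gamma>. (if \<gamma> = \<alpha> then u else 0) + (if \<gamma> = \<beta> then c *\<^sub>C v else 0)"
  have one: "((\<lambda>\<gamma>. monomial \<gamma> (if \<gamma> = \<delta> then w else 0) z) has_sum monomial \<delta> w z) UNIV" for \<delta> :: "'d \<Rightarrow> nat" and w :: 'a and z
    by (rule has_sum_finite_neutralI[where B="{\<delta>}"]) (auto simp: monomial_eq)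
  have "power_coeff (\<lambda>z. monomial \<alpha> u z + c *\<^sub>C monomial \<beta> v z) = ?a"
  proof (rule power_coeff_eqI)
    fix z :: "complex^'d"
    have "((\<lambda>\<gamma>. monomial \<gamma> (if \<gamma> = \<alpha> then u else 0) z + monomial \<gamma> (if \<gamma> = \<beta> then c *\<^sub>C v else 0) z)
        has_sum (monomial \<alpha> u z + monomial \<beta> (c *\<^sub>C v) z)) UNIV"
      by (rule has_sum_add[OF one one])
    then show "((\<lambda>\<gamma>. monomial \<gamma> (?a \<gamma>) z) has_sum (monomial \<alpha> u z + c *\<^sub>C monomial \<beta> v z)) UNIV"
      by (simp add: monomial_eq scaleC_add_right scaleC_scaleC mult.commute)
  qed
  then have "hardy_norm_sq (\<lambda>z. monomial \<alpha> u z + c *\<^sub>C monomial \<beta> v z)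
    = (\<Sum>\<^sub>\<infinity>\<gamma>. ennreal ((norm (?a \<gamma>))\<^sup>2 * hardy_weight \<gamma>))"
    by (simp add: hardy_norm_sq_def hardy_weight_def)
  also have "\<dots> = (\<Sum>\<gamma>\<in>{\<alpha>, \<beta>}. ennreal ((norm (?a \<gamma>))\<^sup>2 * hardy_weight \<gamma>))"
    by (rule infsumI, rule has_sum_finite_neutralI) auto
  also have "\<dots> = ennreal (\<Sum>\<gamma>\<in>{\<alpha>, \<beta>}. (norm (?a \<gamma>))\<^sup>2 * hardy_weight \<gamma>)"
    by (rule sum_ennreal) (simp add: hardy_weight_nonneg)
  finally show ?thesis by (auto simp: hardy_weight_nonneg)
qed

text \<open>For different indices the bracket does not depend on k, and the four powers of \<i> add
  up to 0.\<close>

lemma hardy_polarization: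
  fixes \<alpha> \<beta> :: "'d::finite \<Rightarrow> nat"
  shows "(\<Sum>k<4. \<i> ^ k * complex_of_real
    (if \<alpha> = \<beta> then (norm (u + \<i> ^ k *\<^sub>C v))\<^sup>2 * hardy_weight \<alpha>
     else (norm u)\<^sup>2 * hardy_weight \<alpha> + (norm (\<i> ^ k *\<^sub>C v))\<^sup>2 * hardy_weight \<beta>)) / 4
    = (if \<alpha> = \<beta> then complex_of_real (hardy_weight \<alpha>) * cinner u v else 0)"
proof (cases "\<alpha> = \<beta>")
  case True
  have "cinner u v = (\<Sum>k<4. \<i> ^ k * complex_of_real ((norm (u + \<i> ^ k *\<^sub>C v))\<^sup>2)) / 4"
    unfolding cinner_self[symmetric] by (rule cinner.polarization)
  moreover have "(\<Sum>k<4. \<i> ^ k * complex_of_real ((norm (u + \<i> ^ k *\<^sub>C v))\<^sup>2 * w))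
      = complex_of_real w * (\<Sum>k<4. \<i> ^ k * complex_of_real ((norm (u + \<i> ^ k *\<^sub>C v))\<^sup>2))" for w
    by (simp only: sum_distrib_left of_real_mult ac_simps)
  ultimately show ?thesis using True by simp
next
  case False
  have "norm (\<i> ^ k *\<^sub>C v) = norm v" for k by (simp add: norm_power)
  then show ?thesis using False by (simp add: eval_nat_numeral)
qed

section \<open>The Dirichlet form\<close>

lemma has_derivative_mpow:
  fixes z :: "complex^'d"
  shows "(mpow \<alpha> has_derivative (\<lambda>h. \<Sum>j\<in>UNIV. mpow_partial j \<alpha> z * h $ j)) (at z)"
proof (induction \<alpha> rule: mindex_induct)
  case zero
  have "mpow (\<lambda>_. 0) = (\<lambda>z::complex^'d. 1)" by (rule ext) (rule mpow_0)
  then show ?case by (simp add: mpow_partial_def)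
next
  case (inc \<alpha> l)
  have "((\<lambda>z. z $ l * mpow \<alpha> z) has_derivative (\<lambda>h. z $ l * (\<Sum>j\<in>UNIV. mpow_partial j \<alpha> z * h $ j) + h $ l * mpow \<alpha> z)) (at z)"
    by (rule has_derivative_mult[OF bounded_linear_imp_has_derivative[OF bounded_linear_vec_nth] inc])
  moreover have "(\<lambda>z. z $ l * mpow \<alpha> z) = mpow (inc l \<alpha>)" by (rule ext) (simp add: mpow_inc)
  moreover have "z $ l * (\<Sum>j\<in>UNIV. mpow_partial j \<alpha> z * h $ j) + h $ l * mpow \<alpha> z = (\<Sum>j\<in>UNIV. mpow_partial j (inc l \<alpha>) z * h $ j)" for h
    by (simp add: mpow_partial_inc ring_distribs sum.distrib sum_distrib_left mult.assoc mult_delta_left mult.commute[of "h $ l"])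
  ultimately show ?case by simp
qed

lemma complex_partial_two_monomials:
  fixes z :: "complex^'d"
  shows "complex_partial j (\<lambda>z. monomial \<alpha> u z + c *\<^sub>C monomial \<beta> v z) z = mpow_partial j \<alpha> z *\<^sub>C u + (c * mpow_partial j \<beta> z) *\<^sub>C v"
proof -
  have bl: "bounded_linear (\<lambda>c. c *\<^sub>C w)" for w :: "'a"
    by (rule bounded_bilinear.bounded_linear_left[OF bounded_bilinear_scaleC])
  have "((\<lambda>z. mpow \<alpha> z *\<^sub>C u + mpow \<beta> z *\<^sub>C (c *\<^sub>C v)) has_derivative
      (\<lambda>h. (\<Sum>j\<in>UNIV. mpow_partial j \<alpha> z * h $ j) *\<^sub>C u + (\<Sum>j\<in>UNIV. mpow_partial j \<beta> z * h $ j) *\<^sub>C (c *\<^sub>C v))) (at z)"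
    by (intro has_derivative_add bounded_linear.has_derivative[OF bl] has_derivative_mpow)
  moreover have "(\<lambda>z. monomial \<alpha> u z + c *\<^sub>C monomial \<beta> v z) = (\<lambda>z. mpow \<alpha> z *\<^sub>C u + mpow \<beta> z *\<^sub>C (c *\<^sub>C v))"
    by (simp add: monomial_eq scaleC_scaleC mult.commute)
  ultimately have "((\<lambda>z. monomial \<alpha> u z + c *\<^sub>C monomial \<beta> v z) has_derivative
      (\<lambda>h. (\<Sum>j\<in>UNIV. mpow_partial j \<alpha> z * h $ j) *\<^sub>C u + (\<Sum>j\<in>UNIV. mpow_partial j \<beta> z * h $ j) *\<^sub>C (c *\<^sub>C v))) (at z)"
    by simp
  from frechet_derivative_at[OF this, symmetric] have "frechet_derivative (\<lambda>z. monomial \<alpha> u z + c *\<^sub>C monomial \<beta> v z) (at z)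
      = (\<lambda>h. (\<Sum>j\<in>UNIV. mpow_partial j \<alpha> z * h $ j) *\<^sub>C u + (\<Sum>j\<in>UNIV. mpow_partial j \<beta> z * h $ j) *\<^sub>C (c *\<^sub>C v))" .
  moreover have "(\<Sum>i\<in>UNIV. mpow_partial i \<gamma> z * axis j 1 $ i) = mpow_partial j \<gamma> z" for \<gamma>
    by (simp add: axis_def mult_delta_right)
  ultimately show ?thesis by (simp add: complex_partial_def scaleC_scaleC mult.commute[of c])
qed

lemma poisson_kernel_eq_poisson:
  fixes z \<zeta> :: "complex^'d"
  assumes "norm \<zeta> = 1"
  shows "poisson_kernel z \<zeta> = sphere_pole.poisson \<zeta> CARD('d) z"
  by (simp add: sphere_pole.poisson_def[OF sphere_pole_complex[OF assms]] poisson_kernel_def inv_kernel_def power_mult power2_norm_eq_inner)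

text \<open>Exhibits the Dirichlet integrand as a combination of four products of an energy with a
  value of the form; their integrability follows from \<open>poisson_form_fubini\<close>.\<close>

lemma psd_energy:
  assumes "psd_form G"
  shows "(\<Sum>j\<in>UNIV. G (mpow_partial j \<alpha> z *\<^sub>C h + (c * mpow_partial j \<beta> z) *\<^sub>C k) (mpow_partial j \<alpha> z *\<^sub>C h + (c * mpow_partial j \<beta> z) *\<^sub>C k))
    = energy \<alpha> \<alpha> z * G h h + cnj c * (energy \<alpha> \<beta> z * G h k) + c * (energy \<beta> \<alpha> z * G k h) + c * cnj c * (energy \<beta> \<beta> z * G k k)"
proof -
  interpret G: psd_form G by (rule assms)
  have "G (mpow_partial j \<alpha> z *\<^sub>C h + (c * mpow_partial j \<beta> z) *\<^sub>C k) (mpow_partial j \<alpha> z *\<^sub>C h + (c * mpow_partial j \<beta> z) *\<^sub>C k)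
    = mpow_partial j \<alpha> z * cnj (mpow_partial j \<alpha> z) * G h h + cnj c * (mpow_partial j \<alpha> z * cnj (mpow_partial j \<beta> z) * G h k)
      + c * (mpow_partial j \<beta> z * cnj (mpow_partial j \<alpha> z) * G k h) + c * cnj c * (mpow_partial j \<beta> z * cnj (mpow_partial j \<beta> z) * G k k)" for j
    unfolding G.add_left G.add_right G.scaleC_left G.scaleC_right complex_cnj_mult by (simp only: ring_distribs ac_simps)
  then show ?thesis
    by (simp only: energy_def sum.distrib sum_distrib_left[symmetric] sum_distrib_right[symmetric])
qed

lemma psd_energy_polarization:
  assumes "psd_form G"
  shows "(\<Sum>n<4. \<i> ^ n * (\<Sum>j\<in>UNIV. G (mpow_partial j \<alpha> z *\<^sub>C h + (\<i> ^ n * mpow_partial j \<beta> z) *\<^sub>C k) (mpow_partial j \<alpha> z *\<^sub>C h + (\<i> ^ n * mpow_partial j \<beta> z) *\<^sub>C k))) / 4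
    = energy \<alpha> \<beta> z * G h k"
proof -
  interpret G: psd_form G by (rule assms)
  have "mpow_partial j \<alpha> z * cnj (mpow_partial j \<beta> z) * G h k = (\<Sum>n<4. \<i> ^ n * G (mpow_partial j \<alpha> z *\<^sub>C h + (\<i> ^ n * mpow_partial j \<beta> z) *\<^sub>C k) (mpow_partial j \<alpha> z *\<^sub>C h + (\<i> ^ n * mpow_partial j \<beta> z) *\<^sub>C k)) / 4" for j
    using G.polarization[of "mpow_partial j \<alpha> z *\<^sub>C h" "mpow_partial j \<beta> z *\<^sub>C k"]
    by (simp only: G.scaleC_left G.scaleC_right scaleC_scaleC mult.assoc mult.left_commute[of "mpow_partial j \<alpha> z" "cnj (mpow_partial j \<beta> z)"])
  then have "energy \<alpha> \<beta> z * G h k = (\<Sum>j\<in>UNIV. (\<Sum>n<4. \<i> ^ n * G (mpow_partial j \<alpha> z *\<^sub>C h + (\<i> ^ n * mpow_partial j \<beta> z) *\<^sub>C k) (mpow_partial j \<alpha> z *\<^sub>C h + (\<i> ^ n * mpow_partial j \<beta> z) *\<^sub>C k)) / 4)"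
    unfolding energy_def sum_distrib_right by (rule sum.cong[OF refl])
  also have "\<dots> = (\<Sum>n<4. \<i> ^ n * (\<Sum>j\<in>UNIV. G (mpow_partial j \<alpha> z *\<^sub>C h + (\<i> ^ n * mpow_partial j \<beta> z) *\<^sub>C k) (mpow_partial j \<alpha> z *\<^sub>C h + (\<i> ^ n * mpow_partial j \<beta> z) *\<^sub>C k))) / 4"
    unfolding sum_divide_distrib[symmetric] sum_distrib_left by (subst sum.swap) simp
  finally show ?thesis by simp
qed

lemma continuous_on_energy: "continuous_on S (energy \<alpha> \<beta>)"
  unfolding energy_def by (intro continuous_intros continuous_on_mpow_partial)

lemma borel_measurable_poisson_kernel:
  "(\<lambda>(\<zeta>, z :: complex^'d). poisson_kernel z \<zeta>) \<in> borel_measurable (borel \<Otimes>\<^sub>M borel)"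
  unfolding poisson_kernel_def by measurable

section \<open>Exchanging the integrals over the ball and over the sphere\<close>

context spherical_isometry
begin

text \<open>Fubini applies because for every \<zeta> the kernel is nonnegative on the ball and its
  integral is the volume of the ball: this bound is uniform in \<zeta>, and the spectral measure is
  finite.\<close>

lemma poisson_fubini:
  fixes \<phi> :: "complex^'d \<Rightarrow> complex"
  assumes \<phi>: "continuous_on UNIV \<phi>"
  shows "set_integrable lborel (ball 0 1) (\<lambda>z. \<phi> z * complex_of_real (integral\<^sup>L (spectral_measure x) (poisson_kernel z)))"
    and "(LINT z:ball 0 1|lborel. \<phi> z * complex_of_real (integral\<^sup>L (spectral_measure x) (poisson_kernel z)))
      = (\<integral>\<zeta>. (LINT z:ball 0 1|lborel. complex_of_real (sphere_pole.poisson \<zeta> CARD('d) z) * \<phi> z) \<partial>spectral_measure x)"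
proof -
  interpret n: finite_measure "spectral_measure x" by (rule finite_spectral_measure)
  interpret p: pair_sigma_finite "spectral_measure x" "lborel :: (complex^'d) measure" ..
  define f where "f \<zeta> z = indicator (ball 0 1) z *\<^sub>R (complex_of_real (poisson_kernel z \<zeta>) * \<phi> z)" for \<zeta> z
  have "bounded (\<phi> ` cball 0 1)"
    by (rule compact_imp_bounded[OF compact_continuous_image[OF continuous_on_subset[OF \<phi>]]]) auto
  then obtain C where C: "0 < C" "\<And>z. norm z \<le> 1 \<Longrightarrow> cmod (\<phi> z) \<le> C"
    by (auto simp: bounded_pos)
  have id: "(\<lambda>\<zeta>. \<zeta>) \<in> spectral_measure x \<rightarrow>\<^sub>M borel"
    unfolding measurable_cong_sets[OF sets_spectral_measure refl] sphere_borel_def by (rule measurable_restrict_space1) simp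
  have mp: "(\<lambda>p. (fst p, snd p)) \<in> spectral_measure x \<Otimes>\<^sub>M lborel \<rightarrow>\<^sub>M borel \<Otimes>\<^sub>M borel"
    by (rule measurable_Pair[OF measurable_compose[OF measurable_fst id]]) simp
  have mk: "(\<lambda>p. poisson_kernel (snd p) (fst p)) \<in> borel_measurable (spectral_measure x \<Otimes>\<^sub>M (lborel :: (complex^'d) measure))"
    using measurable_compose[OF mp borel_measurable_poisson_kernel] by simp
  have m\<phi>: "\<phi> \<in> borel_measurable borel" by (rule borel_measurable_continuous_onI[OF \<phi>])
  have mf: "case_prod f \<in> borel_measurable (spectral_measure x \<Otimes>\<^sub>M lborel)"
  proof -
    have "(\<lambda>p. \<phi> (snd p)) \<in> borel_measurable (spectral_measure x \<Otimes>\<^sub>M lborel)"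
      using m\<phi> by (intro measurable_compose[OF measurable_snd]) simp
    moreover have "(\<lambda>p. indicat_real (ball 0 1) (snd p)) \<in> borel_measurable (spectral_measure x \<Otimes>\<^sub>M (lborel :: (complex^'d) measure))"
      by (intro measurable_compose[OF measurable_snd] borel_measurable_indicator) simp
    moreover have "(\<lambda>p. complex_of_real (poisson_kernel (snd p) (fst p))) \<in> borel_measurable (spectral_measure x \<Otimes>\<^sub>M (lborel :: (complex^'d) measure))"
      by (rule measurable_compose[OF mk borel_measurable_continuous_onI]) (intro continuous_intros)
    ultimately show ?thesis unfolding f_def case_prod_beta
      by (intro borel_measurable_scaleR borel_measurable_times)
  qed
  have fb: "norm (f \<zeta> z) \<le> C * (indicator (ball 0 1) z *\<^sub>R sphere_pole.poisson \<zeta> CARD('d) z)" if "norm \<zeta> = 1" for \<zeta> z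
  proof (cases "z \<in> ball 0 1")
    case True
    then have "cmod (\<phi> z) * poisson_kernel z \<zeta> \<le> C * poisson_kernel z \<zeta>"
      by (intro mult_right_mono C poisson_kernel_nonneg) auto
    then show ?thesis using True poisson_kernel_nonneg[of z \<zeta>]
      by (simp add: f_def norm_mult poisson_kernel_eq_poisson[OF that] mult.commute)
  qed (simp add: f_def)
  have sph: "norm \<zeta> = 1" if "\<zeta> \<in> space (spectral_measure x)" for \<zeta> using that by (simp add: space_spectral_measure)
  have int1: "integrable lborel (f \<zeta>)" and le1: "(\<integral>z. norm (f \<zeta> z) \<partial>lborel) \<le> C * measure lborel (ball (0::complex^'d) 1)"
    if \<zeta>: "\<zeta> \<in> space (spectral_measure x)" for \<zeta>
  proof -
    interpret s: sphere_pole \<zeta> "CARD('d)" by (rule sphere_pole_complex[OF sph[OF \<zeta>]])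
    have m: "f \<zeta> \<in> borel_measurable lborel"
      using measurable_compose[OF measurable_Pair1'[OF \<zeta>] mf] by simp
    have i: "integrable lborel (\<lambda>z. C * (indicator (ball 0 1) z *\<^sub>R s.poisson z))"
      using s.set_integrable_poisson unfolding set_integrable_def by simp
    show g: "integrable lborel (f \<zeta>)"
      by (rule Bochner_Integration.integrable_bound[OF i m]) (use fb[OF sph[OF \<zeta>]] in \<open>auto intro!: AE_I2 order_trans[OF _ abs_ge_self]\<close>)
    have "(\<integral>z. norm (f \<zeta> z) \<partial>lborel) \<le> (\<integral>z. C * (indicator (ball 0 1) z *\<^sub>R s.poisson z) \<partial>lborel)"
      by (rule integral_mono[OF integrable_norm[OF g] i fb[OF sph[OF \<zeta>]]])
    also have "\<dots> = C * (LINT z:ball 0 1|lborel. s.poisson z)"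
      unfolding set_lebesgue_integral_def by simp
    finally show "(\<integral>z. norm (f \<zeta> z) \<partial>lborel) \<le> C * measure lborel (ball (0::complex^'d) 1)" unfolding s.integral_poisson .
  qed
  have int: "integrable (spectral_measure x \<Otimes>\<^sub>M lborel) (case_prod f)"
  proof (rule p.Fubini_integrable[OF mf])
    have m: "(\<lambda>\<zeta>. \<integral>z. norm (f \<zeta> z) \<partial>lborel) \<in> borel_measurable (spectral_measure x)"
      using mf by (intro lborel.borel_measurable_lebesgue_integral) (simp add: case_prod_beta)
    have "integrable (spectral_measure x) (\<lambda>\<zeta>. \<integral>z. norm (f \<zeta> z) \<partial>lborel)"
      by (rule n.integrable_const_bound[where B="C * measure lborel (ball (0::complex^'d) 1)", OF _ m])
         (use le1 in \<open>auto intro!: AE_I2\<close>)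
    then show "integrable (spectral_measure x) (\<lambda>\<zeta>. \<integral>z. norm (case (\<zeta>, z) of (\<zeta>, z) \<Rightarrow> f \<zeta> z) \<partial>lborel)" by simp
    show "AE \<zeta> in spectral_measure x. integrable lborel (\<lambda>z. case (\<zeta>, z) of (\<zeta>, z) \<Rightarrow> f \<zeta> z)"
      using int1 by (intro AE_I2) auto
  qed
  have e: "(\<integral>\<zeta>. f \<zeta> z \<partial>spectral_measure x) = indicator (ball 0 1) z *\<^sub>R (\<phi> z * complex_of_real (integral\<^sup>L (spectral_measure x) (poisson_kernel z)))" for z
    unfolding f_def by (simp add: integral_complex_of_real mult.commute[of _ "\<phi> z"] mult.left_commute[of _ "\<phi> z"])
  show "set_integrable lborel (ball 0 1) (\<lambda>z. \<phi> z * complex_of_real (integral\<^sup>L (spectral_measure x) (poisson_kernel z)))"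
    unfolding set_integrable_def e[symmetric] by (rule p.integrable_snd[OF int])
  have "(LINT z:ball 0 1|lborel. \<phi> z * complex_of_real (integral\<^sup>L (spectral_measure x) (poisson_kernel z))) = (\<integral>z. (\<integral>\<zeta>. f \<zeta> z \<partial>spectral_measure x) \<partial>lborel)"
    unfolding set_lebesgue_integral_def e ..
  also have "\<dots> = (\<integral>\<zeta>. (\<integral>z. f \<zeta> z \<partial>lborel) \<partial>spectral_measure x)" by (rule p.Fubini_integral[OF int])
  also have "\<dots> = (\<integral>\<zeta>. (LINT z:ball 0 1|lborel. complex_of_real (sphere_pole.poisson \<zeta> CARD('d) z) * \<phi> z) \<partial>spectral_measure x)"
    unfolding set_lebesgue_integral_def f_def
    by (rule Bochner_Integration.integral_cong[OF refl]) (simp add: poisson_kernel_eq_poisson sph)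
  finally show "(LINT z:ball 0 1|lborel. \<phi> z * complex_of_real (integral\<^sup>L (spectral_measure x) (poisson_kernel z))) = \<dots>" .
qed

text \<open>\<open>L_polar\<close> covers nonnegative functions; adding a bound C of |f| reduces the
  general case to it.\<close>

lemma L_polar_real:
  assumes f: "continuous_on (sphere 0 1) f"
  shows "(\<Sum>j<4. \<i> ^ j * complex_of_real (integral\<^sup>L (spectral_measure (h + \<i> ^ j *\<^sub>C k)) f)) / 4 = L h k (\<lambda>z. complex_of_real (f z))"
proof -
  obtain C where C: "0 \<le> C" "\<And>z. norm z = 1 \<Longrightarrow> cmod (complex_of_real (f z)) \<le> C"
    using L_domain_bound[OF L_domain_continuous_real[OF f]] by blast
  have c: "continuous_on (sphere 0 1) (\<lambda>z. f z + C)" "continuous_on (sphere 0 1) (\<lambda>z::complex^'d. C)"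
    by (intro continuous_intros f)+
  have nn: "0 \<le> f z + C" if "norm z = 1" for z using C(2)[OF that] by (simp add: abs_if split: if_splits)
  have "integral\<^sup>L (spectral_measure y) f = integral\<^sup>L (spectral_measure y) (\<lambda>z. f z + C) - integral\<^sup>L (spectral_measure y) (\<lambda>z. C)" for y
    by (subst Bochner_Integration.integral_add[OF integrable_spectral_measure[OF f] integrable_spectral_measure[OF c(2)]]) simp
  then have "(\<Sum>j<4. \<i> ^ j * complex_of_real (integral\<^sup>L (spectral_measure (h + \<i> ^ j *\<^sub>C k)) f)) / 4
    = (\<Sum>j<4. \<i> ^ j * complex_of_real (integral\<^sup>L (spectral_measure (h + \<i> ^ j *\<^sub>C k)) (\<lambda>z. f z + C))) / 4
     - (\<Sum>j<4. \<i> ^ j * complex_of_real (integral\<^sup>L (spectral_measure (h + \<i> ^ j *\<^sub>C k)) (\<lambda>z. C))) / 4"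
    by (simp only: of_real_diff right_diff_distrib sum_subtractf diff_divide_distrib)
  also have "\<dots> = L h k (\<lambda>z. complex_of_real (f z + C)) - L h k (\<lambda>z. complex_of_real C)"
    using L_polar[OF c(1) nn] L_polar[OF c(2) C(1)] by (simp only:)
  also have "\<dots> = L h k (\<lambda>z. complex_of_real (f z))"
    using L_domain_add(2)[OF L_domain_continuous_real[OF f] L_domain_continuous_real[OF c(2)]] by simp
  finally show ?thesis .
qed

lemma L_polar_complex:
  assumes f: "continuous_on (sphere 0 1) f"
  shows "(\<Sum>j<4. \<i> ^ j * (\<integral>\<zeta>. f \<zeta> \<partial>spectral_measure (h + \<i> ^ j *\<^sub>C k))) / 4 = L h k f"
proof -
  have c: "continuous_on (sphere 0 1) (\<lambda>z. Re (f z))" "continuous_on (sphere 0 1) (\<lambda>z. Im (f z))"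
    by (intro continuous_intros f)+
  have e: "f = (\<lambda>z. complex_of_real (Re (f z)) + \<i> * complex_of_real (Im (f z)))"
    by (rule ext) (rule complex_eq)
  have "(\<integral>\<zeta>. f \<zeta> \<partial>spectral_measure y) = complex_of_real (\<integral>\<zeta>. Re (f \<zeta>) \<partial>spectral_measure y) + \<i> * complex_of_real (\<integral>\<zeta>. Im (f \<zeta>) \<partial>spectral_measure y)" for y
    by (subst e, subst Bochner_Integration.integral_add)
       (auto intro!: integrable_spectral_measure c simp: integral_complex_of_real)
  then have "(\<Sum>j<4. \<i> ^ j * (\<integral>\<zeta>. f \<zeta> \<partial>spectral_measure (h + \<i> ^ j *\<^sub>C k))) / 4
    = (\<Sum>j<4. \<i> ^ j * complex_of_real (\<integral>\<zeta>. Re (f \<zeta>) \<partial>spectral_measure (h + \<i> ^ j *\<^sub>C k))) / 4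
      + \<i> * ((\<Sum>j<4. \<i> ^ j * complex_of_real (\<integral>\<zeta>. Im (f \<zeta>) \<partial>spectral_measure (h + \<i> ^ j *\<^sub>C k))) / 4)"
    by (simp only: ring_distribs sum.distrib add_divide_distrib sum_distrib_left times_divide_eq_right mult.left_commute[of \<i>])
  also have "\<dots> = L h k (\<lambda>z. complex_of_real (Re (f z))) + \<i> * L h k (\<lambda>z. complex_of_real (Im (f z)))"
    by (simp only: L_polar_real[OF c(1)] L_polar_real[OF c(2)])
  also have "\<dots> = L h k f"
    by (subst (3) e) (simp add: L_domain_add(2) L_domain_cmult L_domain_continuous_real c)
  finally show ?thesis .
qed

definition poisson_form :: "complex^'d \<Rightarrow> 'h \<Rightarrow> 'h \<Rightarrow> complex" where
  "poisson_form z h k = L h k (\<lambda>\<zeta>. complex_of_real (poisson_kernel z \<zeta>))"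

lemma psd_poisson_form: "norm z < 1 \<Longrightarrow> psd_form (poisson_form z)"
  unfolding poisson_form_def using psd_form_L[OF continuous_on_poisson_kernel poisson_kernel_nonneg] by blast

lemma poisson_form_fubini:
  fixes \<phi> :: "complex^'d \<Rightarrow> complex"
  assumes \<phi>: "continuous_on UNIV \<phi>"
  shows "set_integrable lborel (ball 0 1) (\<lambda>z. \<phi> z * poisson_form z h k)"
    and "(LINT z:ball 0 1|lborel. \<phi> z * poisson_form z h k)
      = (\<Sum>j<4. \<i> ^ j * (\<integral>\<zeta>. (LINT z:ball 0 1|lborel. complex_of_real (sphere_pole.poisson \<zeta> CARD('d) z) * \<phi> z) \<partial>spectral_measure (h + \<i> ^ j *\<^sub>C k))) / 4"
proof -
  let ?q = "\<lambda>j z. \<phi> z * complex_of_real (integral\<^sup>L (spectral_measure (h + \<i> ^ j *\<^sub>C k)) (poisson_kernel z))"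
  have e: "indicator (ball 0 1) z *\<^sub>R (\<phi> z * poisson_form z h k) = (\<Sum>j<4. (\<i> ^ j / 4) * (indicator (ball 0 1) z *\<^sub>R ?q j z))" for z
  proof (cases "z \<in> ball 0 1")
    case True
    then have "norm z < 1" by simp
    from L_polar[OF continuous_on_poisson_kernel[OF this] poisson_kernel_nonneg[OF this], of h k]
    have "\<phi> z * poisson_form z h k = \<phi> z * ((\<Sum>j<4. \<i> ^ j * complex_of_real (integral\<^sup>L (spectral_measure (h + \<i> ^ j *\<^sub>C k)) (poisson_kernel z))) / 4)"
      by (simp add: poisson_form_def)
    also have "\<dots> = (\<Sum>j<4. (\<i> ^ j / 4) * ?q j z)"
      by (simp add: sum_divide_distrib sum_distrib_left mult.left_commute)
    finally show ?thesis using True by simp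
  qed simp
  have i: "integrable lborel (\<lambda>z. (\<i> ^ j / 4) * (indicator (ball 0 1) z *\<^sub>R ?q j z))" for j
    by (rule integrable_mult_right[OF poisson_fubini(1)[OF \<phi>, unfolded set_integrable_def]])
  show "set_integrable lborel (ball 0 1) (\<lambda>z. \<phi> z * poisson_form z h k)"
    unfolding set_integrable_def e by (rule Bochner_Integration.integrable_sum[OF i])
  have "(LINT z:ball 0 1|lborel. \<phi> z * poisson_form z h k) = (\<Sum>j<4. (\<i> ^ j / 4) * (LINT z:ball 0 1|lborel. ?q j z))"
    unfolding set_lebesgue_integral_def e Bochner_Integration.integral_sum[OF i] integral_mult_right_zero ..
  also have "\<dots> = (\<Sum>j<4. \<i> ^ j * (\<integral>\<zeta>. (LINT z:ball 0 1|lborel. complex_of_real (sphere_pole.poisson \<zeta> CARD('d) z) * \<phi> z) \<partial>spectral_measure (h + \<i> ^ j *\<^sub>C k))) / 4"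
    unfolding poisson_fubini(2)[OF \<phi>] sum_divide_distrib by simp
  finally show "(LINT z:ball 0 1|lborel. \<phi> z * poisson_form z h k) = \<dots>" .
qed

text \<open>The factor 1 / d comes from the norm of the space, the volume from the normalization of
  \<open>ball_volume\<close>.\<close>

definition dirichlet_form :: "('d \<Rightarrow> nat) \<Rightarrow> ('d \<Rightarrow> nat) \<Rightarrow> 'h \<Rightarrow> 'h \<Rightarrow> complex" where
  "dirichlet_form \<alpha> \<beta> h k = complex_of_real (1 / (real CARD('d) * measure lborel (ball (0::complex^'d) 1))) *
    (LINT z:ball 0 1|lborel. energy \<alpha> \<beta> z * poisson_form z h k)"

text \<open>By \<open>sum_energy_inc\<close> the difference of energies is the integrand of the
  Green identity. After Fubini the inner integral is d times the volume times the monomial at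
  \<zeta>, which cancels the normalization, and \<open>L_monomial\<close> evaluates what
  remains.\<close>

lemma sum_dirichlet_form_inc:
  "(\<Sum>l\<in>UNIV. dirichlet_form (inc l \<alpha>) (inc l \<beta>) h k) - dirichlet_form \<alpha> \<beta> h k = B (Tp \<alpha> h) (Tp \<beta> k)"
proof -
  define G :: "complex^'d \<Rightarrow> complex" where "G z = of_nat CARD('d) * (mpow \<alpha> z * cnj (mpow \<beta> z)) + radial_part \<alpha> \<beta> z - complex_of_real (1 - z \<bullet> z) * energy \<alpha> \<beta> z" for z
  have G: "(\<Sum>l\<in>UNIV. energy (inc l \<alpha>) (inc l \<beta>) z) - energy \<alpha> \<beta> z = G z" for z
    unfolding G_def by (rule sum_energy_inc)
  let ?v = "measure lborel (ball (0::complex^'d) 1)"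
  let ?c = "complex_of_real (1 / (real CARD('d) * ?v))"
  have v: "?v \<noteq> 0" using content_ball_pos[of 1 "0::complex^'d"] by simp
  have cG: "continuous_on UNIV G"
    unfolding G[symmetric] by (intro continuous_intros continuous_on_energy)
  note int = poisson_form_fubini(1)[OF continuous_on_energy]
  have "(LINT z:ball 0 1|lborel. G z * poisson_form z h k) = (\<Sum>l\<in>UNIV. LINT z:ball 0 1|lborel. energy (inc l \<alpha>) (inc l \<beta>) z * poisson_form z h k)
    - (LINT z:ball 0 1|lborel. energy \<alpha> \<beta> z * poisson_form z h k)"
  proof -
    have e: "indicator (ball 0 1) z *\<^sub>R (G z * poisson_form z h k)
      = (\<Sum>l\<in>UNIV. indicator (ball 0 1) z *\<^sub>R (energy (inc l \<alpha>) (inc l \<beta>) z * poisson_form z h k))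
        - indicator (ball 0 1) z *\<^sub>R (energy \<alpha> \<beta> z * poisson_form z h k)" for z
      by (simp only: G[symmetric] left_diff_distrib sum_distrib_right scaleR_diff_right scaleR_sum_right)
    note i = int[unfolded set_integrable_def]
    show ?thesis unfolding set_lebesgue_integral_def e
      by (simp only: Bochner_Integration.integral_diff[OF Bochner_Integration.integrable_sum[OF i] i] Bochner_Integration.integral_sum[OF i])
  qed
  then have "(\<Sum>l\<in>UNIV. dirichlet_form (inc l \<alpha>) (inc l \<beta>) h k) - dirichlet_form \<alpha> \<beta> h k = ?c * (LINT z:ball 0 1|lborel. G z * poisson_form z h k)"
    unfolding dirichlet_form_def by (simp only: right_diff_distrib sum_distrib_left)
  also have "(LINT z:ball 0 1|lborel. G z * poisson_form z h k)
    = (\<Sum>j<4. \<i> ^ j * (\<integral>\<zeta>. of_nat CARD('d) * (mpow \<alpha> \<zeta> * cnj (mpow \<beta> \<zeta>)) * complex_of_real ?v \<partial>spectral_measure (h + \<i> ^ j *\<^sub>C k))) / 4"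
  proof -
    have "(\<integral>\<zeta>. (LINT z:ball 0 1|lborel. complex_of_real (sphere_pole.poisson \<zeta> CARD('d) z) * G z) \<partial>spectral_measure y)
      = (\<integral>\<zeta>. of_nat CARD('d) * (mpow \<alpha> \<zeta> * cnj (mpow \<beta> \<zeta>)) * complex_of_real ?v \<partial>spectral_measure y)" for y
      by (rule Bochner_Integration.integral_cong[OF refl]) (unfold G_def, rule integral_poisson_laplacian_mpow(2), simp add: space_spectral_measure)
    then show ?thesis unfolding poisson_form_fubini(2)[OF cG] by simp
  qed
  also have "\<dots> = L h k (\<lambda>\<zeta>. of_nat CARD('d) * (mpow \<alpha> \<zeta> * cnj (mpow \<beta> \<zeta>)) * complex_of_real ?v)"
    by (rule L_polar_complex) (intro continuous_intros continuous_on_mpow)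
  also have "\<dots> = of_nat CARD('d) * complex_of_real ?v * B (Tp \<alpha> h) (Tp \<beta> k)"
    using L_domain_cmult(2)[of "\<lambda>\<zeta>. mpow \<alpha> \<zeta> * cnj (mpow \<beta> \<zeta>)" h k "of_nat CARD('d) * complex_of_real ?v"] L_monomial[of \<alpha> \<beta>]
    by (simp add: ac_simps)
  finally show ?thesis using v by simp
qed

end

section \<open>Joint 2-isometries\<close>

locale joint_2_isometric_tuple =
  fixes T :: "'d::finite \<Rightarrow> 'h::complex_hilbert \<Rightarrow> 'h"
  assumes comm: "commuting_tuple T" and iso: "joint_2_isometry T"
begin

lemma bounded_T: "bounded_clinear (T j)" and comm_T: "T i \<circ> T j = T j \<circ> T i"
  using comm by (auto simp: commuting_tuple_def)

lemma cinner_Q_op: "cinner (Q_op T X h) k = (\<Sum>j\<in>UNIV. cinner (X (T j h)) (T j k))"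
proof -
  have "cinner (adjoint_op (T j) y) k = cinner y (T j k)" for j y
    using cinner_adjoint_op[OF bounded_T, of j k y] by (metis cinner_commute)
  then show ?thesis by (simp add: Q_op_def cinner.sum_left)
qed

definition defect :: "'h \<Rightarrow> 'h \<Rightarrow> complex" where
  "defect h k = (\<Sum>j\<in>UNIV. cinner (T j h) (T j k)) - cinner h k"

text \<open>The defining equation rearranged: Q(D) = D for D = Q(I) - I, the operator behind
  \<open>defect\<close>.\<close>

lemma sum_defect_T: "(\<Sum>j\<in>UNIV. defect (T j h) (T j k)) = defect h k"
proof -
  have "cinner (h - 2 *\<^sub>C Q_op T id h + (Q_op T ^^ 2) id h) k = 0"
    using iso by (simp add: joint_2_isometry_def)
  then have "cinner h k - 2 * cinner (Q_op T id h) k + cinner (Q_op T (Q_op T id) h) k = 0"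
    by (simp add: cinner.add_left cinner.diff_left cinner.scaleC_left numeral_2_eq_2)
  then have "cinner h k - 2 * (\<Sum>j\<in>UNIV. cinner (T j h) (T j k)) + (\<Sum>j\<in>UNIV. \<Sum>i\<in>UNIV. cinner (T i (T j h)) (T i (T j k))) = 0"
    by (simp add: cinner_Q_op)
  then show ?thesis by (simp add: defect_def sum_subtractf algebra_simps)
qed

lemma cinner_Q_power: "cinner ((Q_op T ^^ n) id h) k = cinner h k + of_nat n * defect h k"
proof (induction n arbitrary: h k)
  case (Suc n)
  have "cinner ((Q_op T ^^ Suc n) id h) k = (\<Sum>j\<in>UNIV. cinner (T j h) (T j k) + of_nat n * defect (T j h) (T j k))"
    by (simp add: cinner_Q_op Suc)
  also have "\<dots> = (\<Sum>j\<in>UNIV. cinner (T j h) (T j k)) + of_nat n * defect h k"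
    by (simp add: sum.distrib sum_distrib_left[symmetric] sum_defect_T)
  also have "\<dots> = cinner h k + of_nat (Suc n) * defect h k" by (simp add: defect_def algebra_simps)
  finally show ?case .
qed simp

text \<open>Q^n(I) is positive for every n, whereas |h|^2 + n D(h, h) would be negative for large n
  if D(h, h) < 0.\<close>

lemma defect_nonneg: "0 \<le> Re (defect h h)"
proof (rule ccontr)
  assume "\<not> ?thesis"
  then obtain n where n: "(norm h)\<^sup>2 < real n * (- Re (defect h h))"
    using reals_Archimedean3[of "- Re (defect h h)"] by auto
  have "0 \<le> Re (cinner ((Q_op T ^^ n) id x) x)" for x
    by (induction n arbitrary: x) (auto simp: cinner_Q_op cinner_ge_zero intro: sum_nonneg)
  then have "0 \<le> (norm h)\<^sup>2 + real n * Re (defect h h)" by (simp add: cinner_Q_power Re_cinner_self)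
  then show False using n by simp
qed

lemma psd_form_defect: "psd_form defect"
proof
  show "defect h k = cnj (defect k h)" for h k
    unfolding defect_def complex_cnj_diff cnj_sum by (simp add: cinner_commute[symmetric])
  show "0 \<le> Re (defect h h)" for h by (rule defect_nonneg)
qed (simp_all add: defect_def bounded_clinear_add[OF bounded_T] bounded_clinear_scaleC[OF bounded_T]
  cinner.add_left cinner.scaleC_left sum.distrib sum_distrib_left right_diff_distrib)

lemma spherical_isometry_defect: "spherical_isometry defect T"
proof -
  interpret psd_form defect by (rule psd_form_defect)
  show ?thesis
    by unfold_locales (simp_all add: bounded_clinear_add[OF bounded_T] bounded_clinear_scaleC[OF bounded_T] comm_T sum_defect_T)
qed

lemma defect_bound:
  obtains C where "0 \<le> C" "\<And>h. Re (defect h h) \<le> C * (norm h)\<^sup>2"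
proof -
  have "\<forall>j. \<exists>K. \<forall>h. norm (T j h) \<le> K * norm h" using bounded_clinear_bound[OF bounded_T] by metis
  then obtain K where K: "\<And>j h. norm (T j h) \<le> K j * norm h" by metis
  show ?thesis
  proof (rule that[of "\<Sum>j\<in>UNIV. (K j)\<^sup>2"])
    show "0 \<le> (\<Sum>j\<in>UNIV. (K j)\<^sup>2)" by (simp add: sum_nonneg)
    fix h
    have "Re (defect h h) \<le> (\<Sum>j\<in>UNIV. (norm (T j h))\<^sup>2)" by (simp add: defect_def Re_cinner_self)
    also have "\<dots> \<le> (\<Sum>j\<in>UNIV. (K j)\<^sup>2 * (norm h)\<^sup>2)"
    proof (rule sum_mono)
      fix j show "(norm (T j h))\<^sup>2 \<le> (K j)\<^sup>2 * (norm h)\<^sup>2"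
        using power_mono[OF K, of j h 2] by (simp add: power_mult_distrib)
    qed
    finally show "Re (defect h h) \<le> (\<Sum>j\<in>UNIV. (K j)\<^sup>2) * (norm h)\<^sup>2" by (simp add: sum_distrib_right)
  qed
qed

end

section \<open>The Dirichlet inner product of two monomials\<close>

lemma nn_integral_ball_volume:
  fixes q :: "complex^'d \<Rightarrow> real"
  assumes q: "set_integrable lborel (ball 0 1) q" "\<And>z. norm z < 1 \<Longrightarrow> 0 \<le> q z"
  shows "(\<integral>\<^sup>+ z\<in>ball 0 1. ennreal (q z) \<partial>ball_volume) = ennreal ((LINT z:ball 0 1|lborel. q z) / measure lborel (ball (0::complex^'d) 1))"
proof -
  let ?q = "\<lambda>z. indicator (ball 0 1) z *\<^sub>R q z" and ?v = "measure lborel (ball (0::complex^'d) 1)"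
  have v: "0 < ?v" using content_ball_pos[of 1 "0::complex^'d"] by simp
  have ev: "emeasure lborel (ball (0::complex^'d) 1) = ennreal ?v"
    using emeasure_bounded_finite[of "ball (0::complex^'d) 1"] by (simp add: emeasure_eq_ennreal_measure)
  have i: "integrable lborel ?q" using q(1) unfolding set_integrable_def .
  have q0: "0 \<le> ?q z" for z using q(2) by (simp add: indicator_def)
  have m: "(\<lambda>z. ennreal (?q z)) \<in> borel_measurable lborel" using borel_measurable_integrable[OF i] by measurable
  have e: "ennreal (q z) * indicator (ball 0 1) z = ennreal (?q z)" for z by (simp add: indicator_def)
  have e2: "ennreal (?q z) * indicator (ball 0 1) z = ennreal (?q z)" for z by (simp add: indicator_def)
  have "(\<integral>\<^sup>+ z\<in>ball 0 1. ennreal (q z) \<partial>ball_volume) = (\<integral>\<^sup>+ z. ennreal (?q z) \<partial>lborel) / emeasure lborel (ball (0::complex^'d) 1)"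
    using nn_integral_uniform_measure[OF m, of "ball 0 1"] unfolding ball_volume_def e e2 by simp
  also have "(\<integral>\<^sup>+ z. ennreal (?q z) \<partial>lborel) = ennreal (\<integral>z. ?q z \<partial>lborel)"
    by (rule nn_integral_eq_integral[OF i]) (rule AE_I2, rule q0)
  also have "\<dots> / emeasure lborel (ball (0::complex^'d) 1) = ennreal ((\<integral>z. ?q z \<partial>lborel) / ?v)"
    unfolding ev by (rule divide_ennreal[OF Bochner_Integration.integral_nonneg v]) (rule q0)
  finally show ?thesis unfolding set_lebesgue_integral_def .
qed

context bounded_spherical_isometry
begin

text \<open>The inner product is a polarization of norms, so finiteness has to be established first:
  \<open>enn2real\<close> would send an infinite value to 0. Each norm then splits into a Hardy and
  a Dirichlet part, which are polarized separately.\<close>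

lemma dirichlet_inner_monomials:
  fixes u v :: 'm
  assumes F: "\<And>A a b. A \<in> sets sphere_borel \<Longrightarrow> cinner (F A a) b = spectral_form A (V a) (V b)"
  shows "dirichlet_inner F (monomial \<alpha> u) (monomial \<beta> v)
    = (if \<alpha> = \<beta> then complex_of_real (hardy_weight \<alpha>) * cinner u v else 0) + dirichlet_form \<alpha> \<beta> (V u) (V v)"
proof -
  let ?v = "measure lborel (ball (0::complex^'d) 1)"
  define x where "x n j z = mpow_partial j \<alpha> z *\<^sub>C V u + (\<i> ^ n * mpow_partial j \<beta> z) *\<^sub>C V v" for n j z
  define E where "E n z = (\<Sum>j\<in>UNIV. poisson_form z (x n j z) (x n j z))" for n z
  define Hn where "Hn n = (if \<alpha> = \<beta> then (norm (u + \<i> ^ n *\<^sub>C v))\<^sup>2 * hardy_weight \<alpha>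
     else (norm u)\<^sup>2 * hardy_weight \<alpha> + (norm (\<i> ^ n *\<^sub>C v))\<^sup>2 * hardy_weight \<beta>)" for n
  define I where "I n = (LINT z:ball 0 1|lborel. Re (E n z))" for n
  define c where "c = 1 / (real CARD('d) * ?v)"
  have v: "0 < ?v" using content_ball_pos[of 1 "0::complex^'d"] by simp
  have H0: "0 \<le> Hn n" for n by (simp add: Hn_def hardy_weight_nonneg)
  have E0: "0 \<le> Re (E n z)" and Er: "E n z = complex_of_real (Re (E n z))" if "norm z < 1" for n z
  proof -
    interpret G: psd_form "poisson_form z" by (rule psd_poisson_form[OF that])
    show "0 \<le> Re (E n z)" by (simp add: E_def G.nonneg sum_nonneg)
    have "Im (E n z) = 0" using G.self_real by (simp add: E_def complex_eq_iff)
    then show "E n z = complex_of_real (Re (E n z))" by (simp add: complex_eq_iff)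
  qed
  note int = poisson_form_fubini(1)[OF continuous_on_energy]
  \<comment> \<open>\<open>poisson_form z\<close> is known to be a semidefinite form only inside the
    ball, so the expansion is carried out under the indicator.\<close>
  have Ei: "set_integrable lborel (ball 0 1) (E n)" for n
  proof -
    have "set_integrable lborel (ball 0 1) (\<lambda>z. energy \<alpha> \<alpha> z * poisson_form z (V u) (V u) + cnj (\<i> ^ n) * (energy \<alpha> \<beta> z * poisson_form z (V u) (V v))
        + \<i> ^ n * (energy \<beta> \<alpha> z * poisson_form z (V v) (V u)) + \<i> ^ n * cnj (\<i> ^ n) * (energy \<beta> \<beta> z * poisson_form z (V v) (V v)))"
      by (intro set_integral_add(1) set_integrable_mult_right int)
    moreover have "(\<lambda>z. indicator (ball 0 1) z *\<^sub>R E n z) = (\<lambda>z. indicator (ball 0 1) z *\<^sub>R (energy \<alpha> \<alpha> z * poisson_form z (V u) (V u) + cnj (\<i> ^ n) * (energy \<alpha> \<beta> z * poisson_form z (V u) (V v))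
        + \<i> ^ n * (energy \<beta> \<alpha> z * poisson_form z (V v) (V u)) + \<i> ^ n * cnj (\<i> ^ n) * (energy \<beta> \<beta> z * poisson_form z (V v) (V v))))"
    proof
      fix z :: "complex^'d"
      show "indicator (ball 0 1) z *\<^sub>R E n z = indicator (ball 0 1) z *\<^sub>R (energy \<alpha> \<alpha> z * poisson_form z (V u) (V u) + cnj (\<i> ^ n) * (energy \<alpha> \<beta> z * poisson_form z (V u) (V v))
        + \<i> ^ n * (energy \<beta> \<alpha> z * poisson_form z (V v) (V u)) + \<i> ^ n * cnj (\<i> ^ n) * (energy \<beta> \<beta> z * poisson_form z (V v) (V v)))"
      proof (cases "norm z < 1")
        case True
        show ?thesis unfolding E_def x_def psd_energy[OF psd_poisson_form[OF True]] ..
      qed simp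
    qed
    ultimately show ?thesis unfolding set_integrable_def by simp
  qed
  have Ri: "set_integrable lborel (ball 0 1) (\<lambda>z. Re (E n z))" for n
    using integrable_Re[OF Ei[of n, unfolded set_integrable_def]] by (simp add: set_integrable_def)
  have I0: "0 \<le> I n" for n
    unfolding I_def set_lebesgue_integral_def
    by (rule Bochner_Integration.integral_nonneg) (simp add: indicator_def E0)
  have norm: "dirichlet_norm_sq F (\<lambda>z. monomial \<alpha> u z + \<i> ^ n *\<^sub>C monomial \<beta> v z) = ennreal (Hn n + c * I n)" for n
  proof -
    let ?f = "\<lambda>z. monomial \<alpha> u z + \<i> ^ n *\<^sub>C monomial \<beta> v z"
    have nn: "(\<integral>\<^sup>+ z\<in>ball 0 1. ennreal (Re (E n z)) \<partial>ball_volume) = ennreal (I n / ?v)"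
      unfolding I_def by (rule nn_integral_ball_volume[OF Ri E0])
    have "(\<Sum>j\<in>UNIV. Re (cinner (poisson_integral F z (complex_partial j ?f z)) (complex_partial j ?f z))) = Re (E n z)" if "norm z < 1" for z
    proof -
      have "cinner (poisson_integral F z a) b = poisson_form z (V a) (V b)" for a b
        unfolding poisson_form_def by (rule poisson_integral_form[OF F that])
      then show ?thesis
        unfolding complex_partial_two_monomials V_add V_scaleC E_def x_def Re_sum by (simp only: V_add V_scaleC)
    qed
    then have "ennreal (\<Sum>j\<in>UNIV. Re (cinner (poisson_integral F z (complex_partial j ?f z)) (complex_partial j ?f z))) * indicator (ball 0 1) z
      = ennreal (Re (E n z)) * indicator (ball 0 1) z" for z
      by (cases "norm z < 1") auto
    then have "(\<integral>\<^sup>+ z\<in>ball 0 1. ennreal (\<Sum>j\<in>UNIV. Re (cinner (poisson_integral F z (complex_partial j ?f z)) (complex_partial j ?f z))) \<partial>ball_volume)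
      = ennreal (I n / ?v)"
      using nn by simp
    then have "dirichlet_norm_sq F ?f = ennreal (Hn n) + ennreal (1 / real CARD('d)) * ennreal (I n / ?v)"
      unfolding dirichlet_norm_sq_def hardy_norm_sq_two_monomials Hn_def by simp
    also have "\<dots> = ennreal (Hn n + 1 / real CARD('d) * (I n / ?v))"
      using H0[of n] I0[of n] v by (simp add: ennreal_mult[symmetric] ennreal_plus[symmetric] del: ennreal_plus)
    finally show ?thesis by (simp add: c_def)
  qed
  have c0: "0 \<le> c" using v by (simp add: c_def)
  have real_norm: "enn2real (dirichlet_norm_sq F (\<lambda>z. monomial \<alpha> u z + \<i> ^ n *\<^sub>C monomial \<beta> v z)) = Hn n + c * I n" for n
    unfolding norm by (rule enn2real_ennreal) (use H0[of n] I0[of n] c0 in simp)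
  have I_complex: "complex_of_real (I n) = (LINT z:ball 0 1|lborel. E n z)" for n
  proof -
    have "indicator (ball 0 1) z *\<^sub>R E n z = complex_of_real (indicator (ball 0 1) z *\<^sub>R Re (E n z))" for z
      using Er[of z n] by (cases "norm z < 1") auto
    then show ?thesis unfolding I_def set_lebesgue_integral_def by (simp only: integral_complex_of_real)
  qed
  have "(\<Sum>n<4. \<i> ^ n * complex_of_real (I n)) / 4 = (LINT z:ball 0 1|lborel. energy \<alpha> \<beta> z * poisson_form z (V u) (V v))"
  proof -
    have e: "(\<Sum>n<4. (\<i> ^ n / 4) * (indicator (ball 0 1) z *\<^sub>R E n z)) = indicator (ball 0 1) z *\<^sub>R (energy \<alpha> \<beta> z * poisson_form z (V u) (V v))" for z
    proof (cases "norm z < 1")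
      case True
      have "(\<Sum>n<4. (\<i> ^ n / 4) * E n z) = energy \<alpha> \<beta> z * poisson_form z (V u) (V v)"
        unfolding psd_energy_polarization[OF psd_poisson_form[OF True], symmetric] E_def x_def sum_divide_distrib by simp
      then show ?thesis using True by simp
    qed simp
    have i: "integrable lborel (\<lambda>z. (\<i> ^ n / 4) * (indicator (ball 0 1) z *\<^sub>R E n z))" for n
      by (rule integrable_mult_right[OF Ei[unfolded set_integrable_def]])
    have "(\<Sum>n<4. \<i> ^ n * complex_of_real (I n)) / 4 = (\<Sum>n<4. \<integral>z. (\<i> ^ n / 4) * (indicator (ball 0 1) z *\<^sub>R E n z) \<partial>lborel)"
      unfolding I_complex integral_mult_right_zero set_lebesgue_integral_def sum_divide_distrib by simp
    also have "\<dots> = (\<integral>z. (\<Sum>n<4. (\<i> ^ n / 4) * (indicator (ball 0 1) z *\<^sub>R E n z)) \<partial>lborel)"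
      by (rule Bochner_Integration.integral_sum[OF i, symmetric])
    finally show ?thesis unfolding e set_lebesgue_integral_def .
  qed
  moreover have "dirichlet_inner F (monomial \<alpha> u) (monomial \<beta> v)
    = (\<Sum>n<4. \<i> ^ n * complex_of_real (Hn n)) / 4 + complex_of_real c * ((\<Sum>n<4. \<i> ^ n * complex_of_real (I n)) / 4)"
    unfolding dirichlet_inner_def real_norm
    by (simp only: of_real_add of_real_mult ring_distribs sum.distrib add_divide_distrib sum_distrib_left times_divide_eq_right mult.left_commute[of "complex_of_real c"])
  ultimately show ?thesis
    using hardy_polarization[of \<alpha> \<beta> u v] unfolding Hn_def dirichlet_form_def c_def by simp
qed

end

theorem corollary5p6:
  fixes T :: "'d::finite \<Rightarrow> 'h::complex_hilbert \<Rightarrow> 'h"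
    and f :: "'i \<Rightarrow> 'h"
    and le :: "'i rel"
  assumes "separable_space (euclidean :: 'h topology)"
    and "commuting_tuple T"
    and "directed_index le"
    and "orthonormal_basis f (joint_kernel_adjoint T)"
    and "joint_2_isometry T"
  shows "\<exists>F :: (complex^'d) set \<Rightarrow> 'i ell2 \<Rightarrow> 'i ell2.
    semispectral_measure F \<and>
    (\<forall>(\<alpha>::'d \<Rightarrow> nat) (\<beta>::'d \<Rightarrow> nat) (k::nat).
      \<forall>x\<in>joint_kernel_adjoint T. \<forall>y\<in>joint_kernel_adjoint T.
        cinner ((Q_op T ^^ k) id (tuple_power T \<alpha> x)) (tuple_power T \<beta> y)
          - cinner (tuple_power T \<alpha> x) (tuple_power T \<beta> y)
        = (\<Sum>\<gamma> | mindex_norm \<gamma> = k.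
            of_nat (fact (mindex_norm \<gamma>)) / of_nat (mindex_fact \<gamma>) *
            dirichlet_inner F
              (monomial (\<lambda>j. \<alpha> j + \<gamma> j) (basis_coords f x))
              (monomial (\<lambda>j. \<beta> j + \<gamma> j) (basis_coords f y)))
          - dirichlet_inner F
              (monomial \<alpha> (basis_coords f x)) (monomial \<beta> (basis_coords f y)))"
proof -
  let ?K = "joint_kernel_adjoint T"
  interpret T: joint_2_isometric_tuple T by standard (rule assms)+
  interpret f: orthonormal f by standard (use assms(4) in \<open>simp add: orthonormal_basis_def\<close>)
  \<comment> \<open>\<open>V\<close> undoes the identification of the joint kernel with
    \<open>'i ell2\<close>: on the coordinates of x and y the compressed forms return the values of
    the forms on H at x and y.\<close>
  obtain V :: "'i ell2 \<Rightarrow> 'h" where sec: "bounded_clinear V" "\<And>x. x \<in> ?K \<Longrightarrow> V (basis_coords f x) = x"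
    using f.basis_coords_section assms(4) unfolding orthonormal_basis_def by metis
  obtain C where C: "0 \<le> C" "\<And>h. Re (T.defect h h) \<le> C * (norm h)\<^sup>2" using T.defect_bound by blast
  interpret spherical_isometry T.defect T by (rule T.spherical_isometry_defect)
  interpret bounded_spherical_isometry T.defect T C V by standard (fact C sec(1))+
  obtain F :: "(complex^'d) set \<Rightarrow> 'i ell2 \<Rightarrow> 'i ell2" where F: "semispectral_measure F"
    "\<And>A a b. A \<in> sets sphere_borel \<Longrightarrow> cinner (F A a) b = spectral_form A (V a) (V b)"
    using semispectral_exists by metis
  have "cinner ((Q_op T ^^ k) id (Tp \<alpha> x)) (Tp \<beta> y) - cinner (Tp \<alpha> x) (Tp \<beta> y)
        = (\<Sum>\<gamma> | mindex_norm \<gamma> = k. multinomial \<gamma> *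
            dirichlet_inner F (monomial (\<lambda>j. \<alpha> j + \<gamma> j) (basis_coords f x)) (monomial (\<lambda>j. \<beta> j + \<gamma> j) (basis_coords f y)))
          - dirichlet_inner F (monomial \<alpha> (basis_coords f x)) (monomial \<beta> (basis_coords f y))"
    if x: "x \<in> ?K" and y: "y \<in> ?K" for \<alpha> \<beta> k x y
  proof -
    \<comment> \<open>With \<alpha> and \<beta> fixed the shift \<gamma> is the variable, in the
      format of \<open>sum_multinomial_shift\<close> with increment \<open>c\<close>.\<close>
    define R where "R \<gamma> = dirichlet_inner F (monomial (\<lambda>j. \<alpha> j + \<gamma> j) (basis_coords f x)) (monomial (\<lambda>j. \<beta> j + \<gamma> j) (basis_coords f y))" for \<gamma>
    define c where "c \<gamma> = T.defect (Tp (\<lambda>j. \<alpha> j + \<gamma> j) x) (Tp (\<lambda>j. \<beta> j + \<gamma> j) y)" for \<gamma>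
    have shift: "(\<lambda>i. \<alpha> i + inc j \<gamma> i) = inc j (\<lambda>i. \<alpha> i + \<gamma> i)" for j and \<alpha> \<gamma> :: "'d \<Rightarrow> nat"
      by (auto simp: inc_apply)
    have "(\<Sum>j\<in>UNIV. R (inc j \<gamma>)) = R \<gamma> + c \<gamma>" for \<gamma>
    proof -
      let ?a = "\<lambda>i. \<alpha> i + \<gamma> i" and ?b = "\<lambda>i. \<beta> i + \<gamma> i" and ?u = "basis_coords f x" and ?v = "basis_coords f y"
      have "(\<Sum>j\<in>UNIV. R (inc j \<gamma>)) = (\<Sum>j\<in>UNIV. (if ?a = ?b then complex_of_real (hardy_weight (inc j ?a)) * cinner ?u ?v else 0))
          + (\<Sum>j\<in>UNIV. dirichlet_form (inc j ?a) (inc j ?b) x y)"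
        by (simp only: R_def shift dirichlet_inner_monomials[OF F(2)] inc_inj sec(2)[OF x] sec(2)[OF y] sum.distrib)
      also have "(\<Sum>j\<in>UNIV. (if ?a = ?b then complex_of_real (hardy_weight (inc j ?a)) * cinner ?u ?v else 0))
          = (if ?a = ?b then complex_of_real (\<Sum>j\<in>UNIV. hardy_weight (inc j ?a)) * cinner ?u ?v else 0)"
        by (simp add: sum_distrib_right)
      also have "(\<Sum>j\<in>UNIV. dirichlet_form (inc j ?a) (inc j ?b) x y) = dirichlet_form ?a ?b x y + c \<gamma>"
        using sum_dirichlet_form_inc[of ?a ?b x y] by (simp add: c_def algebra_simps)
      finally show ?thesis
        by (simp only: sum_hardy_weight_inc R_def dirichlet_inner_monomials[OF F(2)] sec(2)[OF x] sec(2)[OF y] add.assoc)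
    qed
    moreover have "(\<Sum>j\<in>UNIV. c (inc j \<gamma>)) = c \<gamma>" for \<gamma>
      unfolding c_def shift Tp_inc by (rule T_iso)
    ultimately have "(\<Sum>\<gamma> | mindex_norm \<gamma> = k. multinomial \<gamma> * R \<gamma>) = R (\<lambda>_. 0) + of_nat k * c (\<lambda>_. 0)"
      by (rule sum_multinomial_shift)
    \<comment> \<open>At \<gamma> = 0 the increment is the defect of \<open>Tp \<alpha> x\<close>
      and \<open>Tp \<beta> y\<close>; by \<open>T.cinner_Q_power\<close> the left-hand side is the
      same k-fold multiple of it.\<close>
    then show ?thesis by (simp add: R_def c_def T.cinner_Q_power)
  qed
  then show ?thesis using F(1) unfolding multinomial_def by blast
qed

end
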